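(* Let $$\Xi^{(4)}:=\frac{1}{16}\left(G_0^{(4)}-G_1^{(4)}+2G_2^{(4)}-8G_3^{(4)}+64G_4^{(4)}\right).$$ Then $\Xi^{(4)}$ is a modular form of weight $8$ with respect to $\Gamma_4(1,2)$, and it satisfies the factorization constraints $$\Xi^{(4)}|_{\mathcal H_1\times\mathcal H_3}=\Xi^{(1)}\cdot\Xi^{(3)},\qquad \Xi^{(4)}|_{\mathcal H_2\times\mathcal H_2}=\Xi^{(2)}\cdot\Xi^{(2)}.$$ Moreover, it is the unique linear combination (with complex coefficients) of $G_0^{(4)},\dots,G_4^{(4)}$ satisfying these factorization constraints.
   Context: $\mathcal H_g$ is the Siegel upper half-space of symmetric complex $g\times g$ matrices with positive-definite imaginary part. The group $\mathrm{Sp}(2g,\mathbb Z)$ acts on $\mathcal H_g$ by $\gamma\circ\tau=(A\tau+B)(C\tau+D)^{-1}$ for $\gamma=\begin{pmatrix}A&B\\C&D\end{pmatrix}$. Let $\Gamma_g(1,2)\subset\mathrm{Sp}(2g,\mathbb Z)$ be the subgroup of those $\gamma$ for which the diagonals of $A\,{}^tB$ and $C\,{}^tD$ are $\equiv 0 \bmod 2$. A modular form of weight $w$ with respect to $\Gamma\subset\mathrm{Sp}(2g,\mathbb Z)$ is a holomorphic function $f:\mathcal H_g\to\mathbb C$ with $f(\gamma\circ\tau)=\det(C\tau+D)^w f(\tau)$ for all $\gamma\in\Gamma$, $\tau\in\mathcal H_g$ (for $g=1$ also holomorphic at the cusps). Let $\mathbb Z_2=\mathbb Z/2\mathbb Z=\{0,1\}$.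 A characteristic is $v=\begin{bmatrix}\varepsilon\\\delta\end{bmatrix}\in\mathbb Z_2^{2g}$ with $\varepsilon,\delta\in\mathbb Z_2^g$. Lifting entries to $\{0,1\}\subset\mathbb Z$, the theta constant with characteristic $v$ is $$\theta[v](\tau)=\sum_{n\in\mathbb Z^g}\exp\Big(\pi i\big((n+\tfrac{\varepsilon}{2})^t\tau(n+\tfrac{\varepsilon}{2})+(n+\tfrac{\varepsilon}{2})^t\delta\big)\Big).$$ For $M\subset\mathbb Z_2^{2g}$ put $P_M(\tau)=\prod_{v\in M}\theta[v](\tau)$. For $0\le i\le 4$ put $$G_i^{(g)}(\tau)=\sum_{V\subset\mathbb Z_2^{2g},\ \dim V=i}P_V(\tau)^{2^{4-i}},$$ the sum being over all $i$-dimensional $\mathbb Z_2$-vector subspaces. For $0<k<g$, $\mathcal H_k\times\mathcal H_{g-k}$ is embedded in $\mathcal H_g$ as the block-diagonal matrices $\mathrm{diag}(\tau_1,\tau_2)$, and for functions $f$ on $\mathcal H_k$ and $h$ on $\mathcal H_{g-k}$, $f\cdot h$ denotes $(\tau_1,\tau_2)\mapsto f(\tau_1)h(\tau_2)$. Lower genus forms: $\Xi^{(1)}=\frac12\big(G_0^{(1)}-G_1^{(1)}\big)$, $\Xi^{(2)}=\frac14\big(G_0^{(2)}-G_1^{(2)}+2G_2^{(2)}\big)$, $\Xi^{(3)}=\frac18\big(G_0^{(3)}-G_1^{(3)}+2G_2^{(3)}-8G_3^{(3)}\big)$. *)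

theory Defs
  imports
    "Jordan_Normal_Form.VS_Connect"
    "Jordan_Normal_Form.Gauss_Jordan_Elimination"
    "HOL-Library.Z2"
    "HOL-Analysis.Infinite_Sum"
begin

definition siegel_space :: "nat \<Rightarrow> complex mat set" where
  "siegel_space g = {\<tau> \<in> carrier_mat g g.
     transpose_mat \<tau> = \<tau> \<and>
     (\<forall>x \<in> carrier_vec g. x \<noteq> 0\<^sub>v g \<longrightarrow> x \<bullet> (map_mat Im \<tau> *\<^sub>v x) > 0)}"

definition Sp_int :: "nat \<Rightarrow> int mat set" where
  "Sp_int g = {\<gamma> \<in> carrier_mat (2 * g) (2 * g).
     (let J = four_block_mat (0\<^sub>m g g) (1\<^sub>m g) (- 1\<^sub>m g) (0\<^sub>m g g)
      in transpose_mat \<gamma> * J * \<gamma> = J)}"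

definition Gamma12 :: "nat \<Rightarrow> int mat set" where
  "Gamma12 g = {\<gamma> \<in> Sp_int g.
     case split_block \<gamma> g g of (A, B, C, D) \<Rightarrow>
       (\<forall>i<g. even ((A * transpose_mat B) $$ (i, i)) \<and> even ((C * transpose_mat D) $$ (i, i)))}"

definition automorphy_mat :: "nat \<Rightarrow> int mat \<Rightarrow> complex mat \<Rightarrow> complex mat" where
  "automorphy_mat g \<gamma> \<tau> =
     (case split_block \<gamma> g g of (A, B, C, D) \<Rightarrow> map_mat of_int C * \<tau> + map_mat of_int D)"

definition siegel_action :: "nat \<Rightarrow> int mat \<Rightarrow> complex mat \<Rightarrow> complex mat" where
  "siegel_action g \<gamma> \<tau> =
     (case split_block \<gamma> g g of (A, B, C, D) \<Rightarrow>
       (map_mat of_int A * \<tau> + map_mat of_int B) * the (mat_inverse (automorphy_mat g \<gamma> \<tau>)))"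

definition mat_norm1 :: "complex mat \<Rightarrow> real" where
  "mat_norm1 M = (\<Sum>i<dim_row M. \<Sum>j<dim_col M. cmod (M $$ (i, j)))"

text \<open>
  Complex Frechet differentiability at every point. The Siegel space is open in the
  space of symmetric matrices, so letting \<open>\<tau>'\<close> range over it is the usual notion for a function
  of the entries on and above the diagonal; the linear form \<open>d\<close> is not unique, because
  only its values on symmetric matrices matter.
\<close>

definition siegel_holomorphic :: "nat \<Rightarrow> (complex mat \<Rightarrow> complex) \<Rightarrow> bool" where
  "siegel_holomorphic g f \<longleftrightarrow>
     (\<forall>\<tau> \<in> siegel_space g. \<exists>d. \<forall>e>0. \<exists>r>0. \<forall>\<tau>' \<in> siegel_space g.
        mat_norm1 (\<tau>' - \<tau>) < r \<longrightarrow>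
        cmod (f \<tau>' - f \<tau> - (\<Sum>i<g. \<Sum>j<g. d i j * (\<tau>' - \<tau>) $$ (i, j))) \<le> e * mat_norm1 (\<tau>' - \<tau>))"

text \<open>
  In genus 1 holomorphy at the cusps is expressed as boundedness near \<open>\<i>\<infinity>\<close> of all translates of
  \<open>f\<close> under the full modular group; this is the usual condition for subgroups of finite index.
\<close>

definition modular_form ::
    "nat \<Rightarrow> nat \<Rightarrow> int mat set \<Rightarrow> (complex mat \<Rightarrow> complex) \<Rightarrow> bool" where
  "modular_form g w \<Gamma> f \<longleftrightarrow>
     siegel_holomorphic g f \<and>
     (\<forall>\<gamma> \<in> \<Gamma>. \<forall>\<tau> \<in> siegel_space g.
        f (siegel_action g \<gamma> \<tau>) = det (automorphy_mat g \<gamma> \<tau>) ^ w * f \<tau>) \<and>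
     (g = 1 \<longrightarrow> (\<forall>\<gamma> \<in> Sp_int 1. \<exists>K Y. \<forall>\<tau> \<in> siegel_space 1. Im (\<tau> $$ (0, 0)) \<ge> Y \<longrightarrow>
        cmod (f (siegel_action 1 \<gamma> \<tau>) / det (automorphy_mat 1 \<gamma> \<tau>) ^ w) \<le> K))"

text \<open>
  A characteristic in genus \<open>g\<close> is a vector of length \<open>2 * g\<close> over the field \<^typ>\<open>bit\<close>; its first
  half is \<open>\<epsilon>\<close> and its second half is \<open>\<delta>\<close>. The coercion \<^const>\<open>of_bit\<close> lifts to \<open>{0, 1}\<close>.
\<close>

definition theta :: "nat \<Rightarrow> bit vec \<Rightarrow> complex mat \<Rightarrow> complex" where
  "theta g v \<tau> =
     (\<Sum>\<^sub>\<infinity>n \<in> (carrier_vec g :: int vec set).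
        let x = map_vec of_int n + (1 / 2) \<cdot>\<^sub>v map_vec of_bit (vec_first v g);
            \<delta> = map_vec of_bit (vec_last v g)
        in exp (complex_of_real pi * \<i> * (x \<bullet> (\<tau> *\<^sub>v x) + x \<bullet> \<delta>)))"

definition theta_prod :: "nat \<Rightarrow> bit vec set \<Rightarrow> complex mat \<Rightarrow> complex" where
  "theta_prod g M \<tau> = (\<Prod>v\<in>M. theta g v \<tau>)"

definition char_subspaces :: "nat \<Rightarrow> nat \<Rightarrow> bit vec set set" where
  "char_subspaces g i =
     {V. VectorSpace.subspace class_ring V (module_vec TYPE(bit) (2 * g)) \<and>
         vectorspace.dim class_ring ((module_vec TYPE(bit) (2 * g))\<lparr>carrier := V\<rparr>) = i}"

text \<open>Meaningful for \<open>i \<le> 4\<close> only, since the exponent uses truncated subtraction.\<close>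

definition G_form :: "nat \<Rightarrow> nat \<Rightarrow> complex mat \<Rightarrow> complex" where
  "G_form g i \<tau> = (\<Sum>V\<in>char_subspaces g i. theta_prod g V \<tau> ^ (2 ^ (4 - i)))"

definition Xi1 :: "complex mat \<Rightarrow> complex" where
  "Xi1 \<tau> = 1/2 * (G_form 1 0 \<tau> - G_form 1 1 \<tau>)"

definition Xi2 :: "complex mat \<Rightarrow> complex" where
  "Xi2 \<tau> = 1/4 * (G_form 2 0 \<tau> - G_form 2 1 \<tau> + 2 * G_form 2 2 \<tau>)"

definition Xi3 :: "complex mat \<Rightarrow> complex" where
  "Xi3 \<tau> = 1/8 * (G_form 3 0 \<tau> - G_form 3 1 \<tau> + 2 * G_form 3 2 \<tau> - 8 * G_form 3 3 \<tau>)"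

definition Xi4 :: "complex mat \<Rightarrow> complex" where
  "Xi4 \<tau> = 1/16 * (G_form 4 0 \<tau> - G_form 4 1 \<tau> + 2 * G_form 4 2 \<tau>
                    - 8 * G_form 4 3 \<tau> + 64 * G_form 4 4 \<tau>)"

definition restricts_to_product ::
    "nat \<Rightarrow> nat \<Rightarrow> (complex mat \<Rightarrow> complex) \<Rightarrow> (complex mat \<Rightarrow> complex) \<Rightarrow> (complex mat \<Rightarrow> complex) \<Rightarrow> bool"
  where
  "restricts_to_product k l F f h \<longleftrightarrow>
     (\<forall>\<tau>1 \<in> siegel_space k. \<forall>\<tau>2 \<in> siegel_space l.
        F (diag_block_mat [\<tau>1, \<tau>2]) = f \<tau>1 * h \<tau>2)"

definition factorization_constraints :: "(complex mat \<Rightarrow> complex) \<Rightarrow> bool" where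
  "factorization_constraints F \<longleftrightarrow>
     restricts_to_product 1 3 F Xi1 Xi3 \<and> restricts_to_product 2 2 F Xi2 Xi2"

end

theory Submission
  imports "HOL-Probability.Probability" "HOL-Complex_Analysis.Complex_Analysis" Defs
begin

text \<open>
  Odd theta constants vanish, so only subspaces \<open>V\<close> on which \<open>\<epsilon> \<bullet> \<delta>\<close> is even contribute to the
  \<open>G_i\<close>; these have dimension at most \<open>g\<close>. On a block-diagonal period matrix \<open>\<theta>[v]\<close> splits into a
  product, and the weight-8 monomial of \<open>V\<close> becomes the product of the monomials of the two projections
  of \<open>V\<close>. The factorization therefore says that the coefficients, summed over all \<open>V\<close> with prescribed
  projections, are multiplicative. The coefficients \<open>1, -1, 2, -8, 64\<close> are the values of the Moebius
  function of the lattice of subspaces over \<open>\<int>/2\<close>, for which this is true because the sum of the Moebius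
  function over the subspaces of a nonzero space vanishes.

  For uniqueness, restrict to \<open>\<H>\<^sub>1 \<times> \<H>\<^sub>h\<close>. At \<open>\<i>\<close>, \<open>1 + \<i>\<close> and \<open>-1/(1 + \<i>)\<close> the eighth powers of the
  three even theta constants are, up to a common factor, the permutations of \<open>(a, b, b)\<close> with \<open>a > b > 0\<close>,
  which makes the contributions of the three totally singular spaces of genus 1 vanish separately; one inducts on \<open>h\<close>.

  For modularity, \<open>Sp(2g, \<int>)\<close> is generated as a monoid by the translations of single entries of \<open>\<tau>\<close> and
  the inversions in a single coordinate. Each generator maps \<open>\<theta>[v]\<close> to \<open>\<theta>[\<phi> v]\<close> up to an eighth root of unity
  and a common factor, with \<open>\<phi>\<close> an affine bijection of the characteristics. In the weight-8 monomial of an affine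
  subspace the roots of unity cancel, because their exponents are cubic in the coordinates of \<open>v\<close> and the
  number of points of a \<open>d\<close>-dimensional affine space where \<open>k\<close> affine functions equal 1 is divisible by \<open>2^(d - k)\<close>.
  For elements of \<open>\<Gamma>(1,2)\<close> the map \<open>\<phi>\<close> fixes 0, so it permutes the linear subspaces. The inversion
  in one coordinate is the Jacobi identity, obtained from Poisson summation for Gaussians.
\<close>

text \<open>The root of unity in the theta transformation formula is never computed for a general
  symplectic matrix: it is explicit for the generators only, and the law is carried along words in
  them. The letters of a word for an element of \<Gamma>(1,2) need not lie in \<Gamma>(1,2) and may
  move the characteristic 0, so a law for linear subspaces would not compose. Affine subspaces are
  permuted by every generator, which is why the law is stated for them. Every monomial has 2^d *
  2^(4-d) = 16 theta factors of weight 1/2. Hence a square root of det(C\<tau> + D) enters through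
  its 16th power, and the choice of the root is immaterial. The exponents of the roots of unity, in
  units of \<pi> i, have quarters in degree 1, halves in degree 2 and integers in degree 3; the
  corresponding counts, times the exponent 2^(4-d), are divisible by 8, 4 and 2, which is exactly
  enough. The factor 1/16 is the case g = 4 of 2^(-g), which is itself multiplicative; the lower
  genus forms carry 1/2, 1/4 and 1/8.\<close>

no_notation Finite_Cartesian_Product.vec_nth (infixl "$" 90)
no_notation fps_nth (infixl "$" 75)

section \<open>The Jacobi inversion formula\<close>

definition e2pi :: "int \<Rightarrow> real \<Rightarrow> complex" where
  "e2pi k x = cis (2 * pi * of_int k * x)"

lemma e2pi_simps [simp]: "e2pi 0 x = 1" "norm (e2pi k x) = 1" "e2pi k 0 = 1"
  by (auto simp: e2pi_def)

lemma e2pi_add: "e2pi (k + l) x = e2pi k x * e2pi l x"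
  by (simp add: e2pi_def cis_mult algebra_simps)

lemma e2pi_shift: "e2pi k (x + 1) = e2pi k x"
proof -
  have "e2pi k (x + 1) = cis (2 * pi * of_int k * x) * cis (2 * pi * of_int k)"
    unfolding e2pi_def cis_mult by (simp add: algebra_simps)
  then show ?thesis by (simp add: cis_multiple_2pi e2pi_def)
qed

lemma continuous_on_e2pi [continuous_intros]: "continuous_on A (e2pi k)"
  unfolding e2pi_def by (intro continuous_intros)

lemma integral_e2pi: "integral {0..1} (e2pi k) = (if k = 0 then 1 else 0)"
proof (cases "k = 0")
  case True
  then have "e2pi k = (\<lambda>_. 1)" by (simp add: fun_eq_iff)
  then show ?thesis using True by simp
next
  case False
  let ?c = "2 * pi * of_int k :: real"
  have c: "?c \<noteq> 0" using False by simp
  have "(e2pi k has_integral (e2pi k 1 / (\<i> * ?c) - e2pi k 0 / (\<i> * ?c))) {0..1}"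
  proof (rule fundamental_theorem_of_calculus)
    fix x :: real assume "x \<in> {0..1}"
    have "((\<lambda>x. exp (\<i> * ?c * of_real x) / (\<i> * ?c)) has_vector_derivative exp (\<i> * ?c * of_real x)) (at x within {0..1})"
      by (rule has_vector_derivative_real_field) (use c in \<open>auto intro!: derivative_eq_intros\<close>)
    then show "((\<lambda>x. e2pi k x / (\<i> * ?c)) has_vector_derivative e2pi k x) (at x within {0..1})"
      by (simp add: e2pi_def cis_conv_exp mult.assoc)
  qed simp
  moreover have "e2pi k 1 = 1"
    using e2pi_shift[of k 0] by simp
  ultimately show ?thesis
    using False by (simp add: integral_unique)
qed

definition no_fourier :: "(real \<Rightarrow> complex) \<Rightarrow> bool" where
  "no_fourier D \<longleftrightarrow> continuous_on {0..1} D \<and> (\<forall>k. integral {0..1} (\<lambda>x. D x * e2pi k x) = 0)"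

text \<open>Multiplication by \<open>e2pi 1 x\<close> or its conjugate only shifts the frequency,
  and every real-linear function of a point of the circle is a combination of these two. Sums and
  products follow by induction; \<open>D\<close> has to be arbitrary because the product case
  applies the hypothesis to a modified \<open>D\<close>.\<close>

lemma no_fourier_polynomial:
  assumes "real_polynomial_function p" "no_fourier D"
  shows "no_fourier (\<lambda>x. D x * of_real (p (e2pi 1 x)))"
  using assms
proof (induction arbitrary: D rule: real_polynomial_function.induct)
  case (linear f)
  note D = linear(2)
  interpret bounded_linear f by (rule linear)
  define a b where "a = complex_of_real (f 1)" and "b = complex_of_real (f \<i>)"
  \<comment> \<open>The coefficients come from f(z) = Re z f(1) + Im z f(\<i>) and Euler's formulas
    for cosine and sine.\<close>
  define \<alpha> \<beta> where "\<alpha> = (a - \<i> * b) / 2" and "\<beta> = (a + \<i> * b) / 2"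
  have f: "complex_of_real (f (e2pi 1 x)) = \<alpha> * e2pi 1 x + \<beta> * e2pi (-1) x" for x
  proof -
    have "f z = Re z * f 1 + Im z * f \<i>" for z
    proof -
      have "z = Re z *\<^sub>R 1 + Im z *\<^sub>R \<i>" by (simp add: complex_eq_iff)
      then show ?thesis by (metis add scaleR real_scaleR_def)
    qed
    from this[of "e2pi 1 x"] have "complex_of_real (f (e2pi 1 x)) = cos (2*pi*x) * a + sin (2*pi*x) * b"
      by (simp add: e2pi_def a_def b_def)
    moreover have "complex_of_real (cos (2*pi*x)) = (e2pi 1 x + e2pi (-1) x) / 2"
      "complex_of_real (sin (2*pi*x)) = \<i> * (e2pi (-1) x - e2pi 1 x) / 2"
      by (simp_all add: e2pi_def complex_eq_iff)
    ultimately have "complex_of_real (f (e2pi 1 x)) = (e2pi 1 x + e2pi (-1) x) / 2 * a + \<i> * (e2pi (-1) x - e2pi 1 x) / 2 * b"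
      by (simp only:)
    then show ?thesis by (simp add: field_simps \<alpha>_def \<beta>_def)
  qed
  have "integral {0..1} (\<lambda>x. D x * of_real (f (e2pi 1 x)) * e2pi k x) = 0" for k
  proof -
    have "(\<lambda>x. D x * of_real (f (e2pi 1 x)) * e2pi k x) =
      (\<lambda>x. \<alpha> * (D x * e2pi (1 + k) x) + \<beta> * (D x * e2pi (-1 + k) x))"
      by (simp only: f e2pi_add) (simp add: algebra_simps)
    moreover have "((\<lambda>x. D x * e2pi l x) has_integral 0) {0..1}" for l
    proof -
      have "(\<lambda>x. D x * e2pi l x) integrable_on {0..1}"
        using D by (auto simp: no_fourier_def intro!: integrable_continuous_real continuous_intros)
      then show ?thesis using D by (metis integrable_integral no_fourier_def)
    qed
    then have "((\<lambda>x. \<alpha> * (D x * e2pi (1 + k) x) + \<beta> * (D x * e2pi (-1 + k) x)) has_integral (\<alpha> * 0 + \<beta> * 0)) {0..1}"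
      by (intro has_integral_add has_integral_mult_right)
    ultimately show ?thesis by (simp add: integral_unique)
  qed
  moreover have "continuous_on {0..1} (\<lambda>x. f (e2pi 1 x))"
    by (intro continuous_on continuous_intros)
  ultimately show ?case
    using D by (auto simp: no_fourier_def intro!: continuous_intros)
next
  case (const c)
  have "(\<lambda>x. D x * complex_of_real c * e2pi k x) = (\<lambda>x. c * (D x * e2pi k x))" for k
    by auto
  with const show ?case by (auto simp: no_fourier_def intro!: continuous_intros)
next
  case (add f g)
  note F = add.IH(1)[OF add.prems] and G = add.IH(2)[OF add.prems]
  have "(\<lambda>x. D x * of_real (h (e2pi 1 x)) * e2pi k x) integrable_on {0..1}" 
    if "no_fourier (\<lambda>x. D x * of_real (h (e2pi 1 x)))" for k h
    using that by (auto simp: no_fourier_def intro!: integrable_continuous_real continuous_intros)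
  with F G show ?case
    by (auto simp: no_fourier_def algebra_simps integral_add intro!: continuous_intros)
next
  case (mult f g)
  show ?case using mult.IH(2)[OF mult.IH(1)[OF mult.prems]] by (simp add: mult.assoc)
qed

text \<open>By Stone-Weierstrass on the circle, of which \<^term>\<open>e2pi 1\<close> is a parametrization.\<close>

lemma no_fourier_imp_integral_eq_0:
  fixes h :: "real \<Rightarrow> real"
  assumes "no_fourier D" "continuous_on {0..1} h" "h 0 = h 1"
  shows "integral {0..1} (\<lambda>x. D x * of_real (h x)) = 0"
proof -
  define S where "S = e2pi 1 ` {0..1}"
  \<comment> \<open>The parametrization identifies nothing but the two end points, where
    \<open>h\<close> agrees by assumption, so \<open>h\<close> descends to a function on the
    circle.\<close>
  have inj: "h x = h y" if "x \<in> {0..1}" "y \<in> {0..1}" "e2pi 1 x = e2pi 1 y" for x y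
  proof -
    have "exp (\<i> * complex_of_real (2 * pi * x)) = exp (\<i> * complex_of_real (2 * pi * y))"
      using that by (simp add: e2pi_def cis_conv_exp)
    then obtain n :: int where "\<i> * complex_of_real (2 * pi * x) = \<i> * complex_of_real (2 * pi * y) + complex_of_real (of_int (2 * n) * pi) * \<i>"
      unfolding exp_eq by auto
    then have "Im (\<i> * complex_of_real (2 * pi * x)) = Im (\<i> * complex_of_real (2 * pi * y) + complex_of_real (of_int (2 * n) * pi) * \<i>)"
      by (rule arg_cong)
    then have "(2 * pi) * x = (2 * pi) * (y + of_int n)" by (simp add: algebra_simps)
    then have n: "x = y + of_int n" unfolding mult_cancel_left by simp
    then have "of_int n \<le> (1::real)" "of_int n \<ge> (-1::real)" using that(1,2) by auto
    then have "n = 0 \<or> n = 1 \<or> n = -1" by linarith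
    then show ?thesis using that n assms(3) by auto
  qed
  define g where "g w = h (SOME x. x \<in> {0..1} \<and> e2pi 1 x = w)" for w
  have g: "g (e2pi 1 x) = h x" if "x \<in> {0..1}" for x
    unfolding g_def
  proof (rule someI2[of _ x])
    show "x \<in> {0..1} \<and> e2pi 1 x = e2pi 1 x" using that by simp
    show "h y = h x" if "y \<in> {0..1} \<and> e2pi 1 y = e2pi 1 x" for y
      using inj[of y x] that \<open>x \<in> {0..1}\<close> by blast
  qed
  have cS: "compact S" unfolding S_def by (intro compact_continuous_image continuous_intros) auto
  have "continuous_on S g"
  proof (subst continuous_on_closed_vimage)
    show "closed S" using cS by (rule compact_imp_closed)
    \<comment> \<open>The preimage under \<open>g\<close> of a closed set is the image of its
      preimage under \<open>h\<close>, a closed part of the compact interval, and hence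
      compact.\<close>
    show "\<forall>B. closed B \<longrightarrow> closed (g -` B \<inter> S)"
    proof (intro allI impI)
      fix B :: "real set" assume "closed B"
      then have "closed (h -` B \<inter> {0..1})"
        using assms(2) continuous_on_closed_vimage[of "{0..1}" h] by auto
      then have "compact (h -` B \<inter> {0..1})"
        by (metis bounded_Int bounded_closed_interval compact_eq_bounded_closed)
      then have "compact (e2pi 1 ` (h -` B \<inter> {0..1}))"
        by (intro compact_continuous_image continuous_intros)
      moreover have "e2pi 1 ` (h -` B \<inter> {0..1}) = g -` B \<inter> S"
        using g by (force simp: S_def)
      ultimately show "closed (g -` B \<inter> S)" by (simp add: compact_imp_closed)
    qed
  qed
  have contD: "continuous_on {0..1} D" using assms(1) by (simp add: no_fourier_def)
  then obtain B where B: "norm (D x) \<le> B" "B > 0" if "x \<in> {0..1}" for x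
    using compact_continuous_image[OF contD] compact_imp_bounded
    by (metis bounded_pos compact_Icc image_eqI)
  have B0: "B > 0" using B(2)[of 0] by simp
  have "norm (integral {0..1} (\<lambda>x. D x * of_real (h x))) \<le> \<epsilon>" if "\<epsilon> > 0" for \<epsilon>
  proof -
    \<comment> \<open>\<open>B\<close> bounds \<open>D\<close>, so replacing \<open>h\<close> by the
      polynomial changes the integral by at most \<epsilon>, and the integral against the polynomial
      vanishes.\<close>
    obtain p where p: "real_polynomial_function p" "\<And>x. x \<in> S \<Longrightarrow> \<bar>g x - p x\<bar> < \<epsilon> / B"
      using Stone_Weierstrass_real_polynomial_function[OF cS \<open>continuous_on S g\<close>, of "\<epsilon> / B"] \<open>\<epsilon> > 0\<close> B0 by auto
    have P: "no_fourier (\<lambda>x. D x * of_real (p (e2pi 1 x)))"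
      by (rule no_fourier_polynomial[OF p(1) assms(1)])
    then have P0: "integral {0..1} (\<lambda>x. D x * of_real (p (e2pi 1 x)) * e2pi 0 x) = 0"
      unfolding no_fourier_def by blast
    have i1: "(\<lambda>x. D x * of_real (h x)) integrable_on {0..1}"
      by (intro integrable_continuous_real continuous_intros contD assms)
    have i2: "(\<lambda>x. D x * of_real (p (e2pi 1 x))) integrable_on {0..1}"
      using P by (auto simp: no_fourier_def intro: integrable_continuous_real)
    have "integral {0..1} (\<lambda>x. D x * of_real (h x)) = integral {0..1} (\<lambda>x. D x * of_real (h x) - D x * of_real (p (e2pi 1 x)))"
      using i1 i2 P0 by (simp add: integral_diff)
    also have "norm \<dots> \<le> \<epsilon> * (1 - 0)"
    proof (rule integral_bound)
      show "continuous_on {0..1} (\<lambda>x. D x * of_real (h x) - D x * of_real (p (e2pi 1 x)))"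
        using P by (auto simp: no_fourier_def intro!: continuous_intros contD assms)
      fix t :: real assume t: "t \<in> {0..1}"
      have "norm (D t * of_real (h t) - D t * of_real (p (e2pi 1 t))) = norm (D t) * \<bar>g (e2pi 1 t) - p (e2pi 1 t)\<bar>"
        unfolding g[OF t] right_diff_distrib[symmetric] of_real_diff[symmetric] norm_mult norm_of_real ..
      also have "\<dots> \<le> B * (\<epsilon> / B)"
        using p(2)[of "e2pi 1 t"] t B[OF t] by (intro mult_mono) (auto simp: S_def)
      finally show "norm (D t * of_real (h t) - D t * of_real (p (e2pi 1 t))) \<le> \<epsilon>" using B0 by simp
    qed simp
    finally show ?thesis by simp
  qed
  then show ?thesis
    by (metis dense_ge norm_le_zero_iff)
qed

text \<open>Testing \<open>D\<close> against its own real and imaginary parts, which are admissible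
  because \<open>D\<close> agrees at the end points, gives the integral of |D|^2. Its vanishing
  forces the continuous function \<open>D\<close> to be 0.\<close>

lemma no_fourier_imp_eq_0:
  assumes "no_fourier D" "D 0 = D 1" "x \<in> {0..1}"
  shows "D x = 0"
proof -
  have cont: "continuous_on {0..1} D" using assms(1) by (simp add: no_fourier_def)
  have 1: "integral {0..1} (\<lambda>x. D x * of_real (Re (D x))) = 0" "integral {0..1} (\<lambda>x. D x * of_real (Im (D x))) = 0"
    by (rule no_fourier_imp_integral_eq_0; use assms cont in \<open>auto intro!: continuous_intros\<close>)+
  have i: "(\<lambda>x. D x * of_real (Re (D x))) integrable_on {0..1}" "(\<lambda>x. D x * of_real (Im (D x))) integrable_on {0..1}"
    by (intro integrable_continuous_real continuous_intros cont)+
  have "integral {0..1} (\<lambda>x. D x * of_real (Re (D x)) - \<i> * (D x * of_real (Im (D x)))) = 0"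
    using 1 i by (simp add: integral_diff)
  also have "(\<lambda>x. D x * of_real (Re (D x)) - \<i> * (D x * of_real (Im (D x)))) = (\<lambda>x. complex_of_real ((norm (D x))\<^sup>2))"
    by (rule ext) (simp add: complex_eq_iff cmod_power2, simp add: power2_eq_square)
  finally have "integral {0..1} (\<lambda>x. complex_of_real ((norm (D x))\<^sup>2)) = 0" .
  moreover have int2: "(\<lambda>x. (norm (D x))\<^sup>2) integrable_on {0..1}"
    by (intro integrable_continuous_real continuous_intros cont)
  moreover have "integral {0..1} (\<lambda>x. complex_of_real ((norm (D x))\<^sup>2)) = of_real (integral {0..1} (\<lambda>x. (norm (D x))\<^sup>2))"
    by (rule integral_unique[OF has_integral_of_real[OF integrable_integral[OF int2]]])
  ultimately have "((\<lambda>x. (norm (D x))\<^sup>2) has_integral 0) (cbox 0 1)"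
    using integrable_integral[OF int2] by simp
  then have "(norm (D x))\<^sup>2 = 0"
    by (rule has_integral_0_cbox_imp_0[rotated 2]) (use assms(3) cont in \<open>auto intro!: continuous_intros\<close>)
  then show ?thesis by simp
qed

section \<open>Gaussian sums over the integers and Jacobi's theta function\<close>

lemma summable_on_exp_abs: "(\<lambda>n::int. exp (- of_int \<bar>n\<bar>) :: real) summable_on UNIV"
proof -
  have g: "(\<lambda>n::nat. exp (- real n)) summable_on UNIV"
  proof (rule norm_summable_imp_summable_on)
    have "summable (\<lambda>n. exp (-1::real) ^ n)" by (rule summable_geometric) simp
    then show "summable (\<lambda>n. norm (exp (- real n)))" by (simp flip: exp_of_nat_mult)
  qed
  have 1: "(\<lambda>n::int. exp (- of_int \<bar>n\<bar>) :: real) summable_on (range int)"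
    by (subst summable_on_reindex) (use g in \<open>auto simp: o_def\<close>)
  have 2: "(\<lambda>n::int. exp (- of_int \<bar>n\<bar>) :: real) summable_on (range (\<lambda>n. - int n))"
    by (subst summable_on_reindex) (use g in \<open>auto simp: o_def inj_on_def\<close>)
  have "UNIV = range int \<union> range (\<lambda>n. - int n)"
    by (auto simp: image_iff) (metis int_cases2)
  then show ?thesis using summable_on_union[OF 1 2] by simp
qed

text \<open>Completing the square bounds the exponent by a constant minus |n|. The linear term
  leaves room for a second variable ranging over a bounded set and for half-integral shifts of
  n.\<close>

lemma summable_on_gauss:
  assumes "a > 0"
  shows "(\<lambda>n::int. exp (- a * (of_int n)\<^sup>2 + b * \<bar>of_int n\<bar>) :: real) summable_on UNIV"
proof (rule summable_on_comparison_test)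
  show "(\<lambda>n::int. exp ((b + 1)\<^sup>2 / (4 * a)) * exp (- of_int \<bar>n\<bar>)) summable_on UNIV"
    by (intro summable_on_cmult_right summable_on_exp_abs)
  fix n :: int
  define m where "m = (of_int \<bar>n\<bar> :: real)"
  have "0 \<le> (2 * a * m - (b + 1))\<^sup>2 / (4 * a)" using assms by simp
  also have "\<dots> = a * m\<^sup>2 - (b + 1) * m + (b + 1)\<^sup>2 / (4 * a)"
    using assms by (simp add: field_simps power2_eq_square)
  finally have "- a * m\<^sup>2 + b * m \<le> (b + 1)\<^sup>2 / (4 * a) + - m" by (simp add: algebra_simps)
  then show "exp (- a * (of_int n)\<^sup>2 + b * \<bar>of_int n\<bar>) \<le> exp ((b + 1)\<^sup>2 / (4 * a)) * exp (- of_int \<bar>n\<bar>)"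
    by (simp add: m_def flip: exp_add)
qed auto

text \<open>Jacobi's theta function \<theta>_3 with modulus \<open>t\<close> and elliptic variable
  \<open>z\<close>. The variable \<open>z\<close> permits analytic continuation from real values and
  later absorbs the characteristics.\<close>

definition jacobi :: "complex \<Rightarrow> complex \<Rightarrow> complex" where
  "jacobi t z = (\<Sum>\<^sub>\<infinity>n::int. exp (pi * \<i> * (t * (of_int n)\<^sup>2 + 2 * of_int n * z)))"

lemma norm_jacobi_term_le:
  assumes "a \<le> Im t" "\<bar>Im z\<bar> \<le> b"
  shows "norm (exp (pi * \<i> * (t * (of_int n)\<^sup>2 + 2 * of_int n * z))) \<le>
         exp (- (pi * a) * (of_int n)\<^sup>2 + (2 * pi * b) * \<bar>of_int n\<bar>)"
proof -
  have n2: "Im (t * (of_int n)\<^sup>2) = Im t * (of_int n)\<^sup>2" "Im (2 * of_int n * z) = 2 * of_int n * Im z"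
    by (simp_all flip: of_int_power)
  have "- (of_int n * Im z) \<le> \<bar>of_int n * Im z\<bar>" by linarith
  also have "\<dots> = \<bar>Im z\<bar> * \<bar>of_int n\<bar>" by (simp add: abs_mult)
  also have "\<dots> \<le> b * \<bar>of_int n\<bar>" using assms by (intro mult_right_mono) auto
  finally have "- (2 * of_int n * Im z) \<le> 2 * b * \<bar>of_int n\<bar>" by linarith
  moreover have "a * (of_int n)\<^sup>2 \<le> Im t * (of_int n)\<^sup>2" using assms by (intro mult_right_mono) auto
  ultimately have "- (Im t * (of_int n)\<^sup>2 + 2 * of_int n * Im z) \<le> - a * (of_int n)\<^sup>2 + 2 * b * \<bar>of_int n\<bar>"
    by linarith
  then have "pi * - (Im t * (of_int n)\<^sup>2 + 2 * of_int n * Im z) \<le> pi * (- a * (of_int n)\<^sup>2 + 2 * b * \<bar>of_int n\<bar>)"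
    by (intro mult_left_mono) auto
  then show ?thesis
    by (simp add: n2 algebra_simps)
qed

text \<open>Stated along a holomorphic curve, so that one-variable theory covers the dependence on
  the modulus, on the elliptic variable, and on both together. On a small closed ball Im f is
  bounded below by a positive number and |Im g| is bounded above, which gives a single Gaussian
  majorant.\<close>

lemma holomorphic_on_jacobi:
  assumes "open S" "f holomorphic_on S" "g holomorphic_on S" "\<And>w. w \<in> S \<Longrightarrow> Im (f w) > 0"
  shows "(\<lambda>w. jacobi (f w) (g w)) holomorphic_on S"
proof -
  have "\<exists>r>0. (\<lambda>w. jacobi (f w) (g w)) holomorphic_on ball w r" if w: "w \<in> S" for w
  proof -
    obtain r where r: "r > 0" "cball w r \<subseteq> S" using assms(1) w open_contains_cball by blast
    have cf: "continuous_on (cball w r) f" "continuous_on (cball w r) g"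
      using assms r holomorphic_on_imp_continuous_on holomorphic_on_subset by metis+
    have ne: "cball w r \<noteq> {}" using r by auto
    obtain u where u: "u \<in> cball w r" "\<And>y. y \<in> cball w r \<Longrightarrow> Im (f u) \<le> Im (f y)"
      using continuous_attains_inf[OF compact_cball ne continuous_on_Im[OF cf(1)]] by auto
    have ca: "continuous_on (cball w r) (\<lambda>y. \<bar>Im (g y)\<bar>)" using cf(2) by (intro continuous_intros)
    obtain v where v: "\<forall>y \<in> cball w r. \<bar>Im (g y)\<bar> \<le> \<bar>Im (g v)\<bar>"
      using continuous_attains_sup[OF compact_cball ne ca] by blast
    define a b where "a = Im (f u)" and "b = \<bar>Im (g v)\<bar>"
    have a: "a > 0" using u r assms by (auto simp: a_def)
    have lim: "uniform_limit (cball w r) (\<lambda>X y. \<Sum>n\<in>X. exp (pi * \<i> * (f y * (of_int n)\<^sup>2 + 2 * of_int n * g y)))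
          (\<lambda>y. jacobi (f y) (g y)) (finite_subsets_at_top UNIV)"
      unfolding jacobi_def
    proof (rule Weierstrass_m_test_general)
      show "(\<lambda>n::int. exp (- (pi * a) * (of_int n)\<^sup>2 + (2 * pi * b) * \<bar>of_int n\<bar>)) summable_on UNIV"
        using a by (intro summable_on_gauss) auto
    qed (intro norm_jacobi_term_le; use u v in \<open>auto simp: a_def b_def\<close>)
    obtain "(\<lambda>y. jacobi (f y) (g y)) holomorphic_on ball w r"
    proof (rule holomorphic_uniform_limit[OF _ lim])
      have "f holomorphic_on ball w r" "g holomorphic_on ball w r"
        using assms r by (meson ball_subset_cball holomorphic_on_subset order_trans)+
      then show "\<forall>\<^sub>F X in finite_subsets_at_top UNIV.
        continuous_on (cball w r) (\<lambda>y. \<Sum>n\<in>X. exp (pi * \<i> * (f y * (of_int n)\<^sup>2 + 2 * of_int n * g y))) \<and>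
        (\<lambda>y. \<Sum>n\<in>X. exp (pi * \<i> * (f y * (of_int n)\<^sup>2 + 2 * of_int n * g y))) holomorphic_on ball w r"
        by (intro always_eventually allI conjI continuous_intros holomorphic_intros cf)
    qed auto
    with r show ?thesis by blast
  qed
  then show ?thesis
    using assms(1) by (metis analytic_on_def analytic_imp_holomorphic)
qed

section \<open>Poisson summation for Gaussians\<close>

lemma gaussian_fourier:
  fixes s :: real
  assumes s: "s > 0"
  shows "integrable lborel (\<lambda>y. of_real (exp (- pi * s * y\<^sup>2)) * e2pi k y)" (is ?I)
    and "(LBINT y. of_real (exp (- pi * s * y\<^sup>2)) * e2pi k y) = of_real (exp (- pi * (of_int k)\<^sup>2 / s) / sqrt s)" (is ?E)
proof -
  \<comment> \<open>Scaling by \<open>c\<close> turns the standard normal density into exp(-\<pi> s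
    y^2) up to a constant; the known characteristic function of the normal distribution at
    \<open>t\<close> is then the Fourier integral sought.\<close>
  define c where "c = sqrt (2 * pi * s)"
  have c: "c > 0" "c\<^sup>2 = 2 * pi * s" using s by (auto simp: c_def)
  define t where "t = 2 * pi * of_int k / c"
  have int0: "integrable std_normal_distribution (\<lambda>x. iexp (t * x))"
    by (rule prob_space.integrable_iexp) (auto simp: prob_space_normal_density real_dist_normal_dist)
  have meas: "(\<lambda>x. iexp (t * x)) \<in> borel_measurable lborel" by measurable
  have int1: "integrable lborel (\<lambda>x. std_normal_density x *\<^sub>R iexp (t * x))"
    using int0 by (subst (asm) integrable_density) (auto simp: normal_density_nonneg)
  have "exp (- (t\<^sup>2) / 2) = (LINT x|lborel. std_normal_density x *\<^sub>R iexp (t * x))"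
    using fun_cong[OF char_std_normal_distribution, of t]
    unfolding char_def by (subst (asm) integral_density) (auto simp: normal_density_nonneg)
  also have "\<dots> = c *\<^sub>R (LINT y|lborel. std_normal_density (0 + c * y) *\<^sub>R iexp (t * (0 + c * y)))"
    using c by (subst lborel_integral_real_affine[of c _ 0]) auto
  finally have E: "exp (- (t\<^sup>2) / 2) = c *\<^sub>R (LINT y|lborel. std_normal_density (0 + c * y) *\<^sub>R iexp (t * (0 + c * y)))" .
  have eq: "std_normal_density (0 + c * y) *\<^sub>R iexp (t * (0 + c * y)) =
      (1 / sqrt (2 * pi)) *\<^sub>R (of_real (exp (- pi * s * y\<^sup>2)) * e2pi k y)" for y
  proof -
    have "(c * y)\<^sup>2 = 2 * pi * s * y\<^sup>2" using c by (simp add: power_mult_distrib)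
    moreover have "t * (0 + c * y) = 2 * pi * of_int k * y" using c by (simp add: t_def)
    ultimately show ?thesis
      unfolding e2pi_def cis_conv_exp \<open>t * (0 + c * y) = 2 * pi * of_int k * y\<close>
      by (simp add: normal_density_def scaleR_conv_of_real)
  qed
  have "integrable lborel (\<lambda>y. std_normal_density (0 + c * y) *\<^sub>R iexp (t * (0 + c * y)))"
    using lborel_integrable_real_affine[OF int1, of c 0] c by simp
  then have "integrable lborel (\<lambda>y. sqrt (2 * pi) *\<^sub>R ((1 / sqrt (2 * pi)) *\<^sub>R (of_real (exp (- pi * s * y\<^sup>2)) * e2pi k y)))"
    unfolding eq by (rule integrable_scaleR_right)
  then show ?I by simp
  have "t\<^sup>2 / 2 = pi * (of_int k)\<^sup>2 / s"
    unfolding t_def power_divide c(2) using s by (simp add: field_simps power2_eq_square)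
  then have t2: "- (t\<^sup>2) / 2 = - pi * (of_int k)\<^sup>2 / s" by simp
  have cs: "c / sqrt (2 * pi) = sqrt s" using s by (simp add: c_def real_sqrt_mult)
  have "complex_of_real (exp (- pi * (of_int k)\<^sup>2 / s)) = sqrt s * (LBINT y. of_real (exp (- pi * s * y\<^sup>2)) * e2pi k y)"
    using E unfolding eq t2 by (simp add: scaleR_conv_of_real flip: cs)
  then show ?E using s by (simp add: field_simps)
qed

lemma has_sum_integral:
  fixes f :: "'a \<Rightarrow> real \<Rightarrow> complex"
  assumes "\<And>n x. x \<in> {a..b} \<Longrightarrow> norm (f n x) \<le> M n" "M summable_on UNIV" "\<And>n. continuous_on {a..b} (f n)"
  shows "((\<lambda>n. integral {a..b} (f n)) has_sum integral {a..b} (\<lambda>x. \<Sum>\<^sub>\<infinity>n. f n x)) UNIV"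
    and "continuous_on {a..b} (\<lambda>x. \<Sum>\<^sub>\<infinity>n. f n x)"
proof -
  have lim: "uniform_limit {a..b} (\<lambda>X x. \<Sum>n\<in>X. f n x) (\<lambda>x. \<Sum>\<^sub>\<infinity>n. f n x) (finite_subsets_at_top UNIV)"
    by (rule Weierstrass_m_test_general) (use assms in auto)
  obtain I J where IJ: "\<And>X. ((\<lambda>x. \<Sum>n\<in>X. f n x) has_integral I X) {a..b}"
     "((\<lambda>x. \<Sum>\<^sub>\<infinity>n. f n x) has_integral J) {a..b}" "(I \<longlongrightarrow> J) (finite_subsets_at_top UNIV)"
    by (rule uniform_limit_integral[OF lim]) (auto intro!: continuous_intros assms)
  have "I X = (\<Sum>n\<in>X. integral {a..b} (f n))" if "finite X" for X
    using IJ(1)[of X] integral_sum[of X f "{a..b}"] that assms(3)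
    by (metis (mono_tags, lifting) integrable_continuous_real integral_unique)
  then have "\<forall>\<^sub>F X in finite_subsets_at_top UNIV. I X = (\<Sum>n\<in>X. integral {a..b} (f n))"
    by (intro eventually_finite_subsets_at_top_weakI) auto
  then have "((\<lambda>X. \<Sum>n\<in>X. integral {a..b} (f n)) \<longlongrightarrow> J) (finite_subsets_at_top UNIV)"
    using IJ(3) by (rule Lim_transform_eventually[rotated])
  with IJ(2) show "((\<lambda>n. integral {a..b} (f n)) has_sum integral {a..b} (\<lambda>x. \<Sum>\<^sub>\<infinity>n. f n x)) UNIV"
    by (simp add: has_sum_def integral_unique)
  show "continuous_on {a..b} (\<lambda>x. \<Sum>\<^sub>\<infinity>n. f n x)"
    by (rule uniform_limit_theorem[OF _ lim]) (auto intro!: always_eventually continuous_intros assms)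
qed

text \<open>The sets {-N..<N} are cofinal among the finite sets of integers, so the unordered sum
  can be read as a limit. Its partial sums are the integrals over [-N, N], which converge to the
  integral over the line by integrability.\<close>

lemma integral_lborel_unit_intervals:
  fixes \<phi> :: "real \<Rightarrow> complex"
  assumes int: "integrable lborel \<phi>" and cont: "continuous_on UNIV \<phi>"
    and sum: "((\<lambda>n::int. integral {of_int n..of_int n + 1} \<phi>) has_sum J) UNIV"
  shows "J = (LBINT y. \<phi> y)"
proof -
  let ?I = "\<lambda>n::int. integral {of_int n..of_int n + 1} \<phi>"
  have "filterlim (\<lambda>N. {- int N..<int N}) (finite_subsets_at_top UNIV) sequentially"
    unfolding filterlim_finite_subsets_at_top
  proof safe
    fix X :: "int set" assume X: "finite X"
    define N where "N = nat (Max (insert 0 (abs ` X)) + 1)"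
    have N: "\<bar>x\<bar> < int N" if "x \<in> X" for x
    proof -
      have "\<bar>x\<bar> \<le> Max (insert 0 (abs ` X))" using X that by (intro Max_ge) auto
      then show ?thesis by (simp add: N_def)
    qed
    show "\<forall>\<^sub>F M in sequentially. finite {- int M..<int M} \<and> X \<subseteq> {- int M..<int M} \<and> {- int M..<int M} \<subseteq> UNIV"
      using eventually_ge_at_top[of N]
    proof eventually_elim
      case (elim M)
      have "x \<in> {- int M..<int M}" if "x \<in> X" for x
        using N[OF that] elim by auto
      then show ?case by auto
    qed
  qed
  from filterlim_compose[OF sum[unfolded has_sum_def] this]
  have L: "(\<lambda>N. \<Sum>n\<in>{- int N..<int N}. ?I n) \<longlonglongrightarrow> J" by simp
  have cont': "continuous_on A \<phi>" for A using cont continuous_on_subset by blast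
  have "(\<Sum>n\<in>{- int N..<int N}. ?I n) = (LINT y:{- real N..real N}|lborel. \<phi> y)" for N
  proof -
    have "(\<Sum>n\<in>{- int N..<int N}. ?I n) = integral {- real N..real N} \<phi>"
    proof (induction N)
      case (Suc N)
      have "{- int (Suc N)..<int (Suc N)} = insert (- int (Suc N)) (insert (int N) {- int N..<int N})" by auto
      then have "(\<Sum>n\<in>{- int (Suc N)..<int (Suc N)}. ?I n) = ?I (- int (Suc N)) + (?I (int N) + integral {- real N..real N} \<phi>)"
        using Suc by simp
      also have "?I (int N) + integral {- real N..real N} \<phi> = integral {- real N..real (Suc N)} \<phi>"
        using Henstock_Kurzweil_Integration.integral_combine[where a = "- real N" and c = "real N" and b = "real (Suc N)" and f = \<phi>] cont'
        by (simp add: integrable_continuous_real add.commute)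
      also have "?I (- int (Suc N)) + \<dots> = integral {- real (Suc N)..real (Suc N)} \<phi>"
        using Henstock_Kurzweil_Integration.integral_combine[where a = "- real (Suc N)" and c = "- real N" and b = "real (Suc N)" and f = \<phi>] cont'
        by (simp add: integrable_continuous_real)
      finally show ?case .
    qed simp
    moreover have "set_integrable lborel {- real N..real N} \<phi>"
      using int by (metis borel_integrable_atLeastAtMost' cont')
    ultimately show ?thesis using set_borel_integral_eq_integral(2) by metis
  qed
  with L have "(\<lambda>N. LINT y:{- real N..real N}|lborel. \<phi> y) \<longlonglongrightarrow> J" by simp
  moreover have "(\<lambda>N. LINT y:{- real N..real N}|lborel. \<phi> y) \<longlonglongrightarrow> (LINT y:(\<Union>N. {- real N..real N})|lborel. \<phi> y)"
  proof (rule set_integral_cont_up)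
    show "set_integrable lborel (\<Union>N. {- real N..real N}) \<phi>"
      unfolding set_integrable_def by (rule integrable_mult_indicator) (use int in auto)
  qed (auto simp: incseq_def)
  moreover have "(\<Union>N. {- real N..real N}) = UNIV"
  proof -
    have "\<exists>N. - real N \<le> x \<and> x \<le> real N" for x :: real
    proof -
      obtain N where "\<bar>x\<bar> \<le> real N" using real_arch_simple by blast
      then show ?thesis by (intro exI[of _ N]) linarith
    qed
    then show ?thesis by auto
  qed
  ultimately show ?thesis
    using LIMSEQ_unique by (fastforce simp: set_lebesgue_integral_def)
qed

text \<open>Both sides are continuous, periodic and have the same Fourier coefficients: on the left
  the translates of the unit interval unfold to the Fourier integral over the real line, on the
  right the series is integrated term by term.\<close>

lemma poisson_gauss:
  fixes s x :: real
  assumes s: "s > 0" and x: "x \<in> {0..1}"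
  shows "(\<Sum>\<^sub>\<infinity>n::int. complex_of_real (exp (- pi * s * (x + of_int n)\<^sup>2))) =
         (\<Sum>\<^sub>\<infinity>n::int. of_real (exp (- pi * (of_int n)\<^sup>2 / s) / sqrt s) * e2pi n x)"
proof -
  define f where "f n x = complex_of_real (exp (- pi * s * (x + of_int n)\<^sup>2))" for n :: int and x :: real
  define c where "c n = exp (- pi * (of_int n)\<^sup>2 / s) / sqrt s" for n :: int
  define A where "A x = (\<Sum>\<^sub>\<infinity>n. f n x)" for x
  define B where "B x = (\<Sum>\<^sub>\<infinity>n. of_real (c n) * e2pi n x)" for x
  define M where "M n = exp (- (pi * s) * (of_int n)\<^sup>2 + (2 * pi * s) * \<bar>of_int n\<bar>)" for n :: int
  have Ms: "M summable_on UNIV" unfolding M_def using s by (intro summable_on_gauss) auto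
  have fM: "norm (f n x) \<le> M n" if "x \<in> {0..1}" for n x
  proof -
    have "- (2 * of_int n * x) \<le> 2 * \<bar>of_int n\<bar> * x"
      using that abs_ge_minus_self[of "of_int n :: real"] mult_right_mono[of "- of_int n" "\<bar>of_int n\<bar>" x]
      by (auto simp: mult.commute)
    also have "\<dots> \<le> 2 * \<bar>of_int n\<bar>" using that by (intro mult_left_le) auto
    finally have "- (2 * of_int n * x) \<le> 2 * \<bar>of_int n\<bar>" .
    moreover have "- (x + of_int n)\<^sup>2 = - (of_int n)\<^sup>2 + - (2 * of_int n * x) - x\<^sup>2"
      by (simp add: power2_eq_square algebra_simps)
    ultimately have "- (x + of_int n)\<^sup>2 \<le> - (of_int n)\<^sup>2 + 2 * \<bar>of_int n\<bar>"
      using zero_le_power2[of x] by linarith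
    then have "(pi * s) * - (x + of_int n)\<^sup>2 \<le> (pi * s) * (- (of_int n)\<^sup>2 + 2 * \<bar>of_int n\<bar>)"
      using s by (intro mult_left_mono) auto
    then show ?thesis by (simp add: f_def M_def algebra_simps)
  qed
  have fc: "continuous_on S (f n)" for n S unfolding f_def by (intro continuous_intros)
  have cs: "c summable_on UNIV"
  proof -
    have "(\<lambda>n::int. exp (- (pi / s) * (of_int n)\<^sup>2 + 0 * \<bar>of_int n\<bar>) * (1 / sqrt s)) summable_on UNIV"
      using s by (intro summable_on_cmult_left summable_on_gauss) auto
    then show ?thesis by (simp add: c_def[abs_def])
  qed
  have c0: "c n \<ge> 0" for n using s by (simp add: c_def)
  have A: "continuous_on {0..1} A" unfolding A_def
    by (rule has_sum_integral(2)[where M = M]) (use fM Ms fc in auto)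
  have B: "continuous_on {0..1} B" unfolding B_def
    by (rule has_sum_integral(2)[where M = c]) (use cs c0 in \<open>auto simp: norm_mult intro!: continuous_intros\<close>)
  \<comment> \<open>The integral picks the coefficient with index \<open>- k\<close>, and
    \<open>c\<close> is even.\<close>
  have IB: "integral {0..1} (\<lambda>x. B x * e2pi k x) = c k" for k
  proof -
    have "((\<lambda>n. integral {0..1} (\<lambda>x. of_real (c n) * e2pi (n + k) x)) has_sum
          integral {0..1} (\<lambda>x. \<Sum>\<^sub>\<infinity>n. of_real (c n) * e2pi (n + k) x)) UNIV"
      by (rule has_sum_integral(1)[where M = c]) (use cs c0 in \<open>auto simp: norm_mult intro!: continuous_intros\<close>)
    moreover have "(\<Sum>\<^sub>\<infinity>n. of_real (c n) * e2pi (n + k) x) = B x * e2pi k x" for x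
      unfolding B_def by (subst infsum_cmult_left'[symmetric]) (simp add: e2pi_add mult.assoc)
    moreover have "integral {0..1} (\<lambda>x. of_real (c n) * e2pi (n + k) x) = (if n = - k then of_real (c (-k)) else 0)" for n
      by (auto simp: integral_e2pi)
    ultimately have "((\<lambda>n. if n = - k then of_real (c (-k)) else 0) has_sum integral {0..1} (\<lambda>x. B x * e2pi k x)) UNIV"
      by simp
    moreover have "((\<lambda>n. if n = - k then of_real (c (-k)) else 0 :: complex) has_sum of_real (c (-k))) UNIV"
      by (rule has_sum_finite_neutralI[of "{-k}"]) auto
    ultimately show ?thesis
      using has_sum_unique by (fastforce simp: c_def)
  qed
  have IA: "integral {0..1} (\<lambda>x. A x * e2pi k x) = c k" for k
  proof -
    define \<phi> where "\<phi> y = complex_of_real (exp (- pi * s * y\<^sup>2)) * e2pi k y" for y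
    have "((\<lambda>n. integral {0..1} (\<lambda>x. f n x * e2pi k x)) has_sum
          integral {0..1} (\<lambda>x. \<Sum>\<^sub>\<infinity>n. f n x * e2pi k x)) UNIV"
      by (rule has_sum_integral(1)[where M = M]) (use Ms fM in \<open>auto simp: norm_mult intro!: continuous_intros fc\<close>)
    moreover have "(\<Sum>\<^sub>\<infinity>n. f n x * e2pi k x) = A x * e2pi k x" for x
      unfolding A_def by (subst infsum_cmult_left'[symmetric]) simp
    moreover have "integral {0..1} (\<lambda>x. f n x * e2pi k x) = integral {of_int n..of_int n + 1} \<phi>" for n
    proof -
      have "e2pi k (of_int n + x) = e2pi k x" for x
      proof -
        have "e2pi k (of_int n + x) = cis (2 * pi * of_int (k * n)) * e2pi k x"
          unfolding e2pi_def cis_mult by (simp add: algebra_simps)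
        also have "cis (2 * pi * of_int (k * n)) = 1" by (rule cis_multiple_2pi) auto
        finally show ?thesis by simp
      qed
      then have "(\<lambda>x. f n x * e2pi k x) = \<phi> \<circ> ((+) (of_int n))"
        by (auto simp: \<phi>_def f_def fun_eq_iff add.commute)
      then show ?thesis using integral_shift_Icc_real[of 0 1 \<phi> "of_int n"] by (simp add: add.commute)
    qed
    ultimately have "((\<lambda>n. integral {of_int n..of_int n + 1} \<phi>) has_sum integral {0..1} (\<lambda>x. A x * e2pi k x)) UNIV"
      by simp
    then have "integral {0..1} (\<lambda>x. A x * e2pi k x) = (LBINT y. \<phi> y)"
      by (intro integral_lborel_unit_intervals)
         (use gaussian_fourier(1)[OF s, of k] in \<open>auto simp: \<phi>_def[abs_def] intro!: continuous_intros\<close>)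
    also have "\<dots> = c k" unfolding \<phi>_def gaussian_fourier(2)[OF s] c_def ..
    finally show ?thesis .
  qed
  have "A x - B x = 0"
  proof (rule no_fourier_imp_eq_0[of "\<lambda>x. A x - B x"])
    have "(\<lambda>x. A x * e2pi k x) integrable_on {0..1}" "(\<lambda>x. B x * e2pi k x) integrable_on {0..1}" for k
      by (intro integrable_continuous_real continuous_intros A B)+
    then show "no_fourier (\<lambda>x. A x - B x)"
      unfolding no_fourier_def left_diff_distrib
      using A B IA IB by (auto intro!: continuous_intros simp: integral_diff)
    have "A 1 = A 0"
      unfolding A_def
      by (rule infsum_reindex_bij_witness[of _ "\<lambda>n. n - 1" "\<lambda>n. n + 1"]) (auto simp: f_def add.commute)
    moreover have "B 1 = B 0"
      unfolding B_def using e2pi_shift[of _ 0] by simp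
    ultimately show "A 0 - B 0 = A 1 - B 1" by simp
  qed (use x in auto)
  then show ?thesis by (simp add: A_def B_def f_def c_def)
qed

text \<open>Poisson summation with 1/s in place of \<open>s\<close>, after expanding (x + n)^2. The
  substitution of -n for n only matches the sign of the linear term.\<close>

lemma jacobi_inversion_real:
  fixes s x :: real
  assumes "s > 0" and x: "x \<in> {0..1}"
  shows "jacobi (- 1 / (\<i> * s)) (x / (\<i> * s)) = csqrt (- \<i> * (\<i> * s)) * exp (pi * \<i> * x\<^sup>2 / (\<i> * s)) * jacobi (\<i> * s) x"
proof -
  have "jacobi (\<i> * s) x = (\<Sum>\<^sub>\<infinity>n::int. of_real (exp (- pi * (of_int n)\<^sup>2 * s)) * e2pi n x)"
    unfolding jacobi_def
    by (intro infsum_cong) (simp add: e2pi_def cis_conv_exp exp_of_real[symmetric] exp_add[symmetric] algebra_simps)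
  also have "\<dots> = (\<Sum>\<^sub>\<infinity>n::int. (1 / sqrt s) * (of_real (exp (- pi * (of_int n)\<^sup>2 / (1/s)) / sqrt (1/s)) * e2pi n x))"
    using assms by (intro infsum_cong) (simp add: real_sqrt_divide)
  also have "\<dots> = (1 / sqrt s) * (\<Sum>\<^sub>\<infinity>n::int. of_real (exp (- pi * (of_int n)\<^sup>2 / (1/s)) / sqrt (1/s)) * e2pi n x)"
    by (rule infsum_cmult_right')
  also have "\<dots> = (1 / sqrt s) * (\<Sum>\<^sub>\<infinity>n::int. complex_of_real (exp (- pi * (1/s) * (x + of_int n)\<^sup>2)))"
    using poisson_gauss[of "1/s" x] assms by simp
  also have "(\<Sum>\<^sub>\<infinity>n::int. complex_of_real (exp (- pi * (1/s) * (x + of_int n)\<^sup>2))) =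
     (\<Sum>\<^sub>\<infinity>n::int. exp (- pi * x\<^sup>2 / s) * exp (pi * \<i> * ((- 1 / (\<i> * s)) * (of_int n)\<^sup>2 + 2 * of_int n * (x / (\<i> * s)))))"
  proof (rule infsum_reindex_bij_witness[of _ uminus uminus])
    fix n :: int
    have "exp (- pi * x\<^sup>2 / s) * exp (pi * \<i> * ((- 1 / (\<i> * s)) * (of_int (- n))\<^sup>2 + 2 * of_int (- n) * (x / (\<i> * s)))) =
      exp (complex_of_real (- pi * x\<^sup>2 / s) + pi * \<i> * ((- 1 / (\<i> * s)) * (of_int (- n))\<^sup>2 + 2 * of_int (- n) * (x / (\<i> * s))))"
      by (simp only: exp_add exp_of_real)
    also have "complex_of_real (- pi * x\<^sup>2 / s) + pi * \<i> * ((- 1 / (\<i> * s)) * (of_int (- n))\<^sup>2 + 2 * of_int (- n) * (x / (\<i> * s)))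
       = complex_of_real (- pi * (1/s) * (x + of_int n)\<^sup>2)"
      using assms by (simp add: field_simps power2_eq_square)
    finally show "exp (- pi * x\<^sup>2 / s) * exp (pi * \<i> * ((- 1 / (\<i> * s)) * (of_int (- n))\<^sup>2 + 2 * of_int (- n) * (x / (\<i> * s)))) =
       complex_of_real (exp (- pi * (1/s) * (x + of_int n)\<^sup>2))" by (simp only: exp_of_real)
  qed auto
  also have "\<dots> = exp (- pi * x\<^sup>2 / s) * jacobi (- 1 / (\<i> * s)) (x / (\<i> * s))"
    unfolding jacobi_def by (rule infsum_cmult_right')
  finally have E: "jacobi (\<i> * s) x = (1 / sqrt s) * (exp (- pi * x\<^sup>2 / s) * jacobi (- 1 / (\<i> * s)) (x / (\<i> * s)))" .
  have "csqrt (- \<i> * (\<i> * s)) = sqrt s" using assms by (simp add: csqrt_of_real_nonneg flip: mult.assoc)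
  moreover have "exp (pi * \<i> * x\<^sup>2 / (\<i> * s)) * exp (- pi * x\<^sup>2 / s) = 1"
    by (simp flip: exp_of_real exp_add)
  ultimately show ?thesis unfolding E using assms by (simp add: field_simps)
qed

text \<open>Two analytic continuations: first in \<open>z\<close>, from the interval [0, 1], for a
  modulus on the imaginary axis, and then in \<open>t\<close> for fixed \<open>z\<close>. Since
  -\<i>t has positive real part, the principal square root is holomorphic on the whole
  half-plane.\<close>

lemma jacobi_inversion:
  assumes t: "Im t > 0"
  shows "jacobi (- 1 / t) (z / t) = csqrt (- \<i> * t) * exp (pi * \<i> * z\<^sup>2 / t) * jacobi t z"
proof -
  have 1: "jacobi (- 1 / (\<i> * s)) (z / (\<i> * s)) = csqrt (- \<i> * (\<i> * s)) * exp (pi * \<i> * z\<^sup>2 / (\<i> * s)) * jacobi (\<i> * s) z" (is "?f z = ?g z")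
    if s: "s > 0" for s :: real and z
  proof -
    have Im: "Im (- 1 / (\<i> * s)) > 0" using s by (simp add: Im_divide power2_eq_square)
    have "?f z - ?g z = 0"
    proof (rule analytic_continuation[of "\<lambda>z. ?f z - ?g z" UNIV "complex_of_real ` {0..1}" 0 z])
      show "(\<lambda>z. ?f z - ?g z) holomorphic_on UNIV"
        by (intro holomorphic_intros holomorphic_on_jacobi) (use s Im in auto)
      show "?f z - ?g z = 0" if "z \<in> complex_of_real ` {0..1}" for z
        using that jacobi_inversion_real[OF s] by auto
      show "(0::complex) islimpt complex_of_real ` {0..1}"
        unfolding islimpt_sequential
      proof (intro exI[of _ "\<lambda>n. complex_of_real (inverse (real (Suc n)))"] conjI allI)
        fix n
        have "inverse (real (Suc n)) \<in> {0..1}" "inverse (real (Suc n)) \<noteq> 0" by (auto simp: field_simps)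
        then show "complex_of_real (inverse (real (Suc n))) \<in> complex_of_real ` {0..1} - {0}"
          unfolding Diff_iff singleton_iff of_real_eq_0_iff by blast
        show "(\<lambda>n. complex_of_real (inverse (real (Suc n)))) \<longlonglongrightarrow> 0"
          using tendsto_of_real[OF LIMSEQ_inverse_real_of_nat, where ?'a = complex] by simp
      qed
    qed auto
    then show ?thesis by simp
  qed
  let ?f = "\<lambda>t. jacobi (- 1 / t) (z / t)" and ?g = "\<lambda>t. csqrt (- \<i> * t) * exp (pi * \<i> * z\<^sup>2 / t) * jacobi t z"
  have "?f t - ?g t = 0"
  proof (rule analytic_continuation[of "\<lambda>t. ?f t - ?g t" "{t. Im t > 0}" "(\<lambda>s. \<i> * complex_of_real s) ` {0<..}" \<i> t])
    have Im: "Im (- 1 / t) > 0" if "Im t > 0" for t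
      using that by (auto simp: Im_divide add_nonneg_pos intro!: divide_pos_pos)
    have nr: "- \<i> * t \<notin> \<real>\<^sub>\<le>\<^sub>0" if "Im t > 0" for t
      using that by (auto simp: complex_nonpos_Reals_iff)
    show "(\<lambda>t. ?f t - ?g t) holomorphic_on {t. Im t > 0}"
      by (intro holomorphic_intros holomorphic_on_jacobi) (use Im nr in \<open>auto simp: open_halfspace_Im_gt\<close>)
    show "open {t. Im t > 0}" "connected {t. Im t > 0}"
      by (auto simp: open_halfspace_Im_gt intro!: convex_connected convex_halfspace_Im_gt)
    show "?f t - ?g t = 0" if "t \<in> (\<lambda>s. \<i> * complex_of_real s) ` {0<..}" for t
      using that 1 by auto
    show "\<i> islimpt (\<lambda>s. \<i> * complex_of_real s) ` {0<..}"
      unfolding islimpt_sequential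
    proof (intro exI[of _ "\<lambda>n. \<i> * of_real (1 + inverse (real (Suc n)))"] conjI allI)
      fix n show "\<i> * complex_of_real (1 + inverse (real (Suc n))) \<in> (\<lambda>s. \<i> * complex_of_real s) ` {0<..} - {\<i>}"
      proof -
        have "complex_of_real (1 + inverse (real (Suc n))) \<noteq> 1"
          unfolding of_real_eq_1_iff by simp
        moreover have "1 + inverse (real (Suc n)) > 0" by (simp add: add_pos_pos)
        ultimately show ?thesis
          using mult_cancel_left1[of \<i>] by (auto simp del: of_real_add of_real_inverse)
      qed
    next
      have "(\<lambda>n. \<i> * of_real (1 + inverse (real (Suc n)))) \<longlonglongrightarrow> \<i> * of_real (1 + 0)"
        by (intro tendsto_intros LIMSEQ_inverse_real_of_nat)
      then show "(\<lambda>n. \<i> * of_real (1 + inverse (real (Suc n)))) \<longlonglongrightarrow> \<i>" by simp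
    qed
  qed (use t in auto)
  then show ?thesis by simp
qed

section \<open>Theta series with integral characteristics\<close>

definition lat :: "nat \<Rightarrow> (nat \<Rightarrow> int) set" where
  "lat g = {n. \<forall>i\<ge>g. n i = 0}"

definition quad :: "nat \<Rightarrow> complex mat \<Rightarrow> (nat \<Rightarrow> real) \<Rightarrow> complex" where
  "quad g \<tau> x = (\<Sum>i<g. \<Sum>j<g. \<tau> $$ (i, j) * of_real (x i * x j))"

definition tterm :: "nat \<Rightarrow> complex mat \<Rightarrow> (nat \<Rightarrow> real) \<Rightarrow> (nat \<Rightarrow> int) \<Rightarrow> complex" where
  "tterm g \<tau> x d = exp (pi * \<i> * (quad g \<tau> x + of_real (\<Sum>i<g. x i * d i)))"

definition xvec :: "(nat \<Rightarrow> int) \<Rightarrow> (nat \<Rightarrow> int) \<Rightarrow> nat \<Rightarrow> real" where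
  "xvec e n i = of_int (n i) + of_int (e i) / 2"

text \<open>The characteristics are arbitrary integers here, so that shifting them by even vectors makes sense.\<close>

definition theta_int :: "nat \<Rightarrow> complex mat \<Rightarrow> (nat \<Rightarrow> int) \<Rightarrow> (nat \<Rightarrow> int) \<Rightarrow> complex" where
  "theta_int g \<tau> e d = (\<Sum>\<^sub>\<infinity>n\<in>lat g. tterm g \<tau> (xvec e n) d)"

lemma theta_eq_theta_int:
  assumes v: "v \<in> carrier_vec (2 * g)" and \<tau>: "\<tau> \<in> carrier_mat g g"
  shows "theta g v \<tau> = theta_int g \<tau> (\<lambda>i. of_bit (v $ i)) (\<lambda>i. of_bit (v $ (g + i)))"
  unfolding theta_def theta_int_def
proof (rule infsum_reindex_bij_witness[of _ "\<lambda>n. vec g n" "\<lambda>v i. if i < g then v $ i else 0"])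
  fix n :: "int vec" assume n: "n \<in> carrier_vec g"
  let ?n = "\<lambda>i. if i < g then n $ i else 0"
  let ?e = "\<lambda>i. of_bit (v $ i) :: int" and ?d = "\<lambda>i. of_bit (v $ (g + i)) :: int"
  let ?x = "map_vec of_int n + (1 / 2) \<cdot>\<^sub>v map_vec of_bit (vec_first v g) :: complex vec"
  have x: "?x $ i = of_real (xvec ?e ?n i)" if "i < g" for i
    using that n v by (simp add: xvec_def vec_first_def)
  have dx: "dim_vec ?x = g" using v by (simp add: vec_first_def)
  define X where "X = ?x"
  note x = x[folded X_def] and dx = dx[folded X_def]
  have "X \<bullet> (\<tau> *\<^sub>v X) = (\<Sum>i<g. \<Sum>j<g. X $ i * (\<tau> $$ (i, j) * X $ j))"
    using dx \<tau> by (simp add: scalar_prod_def sum_distrib_left atLeast0LessThan)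
  also have "\<dots> = quad g \<tau> (xvec ?e ?n)"
    unfolding quad_def by (intro sum.cong refl) (simp add: x)
  finally have 1: "X \<bullet> (\<tau> *\<^sub>v X) = quad g \<tau> (xvec ?e ?n)" .
  have "X \<bullet> map_vec of_bit (vec_last v g) = (\<Sum>i<g. X $ i * of_bit (v $ (g + i)))"
    using v by (simp add: scalar_prod_def vec_last_def atLeast0LessThan mult_2)
  also have "\<dots> = of_real (\<Sum>i<g. xvec ?e ?n i * of_int (?d i))"
    unfolding of_real_sum by (intro sum.cong refl) (simp add: x)
  finally show "tterm g \<tau> (xvec ?e ?n) ?d =
      (let x = ?x; \<delta> = map_vec of_bit (vec_last v g) in exp (complex_of_real pi * \<i> * (x \<bullet> (\<tau> *\<^sub>v x) + x \<bullet> \<delta>)))"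
    by (simp only: tterm_def Let_def 1 X_def[symmetric])
qed (auto simp: lat_def fun_eq_iff)

lemma summable_on_lat_prod:
  fixes f :: "nat \<Rightarrow> int \<Rightarrow> real"
  assumes "\<And>i. i < g \<Longrightarrow> f i summable_on UNIV" "\<And>i m. f i m \<ge> 0"
  shows "(\<lambda>n. \<Prod>i<g. f i (n i)) summable_on lat g"
  using assms(1)
proof (induction g)
  case 0
  have "lat 0 = {\<lambda>_. 0}" by (auto simp: lat_def)
  then show ?case by simp
next
  case (Suc g)
  have "(\<lambda>(n, m). (\<Prod>i<g. f i (n i)) * f g m) summable_on (lat g \<times> UNIV)"
  proof (rule summable_on_SigmaI)
    fix n
    show "((\<lambda>m. case (n, m) of (n, m) \<Rightarrow> (\<Prod>i<g. f i (n i)) * f g m) has_sum (\<Prod>i<g. f i (n i)) * infsum (f g) UNIV) UNIV"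
      using Suc.prems[of g] by (auto intro!: has_sum_cmult_right)
  next
    show "(\<lambda>n. (\<Prod>i<g. f i (n i)) * infsum (f g) UNIV) summable_on lat g"
      using Suc by (intro summable_on_cmult_left) auto
  qed (auto intro!: mult_nonneg_nonneg prod_nonneg assms)
  also have "?this \<longleftrightarrow> ?case"
  proof (rule summable_on_reindex_bij_witness[of _ "\<lambda>n. (n(g := 0), n g)" "\<lambda>(n, m). n(g := m)"])
    fix a assume "a \<in> lat g \<times> (UNIV :: int set)"
    then obtain n m where a: "a = (n, m)" "n \<in> lat g" by auto
    have "(\<Prod>i<g. f i (if i = g then m else n i)) = (\<Prod>i<g. f i (n i))" by (intro prod.cong) auto
    then show "(\<Prod>i<Suc g. f i ((case a of (n, m) \<Rightarrow> n(g := m)) i)) = (case a of (n, m) \<Rightarrow> (\<Prod>i<g. f i (n i)) * f g m)"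
      by (simp add: a)
  qed (auto simp: lat_def)
  finally show ?case .
qed

text \<open>The Gaussian factors over the coordinates, and the half-integral shift costs only a term
  linear in |n_i|, which \<open>summable_on_gauss\<close> tolerates.\<close>

lemma summable_on_lat_gauss:
  fixes a :: real
  assumes "a > 0"
  shows "(\<lambda>n. exp (- a * (\<Sum>i<g. (xvec e n i)\<^sup>2))) summable_on lat g"
proof (rule summable_on_comparison_test)
  let ?f = "\<lambda>i m. exp (- a * (of_int m)\<^sup>2 + a * \<bar>of_int (e i)\<bar> * \<bar>of_int m\<bar>) :: real"
  show "(\<lambda>n. \<Prod>i<g. ?f i (n i)) summable_on lat g"
    by (intro summable_on_lat_prod summable_on_gauss assms) auto
  fix n :: "nat \<Rightarrow> int"
  have "exp (- a * (xvec e n i)\<^sup>2) \<le> ?f i (n i)" for i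
  proof -
    have "(xvec e n i)\<^sup>2 = (of_int (n i))\<^sup>2 + of_int (e i) * of_int (n i) + (of_int (e i))\<^sup>2 / 4"
      by (simp add: xvec_def power2_eq_square algebra_simps)
    moreover have "of_int (e i) * of_int (n i) \<ge> - (\<bar>of_int (e i)\<bar> * \<bar>of_int (n i)\<bar> :: real)"
      by (metis abs_ge_minus_self abs_mult minus_le_iff)
    ultimately have "a * ((of_int (n i))\<^sup>2 - \<bar>of_int (e i)\<bar> * \<bar>of_int (n i)\<bar>) \<le> a * (xvec e n i)\<^sup>2"
      using assms zero_le_power2[of "of_int (e i) :: real"] by (intro mult_left_mono) linarith+
    then show ?thesis by (simp add: algebra_simps)
  qed
  then have "(\<Prod>i<g. exp (- a * (xvec e n i)\<^sup>2)) \<le> (\<Prod>i<g. ?f i (n i))" by (intro prod_mono) auto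
  also have "(\<Prod>i<g. exp (- a * (xvec e n i)\<^sup>2)) = exp (- a * (\<Sum>i<g. (xvec e n i)\<^sup>2))"
    by (simp only: sum_distrib_left exp_sum finite_lessThan)
  finally show "exp (- a * (\<Sum>i<g. (xvec e n i)\<^sup>2)) \<le> (\<Prod>i<g. ?f i (n i))" .
qed auto

definition imag_quad :: "nat \<Rightarrow> complex mat \<Rightarrow> (nat \<Rightarrow> real) \<Rightarrow> real" where
  "imag_quad g \<tau> x = (\<Sum>i<g. \<Sum>j<g. Im (\<tau> $$ (i, j)) * x i * x j)"

lemma Im_quad: "Im (quad g \<tau> x) = imag_quad g \<tau> x"
  by (simp add: quad_def imag_quad_def mult.assoc)

lemma norm_tterm: "norm (tterm g \<tau> x d) = exp (- pi * imag_quad g \<tau> x)"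
  by (simp add: tterm_def Im_quad flip: of_real_sum)

lemma siegel_space_iff:
  "\<tau> \<in> siegel_space g \<longleftrightarrow> \<tau> \<in> carrier_mat g g \<and> (\<forall>i<g. \<forall>j<g. \<tau> $$ (i, j) = \<tau> $$ (j, i)) \<and>
     (\<forall>x. (\<exists>i<g. x i \<noteq> 0) \<longrightarrow> imag_quad g \<tau> x > 0)" (is "_ \<longleftrightarrow> ?c \<and> ?s \<and> ?p")
proof -
  have sym: "transpose_mat \<tau> = \<tau> \<longleftrightarrow> ?s" if "\<tau> \<in> carrier_mat g g"
  proof
    assume "transpose_mat \<tau> = \<tau>"
    then show ?s using that by (metis carrier_matD index_transpose_mat(1))
  qed (use that in \<open>auto simp: mat_eq_iff\<close>)
  have eq: "vec g x \<bullet> (map_mat Im \<tau> *\<^sub>v vec g x) = imag_quad g \<tau> x" if "\<tau> \<in> carrier_mat g g" for x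
    using that by (simp add: scalar_prod_def imag_quad_def sum_distrib_left atLeast0LessThan mult_ac)
  have pos: "(\<forall>x \<in> carrier_vec g. x \<noteq> 0\<^sub>v g \<longrightarrow> x \<bullet> (map_mat Im \<tau> *\<^sub>v x) > 0) \<longleftrightarrow> ?p" if \<tau>: "\<tau> \<in> carrier_mat g g"
  proof (intro iffI allI ballI impI)
    fix x :: "nat \<Rightarrow> real" 
    assume *: "\<forall>x \<in> carrier_vec g. x \<noteq> 0\<^sub>v g \<longrightarrow> x \<bullet> (map_mat Im \<tau> *\<^sub>v x) > 0" "\<exists>i<g. x i \<noteq> 0"
    have "vec g x \<noteq> 0\<^sub>v g" using *(2) by (auto simp: vec_eq_iff)
    with * eq[OF \<tau>, of x] show "imag_quad g \<tau> x > 0" by auto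
  next
    fix x :: "real vec" assume *: ?p "x \<in> carrier_vec g" "x \<noteq> 0\<^sub>v g"
    have "x = vec g (\<lambda>i. x $ i)" using *(2) by auto
    moreover have "\<exists>i<g. x $ i \<noteq> 0" using *(2,3) by (auto simp: vec_eq_iff)
    ultimately show "x \<bullet> (map_mat Im \<tau> *\<^sub>v x) > 0"
      using *(1) eq[OF \<tau>, of "\<lambda>i. x $ i"] by simp
  qed
  show ?thesis
    unfolding siegel_space_def using sym pos by blast
qed

lemma imag_quad_cong: "(\<And>i. i < g \<Longrightarrow> x i = y i) \<Longrightarrow> imag_quad g \<tau> x = imag_quad g \<tau> y"
  by (auto simp: imag_quad_def intro!: sum.cong)

lemma imag_quad_scale: "imag_quad g \<tau> (\<lambda>i. c * x i) = c\<^sup>2 * imag_quad g \<tau> x"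
  by (simp add: imag_quad_def sum_distrib_left power2_eq_square mult_ac)

text \<open>The constant is the minimum of the form on the unit sphere, positive by definiteness;
  homogeneity transfers the bound to all \<open>x\<close>.\<close>

lemma siegel_pos:
  assumes \<tau>: "\<tau> \<in> siegel_space g"
  obtains l where "l > 0" "\<And>x. imag_quad g \<tau> x \<ge> l * (\<Sum>i<g. (x i)\<^sup>2)"
proof (cases "g = 0")
  case True
  then show ?thesis using that[of 1] by (simp add: imag_quad_def)
next
  case False
  have pos: "imag_quad g \<tau> x > 0" if "i < g" "x i \<noteq> 0" for x i
    using \<tau> that by (auto simp: siegel_space_iff)
  \<comment> \<open>The coordinates from \<open>g\<close> on are frozen at 0, so that the cube is
    compact in the product topology of functions; the other coordinates of a unit vector lie in
    [-1, 1].\<close>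
  define K :: "(nat \<Rightarrow> real) set" where "K = PiE UNIV (\<lambda>i. if i < g then {-1..1} else {0})"
  define S where "S = {x \<in> K. (\<Sum>i<g. (x i)\<^sup>2) = 1}"
  have "compactin (product_topology (\<lambda>i. euclidean) UNIV) K"
    unfolding K_def by (subst compactin_PiE) auto
  then have "compact K" by (simp add: euclidean_product_topology)
  moreover have "closed {x :: nat \<Rightarrow> real. (\<Sum>i<g. (x i)\<^sup>2) = 1}"
    by (intro closed_Collect_eq continuous_intros continuous_on_product_coordinates)
  ultimately have "compact S" unfolding S_def Collect_conj_eq by (metis compact_Int_closed Collect_mem_eq)
  moreover have "(\<lambda>i. if i = 0 then 1 else 0) \<in> S"
  proof -
    have "(\<Sum>i<g. (if i = 0 then 1 else 0 :: real)\<^sup>2) = (\<Sum>i<g. if i = 0 then 1 else 0)" by (intro sum.cong) auto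
    then show ?thesis using False by (auto simp: S_def K_def)
  qed
  moreover have "continuous_on S (imag_quad g \<tau>)"
  proof -
    have "continuous_on UNIV (\<lambda>x. imag_quad g \<tau> x)" unfolding imag_quad_def by (intro continuous_intros continuous_on_product_coordinates)
    then show ?thesis by (metis continuous_on_subset subset_UNIV)
  qed
  ultimately obtain x where x: "x \<in> S" "\<And>y. y \<in> S \<Longrightarrow> imag_quad g \<tau> x \<le> imag_quad g \<tau> y"
    using continuous_attains_inf[of S "imag_quad g \<tau>"] by blast
  have "\<exists>i<g. x i \<noteq> 0"
  proof (rule ccontr)
    assume "\<not> ?thesis"
    then have "(\<Sum>i<g. (x i)\<^sup>2) = 0" by auto
    then show False using x(1) by (simp add: S_def)
  qed
  then have xp: "imag_quad g \<tau> x > 0" using pos by blast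
  show ?thesis
  proof (rule that[OF xp])
    fix y :: "nat \<Rightarrow> real"
    define N where "N = (\<Sum>i<g. (y i)\<^sup>2)"
    show "imag_quad g \<tau> y \<ge> imag_quad g \<tau> x * N"
    proof (cases "N = 0")
      case True
      then have "\<forall>i<g. y i = 0" unfolding N_def by (subst (asm) sum_nonneg_eq_0_iff) auto
      then have "imag_quad g \<tau> y = 0" by (auto simp: imag_quad_def)
      with True show ?thesis by simp
    next
      case False
      then have N: "N > 0" unfolding N_def by (metis less_eq_real_def sum_nonneg zero_le_power2)
      define z where "z i = (if i < g then y i / sqrt N else 0)" for i
      have zN: "(z i)\<^sup>2 = (y i)\<^sup>2 / N" if "i < g" for i using that N by (simp add: z_def power_divide)
      have s: "(\<Sum>i<g. (z i)\<^sup>2) = 1" using N by (simp add: zN N_def flip: sum_divide_distrib)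
      have "\<bar>z i\<bar> \<le> 1" if "i < g" for i
      proof -
        have "(z i)\<^sup>2 \<le> 1" unfolding s[symmetric] using that by (intro member_le_sum) auto
        then show ?thesis by (simp add: abs_square_le_1)
      qed
      then have "- 1 \<le> z i \<and> z i \<le> 1" if "i < g" for i using that by (simp add: abs_le_iff minus_le_iff)
      then have "z \<in> K" by (auto simp: K_def PiE_iff z_def)
      then have "z \<in> S" using s by (simp add: S_def)
      then have "imag_quad g \<tau> x \<le> imag_quad g \<tau> z" by (rule x)
      also have "\<dots> = imag_quad g \<tau> (\<lambda>i. (1 / sqrt N) * y i)" by (rule imag_quad_cong) (simp add: z_def)
      also have "\<dots> = imag_quad g \<tau> y / N" using N by (subst imag_quad_scale) (simp add: power_divide)
      finally show ?thesis using N by (simp add: field_simps)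
    qed
  qed
qed

lemma tterm_abs_summable:
  assumes "\<tau> \<in> siegel_space g"
  shows "(\<lambda>n. norm (tterm g \<tau> (xvec e n) d)) summable_on lat g"
proof -
  obtain l where l: "l > 0" "\<And>x. imag_quad g \<tau> x \<ge> l * (\<Sum>i<g. (x i)\<^sup>2)" using siegel_pos[OF assms] by blast
  show ?thesis
  proof (rule summable_on_comparison_test)
    show "(\<lambda>n. exp (- (pi * l) * (\<Sum>i<g. (xvec e n i)\<^sup>2))) summable_on lat g"
      using l by (intro summable_on_lat_gauss) auto
    show "norm (tterm g \<tau> (xvec e n) d) \<le> exp (- (pi * l) * (\<Sum>i<g. (xvec e n i)\<^sup>2))" for n
      unfolding norm_tterm using l(2)[of "xvec e n"] by simp
  qed auto
qed

lemma tterm_summable: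
  assumes "\<tau> \<in> siegel_space g"
  shows "(\<lambda>n. tterm g \<tau> (xvec e n) d) summable_on lat g"
  by (rule abs_summable_summable[OF tterm_abs_summable[OF assms]])

section \<open>Parity, shifts of the characteristic, translations of the period matrix\<close>

lemma exp_even_pi: "exp (pi * \<i> * (of_int (2 * k))) = 1"
proof -
  have "exp (pi * \<i> * (of_int (2 * k))) = exp (of_int (2 * k) * pi * \<i>)" by (simp add: mult_ac)
  then show ?thesis using exp_integer_2pi[of "of_int k"] by (simp add: mult_ac)
qed

text \<open>The substitution of -n - e for n turns \<open>x\<close> into its negative, which keeps
  the quadratic part and multiplies every term by (-1)^(e.d) = -1.\<close>

lemma theta_int_odd:
  assumes "odd (\<Sum>i<g. e i * d i)"
  shows "theta_int g \<tau> e d = 0"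
proof -
  have "theta_int g \<tau> e d = (\<Sum>\<^sub>\<infinity>n\<in>lat g. - tterm g \<tau> (xvec e n) d)"
    unfolding theta_int_def
  proof (rule infsum_reindex_bij_witness[of _ "\<lambda>n i. if i < g then - n i - e i else 0" "\<lambda>n i. if i < g then - n i - e i else 0"])
    fix n assume "n \<in> lat g"
    define n' where "n' = (\<lambda>i. if i < g then - n i - e i else 0)"
    have x: "xvec e n' i = - xvec e n i" if "i < g" for i using that by (simp add: xvec_def n'_def)
    have q: "quad g \<tau> (xvec e n') = quad g \<tau> (xvec e n)" unfolding quad_def by (intro sum.cong refl) (simp add: x)
    have s: "(\<Sum>i<g. xvec e n' i * d i) = - (\<Sum>i<g. xvec e n i * d i)"
      by (simp add: x sum_negf)
    obtain k where k: "(\<Sum>i<g. e i * d i) = 2 * k + 1" using assms by (auto elim: oddE)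
    have "(\<Sum>i<g. xvec e n i * d i) = of_int (\<Sum>i<g. n i * d i) + of_int (\<Sum>i<g. e i * d i) / 2"
      by (simp add: xvec_def sum.distrib sum_divide_distrib algebra_simps)
    then have "(\<Sum>i<g. xvec e n i * d i) = of_int (\<Sum>i<g. n i * d i) + of_int (2 * k + 1) / 2"
      by (simp only: k)
    moreover define S K where "S = (\<Sum>i<g. xvec e n i * d i)" and "K = - (\<Sum>i<g. n i * d i) - k"
    ultimately have K: "- S = S + of_int (2 * K) - 1"
      by (simp add: field_simps del: of_int_sum)
    have "tterm g \<tau> (xvec e n') d = exp (pi * \<i> * (quad g \<tau> (xvec e n) + of_real (S + of_int (2 * K) - 1)))"
      unfolding tterm_def q s S_def[symmetric] by (simp only: K)
    also have "\<dots> = exp (pi * \<i> * (quad g \<tau> (xvec e n) + of_real S)) * exp (pi * \<i> * of_int (2 * K)) * exp (- (pi * \<i>))"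
      by (simp only: exp_add[symmetric]) (simp add: algebra_simps)
    finally show "- tterm g \<tau> (xvec e n') d = tterm g \<tau> (xvec e n) d"
      unfolding exp_even_pi tterm_def S_def[symmetric] by (simp add: exp_minus)
  qed (auto simp: lat_def fun_eq_iff)
  also have "\<dots> = - theta_int g \<tau> e d" unfolding theta_int_def by (rule infsum_uminus)
  finally show ?thesis by simp
qed

lemma tterm_phase:
  assumes "quad g \<tau>' x + of_real (\<Sum>i<g. x i * d i) = quad g \<tau> x + of_real (\<Sum>i<g. x i * d' i) + c + of_int (2 * k)"
  shows "tterm g \<tau>' x d = exp (pi * \<i> * c) * tterm g \<tau> x d'"
proof -
  have "tterm g \<tau>' x d = exp (pi * \<i> * c) * tterm g \<tau> x d' * exp (pi * \<i> * of_int (2 * k))"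
    unfolding tterm_def assms by (simp only: exp_add[symmetric]) (simp add: algebra_simps)
  then show ?thesis unfolding exp_even_pi by simp
qed

lemma sum_fun_upd_add:
  fixes x :: "nat \<Rightarrow> real"
  assumes "i < g"
  shows "(\<Sum>k<g. x k * of_int ((d(i := d i + m)) k)) = (\<Sum>k<g. x k * of_int (d k)) + x i * of_int m"
proof -
  have "(\<Sum>k<g. x k * of_int ((d(i := d i + m)) k)) = (\<Sum>k<g. x k * of_int (d k) + (if k = i then x i * of_int m else 0))"
    by (intro sum.cong) (auto simp: algebra_simps)
  then show ?thesis using assms by (simp add: sum.distrib)
qed

text \<open>The extra exponent is 2m x_i = 2m n_i + m e_i in units of \<pi> i, and its first summand
  is invisible.\<close>

lemma theta_int_shift_d:
  assumes "i < g"
  shows "theta_int g \<tau> e (d(i := d i + 2 * m)) = exp (pi * \<i> * of_int (m * e i)) * theta_int g \<tau> e d"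
proof -
  have "tterm g \<tau> (xvec e n) (d(i := d i + 2 * m)) = exp (pi * \<i> * of_int (m * e i)) * tterm g \<tau> (xvec e n) d" for n
    by (rule tterm_phase[where k = "n i * m"], subst sum_fun_upd_add[OF assms])
       (simp add: xvec_def algebra_simps)
  then show ?thesis unfolding theta_int_def by (simp add: infsum_cmult_right')
qed

text \<open>Since n_i^2 and n_i have the same parity, the new term m x_i^2 is linear in n_i modulo
  2. The linear part moves into \<open>d\<close>, and a constant depending on e_i remains.\<close>

lemma theta_int_add_diag:
  assumes "i < g" and q: "\<And>x. quad g \<tau>' x = quad g \<tau> x + of_real (of_int m * (x i)\<^sup>2)"
  shows "theta_int g \<tau>' e d = exp (pi * \<i> * of_real (- of_int (m * (2 * e i + e i * e i)) / 4)) * theta_int g \<tau> e (d(i := d i + m * (1 + e i)))"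
proof -
  have "tterm g \<tau>' (xvec e n) d = exp (pi * \<i> * of_real (- of_int (m * (2 * e i + e i * e i)) / 4)) * tterm g \<tau> (xvec e n) (d(i := d i + m * (1 + e i)))" for n
  proof -
    obtain k where k: "n i * n i = n i + 2 * k"
    proof -
      have "even (n i * n i - n i)" by simp
      then show ?thesis using that by (metis add_diff_cancel_left' diff_add_cancel evenE add.commute)
    qed
    have k': "of_int (n i) * of_int (n i) = (of_int (n i) + 2 * of_int k :: complex)"
      using arg_cong[OF k, of "of_int :: int \<Rightarrow> complex"] by simp
    have k'': "of_int (n i) * (of_int (n i) * c) = (of_int (n i) + 2 * of_int k) * c" for c :: complex
      by (simp flip: k' mult.assoc)
    show ?thesis
      by (rule tterm_phase[where k = "k * m"], subst sum_fun_upd_add[OF assms(1)])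
         (simp add: q xvec_def power2_eq_square field_simps k'')
  qed
  then show ?thesis unfolding theta_int_def by (simp add: infsum_cmult_right')
qed

lemma theta_int_add_offdiag:
  assumes ij: "i < g" "j < g" "i \<noteq> j" and q: "\<And>x. quad g \<tau>' x = quad g \<tau> x + of_real (2 * x i * x j)"
  shows "theta_int g \<tau>' e d = exp (pi * \<i> * of_real (- of_int (e i * e j) / 2)) * theta_int g \<tau> e (d(i := d i + e j, j := d j + e i))"
proof -
  have "tterm g \<tau>' (xvec e n) d = exp (pi * \<i> * of_real (- of_int (e i * e j) / 2)) * tterm g \<tau> (xvec e n) (d(i := d i + e j, j := d j + e i))" for n
  proof -
    have "(\<Sum>k<g. xvec e n k * of_int ((d(i := d i + e j, j := d j + e i)) k)) = (\<Sum>k<g. xvec e n k * of_int (d k)) + xvec e n i * of_int (e j) + xvec e n j * of_int (e i)"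
      using sum_fun_upd_add[OF ij(2), of "xvec e n" "d(i := d i + e j)" "e i"] sum_fun_upd_add[OF ij(1), of "xvec e n" d "e j"] ij(3)
      by simp
    then show ?thesis
      by (intro tterm_phase[where k = "n i * n j"])
         (simp add: q xvec_def algebra_simps)
  qed
  then show ?thesis unfolding theta_int_def by (simp add: infsum_cmult_right')
qed

section \<open>Splitting for block-diagonal period matrices\<close>

lemma lat_add:
  "bij_betw (\<lambda>(n, m) i. if i < k then n i else m (i - k)) (lat k \<times> lat l) (lat (k + l))"
  by (rule bij_betw_byWitness[of _ "\<lambda>n. (\<lambda>i. if i < k then n i else 0, \<lambda>i. n (i + k))"])
     (auto simp: lat_def fun_eq_iff)

lemma sum_lessThan_add: "(\<Sum>i<k + l. f i) = (\<Sum>i<k. f i) + (\<Sum>i<l. f (i + k :: nat) :: 'a :: comm_monoid_add)"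
  by (induction l) (auto simp: add_ac)

lemma quad_diag_block:
  assumes "\<tau>1 \<in> carrier_mat k k" "\<tau>2 \<in> carrier_mat l l"
  shows "quad (k + l) (diag_block_mat [\<tau>1, \<tau>2]) x = quad k \<tau>1 x + quad l \<tau>2 (\<lambda>i. x (i + k))"
  using assms by (simp add: quad_def sum_lessThan_add Let_def)

text \<open>The exponents of the two blocks add, and absolute convergence allows the sum over the
  product of the lattices to be taken iteratively.\<close>

lemma theta_int_diag_block:
  assumes "\<tau>1 \<in> siegel_space k" "\<tau>2 \<in> siegel_space l"
  shows "theta_int (k + l) (diag_block_mat [\<tau>1, \<tau>2]) e d = theta_int k \<tau>1 e d * theta_int l \<tau>2 (\<lambda>i. e (i + k)) (\<lambda>i. d (i + k))"
proof -
  let ?\<tau> = "diag_block_mat [\<tau>1, \<tau>2]"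
  let ?f = "\<lambda>n. tterm k \<tau>1 (xvec e n) d" and ?h = "\<lambda>m. tterm l \<tau>2 (xvec (\<lambda>i. e (i + k)) m) (\<lambda>i. d (i + k))"
  have c: "\<tau>1 \<in> carrier_mat k k" "\<tau>2 \<in> carrier_mat l l" using assms by (auto simp: siegel_space_def)
  have "theta_int (k + l) ?\<tau> e d = (\<Sum>\<^sub>\<infinity>z\<in>lat k \<times> lat l. tterm (k + l) ?\<tau> (xvec e ((\<lambda>(n, m) i. if i < k then n i else m (i - k)) z)) d)"
    unfolding theta_int_def by (rule infsum_reindex_bij_betw[OF lat_add, symmetric])
  also have "\<dots> = (\<Sum>\<^sub>\<infinity>(n, m)\<in>lat k \<times> lat l. ?f n * ?h m)"
  proof (rule infsum_cong, clarify)
    fix n m :: "nat \<Rightarrow> int"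
    let ?n = "\<lambda>i. if i < k then n i else m (i - k)"
    have "quad k \<tau>1 (xvec e ?n) = quad k \<tau>1 (xvec e n)" "(\<Sum>i<k. xvec e ?n i * d i) = (\<Sum>i<k. xvec e n i * d i)"
      unfolding quad_def by (intro sum.cong refl; simp add: xvec_def)+
    moreover have "(\<lambda>i. xvec e ?n (i + k)) = xvec (\<lambda>i. e (i + k)) m" by (auto simp: xvec_def)
    then have "quad l \<tau>2 (\<lambda>i. xvec e ?n (i + k)) = quad l \<tau>2 (xvec (\<lambda>i. e (i + k)) m)"
      "(\<Sum>i<l. xvec e ?n (i + k) * d (i + k)) = (\<Sum>i<l. xvec (\<lambda>i. e (i + k)) m i * d (i + k))"
      by (simp_all add: fun_eq_iff)
    ultimately show "tterm (k + l) ?\<tau> (xvec e ?n) d = ?f n * ?h m"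
      unfolding tterm_def quad_diag_block[OF c] sum_lessThan_add exp_add[symmetric]
      by (simp add: algebra_simps)
  qed
  also have "\<dots> = (\<Sum>\<^sub>\<infinity>n\<in>lat k. \<Sum>\<^sub>\<infinity>m\<in>lat l. ?f n * ?h m)"
  proof (rule infsum_Sigma'_banach[symmetric], rule abs_summable_summable)
    show "(\<lambda>z. norm (case z of (n, m) \<Rightarrow> ?f n * ?h m)) summable_on (lat k \<times> lat l)"
    proof (rule summable_on_SigmaI)
      fix n
      show "((\<lambda>m. norm (case (n, m) of (n, m) \<Rightarrow> ?f n * ?h m)) has_sum (norm (?f n) * (\<Sum>\<^sub>\<infinity>m\<in>lat l. norm (?h m)))) (lat l)"
        unfolding prod.case norm_mult by (intro has_sum_cmult_right has_sum_infsum tterm_abs_summable assms)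
      show "(\<lambda>n. norm (?f n) * (\<Sum>\<^sub>\<infinity>m\<in>lat l. norm (?h m))) summable_on lat k"
        by (intro summable_on_cmult_left tterm_abs_summable assms)
    qed auto
  qed
  also have "\<dots> = theta_int k \<tau>1 e d * theta_int l \<tau>2 (\<lambda>i. e (i + k)) (\<lambda>i. d (i + k))"
    by (simp add: theta_int_def infsum_cmult_right' infsum_cmult_left')
  finally show ?thesis .
qed

section \<open>Holomorphy\<close>

lemma norm_entry_le_mat_norm1:
  assumes "M \<in> carrier_mat g g" "i < g" "j < g"
  shows "norm (M $$ (i, j)) \<le> mat_norm1 M"
proof -
  have "norm (M $$ (i, j)) \<le> (\<Sum>j<g. norm (M $$ (i, j)))" using assms by (intro member_le_sum) auto
  also have "\<dots> \<le> (\<Sum>i<g. \<Sum>j<g. norm (M $$ (i, j)))" using assms by (intro member_le_sum[where f = "\<lambda>i. \<Sum>j<g. norm (M $$ (i, j))"]) (auto intro: sum_nonneg)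
  finally show ?thesis using assms by (simp add: mat_norm1_def)
qed

lemma mat_norm1_nonneg: "mat_norm1 M \<ge> 0"
  by (auto simp: mat_norm1_def intro!: sum_nonneg)

definition lin_form :: "nat \<Rightarrow> (nat \<Rightarrow> nat \<Rightarrow> complex) \<Rightarrow> complex mat \<Rightarrow> complex" where
  "lin_form g d M = (\<Sum>i<g. \<Sum>j<g. d i j * M $$ (i, j))"

lemma norm_lin_form_le:
  assumes "M \<in> carrier_mat g g"
  shows "norm (lin_form g d M) \<le> (\<Sum>i<g. \<Sum>j<g. norm (d i j)) * mat_norm1 M"
  unfolding lin_form_def sum_distrib_right
  by (intro sum_norm_le) (auto simp: norm_mult intro!: mult_left_mono norm_entry_le_mat_norm1[OF assms])

text \<open>Separating the derivative from its existence lets the sum and product rules name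
  it.\<close>

definition siegel_deriv :: "nat \<Rightarrow> (complex mat \<Rightarrow> complex) \<Rightarrow> complex mat \<Rightarrow> (nat \<Rightarrow> nat \<Rightarrow> complex) \<Rightarrow> bool" where
  "siegel_deriv g f \<tau> d \<longleftrightarrow> (\<forall>e>0. \<exists>r>0. \<forall>\<tau>' \<in> siegel_space g. mat_norm1 (\<tau>' - \<tau>) < r \<longrightarrow>
     cmod (f \<tau>' - f \<tau> - lin_form g d (\<tau>' - \<tau>)) \<le> e * mat_norm1 (\<tau>' - \<tau>))"

lemma siegel_holomorphic_iff:
  "siegel_holomorphic g f \<longleftrightarrow> (\<forall>\<tau> \<in> siegel_space g. \<exists>d. siegel_deriv g f \<tau> d)"
  by (simp add: siegel_holomorphic_def siegel_deriv_def lin_form_def)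

lemma siegel_derivD:
  assumes "siegel_deriv g f \<tau> d" "e > 0"
  obtains r where "r > 0" "\<And>\<tau>'. \<tau>' \<in> siegel_space g \<Longrightarrow> mat_norm1 (\<tau>' - \<tau>) < r \<Longrightarrow>
     cmod (f \<tau>' - f \<tau> - lin_form g d (\<tau>' - \<tau>)) \<le> e * mat_norm1 (\<tau>' - \<tau>)"
  using assms unfolding siegel_deriv_def by blast

lemma siegel_diff_carrier: "\<tau>' \<in> siegel_space g \<Longrightarrow> \<tau> \<in> siegel_space g \<Longrightarrow> \<tau>' - \<tau> \<in> carrier_mat g g"
  by (auto simp: siegel_space_def)

lemma siegel_holomorphic_const: "siegel_holomorphic g (\<lambda>_. c)"
  unfolding siegel_holomorphic_iff siegel_deriv_def
  by (intro ballI exI[of _ "\<lambda>_ _. 0"] allI impI exI[of _ 1])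
     (auto simp: lin_form_def mat_norm1_nonneg)

lemma siegel_holomorphic_cong:
  assumes "siegel_holomorphic g f" "\<And>\<tau>. \<tau> \<in> siegel_space g \<Longrightarrow> f \<tau> = h \<tau>"
  shows "siegel_holomorphic g h"
  using assms(1) unfolding siegel_holomorphic_def by (simp add: assms(2) cong: ball_cong)

lemma lin_form_add: "lin_form g (\<lambda>i j. d i j + d' i j) M = lin_form g d M + lin_form g d' M"
  by (simp add: lin_form_def sum.distrib algebra_simps)

lemma lin_form_cmult: "lin_form g (\<lambda>i j. c * d i j) M = c * lin_form g d M"
  by (simp add: lin_form_def sum_distrib_left mult_ac)

lemma siegel_holomorphic_add:
  assumes "siegel_holomorphic g f" "siegel_holomorphic g h"
  shows "siegel_holomorphic g (\<lambda>\<tau>. f \<tau> + h \<tau>)"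
  unfolding siegel_holomorphic_iff
proof
  fix \<tau> assume \<tau>: "\<tau> \<in> siegel_space g"
  obtain d where d: "siegel_deriv g f \<tau> d"
    using assms(1) \<tau> unfolding siegel_holomorphic_iff by blast
  obtain d' where d': "siegel_deriv g h \<tau> d'"
    using assms(2) \<tau> unfolding siegel_holomorphic_iff by blast
  show "\<exists>d. siegel_deriv g (\<lambda>\<tau>. f \<tau> + h \<tau>) \<tau> d"
    unfolding siegel_deriv_def
  proof (intro exI[of _ "\<lambda>i j. d i j + d' i j"] allI impI)
    fix e :: real assume "e > 0"
    then have "e / 2 > 0" by simp
    obtain r where r: "r > 0" "\<And>\<tau>'. \<tau>' \<in> siegel_space g \<Longrightarrow> mat_norm1 (\<tau>' - \<tau>) < r \<Longrightarrow> cmod (f \<tau>' - f \<tau> - lin_form g d (\<tau>' - \<tau>)) \<le> e / 2 * mat_norm1 (\<tau>' - \<tau>)"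
      by (rule siegel_derivD[OF d \<open>e / 2 > 0\<close>]) (erule that)
    obtain r' where r': "r' > 0" "\<And>\<tau>'. \<tau>' \<in> siegel_space g \<Longrightarrow> mat_norm1 (\<tau>' - \<tau>) < r' \<Longrightarrow> cmod (h \<tau>' - h \<tau> - lin_form g d' (\<tau>' - \<tau>)) \<le> e / 2 * mat_norm1 (\<tau>' - \<tau>)"
      by (rule siegel_derivD[OF d' \<open>e / 2 > 0\<close>]) (erule that)
    show "\<exists>r>0. \<forall>\<tau>'\<in>siegel_space g. mat_norm1 (\<tau>' - \<tau>) < r \<longrightarrow>
       cmod (f \<tau>' + h \<tau>' - (f \<tau> + h \<tau>) - lin_form g (\<lambda>i j. d i j + d' i j) (\<tau>' - \<tau>)) \<le> e * mat_norm1 (\<tau>' - \<tau>)"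
    proof (intro exI[of _ "min r r'"] conjI ballI impI)
      fix \<tau>' assume \<tau>': "\<tau>' \<in> siegel_space g" "mat_norm1 (\<tau>' - \<tau>) < min r r'"
      have "f \<tau>' + h \<tau>' - (f \<tau> + h \<tau>) - lin_form g (\<lambda>i j. d i j + d' i j) (\<tau>' - \<tau>) =
        (f \<tau>' - f \<tau> - lin_form g d (\<tau>' - \<tau>)) + (h \<tau>' - h \<tau> - lin_form g d' (\<tau>' - \<tau>))"
        by (simp add: lin_form_add)
      also have "cmod \<dots> \<le> e / 2 * mat_norm1 (\<tau>' - \<tau>) + e / 2 * mat_norm1 (\<tau>' - \<tau>)"
        using r(2)[OF \<tau>'(1)] r'(2)[OF \<tau>'(1)] \<tau>'(2) by (intro norm_triangle_mono) auto
      finally show "cmod (f \<tau>' + h \<tau>' - (f \<tau> + h \<tau>) - lin_form g (\<lambda>i j. d i j + d' i j) (\<tau>' - \<tau>)) \<le> e * mat_norm1 (\<tau>' - \<tau>)"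
        by simp
    qed (use r r' in auto)
  qed
qed

lemma siegel_holomorphic_mult:
  assumes "siegel_holomorphic g f" "siegel_holomorphic g h"
  shows "siegel_holomorphic g (\<lambda>\<tau>. f \<tau> * h \<tau>)"
  unfolding siegel_holomorphic_iff
proof
  fix \<tau> assume \<tau>: "\<tau> \<in> siegel_space g"
  obtain d where d: "siegel_deriv g f \<tau> d"
    using assms(1) \<tau> unfolding siegel_holomorphic_iff by blast
  obtain d' where d': "siegel_deriv g h \<tau> d'"
    using assms(2) \<tau> unfolding siegel_holomorphic_iff by blast
  define D D' where "D = 1 + (\<Sum>i<g. \<Sum>j<g. norm (d i j))" and "D' = 1 + (\<Sum>i<g. \<Sum>j<g. norm (d' i j))"
  have D: "D \<ge> 1" "D' \<ge> 1" by (auto simp: D_def D'_def intro!: sum_nonneg)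
  show "\<exists>d. siegel_deriv g (\<lambda>\<tau>. f \<tau> * h \<tau>) \<tau> d"
    unfolding siegel_deriv_def
  proof (intro exI[of _ "\<lambda>i j. h \<tau> * d i j + f \<tau> * d' i j"] allI impI)
    fix e :: real assume e: "e > 0"
    \<comment> \<open>The bound 1 makes the increments of \<open>f\<close> and \<open>h\<close> at
      most \<open>D\<close> and \<open>D'\<close> times the distance; the other bound limits the two
      linear remainders together to e/2 times the distance.\<close>
    define \<epsilon> where "\<epsilon> = min 1 (e / (2 * (1 + cmod (h \<tau>) + cmod (f \<tau>))))"
    have c: "1 + cmod (h \<tau>) + cmod (f \<tau>) > 0" by (simp add: add_pos_nonneg)
    have \<epsilon>: "\<epsilon> > 0" "\<epsilon> \<le> 1" using e c by (auto simp: \<epsilon>_def)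
    have "\<epsilon> \<le> e / (2 * (1 + cmod (h \<tau>) + cmod (f \<tau>)))" by (simp add: \<epsilon>_def)
    then have \<epsilon>2: "(1 + cmod (h \<tau>) + cmod (f \<tau>)) * \<epsilon> \<le> e / 2" using c by (simp add: field_simps)
    obtain r where r: "r > 0" "\<And>\<tau>'. \<tau>' \<in> siegel_space g \<Longrightarrow> mat_norm1 (\<tau>' - \<tau>) < r \<Longrightarrow> cmod (f \<tau>' - f \<tau> - lin_form g d (\<tau>' - \<tau>)) \<le> \<epsilon> * mat_norm1 (\<tau>' - \<tau>)"
      by (rule siegel_derivD[OF d \<epsilon>(1)]) (erule that)
    obtain r' where r': "r' > 0" "\<And>\<tau>'. \<tau>' \<in> siegel_space g \<Longrightarrow> mat_norm1 (\<tau>' - \<tau>) < r' \<Longrightarrow> cmod (h \<tau>' - h \<tau> - lin_form g d' (\<tau>' - \<tau>)) \<le> \<epsilon> * mat_norm1 (\<tau>' - \<tau>)"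
      by (rule siegel_derivD[OF d' \<epsilon>(1)]) (erule that)
    \<comment> \<open>The last bound makes the product of the two increments at most e/2 times the
      distance.\<close>
    define R where "R = min (min r r') (e / (2 * D * D'))"
    show "\<exists>r>0. \<forall>\<tau>'\<in>siegel_space g. mat_norm1 (\<tau>' - \<tau>) < r \<longrightarrow>
       cmod (f \<tau>' * h \<tau>' - f \<tau> * h \<tau> - lin_form g (\<lambda>i j. h \<tau> * d i j + f \<tau> * d' i j) (\<tau>' - \<tau>)) \<le> e * mat_norm1 (\<tau>' - \<tau>)"
    proof (intro exI[of _ R] conjI ballI impI)
      show "R > 0" using r(1) r'(1) e D by (auto simp: R_def)
      fix \<tau>' assume \<tau>': "\<tau>' \<in> siegel_space g" "mat_norm1 (\<tau>' - \<tau>) < R"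
      define N where "N = mat_norm1 (\<tau>' - \<tau>)"
      define L L' where "L = lin_form g d (\<tau>' - \<tau>)" and "L' = lin_form g d' (\<tau>' - \<tau>)"
      have N: "N \<ge> 0" "N * (2 * D * D') \<le> e" using \<tau>' D by (auto simp: N_def mat_norm1_nonneg R_def field_simps)
      have E: "cmod (f \<tau>' - f \<tau> - L) \<le> \<epsilon> * N" "cmod (h \<tau>' - h \<tau> - L') \<le> \<epsilon> * N"
        using r(2)[OF \<tau>'(1)] r'(2)[OF \<tau>'(1)] \<tau>'(2) by (auto simp: R_def N_def L_def L'_def)
      have L: "cmod L \<le> (D - 1) * N" "cmod L' \<le> (D' - 1) * N"
        using norm_lin_form_le[OF siegel_diff_carrier[OF \<tau>'(1) \<tau>]] by (auto simp: L_def L'_def D_def D'_def N_def)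
      have F: "cmod (f \<tau>' - f \<tau>) \<le> D * N"
      proof -
        have "cmod (f \<tau>' - f \<tau>) \<le> cmod (f \<tau>' - f \<tau> - L) + cmod L" by (metis diff_add_cancel norm_triangle_ineq)
        also have "\<dots> \<le> \<epsilon> * N + (D - 1) * N" using E L by (intro add_mono)
        also have "\<dots> \<le> 1 * N + (D - 1) * N" using \<epsilon> N by (intro add_mono mult_right_mono) auto
        finally show ?thesis by (simp add: algebra_simps)
      qed
      have H: "cmod (h \<tau>' - h \<tau>) \<le> D' * N"
      proof -
        have "cmod (h \<tau>' - h \<tau>) \<le> cmod (h \<tau>' - h \<tau> - L') + cmod L'" by (metis diff_add_cancel norm_triangle_ineq)
        also have "\<dots> \<le> \<epsilon> * N + (D' - 1) * N" using E L by (intro add_mono)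
        also have "\<dots> \<le> 1 * N + (D' - 1) * N" using \<epsilon> N by (intro add_mono mult_right_mono) auto
        finally show ?thesis by (simp add: algebra_simps)
      qed
      have "f \<tau>' * h \<tau>' - f \<tau> * h \<tau> - lin_form g (\<lambda>i j. h \<tau> * d i j + f \<tau> * d' i j) (\<tau>' - \<tau>)
        = (f \<tau>' - f \<tau>) * (h \<tau>' - h \<tau>) + (h \<tau> * (f \<tau>' - f \<tau> - L) + f \<tau> * (h \<tau>' - h \<tau> - L'))"
        by (simp add: lin_form_add lin_form_cmult L_def L'_def algebra_simps)
      also have "cmod \<dots> \<le> (D * N) * (D' * N) + (cmod (h \<tau>) * (\<epsilon> * N) + cmod (f \<tau>) * (\<epsilon> * N))"
        using F H E N D by (intro norm_triangle_mono) (auto simp: norm_mult intro!: mult_mono mult_left_mono)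
      also have "\<dots> \<le> (N * (D * D')) * N + ((1 + cmod (h \<tau>) + cmod (f \<tau>)) * \<epsilon>) * N"
        using \<epsilon> N by (simp add: algebra_simps)
      also have "\<dots> \<le> e / 2 * N + e / 2 * N"
        using N \<epsilon>2 by (intro add_mono mult_right_mono) auto
      finally show "cmod (f \<tau>' * h \<tau>' - f \<tau> * h \<tau> - lin_form g (\<lambda>i j. h \<tau> * d i j + f \<tau> * d' i j) (\<tau>' - \<tau>)) \<le> e * mat_norm1 (\<tau>' - \<tau>)"
        by (simp add: N_def)
    qed
  qed
qed

lemma siegel_holomorphic_sum:
  "(\<And>x. x \<in> A \<Longrightarrow> siegel_holomorphic g (f x)) \<Longrightarrow> siegel_holomorphic g (\<lambda>\<tau>. \<Sum>x\<in>A. f x \<tau>)"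
  by (induction A rule: infinite_finite_induct) (auto intro: siegel_holomorphic_const siegel_holomorphic_add)

lemma siegel_holomorphic_prod:
  "(\<And>x. x \<in> A \<Longrightarrow> siegel_holomorphic g (f x)) \<Longrightarrow> siegel_holomorphic g (\<lambda>\<tau>. \<Prod>x\<in>A. f x \<tau>)"
  by (induction A rule: infinite_finite_induct) (auto intro: siegel_holomorphic_const siegel_holomorphic_mult)

lemma siegel_holomorphic_power: "siegel_holomorphic g f \<Longrightarrow> siegel_holomorphic g (\<lambda>\<tau>. f \<tau> ^ n)"
  by (induction n) (auto intro: siegel_holomorphic_const siegel_holomorphic_mult)

lemma has_sum_finite_sum:
  fixes f :: "'a \<Rightarrow> 'b \<Rightarrow> complex"
  assumes "\<And>i. i \<in> I \<Longrightarrow> (f i has_sum S i) A"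
  shows "((\<lambda>x. \<Sum>i\<in>I. f i x) has_sum (\<Sum>i\<in>I. S i)) A"
  using assms by (induction I rule: infinite_finite_induct) (auto intro: has_sum_add has_sum_0)

lemma has_sum_diff:
  fixes f h :: "'a \<Rightarrow> complex"
  assumes "(f has_sum a) A" "(h has_sum b) A"
  shows "((\<lambda>x. f x - h x) has_sum (a - b)) A"
  using has_sum_add[OF assms(1), of "\<lambda>x. - h x" "- b"] assms(2) by (simp add: has_sum_uminus)

text \<open>The series is differentiated term by term in the entries of \<tau>. The second-order
  Taylor remainder of the exponential is at most the squared distance times a summable Gaussian,
  uniformly for all nearby period matrices.\<close>

lemma siegel_holomorphic_theta_int: "siegel_holomorphic g (\<lambda>\<tau>. theta_int g \<tau> e d)"
  unfolding siegel_holomorphic_iff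
proof
  fix \<tau> assume \<tau>: "\<tau> \<in> siegel_space g"
  obtain l where l: "l > 0" "\<And>x. imag_quad g \<tau> x \<ge> l * (\<Sum>i<g. (x i)\<^sup>2)" using siegel_pos[OF \<tau>] by blast
  define a where "a = pi * l"
  have a: "a > 0" using l by (simp add: a_def)
  define X where "X n = (\<Sum>i<g. (xvec e n i)\<^sup>2)" for n
  define t where "t n = tterm g \<tau> (xvec e n) d" for n
  \<comment> \<open>The decay exp(-a X) of a term is shared out: a quarter of the exponent pays for
    the change of \<tau>, a quarter for the factor X^2 in the remainder, and the half left over is
    the majorant \<open>B\<close>.\<close>
  define B where "B n = exp (- (a/2) * X n)" for n
  have X0: "X n \<ge> 0" for n by (auto simp: X_def intro: sum_nonneg)
  have Bs: "B summable_on lat g" unfolding B_def X_def using a by (intro summable_on_lat_gauss) auto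
  have tB: "norm (t n) \<le> exp (- a * X n)" for n
    unfolding t_def norm_tterm a_def X_def using l(2)[of "xvec e n"] by simp
  have xX: "\<bar>xvec e n i * xvec e n j\<bar> \<le> X n" if "i < g" "j < g" for n i j
  proof -
    have "(xvec e n k)\<^sup>2 \<le> X n" if "k < g" for k
      unfolding X_def using that by (intro member_le_sum) auto
    then have "\<bar>xvec e n k\<bar> \<le> sqrt (X n)" if "k < g" for k
      using that by (metis real_sqrt_abs real_sqrt_le_iff)
    then have "\<bar>xvec e n i\<bar> * \<bar>xvec e n j\<bar> \<le> sqrt (X n) * sqrt (X n)"
      using that by (intro mult_mono) (auto simp: X0)
    then show ?thesis by (simp add: abs_mult X0)
  qed
  have poly: "X n ^ 2 * exp (- (a/4) * X n) \<le> 32 / a\<^sup>2" for n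
  proof -
    define y where "y = a/4 * X n"
    have y: "y \<ge> 0" using a X0 by (simp add: y_def)
    have "y^2 / 2 \<le> exp y" using exp_lower_Taylor_quadratic[OF y] y by linarith
    then have "y^2 \<le> 2 * exp y" by simp
    then have "y^2 * exp (-y) \<le> 2 * exp y * exp (- y)" by (intro mult_right_mono) auto
    then have y2: "y^2 * exp (-y) \<le> 2" by (simp add: mult.assoc flip: exp_add)
    have "X n ^ 2 = 16 / a\<^sup>2 * y^2" using a by (simp add: y_def power_mult_distrib power_divide)
    then have "X n ^ 2 * exp (- (a/4) * X n) = 16 / a\<^sup>2 * (y^2 * exp (- y))" by (simp add: y_def)
    also have "\<dots> \<le> 16 / a\<^sup>2 * 2" using y2 by (intro mult_left_mono) auto
    finally show ?thesis by simp
  qed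
  have poly1: "X n * exp (- a * X n) \<le> (2 / a) * B n" for n
  proof -
    have "a/2 * X n \<le> exp (a/2 * X n)" using exp_ge_add_one_self[of "a/2 * X n"] by linarith
    then have "a/2 * X n * exp (- (a/2 * X n)) \<le> exp (a/2 * X n) * exp (- (a/2 * X n))"
      by (intro mult_right_mono) auto
    then have "a/2 * X n * exp (- (a/2 * X n)) \<le> 1" by (simp flip: exp_add)
    then have "(2 / a) * (a/2 * X n * exp (- (a/2 * X n))) \<le> (2 / a) * 1" using a by (intro mult_left_mono) auto
    then have "X n * exp (- (a/2 * X n)) \<le> 2 / a" using a by simp
    then have "X n * exp (- (a/2 * X n)) * B n \<le> 2 / a * B n" by (intro mult_right_mono) (auto simp: B_def)
    also have "X n * exp (- (a/2 * X n)) * B n = X n * exp (- a * X n)"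
      by (simp add: B_def mult.assoc flip: exp_add)
    finally show ?thesis .
  qed
  define D where "D i j = (\<Sum>\<^sub>\<infinity>n\<in>lat g. (pi * \<i> * of_real (xvec e n i * xvec e n j)) * t n)" for i j
  have Ds: "(\<lambda>n. (pi * \<i> * of_real (xvec e n i * xvec e n j)) * t n) summable_on lat g" if "i < g" "j < g" for i j
  proof (rule abs_summable_summable, rule summable_on_comparison_test)
    show "(\<lambda>n. pi * (2 / a) * B n) summable_on lat g" by (intro summable_on_cmult_right Bs)
    show "norm ((pi * \<i> * of_real (xvec e n i * xvec e n j)) * t n) \<le> pi * (2 / a) * B n" for n
    proof -
      have "norm ((pi * \<i> * of_real (xvec e n i * xvec e n j)) * t n) = pi * (\<bar>xvec e n i * xvec e n j\<bar> * norm (t n))"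
        by (simp add: norm_mult abs_mult)
      also have "\<dots> \<le> pi * (X n * exp (- a * X n))"
        using xX[OF that] tB by (intro mult_left_mono mult_mono) (auto simp: X0)
      also have "\<dots> \<le> pi * ((2 / a) * B n)" by (intro mult_left_mono poly1) auto
      finally show ?thesis by (simp add: mult.assoc)
    qed
  qed auto
  have lin: "lin_form g D M = (\<Sum>\<^sub>\<infinity>n\<in>lat g. (pi * \<i> * quad g M (xvec e n)) * t n)" 
    and lins: "(\<lambda>n. (pi * \<i> * quad g M (xvec e n)) * t n) summable_on lat g" for M
  proof -
    have "((\<lambda>n. \<Sum>i<g. \<Sum>j<g. (pi * \<i> * of_real (xvec e n i * xvec e n j)) * t n * M $$ (i, j)) has_sum lin_form g D M) (lat g)"
      unfolding lin_form_def D_def by (intro has_sum_finite_sum has_sum_cmult_left has_sum_infsum Ds) auto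
    also have "(\<lambda>n. \<Sum>i<g. \<Sum>j<g. (pi * \<i> * of_real (xvec e n i * xvec e n j)) * t n * M $$ (i, j)) = (\<lambda>n. (pi * \<i> * quad g M (xvec e n)) * t n)"
      by (simp add: quad_def sum_distrib_left sum_distrib_right mult_ac)
    finally show "lin_form g D M = (\<Sum>\<^sub>\<infinity>n\<in>lat g. (pi * \<i> * quad g M (xvec e n)) * t n)"
       "(\<lambda>n. (pi * \<i> * quad g M (xvec e n)) * t n) summable_on lat g"
      by (auto simp: infsumI has_sum_imp_summable)
  qed
  define C where "C = 32 * pi\<^sup>2 / a\<^sup>2 * infsum B (lat g)"
  have key: "norm (theta_int g \<tau>' e d - theta_int g \<tau> e d - lin_form g D (\<tau>' - \<tau>)) \<le> C * (mat_norm1 (\<tau>' - \<tau>))\<^sup>2"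
    if \<tau>': "\<tau>' \<in> siegel_space g" and small: "mat_norm1 (\<tau>' - \<tau>) < l / 4" for \<tau>'
  proof -
    define N where "N = mat_norm1 (\<tau>' - \<tau>)"
    have N: "N \<ge> 0" "pi * N \<le> a / 4" using small by (auto simp: N_def mat_norm1_nonneg a_def)
    define h where "h n = pi * \<i> * quad g (\<tau>' - \<tau>) (xvec e n)" for n
    have c: "\<tau> \<in> carrier_mat g g" "\<tau>' \<in> carrier_mat g g" using \<tau> \<tau>' by (auto simp: siegel_space_def)
    have qd: "quad g \<tau>' x = quad g \<tau> x + quad g (\<tau>' - \<tau>) x" for x
      using c by (simp add: quad_def algebra_simps flip: sum.distrib)
    have tt: "tterm g \<tau>' (xvec e n) d = t n * exp (h n)" for n
      unfolding t_def tterm_def h_def qd by (simp add: algebra_simps flip: exp_add)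
    have hX: "norm (h n) \<le> pi * N * X n" for n
    proof -
      have "norm (quad g (\<tau>' - \<tau>) (xvec e n)) \<le> (\<Sum>i<g. \<Sum>j<g. norm ((\<tau>' - \<tau>) $$ (i, j)) * X n)"
        unfolding quad_def using xX by (intro sum_norm_le) (auto simp: norm_mult simp flip: abs_mult intro!: mult_left_mono)
      also have "\<dots> = N * X n" using siegel_diff_carrier[OF \<tau>' \<tau>] c
        by (simp add: N_def mat_norm1_def sum_distrib_right)
      finally show ?thesis by (simp add: h_def norm_mult mult.assoc)
    qed
    have "((\<lambda>n. t n * exp (h n) - t n - h n * t n) has_sum (theta_int g \<tau>' e d - theta_int g \<tau> e d - lin_form g D (\<tau>' - \<tau>))) (lat g)"
    proof (intro has_sum_diff)
      show "((\<lambda>n. t n * exp (h n)) has_sum theta_int g \<tau>' e d) (lat g)"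
        unfolding tt[symmetric] theta_int_def by (intro has_sum_infsum tterm_summable \<tau>')
      show "(t has_sum theta_int g \<tau> e d) (lat g)"
        unfolding t_def[abs_def] theta_int_def by (intro has_sum_infsum tterm_summable \<tau>)
      show "((\<lambda>n. h n * t n) has_sum lin_form g D (\<tau>' - \<tau>)) (lat g)"
        unfolding lin h_def by (intro has_sum_infsum lins)
    qed
    moreover have "((\<lambda>n. (32 * pi\<^sup>2 / a\<^sup>2 * N\<^sup>2) * B n) has_sum ((32 * pi\<^sup>2 / a\<^sup>2 * N\<^sup>2) * infsum B (lat g))) (lat g)"
      by (intro has_sum_cmult_right has_sum_infsum Bs)
    moreover have "norm (t n * exp (h n) - t n - h n * t n) \<le> (32 * pi\<^sup>2 / a\<^sup>2 * N\<^sup>2) * B n" for n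
    proof -
      have "t n * exp (h n) - t n - h n * t n = t n * (exp (h n) - (\<Sum>k\<le>1. h n ^ k / fact k))"
        by (simp add: algebra_simps)
      then have "norm (t n * exp (h n) - t n - h n * t n) = norm (t n) * norm (exp (h n) - (\<Sum>k\<le>1. h n ^ k / fact k))"
        by (simp only: norm_mult)
      also have "\<dots> \<le> exp (- a * X n) * (exp \<bar>Re (h n)\<bar> * norm (h n) ^ Suc 1 / fact 1)"
        by (intro mult_mono tB Taylor_exp) auto
      also have "\<dots> \<le> exp (- a * X n) * (exp (a / 4 * X n) * (pi * N * X n)\<^sup>2)"
      proof -
        have "\<bar>Re (h n)\<bar> \<le> pi * N * X n" using hX[of n] abs_Re_le_cmod[of "h n"] by linarith
        also have "\<dots> \<le> a / 4 * X n" using N X0 by (intro mult_right_mono) auto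
        finally have "exp \<bar>Re (h n)\<bar> \<le> exp (a / 4 * X n)" by simp
        moreover have "norm (h n) ^ 2 \<le> (pi * N * X n)\<^sup>2" using hX by (intro power_mono) auto
        ultimately show ?thesis by (simp add: mult_mono numeral_2_eq_2)
      qed
      also have "\<dots> = (pi\<^sup>2 * N\<^sup>2) * (X n ^ 2 * exp (- (a/4) * X n)) * B n"
      proof -
        have "exp (- a * X n) * exp (a / 4 * X n) = exp (- (a/4) * X n) * B n"
          by (simp add: B_def flip: exp_add)
        then show ?thesis by (simp add: power_mult_distrib mult_ac)
      qed
      also have "\<dots> \<le> (pi\<^sup>2 * N\<^sup>2) * (32 / a\<^sup>2) * B n"
        by (intro mult_right_mono mult_left_mono poly) (auto simp: B_def)
      finally show ?thesis by (simp add: mult_ac)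
    qed
    ultimately have "norm (theta_int g \<tau>' e d - theta_int g \<tau> e d - lin_form g D (\<tau>' - \<tau>)) \<le> (32 * pi\<^sup>2 / a\<^sup>2 * N\<^sup>2) * infsum B (lat g)"
      by (rule norm_infsum_le)
    then show ?thesis by (simp add: C_def N_def mult_ac)
  qed
  have C0: "C \<ge> 0" unfolding C_def by (intro mult_nonneg_nonneg infsum_nonneg) (auto simp: B_def)
  show "\<exists>d'. siegel_deriv g (\<lambda>\<tau>. theta_int g \<tau> e d) \<tau> d'"
    unfolding siegel_deriv_def
  proof (intro exI[of _ D] allI impI)
    fix \<epsilon> :: real assume \<epsilon>: "\<epsilon> > 0"
    show "\<exists>r>0. \<forall>\<tau>'\<in>siegel_space g. mat_norm1 (\<tau>' - \<tau>) < r \<longrightarrow>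
      cmod (theta_int g \<tau>' e d - theta_int g \<tau> e d - lin_form g D (\<tau>' - \<tau>)) \<le> \<epsilon> * mat_norm1 (\<tau>' - \<tau>)"
    proof (intro exI[of _ "min (l / 4) (\<epsilon> / (C + 1))"] conjI ballI impI)
      show "min (l / 4) (\<epsilon> / (C + 1)) > 0" using l \<epsilon> C0 by (auto intro: divide_pos_pos)
      fix \<tau>' assume \<tau>': "\<tau>' \<in> siegel_space g" "mat_norm1 (\<tau>' - \<tau>) < min (l / 4) (\<epsilon> / (C + 1))"
      define N where "N = mat_norm1 (\<tau>' - \<tau>)"
      have N: "N \<ge> 0" "N * (C + 1) \<le> \<epsilon>" using \<tau>' C0 by (auto simp: N_def mat_norm1_nonneg field_simps)
      have "C * N\<^sup>2 \<le> (N * (C + 1)) * N" using N by (simp add: algebra_simps power2_eq_square)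
      also have "\<dots> \<le> \<epsilon> * N" using N by (intro mult_right_mono) auto
      finally show "cmod (theta_int g \<tau>' e d - theta_int g \<tau> e d - lin_form g D (\<tau>' - \<tau>)) \<le> \<epsilon> * mat_norm1 (\<tau>' - \<tau>)"
        using key[OF \<tau>'(1)] \<tau>'(2) by (auto simp: N_def)
    qed
  qed
qed

section \<open>Inversion in one coordinate\<close>

text \<open>The action of \<open>gen_inv g j\<close> below: \<open>-1/\<tau>\<close> in genus 1.\<close>

definition inv_at :: "nat \<Rightarrow> nat \<Rightarrow> complex mat \<Rightarrow> complex mat" where
  "inv_at g j \<tau> = mat g g (\<lambda>(k, l). if k = j \<and> l = j then - 1 / \<tau> $$ (j, j)
     else if k = j \<or> l = j then \<tau> $$ (k, l) / \<tau> $$ (j, j)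
     else \<tau> $$ (k, l) - \<tau> $$ (k, j) * \<tau> $$ (j, l) / \<tau> $$ (j, j))"

text \<open>The quadratic form is regarded as a polynomial in the single variable x_j. This is half
  its linear coefficient, and \<open>off_quad\<close> is its constant term.\<close>

definition off_lin :: "nat \<Rightarrow> nat \<Rightarrow> complex mat \<Rightarrow> (nat \<Rightarrow> real) \<Rightarrow> complex" where
  "off_lin g j \<tau> x = (\<Sum>k\<in>{..<g} - {j}. \<tau> $$ (j, k) * of_real (x k))"

definition off_quad :: "nat \<Rightarrow> nat \<Rightarrow> complex mat \<Rightarrow> (nat \<Rightarrow> real) \<Rightarrow> complex" where
  "off_quad g j \<tau> x = (\<Sum>k\<in>{..<g} - {j}. \<Sum>l\<in>{..<g} - {j}. \<tau> $$ (k, l) * of_real (x k * x l))"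

lemma off_cong:
  assumes "\<And>k. k < g \<Longrightarrow> k \<noteq> j \<Longrightarrow> x k = y k"
  shows "off_lin g j \<tau> x = off_lin g j \<tau> y" "off_quad g j \<tau> x = off_quad g j \<tau> y"
  unfolding off_lin_def off_quad_def using assms by (auto intro!: sum.cong)

lemma quad_split:
  assumes "j < g" "\<And>k l. k < g \<Longrightarrow> l < g \<Longrightarrow> \<tau> $$ (k, l) = \<tau> $$ (l, k)"
  shows "quad g \<tau> x = \<tau> $$ (j, j) * of_real (x j)^2 + 2 * of_real (x j) * off_lin g j \<tau> x + off_quad g j \<tau> x"
proof -
  have S: "(\<Sum>k<g. f k) = f j + (\<Sum>k\<in>{..<g} - {j}. f k)" for f :: "nat \<Rightarrow> complex"
    using assms(1) by (simp add: sum.remove)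
  have "quad g \<tau> x = \<tau> $$ (j, j) * of_real (x j * x j) + (\<Sum>l\<in>{..<g} - {j}. \<tau> $$ (j, l) * of_real (x j * x l))
     + (\<Sum>k\<in>{..<g} - {j}. \<tau> $$ (k, j) * of_real (x k * x j) + (\<Sum>l\<in>{..<g} - {j}. \<tau> $$ (k, l) * of_real (x k * x l)))"
    unfolding quad_def S ..
  also have "\<dots> = \<tau> $$ (j, j) * of_real (x j * x j) + (\<Sum>l\<in>{..<g} - {j}. \<tau> $$ (j, l) * of_real (x j * x l))
     + (\<Sum>k\<in>{..<g} - {j}. \<tau> $$ (j, k) * of_real (x j * x k)) + off_quad g j \<tau> x"
    unfolding sum.distrib off_quad_def using assms by (simp add: mult.commute)
  also have "(\<Sum>k\<in>{..<g} - {j}. \<tau> $$ (j, k) * of_real (x j * x k)) = of_real (x j) * off_lin g j \<tau> x"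
    by (simp add: off_lin_def sum_distrib_left mult_ac)
  finally show ?thesis by (simp add: power2_eq_square)
qed

lemma inv_at_carrier: "inv_at g j \<tau> \<in> carrier_mat g g" by (simp add: inv_at_def)

lemma inv_at_sym:
  assumes "j < g" "\<And>k l. k < g \<Longrightarrow> l < g \<Longrightarrow> \<tau> $$ (k, l) = \<tau> $$ (l, k)" "k < g" "l < g"
  shows "inv_at g j \<tau> $$ (k, l) = inv_at g j \<tau> $$ (l, k)"
proof -
  have e: "\<tau> $$ (k, l) = \<tau> $$ (l, k)" "\<tau> $$ (k, j) = \<tau> $$ (j, k)" "\<tau> $$ (j, l) = \<tau> $$ (l, j)"
    using assms by blast+
  show ?thesis
  proof (cases "k = j \<or> l = j")
    case True
    then show ?thesis using assms(1,3,4) e(2,3) by (elim disjE) (simp_all add: inv_at_def)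
  next
    case False
    then show ?thesis using assms(1,3,4) by (simp add: inv_at_def e mult.commute)
  qed
qed

lemma quad_inv_at:
  assumes j: "j < g" and sym: "\<And>k l. k < g \<Longrightarrow> l < g \<Longrightarrow> \<tau> $$ (k, l) = \<tau> $$ (l, k)"
  shows "quad g (inv_at g j \<tau>) x = - (of_real (x j)^2) / \<tau> $$ (j, j) + 2 * of_real (x j) * off_lin g j \<tau> x / \<tau> $$ (j, j)
    + off_quad g j \<tau> x - ((off_lin g j \<tau> x)^2) / \<tau> $$ (j, j)"
proof -
  have 1: "off_lin g j (inv_at g j \<tau>) x = off_lin g j \<tau> x / \<tau> $$ (j, j)"
    unfolding off_lin_def sum_divide_distrib using j by (intro sum.cong) (auto simp: inv_at_def)
  have "off_quad g j (inv_at g j \<tau>) x = (\<Sum>k\<in>{..<g} - {j}. \<Sum>l\<in>{..<g} - {j}. \<tau> $$ (k, l) * of_real (x k * x l)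
      - (\<tau> $$ (j, k) * of_real (x k)) * (\<tau> $$ (j, l) * of_real (x l)) / \<tau> $$ (j, j))"
    unfolding off_quad_def
  proof (intro sum.cong refl)
    fix k l assume "k \<in> {..<g} - {j}" "l \<in> {..<g} - {j}"
    then show "inv_at g j \<tau> $$ (k, l) * of_real (x k * x l) = \<tau> $$ (k, l) * of_real (x k * x l)
      - (\<tau> $$ (j, k) * of_real (x k)) * (\<tau> $$ (j, l) * of_real (x l)) / \<tau> $$ (j, j)"
      using sym[of k j] j by (simp add: inv_at_def algebra_simps)
  qed
  also have "\<dots> = off_quad g j \<tau> x - ((off_lin g j \<tau> x)^2) / \<tau> $$ (j, j)"
    unfolding off_quad_def sum_subtractf power2_eq_square off_lin_def sum_product sum_divide_distrib ..
  finally have 2: "off_quad g j (inv_at g j \<tau>) x = off_quad g j \<tau> x - ((off_lin g j \<tau> x)^2) / \<tau> $$ (j, j)" .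
  have 3: "inv_at g j \<tau> $$ (j, j) = - 1 / \<tau> $$ (j, j)" using j by (simp add: inv_at_def)
  show ?thesis
    by (subst quad_split[OF j inv_at_sym[OF j sym]], assumption+) (simp add: 1 2 3)
qed

lemma siegel_sym: "\<tau> \<in> siegel_space g \<Longrightarrow> k < g \<Longrightarrow> l < g \<Longrightarrow> \<tau> $$ (k, l) = \<tau> $$ (l, k)"
  by (simp add: siegel_space_iff)

lemma siegel_Im_diag_pos:
  assumes "\<tau> \<in> siegel_space g" "j < g"
  shows "Im (\<tau> $$ (j, j)) > 0"
proof -
  let ?x = "\<lambda>i. if i = j then 1 else 0 :: real"
  have "imag_quad g \<tau> ?x > 0" using assms by (auto simp: siegel_space_iff)
  also have "imag_quad g \<tau> ?x = (\<Sum>i<g. if i = j then Im (\<tau> $$ (j, j)) else 0)"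
    unfolding imag_quad_def
  proof (intro sum.cong refl)
    fix i
    have "(\<Sum>k<g. Im (\<tau> $$ (i, k)) * ?x i * ?x k) = (\<Sum>k<g. if k = j then Im (\<tau> $$ (i, j)) * ?x i else 0)"
      by (intro sum.cong) auto
    then show "(\<Sum>k<g. Im (\<tau> $$ (i, k)) * ?x i * ?x k) = (if i = j then Im (\<tau> $$ (j, j)) else 0)"
      using assms by simp
  qed
  finally show ?thesis using assms by simp
qed

text \<open>If J denotes C\<tau> + D for this inversion, the imaginary form of the new matrix at
  \<open>x\<close> is the sum of the old one at the real part and at the imaginary part of J^(-1) x.
  The vectors \<open>y\<close> and \<open>z\<close> in the proof are these two parts.\<close>

lemma inv_at_siegel:
  assumes \<tau>: "\<tau> \<in> siegel_space g" and j: "j < g"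
  shows "inv_at g j \<tau> \<in> siegel_space g"
  unfolding siegel_space_iff
proof (intro conjI allI impI)
  note sym = siegel_sym[OF \<tau>]
  fix x :: "nat \<Rightarrow> real" assume x: "\<exists>i<g. x i \<noteq> 0"
  define t w r where "t = \<tau> $$ (j, j)" and "w = off_lin g j \<tau> x" and "r = off_quad g j \<tau> x"
  have t: "Im t > 0" "t \<noteq> 0" using siegel_Im_diag_pos[OF \<tau> j] by (auto simp: t_def)
  \<comment> \<open>The entry with index \<open>j\<close> of J^(-1) x; the other entries are those
    of \<open>x\<close> and stay real.\<close>
  define u where "u = (of_real (x j) - w) / t"
  have w: "w = of_real (x j) - t * u" using t by (simp add: u_def)
  define y z where "y = x(j := Re u)" and "z = (\<lambda>i. if i = j then Im u else 0 :: real)"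
  have y: "quad g \<tau> y = t * of_real (Re u)^2 + 2 * of_real (Re u) * w + r"
    using quad_split[OF j sym, of y] off_cong[of g j y x \<tau>] by (simp add: t_def w_def r_def y_def)
  have z: "quad g \<tau> z = t * of_real (Im u)^2"
    using quad_split[OF j sym, of z] off_cong[of g j z "\<lambda>_. 0" \<tau>] by (simp add: t_def z_def off_lin_def off_quad_def)
  have "quad g (inv_at g j \<tau>) x = r - ((of_real (x j) - w)^2) / t"
    using t by (simp add: quad_inv_at[OF j sym] t_def[symmetric] w_def[symmetric] r_def[symmetric] power2_eq_square algebra_simps diff_divide_distrib add_divide_distrib)
  also have "\<dots> = r - t * u^2"
  proof -
    have "of_real (x j) - w = t * u" using w by simp
    then show ?thesis using t by (simp add: power2_eq_square)
  qed
  finally have "imag_quad g (inv_at g j \<tau>) x = Im (r - t * u^2)" by (simp flip: Im_quad)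
  also have "\<dots> = Im (quad g \<tau> y) + Im (quad g \<tau> z)"
    unfolding y z w by (simp add: power2_eq_square algebra_simps)
  finally have eq: "imag_quad g (inv_at g j \<tau>) x = imag_quad g \<tau> y + imag_quad g \<tau> z" by (simp add: Im_quad)
  have pos: "imag_quad g \<tau> v > 0" if "i < g" "v i \<noteq> 0" for v i using \<tau> that by (auto simp: siegel_space_iff)
  have nonneg: "imag_quad g \<tau> v \<ge> 0" for v
  proof (cases "\<exists>i<g. v i \<noteq> 0")
    case False
    then show ?thesis by (simp add: imag_quad_def)
  qed (use pos less_imp_le in blast)
  show "imag_quad g (inv_at g j \<tau>) x > 0"
  proof (cases "\<exists>i<g. y i \<noteq> 0 \<or> z i \<noteq> 0")
    case True
    then show ?thesis unfolding eq using pos nonneg[of y] nonneg[of z] by (metis add_nonneg_pos add_pos_nonneg)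
  next
    case False
    then have "u = 0" using j by (auto simp: y_def z_def complex_eq_iff)
    have x0: "x k = 0" if "k < g" "k \<noteq> j" for k using False that by (auto simp: y_def)
    then have "w = 0" unfolding w_def off_lin_def by simp
    then have "x j = 0" using w \<open>u = 0\<close> by simp
    then show ?thesis using x x0 by blast
  qed
qed (use inv_at_sym[OF j siegel_sym[OF \<tau>]] in \<open>auto simp: inv_at_carrier\<close>)

lemma mult_regroup: "X * Y = Z \<Longrightarrow> ((a * X) * S) * Y = a * (S * Z)" for a :: "'a :: comm_semiring_1"
  by (auto simp: mult_ac)

lemma exp_pi_i_add: "exp (pi * \<i> * (a + b)) = exp (pi * \<i> * a) * exp (pi * \<i> * b)"
  by (simp only: distrib_left exp_add)

text \<open>Completing squares turns the left side into a Jacobi series at (-1/t, z/t) and the right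
  side into one at (t, z) with the same z = w - e/2 + td/2. Up to the stated factors the exponents
  differ by even integers, so \<open>jacobi_inversion\<close> applies.\<close>

lemma theta_inversion_1dim:
  assumes t: "Im t > 0"
  shows "(\<Sum>\<^sub>\<infinity>m::int. exp (pi * \<i> * (- ((of_int m + of_int e / 2)^2) / t + 2 * (of_int m + of_int e / 2) * w / t + (of_int m + of_int e / 2) * of_int d)))
   = csqrt (- \<i> * t) * exp (pi * \<i> * of_real (- of_int (e * d) / 2)) * exp (pi * \<i> * (w^2 / t)) *
     (\<Sum>\<^sub>\<infinity>m::int. exp (pi * \<i> * (t * (of_int m + of_int d / 2)^2 + 2 * (of_int m + of_int d / 2) * w + (of_int m + of_int d / 2) * of_int e)))"
proof -
  have t0: "t \<noteq> 0" using t by auto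
  define E D where "E = (of_int e :: complex)" and "D = (of_int d :: complex)"
  define z where "z = w - E / 2 + t * D / 2"
  have zt: "z / t = w / t - E / (2 * t) + D / 2"
    using t0 by (simp add: z_def add_divide_distrib diff_divide_distrib)
  have 1: "- ((of_int m + E / 2)^2) / t + 2 * (of_int m + E / 2) * w / t + (of_int m + E / 2) * D
     = ((- 1 / t) * (of_int m)^2 + 2 * of_int m * (z / t)) + (- (E^2) / (4 * t) + E * w / t + E * D / 2)" for m :: int
    unfolding zt by (simp add: power2_eq_square algebra_simps add_divide_distrib diff_divide_distrib)
  have 2: "t * (of_int m + D / 2)^2 + 2 * (of_int m + D / 2) * w + (of_int m + D / 2) * E
     = (t * (of_int m)^2 + 2 * of_int m * z) + (t * D^2 / 4 + D * w + D * E / 2) + of_int (2 * (m * e))" for m :: int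
    by (simp add: z_def power2_eq_square field_simps E_def)
  have "(\<Sum>\<^sub>\<infinity>m::int. exp (pi * \<i> * (- ((of_int m + E / 2)^2) / t + 2 * (of_int m + E / 2) * w / t + (of_int m + E / 2) * D)))
     = jacobi (- 1 / t) (z / t) * exp (pi * \<i> * (- (E^2) / (4 * t) + E * w / t + E * D / 2))"
    unfolding jacobi_def 1
    by (subst infsum_cmult_left'[symmetric], rule infsum_cong, rule exp_pi_i_add)
  also have "\<dots> = csqrt (- \<i> * t) * (exp (pi * \<i> * z\<^sup>2 / t) * exp (pi * \<i> * (- (E^2) / (4 * t) + E * w / t + E * D / 2))) * jacobi t z"
    unfolding jacobi_inversion[OF t] by (simp only: mult_ac)
  also have "exp (pi * \<i> * z\<^sup>2 / t) * exp (pi * \<i> * (- (E^2) / (4 * t) + E * w / t + E * D / 2)) =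
      exp (pi * \<i> * of_real (- of_int (e * d) / 2)) * exp (pi * \<i> * (w^2 / t)) * exp (pi * \<i> * (t * D^2 / 4 + D * w + D * E / 2))"
  proof -
    have zz: "z\<^sup>2 / t = w\<^sup>2 / t + (E^2) / (4 * t) + t * D^2 / 4 - E * w / t + w * D - E * D / 2"
    proof -
      have "z\<^sup>2 = t * (w\<^sup>2 / t + (E^2) / (4 * t) + t * D^2 / 4 - E * w / t + w * D - E * D / 2)"
        unfolding distrib_left right_diff_distrib using t0 by (simp add: z_def power2_eq_square algebra_simps)
      then show ?thesis using t0 by simp
    qed
    have "pi * \<i> * (z\<^sup>2 / t) + pi * \<i> * (- (E^2) / (4 * t) + E * w / t + E * D / 2) =
       pi * \<i> * of_real (- of_int (e * d) / 2) + pi * \<i> * (w^2 / t) + pi * \<i> * (t * D^2 / 4 + D * w + D * E / 2)"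
      unfolding zz by (simp add: algebra_simps E_def D_def)
    then show ?thesis by (simp only: exp_add[symmetric] times_divide_eq_right)
  qed
  also have "csqrt (- \<i> * t) * (exp (pi * \<i> * of_real (- of_int (e * d) / 2)) * exp (pi * \<i> * (w^2 / t)) * exp (pi * \<i> * (t * D^2 / 4 + D * w + D * E / 2))) * jacobi t z
    = csqrt (- \<i> * t) * exp (pi * \<i> * of_real (- of_int (e * d) / 2)) * exp (pi * \<i> * (w^2 / t)) * (jacobi t z * exp (pi * \<i> * (t * D^2 / 4 + D * w + D * E / 2)))"
    by (simp only: mult_ac)
  also have "jacobi t z * exp (pi * \<i> * (t * D^2 / 4 + D * w + D * E / 2)) =
     (\<Sum>\<^sub>\<infinity>m::int. exp (pi * \<i> * (t * (of_int m + D / 2)^2 + 2 * (of_int m + D / 2) * w + (of_int m + D / 2) * E)))"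
    unfolding jacobi_def 2
    by (subst infsum_cmult_left'[symmetric], rule infsum_cong, simp only: exp_pi_i_add exp_even_pi mult_1_right)
  finally show ?thesis by (simp only: E_def D_def)
qed

lemma lat_split:
  assumes "j < g"
  shows "bij_betw (\<lambda>(n, m). n(j := m)) ({n \<in> lat g. n j = 0} \<times> UNIV) (lat g)"
  by (rule bij_betw_byWitness[of _ "\<lambda>n. (n(j := 0), n j)"]) (use assms in \<open>auto simp: lat_def fun_eq_iff\<close>)

lemma theta_int_split:
  assumes \<tau>: "\<tau> \<in> siegel_space g" and j: "j < g"
  shows "theta_int g \<tau> e d = (\<Sum>\<^sub>\<infinity>n\<in>{n \<in> lat g. n j = 0}. \<Sum>\<^sub>\<infinity>m. tterm g \<tau> (xvec e (n(j := m))) d)"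
proof -
  have "theta_int g \<tau> e d = (\<Sum>\<^sub>\<infinity>z\<in>{n \<in> lat g. n j = 0} \<times> UNIV. tterm g \<tau> (xvec e ((\<lambda>(n, m). n(j := m)) z)) d)"
    unfolding theta_int_def by (rule infsum_reindex_bij_betw[OF lat_split[OF j], symmetric])
  also have "\<dots> = (\<Sum>\<^sub>\<infinity>(n, m)\<in>{n \<in> lat g. n j = 0} \<times> UNIV. tterm g \<tau> (xvec e (n(j := m))) d)"
    by (simp add: case_prod_unfold)
  also have "\<dots> = (\<Sum>\<^sub>\<infinity>n\<in>{n \<in> lat g. n j = 0}. \<Sum>\<^sub>\<infinity>m. tterm g \<tau> (xvec e (n(j := m))) d)"
  proof (rule infsum_Sigma'_banach[symmetric])
    have "(\<lambda>n. tterm g \<tau> (xvec e n) d) summable_on (\<lambda>(n, m). n(j := m)) ` ({n \<in> lat g. n j = 0} \<times> UNIV)"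
      using tterm_summable[OF \<tau>] lat_split[OF j] by (simp add: bij_betw_def)
    then have "((\<lambda>n. tterm g \<tau> (xvec e n) d) \<circ> (\<lambda>(n, m). n(j := m))) summable_on ({n \<in> lat g. n j = 0} \<times> UNIV)"
      by (subst (asm) summable_on_reindex) (use lat_split[OF j] in \<open>auto simp: bij_betw_def\<close>)
    then show "(\<lambda>(n, m). tterm g \<tau> (xvec e (n(j := m))) d) summable_on ({n \<in> lat g. n j = 0} \<times> UNIV)"
      by (simp add: o_def case_prod_unfold)
  qed
  finally show ?thesis .
qed

text \<open>Poisson summation in the coordinate \<open>j\<close> alone: with the other coordinates
  of the lattice point fixed, the inner sum is the one-dimensional one with t = \<tau>_jj and w =
  \<open>off_lin\<close>. Its factor exp(\<pi> i w^2/t) cancels the correction term in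
  \<open>quad_inv_at\<close>, so the remaining constant can be taken out of the outer sum.\<close>

lemma theta_int_inv_at:
  assumes \<tau>: "\<tau> \<in> siegel_space g" and j: "j < g"
  shows "theta_int g (inv_at g j \<tau>) e d = csqrt (- \<i> * \<tau> $$ (j, j)) * exp (pi * \<i> * of_real (- of_int (e j * d j) / 2)) * theta_int g \<tau> (e(j := d j)) (d(j := e j))"
proof -
  note sym = siegel_sym[OF \<tau>]
  define t c where "t = \<tau> $$ (j, j)" and "c = csqrt (- \<i> * t) * exp (pi * \<i> * of_real (- of_int (e j * d j) / 2))"
  have t: "Im t > 0" using siegel_Im_diag_pos[OF \<tau> j] by (simp add: t_def)
  have qi: "quad g (inv_at g j \<tau>) x = - (of_real (x j)^2) / t + 2 * of_real (x j) * off_lin g j \<tau> x / t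
    + off_quad g j \<tau> x - (off_lin g j \<tau> x)^2 / t" for x
    unfolding t_def by (rule quad_inv_at[OF j sym])
  have qs: "quad g \<tau> x = t * of_real (x j)^2 + 2 * of_real (x j) * off_lin g j \<tau> x + off_quad g j \<tau> x" for x
    unfolding t_def by (rule quad_split[OF j sym])
  have "theta_int g (inv_at g j \<tau>) e d = (\<Sum>\<^sub>\<infinity>n\<in>{n \<in> lat g. n j = 0}. \<Sum>\<^sub>\<infinity>m. tterm g (inv_at g j \<tau>) (xvec e (n(j := m))) d)"
    by (rule theta_int_split[OF inv_at_siegel[OF \<tau> j] j])
  also have "\<dots> = (\<Sum>\<^sub>\<infinity>n\<in>{n \<in> lat g. n j = 0}. c * (\<Sum>\<^sub>\<infinity>m. tterm g \<tau> (xvec (e(j := d j)) (n(j := m))) (d(j := e j))))"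
  proof (rule infsum_cong)
    fix n assume n: "n \<in> {n \<in> lat g. n j = 0}"
    define w r s where "w = off_lin g j \<tau> (xvec e n)" and "r = off_quad g j \<tau> (xvec e n)"
      and "s = (\<Sum>k\<in>{..<g} - {j}. xvec e n k * d k)"
    have off: "off_lin g j \<tau> (xvec e' (n(j := m))) = w" "off_quad g j \<tau> (xvec e' (n(j := m))) = r"
      if "\<And>k. k \<noteq> j \<Longrightarrow> e' k = e k" for e' m
      using off_cong[of g j "xvec e' (n(j := m))" "xvec e n" \<tau>] that by (auto simp: w_def r_def xvec_def)
    have s: "(\<Sum>k<g. xvec e' (n(j := m)) k * d' k) = (of_int m + of_int (e' j) / 2) * of_int (d' j) + s"
      if "\<And>k. k \<noteq> j \<Longrightarrow> e' k = e k" "\<And>k. k \<noteq> j \<Longrightarrow> d' k = d k" for e' d' :: "nat \<Rightarrow> int" and m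
    proof -
      have "(\<Sum>k\<in>{..<g} - {j}. xvec e' (n(j := m)) k * d' k) = s"
        unfolding s_def using that by (intro sum.cong) (auto simp: xvec_def)
      then show ?thesis using j by (simp add: sum.remove[of "{..<g}" j] xvec_def)
    qed
    have xj: "xvec e' (n(j := m)) j = of_int m + of_int (e' j) / 2" for e' m by (simp add: xvec_def)
    have A: "tterm g (inv_at g j \<tau>) (xvec e (n(j := m))) d =
       exp (pi * \<i> * (- ((of_int m + of_int (e j) / 2)^2) / t + 2 * (of_int m + of_int (e j) / 2) * w / t + (of_int m + of_int (e j) / 2) * of_int (d j)))
       * exp (pi * \<i> * (r - w^2 / t + s))" for m
      unfolding tterm_def qi s[of e d, OF refl refl] off[of e, OF refl] xj exp_add[symmetric]
      by (simp add: algebra_simps)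
    have B: "tterm g \<tau> (xvec (e(j := d j)) (n(j := m))) (d(j := e j)) =
       exp (pi * \<i> * (t * (of_int m + of_int (d j) / 2)^2 + 2 * (of_int m + of_int (d j) / 2) * w + (of_int m + of_int (d j) / 2) * of_int (e j)))
       * exp (pi * \<i> * (r + s))" for m
    proof -
      have o: "off_lin g j \<tau> (xvec (e(j := d j)) (n(j := m))) = w" "off_quad g j \<tau> (xvec (e(j := d j)) (n(j := m))) = r"
        by (rule off; simp)+
      have s': "(\<Sum>k<g. xvec (e(j := d j)) (n(j := m)) k * (d(j := e j)) k) = (of_int m + of_int (d j) / 2) * of_int (e j) + s"
        by (subst s) auto
      show ?thesis
        unfolding tterm_def qs s' o xj exp_add[symmetric]
        by (simp add: algebra_simps)
    qed
    have W: "exp (pi * \<i> * (w^2 / t)) * exp (pi * \<i> * (r - w^2 / t + s)) = exp (pi * \<i> * (r + s))"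
      by (simp only: exp_pi_i_add[symmetric]) (simp add: algebra_simps)
    show "(\<Sum>\<^sub>\<infinity>m. tterm g (inv_at g j \<tau>) (xvec e (n(j := m))) d) = c * (\<Sum>\<^sub>\<infinity>m. tterm g \<tau> (xvec (e(j := d j)) (n(j := m))) (d(j := e j)))"
      unfolding A B infsum_cmult_left' theta_inversion_1dim[OF t] c_def by (rule mult_regroup[OF W])
  qed
  also have "\<dots> = c * theta_int g \<tau> (e(j := d j)) (d(j := e j))"
    unfolding theta_int_split[OF \<tau> j] by (rule infsum_cmult_right')
  finally show ?thesis by (simp add: c_def t_def)
qed

section \<open>Subspaces of characteristics\<close>

definition lin :: "nat \<Rightarrow> bit vec set \<Rightarrow> bool" where
  "lin N V \<longleftrightarrow> V \<subseteq> carrier_vec N \<and> 0\<^sub>v N \<in> V \<and> (\<forall>x\<in>V. \<forall>y\<in>V. x + y \<in> V)"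

text \<open>Over the field with two elements, affine combinations are sums of an odd number of
  points. Closure under sums of three therefore describes the affine subspaces, the empty set
  included.\<close>

definition aff :: "nat \<Rightarrow> bit vec set \<Rightarrow> bool" where
  "aff N A \<longleftrightarrow> A \<subseteq> carrier_vec N \<and> (\<forall>x\<in>A. \<forall>y\<in>A. \<forall>z\<in>A. x + y + z \<in> A)"

lemma bit_cases: "(x :: bit) = 0 \<or> x = 1"
  by (cases x) auto

lemma bit_ne_0: "(x :: bit) \<noteq> 0 \<longleftrightarrow> x = 1"
  by (cases x) auto

lemma bitvec_add_self: "x \<in> carrier_vec N \<Longrightarrow> (x :: bit vec) + x = 0\<^sub>v N"
  by (intro eq_vecI) auto

lemma bit_add_cancel:
  "(p :: bit) + q + q = p" "q + p + q = p" "p + (p + q) = q" "p + (q + p) = q" "q + (p + q) = p"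
  "p + q + r + q + r = p"
  by (cases p; cases q; cases r; simp)+

lemma bitvec_add_cancel:
  assumes "x \<in> carrier_vec N" "y \<in> carrier_vec N"
  shows "(x :: bit vec) + y + y = x" "x + (x + y) = y"
proof -
  show "x + y + y = x"
  proof (rule eq_vecI)
    fix i assume "i < dim_vec x"
    then show "(x + y + y) $ i = x $ i" using assms by (simp only: index_add_vec carrier_vecD bit_add_cancel)
  qed (use assms in auto)
  show "x + (x + y) = y"
  proof (rule eq_vecI)
    fix i assume "i < dim_vec y"
    then show "(x + (x + y)) $ i = y $ i" using assms by (simp only: index_add_vec carrier_vecD bit_add_cancel)
  qed (use assms in auto)
qed

lemma carrier_bitvec: "(carrier_vec N :: bit vec set) = vec N ` (PiE {..<N} (\<lambda>_. UNIV))"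
proof
  show "(carrier_vec N :: bit vec set) \<subseteq> vec N ` (PiE {..<N} (\<lambda>_. UNIV))"
  proof
    fix v :: "bit vec" assume "v \<in> carrier_vec N"
    then have "v = vec N (restrict (\<lambda>i. v $ i) {..<N})" (is "_ = vec N ?f") by (intro eq_vecI) auto
    moreover have "?f \<in> PiE {..<N} (\<lambda>_. UNIV)" by simp
    ultimately show "v \<in> vec N ` (PiE {..<N} (\<lambda>_. UNIV))" by (rule image_eqI)
  qed
qed (rule image_subsetI, rule vec_carrier)

lemma inj_on_vec_PiE: "inj_on (vec N) (PiE {..<N} (\<lambda>_. UNIV))"
proof (rule inj_onI, rule PiE_ext)
  fix x y :: "nat \<Rightarrow> 'a" and i
  assume "vec N x = vec N y" "i \<in> {..<N}"
  then show "x i = y i" by (metis index_vec lessThan_iff)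
qed

lemma UNIV_bit: "(UNIV :: bit set) = {0, 1}"
  using bit_cases by auto

lemma finite_carrier_bitvec [simp]: "finite (carrier_vec N :: bit vec set)"
  unfolding carrier_bitvec by (intro finite_imageI finite_PiE) (auto simp: UNIV_bit)

lemma card_carrier_bitvec: "card (carrier_vec N :: bit vec set) = 2 ^ N"
  unfolding carrier_bitvec by (subst card_image[OF inj_on_vec_PiE]) (simp add: card_PiE UNIV_bit numeral_2_eq_2)

lemma lin_imp_aff: "lin N V \<Longrightarrow> aff N V"
  by (auto simp: lin_def aff_def)

lemma lin_finite: "lin N V \<Longrightarrow> finite V"
  by (meson finite_carrier_bitvec finite_subset lin_def)

lemma aff_finite: "aff N V \<Longrightarrow> finite V"
  by (meson finite_carrier_bitvec finite_subset aff_def)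

lemma lin_carrier: "lin N V \<Longrightarrow> x \<in> V \<Longrightarrow> x \<in> carrier_vec N"
  by (auto simp: lin_def)

section \<open>Counting the points where several affine functions equal 1\<close>

definition aff_on :: "bit vec set \<Rightarrow> (bit vec \<Rightarrow> bit) \<Rightarrow> bool" where
  "aff_on A l \<longleftrightarrow> (\<forall>x\<in>A. \<forall>y\<in>A. \<forall>z\<in>A. l (x + y + z) = l x + l y + l z)"

lemma aff_on_subset: "aff_on A l \<Longrightarrow> B \<subseteq> A \<Longrightarrow> aff_on B l"
  unfolding aff_on_def by blast

lemma aff_on_coord: "A \<subseteq> carrier_vec N \<Longrightarrow> i < N \<Longrightarrow> aff_on A (\<lambda>x. x $ i)"
  unfolding aff_on_def
proof (intro ballI)
  fix x y z assume "A \<subseteq> carrier_vec N" "i < N" "x \<in> A" "y \<in> A" "z \<in> A"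
  then have "x \<in> carrier_vec N" "y \<in> carrier_vec N" "z \<in> carrier_vec N" "i < N" by auto
  then show "(x + y + z) $ i = x $ i + y $ i + z $ i" by (simp only: index_add_vec(1) carrier_vecD)
qed

lemma aff_level:
  assumes "aff N A" "aff_on A l"
  shows "aff N {x \<in> A. l x = c}"
proof -
  have "c + c + c = c" by (cases c) auto
  then show ?thesis using assms unfolding aff_def aff_on_def by auto
qed

text \<open>Translation by a + b exchanges the two level sets.\<close>

lemma aff_half:
  assumes A: "aff N A" and l: "aff_on A l" and a: "a \<in> A" "l a = 1" and b: "b \<in> A" "l b = 0"
  shows "card {x \<in> A. l x = 0} = card {x \<in> A. l x = 1}" "card A = 2 * card {x \<in> A. l x = 1}"
proof -
  have car: "x \<in> carrier_vec N" if "x \<in> A" for x using that A by (auto simp: aff_def)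
  have inv: "x + a + b + a + b = x" if "x \<in> A" for x
  proof -
    have c: "x \<in> carrier_vec N" "a \<in> carrier_vec N" "b \<in> carrier_vec N" using car that a b by auto
    show ?thesis
    proof (rule eq_vecI)
      fix i assume "i < dim_vec x"
      then show "(x + a + b + a + b) $ i = x $ i" using c by (simp only: index_add_vec carrier_vecD bit_add_cancel)
    qed (use c in auto)
  qed
  have cl: "x + a + b \<in> A" if "x \<in> A" for x using A that a b by (auto simp: aff_def)
  have lv: "l (x + a + b) = l x + 1" if "x \<in> A" for x using l that a b by (auto simp: aff_on_def)
  have "bij_betw (\<lambda>x. x + a + b) {x \<in> A. l x = 0} {x \<in> A. l x = 1}"
    by (rule bij_betw_byWitness[of _ "\<lambda>x. x + a + b"]) (auto simp: inv cl lv)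
  then show eq: "card {x \<in> A. l x = 0} = card {x \<in> A. l x = 1}" by (rule bij_betw_same_card)
  have "card A = card ({x \<in> A. l x = 0} \<union> {x \<in> A. l x = 1})"
    by (rule arg_cong[of _ _ card]) (use bit_cases in blast)
  also have "\<dots> = card {x \<in> A. l x = 0} + card {x \<in> A. l x = 1}"
    by (rule card_Un_disjoint) (use aff_finite[OF A] in auto)
  finally show "card A = 2 * card {x \<in> A. l x = 1}" using eq by simp
qed

text \<open>An affine function is constantly 0, constantly 1, or splits the space in half.
  Divisibility covers all three cases at once and can be iterated on level sets.\<close>

lemma aff_card_dvd:
  assumes A: "aff N A" and l: "aff_on A l"
  shows "card A dvd 2 * card {x \<in> A. l x = 1}"
proof (cases "\<exists>a\<in>A. l a = 1")
  case False
  then have "{x \<in> A. l x = 1} = {}" by auto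
  then show ?thesis by (simp only: card.empty mult_0_right dvd_0_right)
next
  case True
  then obtain a where a: "a \<in> A" "l a = 1" by blast
  show ?thesis
  proof (cases "\<exists>b\<in>A. l b = 0")
    case True
    then obtain b where "b \<in> A" "l b = 0" by blast
    from aff_half(2)[OF A l a this] show ?thesis by simp
  next
    case False
    then have "{x \<in> A. l x = 1} = A" using bit_ne_0 by auto
    then show ?thesis by simp
  qed
qed

lemma aff_card_dvd2:
  assumes A: "aff N A" and l: "aff_on A l" "aff_on A m"
  shows "card A dvd 4 * card {x \<in> A. l x = 1 \<and> m x = 1}"
proof -
  let ?B = "{x \<in> A. l x = 1}"
  have "card ?B dvd 2 * card {x \<in> ?B. m x = 1}"
    by (rule aff_card_dvd[OF aff_level[OF A l(1)]]) (rule aff_on_subset[OF l(2)], auto)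
  then have "2 * card ?B dvd 4 * card {x \<in> ?B. m x = 1}" by (auto simp: dvd_def)
  with aff_card_dvd[OF A l(1)] have "card A dvd 4 * card {x \<in> ?B. m x = 1}" by (rule dvd_trans)
  also have "{x \<in> ?B. m x = 1} = {x \<in> A. l x = 1 \<and> m x = 1}" by auto
  finally show ?thesis .
qed

lemma aff_card_dvd3:
  assumes A: "aff N A" and l: "aff_on A l" "aff_on A m" "aff_on A k"
  shows "card A dvd 8 * card {x \<in> A. l x = 1 \<and> m x = 1 \<and> k x = 1}"
proof -
  let ?B = "{x \<in> A. l x = 1}"
  have "card ?B dvd 4 * card {x \<in> ?B. m x = 1 \<and> k x = 1}"
    by (rule aff_card_dvd2[OF aff_level[OF A l(1)]]) (rule aff_on_subset[OF l(2)] aff_on_subset[OF l(3)], auto)+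
  then have "2 * card ?B dvd 8 * card {x \<in> ?B. m x = 1 \<and> k x = 1}" by (auto simp: dvd_def)
  with aff_card_dvd[OF A l(1)] have "card A dvd 8 * card {x \<in> ?B. m x = 1 \<and> k x = 1}" by (rule dvd_trans)
  also have "{x \<in> ?B. m x = 1 \<and> k x = 1} = {x \<in> A. l x = 1 \<and> m x = 1 \<and> k x = 1}" by auto
  finally show ?thesis .
qed

section \<open>Linear subspaces and their Moebius function\<close>

lemma lin_hyperplane:
  assumes V: "lin N V" and i: "i < N" and w: "w \<in> V" "w $ i = 1"
  shows "lin N {x \<in> V. x $ i = 0}" "card V = 2 * card {x \<in> V. x $ i = 0}"
    "card {x \<in> V. x $ i \<noteq> 0} = card {x \<in> V. x $ i = 0}"
proof -
  have s: "V \<subseteq> carrier_vec N" using V by (simp add: lin_def)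
  have "(x + y) $ i = x $ i + y $ i" if "y \<in> V" for x y using s that i by auto
  then show "lin N {x \<in> V. x $ i = 0}" using V i unfolding lin_def by auto
  have z: "0\<^sub>v N \<in> V" "0\<^sub>v N $ i = (0 :: bit)" using V i by (auto simp: lin_def)
  note h = aff_half[OF lin_imp_aff[OF V] aff_on_coord[OF s i] w z]
  show "card V = 2 * card {x \<in> V. x $ i = 0}" using h by simp
  have "{x \<in> V. x $ i \<noteq> 0} = {x \<in> V. x $ i = 1}" by (simp add: bit_ne_0)
  with h show "card {x \<in> V. x $ i \<noteq> 0} = card {x \<in> V. x $ i = 0}" by simp
qed

lemma lin_nonzero_coord:
  assumes "lin N V" "V \<noteq> {0\<^sub>v N}"
  obtains w i where "w \<in> V" "i < N" "w $ i = 1"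
proof -
  obtain w where w: "w \<in> V" "w \<noteq> 0\<^sub>v N" using assms by (auto simp: lin_def)
  then have "w \<in> carrier_vec N" using lin_carrier[OF assms(1)] by blast
  then obtain i where "i < N" "w $ i \<noteq> 0" using w by (auto simp: vec_eq_iff)
  then show ?thesis using that w bit_ne_0 by blast
qed

lemma lin_card:
  assumes "lin N V"
  shows "\<exists>d. card V = 2 ^ d"
  using assms
proof (induction "card V" arbitrary: V rule: less_induct)
  case less
  show ?case
  proof (cases "V = {0\<^sub>v N}")
    case True
    then have "card V = 2 ^ 0" by simp
    then show ?thesis ..
  next
    case False
    obtain w i where wi: "w \<in> V" "i < N" "w $ i = 1" using lin_nonzero_coord[OF less.prems False] by blast
    note h = lin_hyperplane[OF less.prems wi(2,1,3)]
    have "card V > 0" using lin_finite[OF less.prems] wi by (auto simp: card_gt_0_iff)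
    then have "card {x \<in> V. x $ i = 0} < card V" using h(2) by linarith
    from less.hyps[OF this h(1)] obtain d where "card {x \<in> V. x $ i = 0} = 2 ^ d" by blast
    then have "card V = 2 ^ Suc d" using h(2) by simp
    then show ?thesis ..
  qed
qed

text \<open>The binary logarithm of the number of elements is the dimension;
  \<open>card_eq_dim\<close> gives the link to the vector-space notion.\<close>

definition ldim :: "bit vec set \<Rightarrow> nat" where
  "ldim V = (THE d. card V = 2 ^ d)"

lemma ldim_eqI: "card V = 2 ^ d \<Longrightarrow> ldim V = d"
  unfolding ldim_def by (rule the_equality) auto

lemma card_lin: "lin N V \<Longrightarrow> card V = 2 ^ ldim V"
  using lin_card ldim_eqI by metis

text \<open>The Moebius function of the lattice of subspaces of a \<open>d\<close>-dimensional space over \<open>\<int>/2\<close>.\<close>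

fun mobius :: "nat \<Rightarrow> int" where
  "mobius 0 = 1"
| "mobius (Suc d) = - (2 ^ d) * mobius d"

definition subspaces_of :: "nat \<Rightarrow> bit vec set \<Rightarrow> bit vec set set" where
  "subspaces_of N W = {V. lin N V \<and> V \<subseteq> W}"

lemma finite_subspaces_of: "lin N W \<Longrightarrow> finite (subspaces_of N W)"
  by (rule finite_subset[of _ "Pow W"]) (auto simp: subspaces_of_def lin_finite)

lemma lin_zero: "lin N {0\<^sub>v N}"
  by (auto simp: lin_def)

lemma lin_eq_zero: "lin N V \<Longrightarrow> V \<subseteq> {0\<^sub>v N} \<Longrightarrow> V = {0\<^sub>v N}"
  by (auto simp: lin_def)

lemma lin_extend:
  assumes U: "lin N U" and w: "w \<in> carrier_vec N"
  shows "lin N (U \<union> (\<lambda>u. w + u) ` U)"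
proof -
  have c: "x \<in> carrier_vec N" if "x \<in> U" for x using U that by (rule lin_carrier)
  have e1: "w + x + y = w + (x + y)" "x + (w + y) = w + (x + y)" "w + x + (w + y) = x + y" if "x \<in> U" "y \<in> U" for x y
  proof -
    have cs: "x \<in> carrier_vec N" "y \<in> carrier_vec N" using c that by auto
    show "w + x + y = w + (x + y)" using cs w by (rule assoc_add_vec[rotated])
    show "x + (w + y) = w + (x + y)"
    proof (rule eq_vecI)
      fix i assume "i < dim_vec (w + (x + y))"
      then show "(x + (w + y)) $ i = (w + (x + y)) $ i"
        using cs w by (cases "x $ i"; cases "y $ i"; cases "w $ i") auto
    qed (use cs w in auto)
    show "w + x + (w + y) = x + y"
    proof (rule eq_vecI)
      fix i assume "i < dim_vec (x + y)"
      then show "(w + x + (w + y)) $ i = (x + y) $ i"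
        using cs w by (cases "x $ i"; cases "y $ i"; cases "w $ i") auto
    qed (use cs w in auto)
  qed
  have U': "0\<^sub>v N \<in> U" "\<And>x y. x \<in> U \<Longrightarrow> y \<in> U \<Longrightarrow> x + y \<in> U" using U by (auto simp: lin_def)
  let ?V = "U \<union> (\<lambda>u. w + u) ` U"
  have "x + y \<in> ?V" if "x \<in> ?V" "y \<in> ?V" for x y
    using that
  proof (elim UnE imageE)
    show "x + y \<in> ?V" if "x \<in> U" "y \<in> U" using U'(2)[OF that] by (rule UnI1)
    show "x + y \<in> ?V" if "x \<in> U" "y = w + v" "v \<in> U" for v
      unfolding that(2) e1(2)[OF that(1,3)] using U'(2)[OF that(1,3)] by (intro UnI2 imageI)
    show "x + y \<in> ?V" if "y \<in> U" "x = w + v" "v \<in> U" for v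
      unfolding that(2) e1(1)[OF that(3,1)] using U'(2)[OF that(3,1)] by (intro UnI2 imageI)
    show "x + y \<in> ?V" if "x = w + u" "u \<in> U" "y = w + v" "v \<in> U" for u v
      unfolding that(1,3) e1(3)[OF that(2,4)] using U'(2)[OF that(2,4)] by (rule UnI1)
  qed
  moreover have "?V \<subseteq> carrier_vec N"
  proof
    fix x assume "x \<in> ?V"
    then show "x \<in> carrier_vec N" using c w add_carrier_vec by (elim UnE imageE) simp_all
  qed
  ultimately show ?thesis unfolding lin_def using U'(1) by blast
qed

text \<open>
  For a hyperplane \<open>H\<close> of \<open>W\<close>, a subspace of \<open>W\<close> not contained in \<open>H\<close> is determined by its intersection
  \<open>U\<close> with \<open>H\<close> and one of the \<open>card H / card U\<close> cosets of \<open>U\<close> outside \<open>H\<close>.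
\<close>

lemma mobius_sum:
  assumes "lin N W"
  shows "(\<Sum>V\<in>subspaces_of N W. mobius (ldim V)) = (if W = {0\<^sub>v N} then 1 else 0)"
  using assms
proof (induction "card W" arbitrary: W rule: less_induct)
  case less
  note W = \<open>lin N W\<close>
  show ?case
  proof (cases "W = {0\<^sub>v N}")
    case True
    then have "subspaces_of N W = {{0\<^sub>v N}}" using lin_eq_zero lin_zero by (auto simp: subspaces_of_def)
    moreover have "ldim {0\<^sub>v N} = 0" by (rule ldim_eqI) simp
    ultimately show ?thesis using True by simp
  next
    case False
    obtain w i where wi: "w \<in> W" "i < N" "w $ i = 1" using lin_nonzero_coord[OF W False] by blast
    define H where "H = {x \<in> W. x $ i = 0}"
    note h = lin_hyperplane[OF W wi(2,1,3), folded H_def]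
    have "card W > 0" using lin_finite[OF W] wi by (auto simp: card_gt_0_iff)
    then have IH: "(\<Sum>V\<in>subspaces_of N H. mobius (ldim V)) = (if H = {0\<^sub>v N} then 1 else 0)"
      using less.hyps[of H] h by simp
    have add_i: "(x + y) $ i = x $ i + y $ i" if "y \<in> W" for x y
      using lin_carrier[OF W that] wi(2) by auto
    define E where "E U = {V \<in> subspaces_of N W. V \<inter> H = U \<and> \<not> V \<subseteq> H}" for U
    have finW: "finite (subspaces_of N W)" by (rule finite_subspaces_of[OF W])
    have VH: "V \<inter> H = {x \<in> V. x $ i = 0}" if "V \<in> subspaces_of N W" for V using that by (auto simp: subspaces_of_def H_def)
    have VE: "card V = 2 * card U" "lin N U" "{x \<in> V. x $ i \<noteq> 0} = V - H" "card (V - H) = card U" "lin N V" "U \<subseteq> V" "V \<subseteq> W" if "V \<in> E U" for V U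
    proof -
      have V: "V \<in> subspaces_of N W" "V \<inter> H = U" "\<not> V \<subseteq> H" using that by (auto simp: E_def)
      show l: "lin N V" "U \<subseteq> V" "V \<subseteq> W" using V by (auto simp: subspaces_of_def)
      show e: "{x \<in> V. x $ i \<noteq> 0} = V - H" using V by (auto simp: H_def subspaces_of_def)
      obtain v where "v \<in> V" "v $ i = 1" using V e bit_ne_0 by blast
      note hh = lin_hyperplane[OF l(1) wi(2) this, folded VH[OF V(1)], unfolded V(2) e]
      show "card V = 2 * card U" "lin N U" "card (V - H) = card U" by (rule hh)+
    qed
    have split: "subspaces_of N W = subspaces_of N H \<union> (\<Union>U\<in>subspaces_of N H. E U)"
    proof
      show "subspaces_of N W \<subseteq> subspaces_of N H \<union> (\<Union>U\<in>subspaces_of N H. E U)"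
      proof
        fix V assume V: "V \<in> subspaces_of N W"
        show "V \<in> subspaces_of N H \<union> (\<Union>U\<in>subspaces_of N H. E U)"
        proof (cases "V \<subseteq> H")
          case True
          then show ?thesis using V by (auto simp: subspaces_of_def)
        next
          case False
          then have "V \<in> E (V \<inter> H)" using V by (auto simp: E_def)
          then show ?thesis using VE(2) by (auto simp: subspaces_of_def)
        qed
      qed
      show "subspaces_of N H \<union> (\<Union>U\<in>subspaces_of N H. E U) \<subseteq> subspaces_of N W"
        by (auto simp: subspaces_of_def E_def H_def)
    qed
    have cardE: "card (E U) * card U = card H" if U: "U \<in> subspaces_of N H" for U
    proof -
      have Ul: "lin N U" "U \<subseteq> H" using U by (auto simp: subspaces_of_def)
      have Uc: "x \<in> carrier_vec N" if "x \<in> U" for x using Ul(1) that by (rule lin_carrier)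
      \<comment> \<open>Every point of \<open>W\<close> outside \<open>H\<close> lies in exactly one
        member of \<open>E U\<close>, the span of \<open>U\<close> and that point, so counting these
        points gives the identity.\<close>
      have "W - H = (\<Union>V\<in>E U. V - H)"
      proof
        show "W - H \<subseteq> (\<Union>V\<in>E U. V - H)"
        proof
          fix x assume x: "x \<in> W - H"
          then have xi: "x $ i = 1" "x \<in> carrier_vec N" using bit_ne_0 lin_carrier[OF W] by (auto simp: H_def)
          define V where "V = U \<union> (\<lambda>u. x + u) ` U"
          have lV: "lin N V" unfolding V_def by (rule lin_extend[OF Ul(1) xi(2)])
          have VW: "V \<subseteq> W" using Ul x W by (auto simp: V_def H_def lin_def)
          have "(x + u) $ i = 1" if "u \<in> U" for u
            using that Ul x add_i[of u x] xi by (auto simp: H_def)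
          then have "V \<inter> H = U" using Ul VW by (auto simp: V_def H_def)
          moreover have xV: "x \<in> V"
          proof -
            have "x + 0\<^sub>v N \<in> V" using Ul(1) by (auto simp: V_def lin_def)
            then show ?thesis using xi by simp
          qed
          ultimately have "V \<in> E U" using lV VW x by (auto simp: E_def subspaces_of_def)
          then show "x \<in> (\<Union>V\<in>E U. V - H)" using xV x by auto
        qed
        show "(\<Union>V\<in>E U. V - H) \<subseteq> W - H" using VE(7) by blast
      qed
      moreover have "card (\<Union>V\<in>E U. V - H) = (\<Sum>V\<in>E U. card (V - H))"
      proof (rule card_UN_disjoint)
        show "finite (E U)" using finW by (simp add: E_def)
        show "\<forall>V\<in>E U. finite (V - H)" using VE(5) lin_finite by blast
        \<comment> \<open>A member of \<open>E U\<close> is determined by any of its points outside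
          \<open>H\<close>: it is the union of \<open>U\<close> and the coset of that point.\<close>
        have sub: "V \<subseteq> V'" if V: "V \<in> E U" "V' \<in> E U" and x: "x \<in> V" "x \<in> V'" "x \<notin> H" for V V' x
        proof
          fix y assume y: "y \<in> V"
          have UV: "V \<inter> H = U" "V' \<inter> H = U" using V by (auto simp: E_def)
          have xi: "x $ i = 1" using x VE(7)[OF V(1)] bit_ne_0 by (auto simp: H_def)
          show "y \<in> V'"
          proof (cases "y \<in> H")
            case True
            then show ?thesis using y UV by auto
          next
            case False
            then have yi: "y $ i = 1" using y VE(7)[OF V(1)] bit_ne_0 by (auto simp: H_def)
            have "x + y \<in> V" using VE(5)[OF V(1)] x y by (auto simp: lin_def)
            moreover have "(x + y) $ i = 0" using add_i[of y x] y VE(7)[OF V(1)] xi yi by auto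
            ultimately have "x + y \<in> V'" using VE(7)[OF V(1)] UV by (auto simp: H_def)
            then have "x + (x + y) \<in> V'" using VE(5)[OF V(2)] x by (auto simp: lin_def)
            then show ?thesis
              using bitvec_add_cancel(2)[of x N y] lin_carrier[OF VE(5)[OF V(1)]] x y by auto
          qed
        qed
        show "\<forall>V\<in>E U. \<forall>V'\<in>E U. V \<noteq> V' \<longrightarrow> (V - H) \<inter> (V' - H) = {}"
          using sub by blast
      qed
      moreover have "(\<Sum>V\<in>E U. card (V - H)) = card (E U) * card U" using VE(4) by simp
      moreover have "card (W - H) = card H"
      proof -
        have "W - H = {x \<in> W. x $ i \<noteq> 0}" by (auto simp: H_def)
        then show ?thesis using h(3) by simp
      qed
      ultimately show ?thesis by simp
    qed
    have mobE: "(\<Sum>V\<in>E U. mobius (ldim V)) = - int (card H) * mobius (ldim U)" if U: "U \<in> subspaces_of N H" for U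
    proof -
      have Ul: "lin N U" using U by (auto simp: subspaces_of_def)
      have "mobius (ldim V) = - int (card U) * mobius (ldim U)" if "V \<in> E U" for V
      proof -
        have "card V = 2 ^ Suc (ldim U)" using VE(1)[OF that] card_lin[OF Ul] by simp
        then have "ldim V = Suc (ldim U)" by (rule ldim_eqI)
        then show ?thesis using card_lin[OF Ul] by simp
      qed
      then have "(\<Sum>V\<in>E U. mobius (ldim V)) = - int (card (E U) * card U) * mobius (ldim U)" by simp
      then show ?thesis using cardE[OF U] by simp
    qed
    have "(\<Sum>V\<in>subspaces_of N W. mobius (ldim V)) = (\<Sum>V\<in>subspaces_of N H. mobius (ldim V)) + (\<Sum>V\<in>(\<Union>U\<in>subspaces_of N H. E U). mobius (ldim V))"
      unfolding split
    proof (rule sum.union_disjoint)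
      show "finite (subspaces_of N H)" by (rule finite_subspaces_of[OF h(1)])
      then show "finite (\<Union>U\<in>subspaces_of N H. E U)" using finW by (auto simp: E_def)
      show "subspaces_of N H \<inter> (\<Union>U\<in>subspaces_of N H. E U) = {}" by (auto simp: subspaces_of_def E_def)
    qed
    also have "(\<Sum>V\<in>(\<Union>U\<in>subspaces_of N H. E U). mobius (ldim V)) = (\<Sum>U\<in>subspaces_of N H. \<Sum>V\<in>E U. mobius (ldim V))"
      by (rule sum.UNION_disjoint) (use finite_subspaces_of[OF h(1)] finW in \<open>auto simp: E_def\<close>)
    also have "\<dots> = - int (card H) * (\<Sum>U\<in>subspaces_of N H. mobius (ldim U))"
      by (simp add: mobE sum_distrib_left sum_negf)
    \<comment> \<open>The factor 1 - |H| vanishes when \<open>H\<close> is zero, and otherwise the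
      sum over the subspaces of \<open>H\<close> does.\<close>
    also have "(\<Sum>V\<in>subspaces_of N H. mobius (ldim V)) + \<dots> = 0"
      using IH by auto
    finally show ?thesis using False by simp
  qed
qed

section \<open>Agreement with the vector-space notions of the statement\<close>

lemma bit_smult_vec:
  assumes "v \<in> carrier_vec N"
  shows "(c :: bit) \<cdot>\<^sub>v v = (if c = 0 then 0\<^sub>v N else v)"
proof (rule eq_vecI)
  fix i assume "i < dim_vec (if c = 0 then 0\<^sub>v N else v)"
  then show "(c \<cdot>\<^sub>v v) $ i = (if c = 0 then 0\<^sub>v N else v) $ i" using assms by (cases c) auto
qed (use assms in auto)

lemma subspace_iff_lin:
  "VectorSpace.subspace class_ring V (module_vec TYPE(bit) N) \<longleftrightarrow> lin N V"
proof
  assume "VectorSpace.subspace class_ring V (module_vec TYPE(bit) N)"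
  then interpret S: submodule class_ring V "module_vec TYPE(bit) N" by (simp add: VectorSpace.subspace_def)
  show "lin N V"
    using S.subset S.m_closed S.zero_closed by (auto simp: lin_def module_vec_simps)
next
  assume V: "lin N V"
  show "VectorSpace.subspace class_ring V (module_vec TYPE(bit) N)"
    unfolding VectorSpace.subspace_def
  proof (intro conjI vec_vs submodule.intro)
    show "Module.module class_ring (module_vec TYPE(bit) N)" by (rule vec_module)
    show "V \<subseteq> carrier (module_vec TYPE(bit) N)" using V by (simp add: lin_def module_vec_simps)
    show "v \<oplus>\<^bsub>module_vec TYPE(bit) N\<^esub> w \<in> V" if "v \<in> V" "w \<in> V" for v w
      using V that by (simp add: lin_def module_vec_simps)
    show "\<zero>\<^bsub>module_vec TYPE(bit) N\<^esub> \<in> V" using V by (simp add: lin_def module_vec_simps)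
    show "c \<odot>\<^bsub>module_vec TYPE(bit) N\<^esub> v \<in> V" if "v \<in> V" for c v
      using V that lin_carrier[OF V that] by (simp add: lin_def module_vec_simps bit_smult_vec)
  qed
qed

text \<open>Unique coordinates with respect to a basis identify \<open>V\<close> with the functions
  from the basis to a field of two elements.\<close>

lemma card_eq_dim:
  assumes V: "lin N V"
  shows "card V = 2 ^ vectorspace.dim class_ring ((module_vec TYPE(bit) N)\<lparr>carrier := V\<rparr>)"
proof -
  have "VectorSpace.subspace class_ring V (module_vec TYPE(bit) N)" unfolding subspace_iff_lin by (rule V)
  then have "vectorspace class_ring ((module_vec TYPE(bit) N)\<lparr>carrier := V\<rparr>)"
    by (rule vectorspace.subspace_is_vs[OF vec_vs])
  then interpret W: vectorspace class_ring "(module_vec TYPE(bit) N)\<lparr>carrier := V\<rparr>" .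
  have "W.fin_dim" unfolding W.fin_dim_def
  proof (intro exI conjI)
    show "finite V" using V by (rule lin_finite)
    show "V \<subseteq> carrier ((module_vec TYPE(bit) N)\<lparr>carrier := V\<rparr>)" by simp
    have "V \<subseteq> W.span V" using W.in_own_span[of V] by simp
    moreover have "W.span V \<subseteq> V" using W.span_is_subset2[of V] by simp
    ultimately show "W.gen_set V" by simp
  qed
  then obtain B where B: "finite B" "W.basis B" using W.finite_basis_exists by blast
  have BV': "B \<subseteq> carrier ((module_vec TYPE(bit) N)\<lparr>carrier := V\<rparr>)" using B(2) unfolding W.basis_def by blast
  then have BV: "B \<subseteq> V" by simp
  have uniq: "\<exists>!a. a \<in> B \<rightarrow>\<^sub>E UNIV \<and> W.lincomb a B = v" if "v \<in> V" for v
    using iffD1[OF W.basis_criterion[OF B(1) BV'] B(2), rule_format, of v] that by simp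
  have mem: "W.lincomb a B \<in> V" for a
    using W.lincomb_closed[of B a] BV by simp
  have "bij_betw (\<lambda>a. W.lincomb a B) (B \<rightarrow>\<^sub>E UNIV) V"
    unfolding bij_betw_def
  proof
    show "inj_on (\<lambda>a. W.lincomb a B) (B \<rightarrow>\<^sub>E UNIV)"
    proof (rule inj_onI)
      fix x y assume xy: "x \<in> B \<rightarrow>\<^sub>E UNIV" "y \<in> B \<rightarrow>\<^sub>E UNIV" "W.lincomb x B = W.lincomb y B"
      from uniq[OF mem[of x]] obtain a where a: "\<And>b. b \<in> B \<rightarrow>\<^sub>E UNIV \<and> W.lincomb b B = W.lincomb x B \<Longrightarrow> b = a"
        by (elim ex1E) (rule that, drule spec, erule mp, assumption)
      have "x = a" by (rule a[OF conjI[OF xy(1) refl]])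
      moreover have "y = a" by (rule a[OF conjI[OF xy(2) xy(3)[symmetric]]])
      ultimately show "x = y" by simp
    qed
    show "(\<lambda>a. W.lincomb a B) ` (B \<rightarrow>\<^sub>E UNIV) = V"
    proof
      show "(\<lambda>a. W.lincomb a B) ` (B \<rightarrow>\<^sub>E UNIV) \<subseteq> V" by (rule image_subsetI) (rule mem)
      show "V \<subseteq> (\<lambda>a. W.lincomb a B) ` (B \<rightarrow>\<^sub>E UNIV)"
      proof
        fix v assume "v \<in> V"
        from uniq[OF this] obtain a where "a \<in> B \<rightarrow>\<^sub>E UNIV" "W.lincomb a B = v" by (elim ex1E conjE) (rule that)
        then show "v \<in> (\<lambda>a. W.lincomb a B) ` (B \<rightarrow>\<^sub>E UNIV)" by (intro image_eqI) (rule sym)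
      qed
    qed
  qed
  then have "card V = card (B \<rightarrow>\<^sub>E (UNIV :: bit set))" by (metis bij_betw_same_card)
  also have "\<dots> = 2 ^ card B" using B(1) by (simp add: card_PiE UNIV_bit numeral_2_eq_2)
  also have "card B = W.dim" by (rule W.dim_basis[OF B, symmetric])
  finally show ?thesis .
qed

lemma char_subspaces_eq: "char_subspaces g i = {V. lin (2 * g) V \<and> card V = 2 ^ i}"
  unfolding char_subspaces_def subspace_iff_lin using card_eq_dim by (auto simp: card_eq_dim)

section \<open>Totally singular subspaces for the parity of characteristics\<close>

definition parity_form :: "nat \<Rightarrow> bit vec \<Rightarrow> bit" where
  "parity_form g v = (\<Sum>i<g. v $ i * v $ (g + i))"

definition pairing :: "nat \<Rightarrow> bit vec \<Rightarrow> bit vec \<Rightarrow> bit" where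
  "pairing g v w = (\<Sum>i<g. v $ i * w $ (g + i) + v $ (g + i) * w $ i)"

definition totally_singular :: "nat \<Rightarrow> bit vec set \<Rightarrow> bool" where
  "totally_singular g V \<longleftrightarrow> lin (2 * g) V \<and> (\<forall>v\<in>V. parity_form g v = 0)"

lemma bitvec_index_add:
  assumes "w \<in> carrier_vec (2 * g)" "i < g"
  shows "(v + w) $ i = v $ i + w $ i" "(v + w) $ (g + i) = v $ (g + i) + w $ (g + i)"
  by (rule index_add_vec(1); use assms in simp)+

lemma parity_form_add:
  assumes "v \<in> carrier_vec (2 * g)" "w \<in> carrier_vec (2 * g)"
  shows "parity_form g (v + w) = parity_form g v + parity_form g w + pairing g v w"
proof -
  have "parity_form g (v + w) = (\<Sum>i<g. v $ i * v $ (g + i) + w $ i * w $ (g + i) + (v $ i * w $ (g + i) + v $ (g + i) * w $ i))"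
    unfolding parity_form_def
  proof (intro sum.cong refl)
    fix i assume "i \<in> {..<g}"
    then have "i < g" by simp
    note e = bitvec_index_add[OF assms(2) this, of v]
    show "(v + w) $ i * (v + w) $ (g + i) = v $ i * v $ (g + i) + w $ i * w $ (g + i) + (v $ i * w $ (g + i) + v $ (g + i) * w $ i)"
      unfolding e by (simp only: distrib_left distrib_right ac_simps)
  qed
  then show ?thesis by (simp only: sum.distrib parity_form_def pairing_def)
qed

lemma pairing_sym: "pairing g v w = pairing g w v"
  unfolding pairing_def by (intro sum.cong refl) (simp only: ac_simps)

lemma pairing_add:
  assumes "w \<in> carrier_vec (2 * g)"
  shows "pairing g u (v + w) = pairing g u v + pairing g u w"
proof -
  have "pairing g u (v + w) = (\<Sum>i<g. (u $ i * v $ (g + i) + u $ (g + i) * v $ i) + (u $ i * w $ (g + i) + u $ (g + i) * w $ i))"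
    unfolding pairing_def
  proof (intro sum.cong refl)
    fix i assume "i \<in> {..<g}"
    then have "i < g" by simp
    note e = bitvec_index_add[OF assms this, of v]
    show "u $ i * (v + w) $ (g + i) + u $ (g + i) * (v + w) $ i = (u $ i * v $ (g + i) + u $ (g + i) * v $ i) + (u $ i * w $ (g + i) + u $ (g + i) * w $ i)"
      unfolding e by (simp only: distrib_left ac_simps)
  qed
  then show ?thesis by (simp only: sum.distrib pairing_def)
qed

lemma pairing_nondeg:
  assumes v: "v \<in> carrier_vec (2 * g)" "v \<noteq> 0\<^sub>v (2 * g)"
  obtains w where "w \<in> carrier_vec (2 * g)" "pairing g v w = 1"
proof -
  obtain i where i: "i < 2 * g" "v $ i = 1" using v bit_ne_0 by (auto simp: vec_eq_iff)
  define j where "j = (if i < g then g + i else i - g)"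
  let ?w = "unit_vec (2 * g) j :: bit vec"
  have "pairing g v ?w = (\<Sum>k<g. if k = (if i < g then i else i - g) then 1 else 0)"
    unfolding pairing_def using i by (intro sum.cong refl) (auto simp: j_def)
  also have "\<dots> = 1" using i by auto
  finally show ?thesis using that by (metis unit_vec_carrier)
qed

text \<open>Counting the pairs (v, x) with pairing 1 by rows and by columns yields |V| |K| = 2^(2g)
  for the orthogonal complement \<open>K\<close> of \<open>V\<close>. By polarization a totally
  singular space is isotropic, so it is contained in \<open>K\<close>.\<close>

lemma totally_singular_card_le:
  assumes "totally_singular g V"
  shows "card V \<le> 2 ^ g"
proof -
  let ?C = "carrier_vec (2 * g) :: bit vec set"
  have V: "lin (2 * g) V" "\<And>v. v \<in> V \<Longrightarrow> parity_form g v = 0" using assms by (auto simp: totally_singular_def)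
  have Vc: "v \<in> ?C" if "v \<in> V" for v using V(1) that by (rule lin_carrier)
  have fV: "finite V" by (rule lin_finite[OF V(1)])
  have V0: "0\<^sub>v (2 * g) \<in> V" using V(1) by (simp add: lin_def)
  have iso: "pairing g v w = 0" if "v \<in> V" "w \<in> V" for v w
  proof -
    have "v + w \<in> V" using V(1) that by (auto simp: lin_def)
    then have "parity_form g v + parity_form g w + pairing g v w = 0" using V(2) parity_form_add[OF Vc Vc] that by metis
    then show ?thesis using V(2) that by simp
  qed
  have aff: "aff_on A (pairing g v)" if "A \<subseteq> ?C" for v A
    unfolding aff_on_def
  proof (intro ballI)
    fix x y z assume "x \<in> A" "y \<in> A" "z \<in> A"
    then have "x \<in> ?C" "y \<in> ?C" "z \<in> ?C" using that by auto
    then show "pairing g v (x + y + z) = pairing g v x + pairing g v y + pairing g v z" by (simp only: pairing_add add_carrier_vec)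
  qed
  have linC: "lin (2 * g) ?C" by (auto simp: lin_def)
  have b0: "pairing g v (0\<^sub>v (2 * g)) = 0" for v by (simp add: pairing_def)
  define K where "K = {x \<in> ?C. \<forall>v\<in>V. pairing g v x = 0}"
  have VK: "V \<subseteq> K" using iso Vc by (auto simp: K_def)
  have fC: "finite ?C" by simp
  have row: "2 * card {x \<in> ?C. pairing g v x = 1} = (if v = 0\<^sub>v (2 * g) then 0 else 2 ^ (2 * g))" if v: "v \<in> V" for v
  proof (cases "v = 0\<^sub>v (2 * g)")
    case True
    have "pairing g v x = 0" for x unfolding True by (simp add: pairing_def)
    then show ?thesis using True by simp
  next
    case False
    obtain w where w: "w \<in> ?C" "pairing g v w = 1" using pairing_nondeg[OF Vc[OF v] False] by blast
    have "0\<^sub>v (2 * g) \<in> ?C" by simp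
    from aff_half(2)[OF lin_imp_aff[OF linC] aff[OF subset_refl, of v] w this b0] show ?thesis
      using False by (simp add: card_carrier_bitvec)
  qed
  have col: "2 * card {v \<in> V. pairing g v x = 1} = (if x \<in> K then 0 else card V)" if x: "x \<in> ?C" for x
  proof (cases "x \<in> K")
    case True
    then have "{v \<in> V. pairing g v x = 1} = {}" by (auto simp: K_def)
    then show ?thesis using True by (simp only: card.empty if_True mult_0_right)
  next
    case False
    then obtain w where w: "w \<in> V" "pairing g x w = 1" using x bit_ne_0 by (auto simp: K_def pairing_sym[of g x])
    have "V \<subseteq> ?C" using Vc by auto
    from aff_half(2)[OF lin_imp_aff[OF V(1)] aff[OF this, of x] w V0 b0] show ?thesis
      using False by (simp add: pairing_sym[of g x])
  qed
  have "(\<Sum>v\<in>V. 2 * card {x \<in> ?C. pairing g v x = 1}) = (\<Sum>x\<in>?C. 2 * card {v \<in> V. pairing g v x = 1})"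
  proof -
    have "(\<Sum>v\<in>V. card {x \<in> ?C. pairing g v x = 1}) = (\<Sum>x\<in>?C. card {v \<in> V. pairing g v x = 1})"
      unfolding card_eq_sum sum.inter_filter[OF fC] sum.inter_filter[OF fV] by (rule sum.swap)
    then show ?thesis by (simp flip: sum_distrib_left)
  qed
  moreover have "(\<Sum>v\<in>V. 2 * card {x \<in> ?C. pairing g v x = 1}) = (card V - 1) * 2 ^ (2 * g)"
  proof -
    have "(\<Sum>v\<in>V. 2 * card {x \<in> ?C. pairing g v x = 1}) = (\<Sum>v\<in>V. if v = 0\<^sub>v (2 * g) then 0 else 2 ^ (2 * g))"
      by (intro sum.cong refl row)
    also have "\<dots> = (\<Sum>v\<in>V - {0\<^sub>v (2 * g)}. 2 ^ (2 * g))"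
      using fV by (intro sum.mono_neutral_cong_right) auto
    finally show ?thesis using V0 fV by simp
  qed
  moreover have "(\<Sum>x\<in>?C. 2 * card {v \<in> V. pairing g v x = 1}) = (2 ^ (2 * g) - card K) * card V"
  proof -
    have "(\<Sum>x\<in>?C. 2 * card {v \<in> V. pairing g v x = 1}) = (\<Sum>x\<in>?C. if x \<in> K then 0 else card V)"
      by (intro sum.cong refl col)
    also have "\<dots> = (\<Sum>x\<in>?C - K. card V)"
      using fC by (intro sum.mono_neutral_cong_right) auto
    also have "\<dots> = (card ?C - card K) * card V"
      by (subst sum_constant, subst card_Diff_subset) (auto simp: K_def)
    finally show ?thesis by (simp add: card_carrier_bitvec)
  qed
  ultimately have eq: "(card V - 1) * 2 ^ (2 * g) = (2 ^ (2 * g) - card K) * card V" by simp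
  have cK: "card V \<le> card K" using VK fC by (intro card_mono) (auto simp: K_def)
  have cV: "card V \<ge> 1" 
  proof -
    have "card V > 0" unfolding card_gt_0_iff using V0 fV by auto
    then show ?thesis by linarith
  qed
  have KC: "card K \<le> 2 ^ (2 * g)" using card_mono[OF fC, of K] by (auto simp: K_def card_carrier_bitvec)
  have "card V * card V \<le> card K * card V" using cK by simp
  also have "\<dots> = 2 ^ (2 * g)"
  proof -
    have "int (card V - 1) * 2 ^ (2 * g) = int (2 ^ (2 * g) - card K) * int (card V)"
      using arg_cong[OF eq, of int] by simp
    then have "int (card K * card V) = int (2 ^ (2 * g))"
      using cV KC by (simp add: of_nat_diff algebra_simps)
    then show ?thesis by (simp only: of_nat_eq_iff)
  qed
  also have "(2::nat) ^ (2 * g) = 2 ^ g * 2 ^ g" by (simp add: mult_2 power_add)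
  finally show ?thesis by (simp add: power2_eq_square[symmetric] power2_nat_le_eq_le)
qed

section \<open>Subspaces of a direct sum with prescribed projections\<close>

locale split_product =
  fixes N N1 N2 :: nat and p1 p2 :: "bit vec \<Rightarrow> bit vec" and j :: "bit vec \<Rightarrow> bit vec \<Rightarrow> bit vec"
  assumes p1_carrier: "\<And>v. p1 v \<in> carrier_vec N1" and p2_carrier: "\<And>v. p2 v \<in> carrier_vec N2"
    and j_carrier: "\<And>x y. j x y \<in> carrier_vec N"
    and p1_add: "\<And>v w. v \<in> carrier_vec N \<Longrightarrow> w \<in> carrier_vec N \<Longrightarrow> p1 (v + w) = p1 v + p1 w"
    and p2_add: "\<And>v w. v \<in> carrier_vec N \<Longrightarrow> w \<in> carrier_vec N \<Longrightarrow> p2 (v + w) = p2 v + p2 w"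
    and j_inv: "\<And>v. v \<in> carrier_vec N \<Longrightarrow> j (p1 v) (p2 v) = v"
    and p1_j: "\<And>x y. x \<in> carrier_vec N1 \<Longrightarrow> y \<in> carrier_vec N2 \<Longrightarrow> p1 (j x y) = x"
    and p2_j: "\<And>x y. x \<in> carrier_vec N1 \<Longrightarrow> y \<in> carrier_vec N2 \<Longrightarrow> p2 (j x y) = y"
begin

lemma p_zero: "p1 (0\<^sub>v N) = 0\<^sub>v N1" "p2 (0\<^sub>v N) = 0\<^sub>v N2"
proof -
  have z: "0\<^sub>v N \<in> carrier_vec N" by simp
  have "p1 (0\<^sub>v N + 0\<^sub>v N) = 0\<^sub>v N1" unfolding p1_add[OF z z] using p1_carrier by (rule bitvec_add_self)
  then show "p1 (0\<^sub>v N) = 0\<^sub>v N1" by simp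
  have "p2 (0\<^sub>v N + 0\<^sub>v N) = 0\<^sub>v N2" unfolding p2_add[OF z z] using p2_carrier by (rule bitvec_add_self)
  then show "p2 (0\<^sub>v N) = 0\<^sub>v N2" by simp
qed

lemma lin_image:
  assumes "lin N V"
  shows "lin N1 (p1 ` V)" "lin N2 (p2 ` V)"
proof -
  note c = lin_carrier[OF assms]
  have z: "0\<^sub>v N \<in> V" and a: "\<And>x y. x \<in> V \<Longrightarrow> y \<in> V \<Longrightarrow> x + y \<in> V" using assms by (auto simp: lin_def)
  show "lin N1 (p1 ` V)"
    unfolding lin_def
  proof (intro conjI ballI)
    show "0\<^sub>v N1 \<in> p1 ` V" using imageI[OF z, of p1] p_zero by simp
    fix x y assume "x \<in> p1 ` V" "y \<in> p1 ` V"
    then obtain v w where "v \<in> V" "w \<in> V" "x = p1 v" "y = p1 w" by blast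
    then show "x + y \<in> p1 ` V" using imageI[OF a[of v w], of p1] p1_add[OF c c, of v w] by simp
  qed (use p1_carrier in auto)
  show "lin N2 (p2 ` V)"
    unfolding lin_def
  proof (intro conjI ballI)
    show "0\<^sub>v N2 \<in> p2 ` V" using imageI[OF z, of p2] p_zero by simp
    fix x y assume "x \<in> p2 ` V" "y \<in> p2 ` V"
    then obtain v w where "v \<in> V" "w \<in> V" "x = p2 v" "y = p2 w" by blast
    then show "x + y \<in> p2 ` V" using imageI[OF a[of v w], of p2] p2_add[OF c c, of v w] by simp
  qed (use p2_carrier in auto)
qed

definition dsum :: "bit vec set \<Rightarrow> bit vec set \<Rightarrow> bit vec set" where
  "dsum W1 W2 = {v \<in> carrier_vec N. p1 v \<in> W1 \<and> p2 v \<in> W2}"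

lemma lin_dsum:
  assumes "lin N1 W1" "lin N2 W2"
  shows "lin N (dsum W1 W2)"
  using assms unfolding lin_def dsum_def by (auto simp: p_zero p1_add p2_add)

lemma dsum_bij:
  assumes "lin N1 W1" "lin N2 W2"
  shows "bij_betw (\<lambda>(x, y). j x y) (W1 \<times> W2) (dsum W1 W2)"
proof (rule bij_betw_byWitness[of _ "\<lambda>v. (p1 v, p2 v)"])
  note c = lin_carrier[OF assms(1)] lin_carrier[OF assms(2)]
  show "\<forall>a\<in>W1 \<times> W2. (\<lambda>v. (p1 v, p2 v)) (case a of (x, y) \<Rightarrow> j x y) = a" using c p1_j p2_j by auto
  show "(\<lambda>(x, y). j x y) ` (W1 \<times> W2) \<subseteq> dsum W1 W2" using c p1_j p2_j j_carrier by (auto simp: dsum_def)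
qed (auto simp: dsum_def j_inv)

lemma card_dsum: "lin N1 W1 \<Longrightarrow> lin N2 W2 \<Longrightarrow> card (dsum W1 W2) = card W1 * card W2"
  using bij_betw_same_card[OF dsum_bij] by (simp add: card_cartesian_product)

lemma image_dsum:
  assumes "lin N1 W1" "lin N2 W2"
  shows "p1 ` dsum W1 W2 = W1" "p2 ` dsum W1 W2 = W2"
proof -
  note c = lin_carrier[OF assms(1)] lin_carrier[OF assms(2)]
  have z: "0\<^sub>v N1 \<in> W1" "0\<^sub>v N2 \<in> W2" using assms by (auto simp: lin_def)
  have m: "j x y \<in> dsum W1 W2" if "x \<in> W1" "y \<in> W2" for x y
    using that c by (simp add: dsum_def j_carrier p1_j p2_j)
  show "p1 ` dsum W1 W2 = W1"
  proof
    show "W1 \<subseteq> p1 ` dsum W1 W2"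
    proof
      fix x assume x: "x \<in> W1"
      have "x = p1 (j x (0\<^sub>v N2))" using x z c by (simp add: p1_j)
      then show "x \<in> p1 ` dsum W1 W2" using m[OF x z(2)] by (rule image_eqI)
    qed
  qed (auto simp: dsum_def)
  show "p2 ` dsum W1 W2 = W2"
  proof
    show "W2 \<subseteq> p2 ` dsum W1 W2"
    proof
      fix y assume y: "y \<in> W2"
      have "y = p2 (j (0\<^sub>v N1) y)" using y z c by (simp add: p2_j)
      then show "y \<in> p2 ` dsum W1 W2" using m[OF z(1) y] by (rule image_eqI)
    qed
  qed (auto simp: dsum_def)
qed

text \<open>The subdirect sums of \<open>W1\<close> and \<open>W2\<close>. Their monomials all
  become the same product upon restriction to block-diagonal matrices, so only the sum of their
  coefficients matters there.\<close>

definition over :: "bit vec set \<Rightarrow> bit vec set \<Rightarrow> bit vec set set" where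
  "over W1 W2 = {V. lin N V \<and> p1 ` V = W1 \<and> p2 ` V = W2}"

lemma finite_lin: "finite {V. lin N V}"
  by (rule finite_subset[of _ "Pow (carrier_vec N)"]) (auto simp: lin_def)

lemma finite_over: "finite (over W1 W2)"
  by (rule finite_subset[OF _ finite_lin]) (auto simp: over_def)

lemma over_subset_dsum: "V \<in> over W1 W2 \<Longrightarrow> V \<subseteq> dsum W1 W2"
  by (auto simp: over_def dsum_def lin_def)

lemma sum_subspaces_of_dsum:
  fixes f :: "bit vec set \<Rightarrow> 'a :: comm_monoid_add"
  assumes "lin N1 W1" "lin N2 W2"
  shows "(\<Sum>V\<in>subspaces_of N (dsum W1 W2). f V) = (\<Sum>V1\<in>subspaces_of N1 W1. \<Sum>V2\<in>subspaces_of N2 W2. \<Sum>V\<in>over V1 V2. f V)"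
proof -
  have fin: "finite (subspaces_of N1 W1)" "finite (subspaces_of N2 W2)" using assms by (auto simp: finite_subspaces_of)
  have "(\<Sum>V1\<in>subspaces_of N1 W1. \<Sum>V2\<in>subspaces_of N2 W2. \<Sum>V\<in>over V1 V2. f V) = (\<Sum>z\<in>subspaces_of N1 W1 \<times> subspaces_of N2 W2. \<Sum>V\<in>over (fst z) (snd z). f V)"
    by (simp add: sum.cartesian_product case_prod_unfold)
  also have "\<dots> = (\<Sum>V\<in>(\<Union>z\<in>subspaces_of N1 W1 \<times> subspaces_of N2 W2. over (fst z) (snd z)). f V)"
    by (rule sum.UNION_disjoint[symmetric]) (use fin finite_over in \<open>auto simp: over_def\<close>)
  also have "(\<Union>z\<in>subspaces_of N1 W1 \<times> subspaces_of N2 W2. over (fst z) (snd z)) = subspaces_of N (dsum W1 W2)"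
  proof
    show "(\<Union>z\<in>subspaces_of N1 W1 \<times> subspaces_of N2 W2. over (fst z) (snd z)) \<subseteq> subspaces_of N (dsum W1 W2)"
    proof
      fix V assume "V \<in> (\<Union>z\<in>subspaces_of N1 W1 \<times> subspaces_of N2 W2. over (fst z) (snd z))"
      then obtain V1 V2 where V: "V1 \<subseteq> W1" "V2 \<subseteq> W2" "V \<in> over V1 V2" by (auto simp: subspaces_of_def)
      then have "V \<subseteq> dsum V1 V2" by (intro over_subset_dsum)
      also have "\<dots> \<subseteq> dsum W1 W2" using V by (auto simp: dsum_def)
      finally show "V \<in> subspaces_of N (dsum W1 W2)" using V by (auto simp: subspaces_of_def over_def)
    qed
    show "subspaces_of N (dsum W1 W2) \<subseteq> (\<Union>z\<in>subspaces_of N1 W1 \<times> subspaces_of N2 W2. over (fst z) (snd z))"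
    proof
      fix V assume V: "V \<in> subspaces_of N (dsum W1 W2)"
      then have l: "lin N V" "V \<subseteq> dsum W1 W2" by (auto simp: subspaces_of_def)
      then have "p1 ` V \<in> subspaces_of N1 W1" "p2 ` V \<in> subspaces_of N2 W2"
        using lin_image[OF l(1)] by (auto simp: subspaces_of_def dsum_def)
      moreover have "V \<in> over (p1 ` V) (p2 ` V)" using l by (simp add: over_def)
      ultimately show "V \<in> (\<Union>z\<in>subspaces_of N1 W1 \<times> subspaces_of N2 W2. over (fst z) (snd z))" by force
    qed
  qed
  finally show ?thesis ..
qed

text \<open>Summed over all pairs of subspaces of \<open>W1\<close> and \<open>W2\<close>, both
  sides give the same value by \<open>mobius_sum\<close>, because a direct sum is zero exactly when
  both summands are. By induction the terms of all smaller pairs agree, hence so do those of the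
  pair itself.\<close>

lemma mobius_over:
  assumes "lin N1 W1" "lin N2 W2"
  shows "(\<Sum>V\<in>over W1 W2. mobius (ldim V)) = mobius (ldim W1) * mobius (ldim W2)"
  using assms
proof (induction "card W1 + card W2" arbitrary: W1 W2 rule: less_induct)
  case less
  note W = less.prems
  have fin: "finite (subspaces_of N1 W1)" "finite (subspaces_of N2 W2)" using W by (auto simp: finite_subspaces_of)
  let ?F = "\<lambda>z. \<Sum>V\<in>over (fst z) (snd z). mobius (ldim V)" and ?G = "\<lambda>z. mobius (ldim (fst z)) * mobius (ldim (snd z))"
  let ?P = "subspaces_of N1 W1 \<times> subspaces_of N2 W2"
  have "(\<Sum>z\<in>?P. ?F z) = (\<Sum>V\<in>subspaces_of N (dsum W1 W2). mobius (ldim V))"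
    by (simp add: sum_subspaces_of_dsum[OF W] sum.cartesian_product case_prod_unfold)
  also have "\<dots> = (if dsum W1 W2 = {0\<^sub>v N} then 1 else 0)"
    by (rule mobius_sum[OF lin_dsum[OF W]])
  also have "dsum W1 W2 = {0\<^sub>v N} \<longleftrightarrow> W1 = {0\<^sub>v N1} \<and> W2 = {0\<^sub>v N2}"
  proof
    assume "dsum W1 W2 = {0\<^sub>v N}"
    then show "W1 = {0\<^sub>v N1} \<and> W2 = {0\<^sub>v N2}" using image_dsum[OF W] p_zero by simp
  next
    assume z: "W1 = {0\<^sub>v N1} \<and> W2 = {0\<^sub>v N2}"
    have "v = 0\<^sub>v N" if "v \<in> dsum W1 W2" for v
    proof -
      have v: "v \<in> carrier_vec N" "p1 v = 0\<^sub>v N1" "p2 v = 0\<^sub>v N2" using that z by (auto simp: dsum_def)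
      have "v = j (p1 v) (p2 v)" by (rule j_inv[OF v(1), symmetric])
      also have "\<dots> = j (p1 (0\<^sub>v N)) (p2 (0\<^sub>v N))" unfolding v(2,3) p_zero ..
      also have "\<dots> = 0\<^sub>v N" by (rule j_inv) simp
      finally show ?thesis .
    qed
    then show "dsum W1 W2 = {0\<^sub>v N}" by (intro lin_eq_zero lin_dsum W) auto
  qed
  also have "(if W1 = {0\<^sub>v N1} \<and> W2 = {0\<^sub>v N2} then 1 else 0 :: int) = (\<Sum>z\<in>?P. ?G z)"
  proof -
    have "(\<Sum>z\<in>?P. ?G z) = (\<Sum>V1\<in>subspaces_of N1 W1. mobius (ldim V1)) * (\<Sum>V2\<in>subspaces_of N2 W2. mobius (ldim V2))"
      by (simp add: sum_product sum.cartesian_product case_prod_unfold)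
    then show ?thesis by (simp add: mobius_sum[OF W(1)] mobius_sum[OF W(2)])
  qed
  finally have eq: "(\<Sum>z\<in>?P. ?F z) = (\<Sum>z\<in>?P. ?G z)" .
  have W_in: "(W1, W2) \<in> ?P" using W by (auto simp: subspaces_of_def)
  have finP: "finite ?P" using fin by simp
  have "?F z = ?G z" if z: "z \<in> ?P - {(W1, W2)}" for z
  proof -
    obtain V1 V2 where V: "z = (V1, V2)" "lin N1 V1" "lin N2 V2" "V1 \<subseteq> W1" "V2 \<subseteq> W2" using z by (auto simp: subspaces_of_def)
    have f: "finite W1" "finite W2" using W lin_finite by blast+
    have "card V1 \<le> card W1" "card V2 \<le> card W2" using f V by (auto intro: card_mono)
    moreover have "card V1 \<noteq> card W1 \<or> card V2 \<noteq> card W2" using z V f card_subset_eq by blast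
    ultimately have "card V1 + card V2 < card W1 + card W2" by linarith
    from less.hyps[OF this V(2,3)] show ?thesis using V(1) by simp
  qed
  then have "(\<Sum>z\<in>?P - {(W1, W2)}. ?F z) = (\<Sum>z\<in>?P - {(W1, W2)}. ?G z)" by (intro sum.cong refl)
  with eq have "?F (W1, W2) = ?G (W1, W2)"
    using sum.remove[OF finP W_in, of ?F] sum.remove[OF finP W_in, of ?G] by linarith
  then show ?case by simp
qed

end

section \<open>Generators of the symplectic group\<close>

definition omega :: "nat \<Rightarrow> (nat \<Rightarrow> int) \<Rightarrow> (nat \<Rightarrow> int) \<Rightarrow> int" where
  "omega g X Y = (\<Sum>i<g. X i * Y (g + i) - X (g + i) * Y i)"

definition Jmat :: "nat \<Rightarrow> int mat" where
  "Jmat g = four_block_mat (0\<^sub>m g g) (1\<^sub>m g) (- 1\<^sub>m g) (0\<^sub>m g g)"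

definition gen_diag :: "nat \<Rightarrow> nat \<Rightarrow> int \<Rightarrow> int mat" where
  "gen_diag g i m = mat (2 * g) (2 * g) (\<lambda>(r, c). (if r = c then 1 else 0) + (if r = i \<and> c = g + i then m else 0))"

definition gen_off :: "nat \<Rightarrow> nat \<Rightarrow> nat \<Rightarrow> int mat" where
  "gen_off g i j = mat (2 * g) (2 * g) (\<lambda>(r, c). (if r = c then 1 else 0) + (if r = i \<and> c = g + j then 1 else 0)
     + (if r = j \<and> c = g + i then 1 else 0))"

definition gen_inv :: "nat \<Rightarrow> nat \<Rightarrow> int mat" where
  "gen_inv g j = mat (2 * g) (2 * g) (\<lambda>(r, c). (if r = c \<and> r \<noteq> j \<and> r \<noteq> g + j then 1 else 0)
     + (if r = j \<and> c = g + j then - 1 else 0) + (if r = g + j \<and> c = j then 1 else 0))"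

inductive_set base_gens :: "nat \<Rightarrow> int mat set" for g where
  diag: "i < g \<Longrightarrow> gen_diag g i m \<in> base_gens g"
| off: "i < g \<Longrightarrow> j < g \<Longrightarrow> i \<noteq> j \<Longrightarrow> gen_off g i j \<in> base_gens g"
| inv: "j < g \<Longrightarrow> gen_inv g j \<in> base_gens g"

text \<open>Words contain no inverses, so that the transformation law has to be checked on the
  generators only; that the monoid is the whole group comes out in
  \<open>Sp_int_eq_gens\<close>.\<close>

inductive_set gens :: "nat \<Rightarrow> int mat set" for g where
  one: "1\<^sub>m (2 * g) \<in> gens g"
| step: "s \<in> base_gens g \<Longrightarrow> h \<in> gens g \<Longrightarrow> s * h \<in> gens g"

lemma base_gens_carrier: "s \<in> base_gens g \<Longrightarrow> s \<in> carrier_mat (2 * g) (2 * g)"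
  by (auto elim!: base_gens.cases simp: gen_diag_def gen_off_def gen_inv_def)

lemma gens_carrier: "h \<in> gens g \<Longrightarrow> h \<in> carrier_mat (2 * g) (2 * g)"
  by (induction rule: gens.induct) (auto intro: base_gens_carrier mult_carrier_mat)

lemma gens_mult:
  assumes "h \<in> gens g" "h' \<in> gens g"
  shows "h * h' \<in> gens g"
  using assms(1)
proof (induction rule: gens.induct)
  case one
  then show ?case using assms(2) gens_carrier[OF assms(2)] by simp
next
  case (step s h)
  have "s * h * h' = s * (h * h')"
    using base_gens_carrier[OF step(1)] gens_carrier[OF step(2)] gens_carrier[OF assms(2)] by (rule assoc_mult_mat)
  then show ?case using gens.step[OF step(1) step.IH] by simp
qed

lemma base_gens_in_gens: "s \<in> base_gens g \<Longrightarrow> s \<in> gens g"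
  using gens.step[OF _ gens.one, of s g] base_gens_carrier[of s g] by simp

section \<open>Operations on coordinates realized by words in the generators\<close>

definition coords :: "'a vec \<Rightarrow> nat \<Rightarrow> 'a" where "coords x r = x $ r"

definition eq_upto :: "nat \<Rightarrow> (nat \<Rightarrow> int) \<Rightarrow> (nat \<Rightarrow> int) \<Rightarrow> bool" where
  "eq_upto n X Y \<longleftrightarrow> (\<forall>r<n. X r = Y r)"

text \<open>
  Vectors are replaced by coordinate functions, whose values from \<open>2 * g\<close> on are irrelevant.
\<close>

definition realizes :: "nat \<Rightarrow> int mat \<Rightarrow> ((nat \<Rightarrow> int) \<Rightarrow> nat \<Rightarrow> int) \<Rightarrow> bool" where
  "realizes g h F \<longleftrightarrow> (\<forall>x\<in>carrier_vec (2 * g). eq_upto (2 * g) (coords (h *\<^sub>v x)) (F (coords x)))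
     \<and> (\<forall>X Y. eq_upto (2 * g) X Y \<longrightarrow> eq_upto (2 * g) (F X) (F Y))
     \<and> (\<forall>X Y. omega g (F X) (F Y) = omega g X Y)"

definition generated :: "nat \<Rightarrow> ((nat \<Rightarrow> int) \<Rightarrow> nat \<Rightarrow> int) \<Rightarrow> bool" where
  "generated g F \<longleftrightarrow> (\<exists>h\<in>gens g. realizes g h F)"

lemma eq_upto_trans: "eq_upto n X Y \<Longrightarrow> eq_upto n Y Z \<Longrightarrow> eq_upto n X Z"
  by (simp add: eq_upto_def)

lemma generated_comp:
  assumes "generated g F" "generated g G"
  shows "generated g (\<lambda>X. F (G X))"
proof -
  obtain h where h: "h \<in> gens g" "\<And>x. x \<in> carrier_vec (2 * g) \<Longrightarrow> eq_upto (2 * g) (coords (h *\<^sub>v x)) (F (coords x))"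
    using assms(1) by (auto simp: generated_def realizes_def)
  obtain h' where h': "h' \<in> gens g" "\<And>x. x \<in> carrier_vec (2 * g) \<Longrightarrow> eq_upto (2 * g) (coords (h' *\<^sub>v x)) (G (coords x))"
    using assms(2) by (auto simp: generated_def realizes_def)
  have F: "eq_upto (2 * g) (F X) (F Y)" if "eq_upto (2 * g) X Y" for X Y using assms(1) that by (auto simp: generated_def realizes_def)
  have G: "eq_upto (2 * g) (G X) (G Y)" if "eq_upto (2 * g) X Y" for X Y using assms(2) that by (auto simp: generated_def realizes_def)
  have "eq_upto (2 * g) (coords (h * h' *\<^sub>v x)) (F (G (coords x)))" if x: "x \<in> carrier_vec (2 * g)" for x
  proof -
    have "h * h' *\<^sub>v x = h *\<^sub>v (h' *\<^sub>v x)" by (rule assoc_mult_mat_vec[OF gens_carrier[OF h(1)] gens_carrier[OF h'(1)] x])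
    moreover have "h' *\<^sub>v x \<in> carrier_vec (2 * g)" using gens_carrier[OF h'(1)] x by simp
    ultimately show ?thesis using eq_upto_trans[OF h(2) F[OF h'(2)[OF x]]] by simp
  qed
  moreover have "h * h' \<in> gens g" using h(1) h'(1) by (rule gens_mult)
  moreover have "omega g (F (G X)) (F (G Y)) = omega g X Y" for X Y using assms by (auto simp: generated_def realizes_def)
  ultimately show ?thesis using F G unfolding generated_def realizes_def by blast
qed

lemma sum_lessThan_double:
  fixes f :: "nat \<Rightarrow> int"
  shows "(\<Sum>c<2 * g. f c) = (\<Sum>c<g. f c) + (\<Sum>c<g. f (g + c))"
proof -
  have "(\<Sum>c<g + n. f c) = (\<Sum>c<g. f c) + (\<Sum>c<n. f (g + c))" for n :: nat by (induction n) (auto simp: add_ac)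
  then show ?thesis by (simp add: mult_2)
qed

lemma mult_vec_coord:
  assumes "x \<in> carrier_vec (2 * g)" "r < 2 * g"
  shows "(mat (2 * g) (2 * g) f *\<^sub>v x) $ r = (\<Sum>c<2 * g. f (r, c) * x $ c)"
  using assms by (simp add: scalar_prod_def atLeast0LessThan)

lemma sum_delta_int: "finite A \<Longrightarrow> (\<Sum>c\<in>A. (if c = k then a else 0) * f c) = (if k \<in> A then a * f k else (0::int))"
  by (simp add: if_distrib[of "\<lambda>x. x * _"] sum.delta cong: if_cong)

lemma omega_split:
  assumes "i < g"
  shows "omega g X Y = X i * Y (g + i) - X (g + i) * Y i + (\<Sum>k\<in>{..<g} - {i}. X k * Y (g + k) - X (g + k) * Y k)"
  unfolding omega_def using assms by (simp add: sum.remove)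

lemma realizes_diag:
  assumes i: "i < g"
  shows "realizes g (gen_diag g i m) (\<lambda>X. X(i := X i + m * X (g + i)))"
  unfolding realizes_def
proof (intro conjI allI impI ballI)
  fix x :: "int vec" assume x: "x \<in> carrier_vec (2 * g)"
  have "(gen_diag g i m *\<^sub>v x) $ r = x $ r + (if r = i then m * x $ (g + i) else 0)" if r: "r < 2 * g" for r
  proof -
    have "(gen_diag g i m *\<^sub>v x) $ r = (\<Sum>c<2 * g. (if c = r then 1 else 0) * x $ c + (if c = g + i then (if r = i then m else 0) else 0) * x $ c)"
      unfolding gen_diag_def mult_vec_coord[OF x r] by (intro sum.cong) auto
    also have "\<dots> = x $ r + (if r = i then m * x $ (g + i) else 0)"
      unfolding sum.distrib using r i by (simp add: sum_delta_int)
    finally show ?thesis .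
  qed
  then show "eq_upto (2 * g) (coords (gen_diag g i m *\<^sub>v x)) ((coords x)(i := coords x i + m * coords x (g + i)))"
    by (auto simp: eq_upto_def coords_def)
next
  fix X Y :: "nat \<Rightarrow> int"
  show "omega g (X(i := X i + m * X (g + i))) (Y(i := Y i + m * Y (g + i))) = omega g X Y"
    unfolding omega_split[OF i] using i by (simp add: algebra_simps)
  assume "eq_upto (2 * g) X Y"
  then show "eq_upto (2 * g) (X(i := X i + m * X (g + i))) (Y(i := Y i + m * Y (g + i)))"
    using i by (auto simp: eq_upto_def)
qed

lemma generated_diag:
  assumes i: "i < g"
  shows "generated g (\<lambda>X. X(i := X i + m * X (g + i)))"
  unfolding generated_def by (rule bexI[OF _ base_gens_in_gens[OF base_gens.diag[OF i, of m]]]) (rule realizes_diag[OF i])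

lemma realizes_inv:
  assumes j: "j < g"
  shows "realizes g (gen_inv g j) (\<lambda>X. X(j := - X (g + j), g + j := X j))"
  unfolding realizes_def
proof (intro conjI allI impI ballI)
  fix x :: "int vec" assume x: "x \<in> carrier_vec (2 * g)"
  have "(gen_inv g j *\<^sub>v x) $ r = (if r = j then - x $ (g + j) else if r = g + j then x $ j else x $ r)" if r: "r < 2 * g" for r
  proof -
    have "(gen_inv g j *\<^sub>v x) $ r = (\<Sum>c<2 * g. (if c = r then (if r \<noteq> j \<and> r \<noteq> g + j then 1 else 0) else 0) * x $ c
       + (if c = g + j then (if r = j then - 1 else 0) else 0) * x $ c + (if c = j then (if r = g + j then 1 else 0) else 0) * x $ c)"
      unfolding gen_inv_def mult_vec_coord[OF x r] using j by (intro sum.cong) auto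
    also have "\<dots> = (if r = j then - x $ (g + j) else if r = g + j then x $ j else x $ r)"
      unfolding sum.distrib using r j by (simp add: sum_delta_int)
    finally show ?thesis .
  qed
  then show "eq_upto (2 * g) (coords (gen_inv g j *\<^sub>v x)) ((coords x)(j := - coords x (g + j), g + j := coords x j))"
    by (auto simp: eq_upto_def coords_def)
next
  fix X Y :: "nat \<Rightarrow> int"
  show "omega g (X(j := - X (g + j), g + j := X j)) (Y(j := - Y (g + j), g + j := Y j)) = omega g X Y"
    unfolding omega_split[OF j] using j by (simp add: algebra_simps)
  assume "eq_upto (2 * g) X Y"
  then show "eq_upto (2 * g) (X(j := - X (g + j), g + j := X j)) (Y(j := - Y (g + j), g + j := Y j))"
    using j by (auto simp: eq_upto_def)
qed

lemma generated_inv: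
  assumes j: "j < g"
  shows "generated g (\<lambda>X. X(j := - X (g + j), g + j := X j))"
  unfolding generated_def by (rule bexI[OF _ base_gens_in_gens[OF base_gens.inv[OF j]]]) (rule realizes_inv[OF j])

lemma realizes_off:
  assumes ij: "i < g" "j < g" "i \<noteq> j"
  shows "realizes g (gen_off g i j) (\<lambda>X. X(i := X i + X (g + j), j := X j + X (g + i)))"
  unfolding realizes_def
proof (intro conjI allI impI ballI)
  fix x :: "int vec" assume x: "x \<in> carrier_vec (2 * g)"
  have "(gen_off g i j *\<^sub>v x) $ r = x $ r + (if r = i then x $ (g + j) else 0) + (if r = j then x $ (g + i) else 0)" if r: "r < 2 * g" for r
  proof -
    have "(gen_off g i j *\<^sub>v x) $ r = (\<Sum>c<2 * g. (if c = r then 1 else 0) * x $ c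
       + (if c = g + j then (if r = i then 1 else 0) else 0) * x $ c + (if c = g + i then (if r = j then 1 else 0) else 0) * x $ c)"
      unfolding gen_off_def mult_vec_coord[OF x r] using ij by (intro sum.cong) auto
    also have "\<dots> = x $ r + (if r = i then x $ (g + j) else 0) + (if r = j then x $ (g + i) else 0)"
      unfolding sum.distrib using r ij by (simp add: sum_delta_int)
    finally show ?thesis .
  qed
  then show "eq_upto (2 * g) (coords (gen_off g i j *\<^sub>v x)) ((coords x)(i := coords x i + coords x (g + j), j := coords x j + coords x (g + i)))"
    using ij by (auto simp: eq_upto_def coords_def)
next
  fix X Y :: "nat \<Rightarrow> int"
  let ?X = "X(i := X i + X (g + j), j := X j + X (g + i))" and ?Y = "Y(i := Y i + Y (g + j), j := Y j + Y (g + i))"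
  have S: "(\<Sum>k<g. f k) = f i + f j + (\<Sum>k\<in>{..<g} - {i} - {j}. f k)" for f :: "nat \<Rightarrow> int"
    using ij by (simp add: sum.remove[of "{..<g}" i] sum.remove[of "{..<g} - {i}" j])
  show "omega g ?X ?Y = omega g X Y"
    unfolding omega_def S using ij by (simp add: algebra_simps)
  assume "eq_upto (2 * g) X Y"
  then show "eq_upto (2 * g) ?X ?Y"
    using ij by (auto simp: eq_upto_def)
qed

lemma generated_off:
  assumes ij: "i < g" "j < g" "i \<noteq> j"
  shows "generated g (\<lambda>X. X(i := X i + X (g + j), j := X j + X (g + i)))"
  unfolding generated_def by (rule bexI[OF _ base_gens_in_gens[OF base_gens.off[OF ij]]]) (rule realizes_off[OF ij])

lemma base_gens_realizes: "s \<in> base_gens g \<Longrightarrow> \<exists>F. realizes g s F"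
proof (erule base_gens.cases)
  show "\<exists>F. realizes g s F" if "s = gen_diag g i m" "i < g" for i m
    unfolding that(1) by (rule exI, rule realizes_diag[OF that(2)])
  show "\<exists>F. realizes g s F" if "s = gen_off g i j" "i < g" "j < g" "i \<noteq> j" for i j
    unfolding that(1) by (rule exI, rule realizes_off[OF that(2-4)])
  show "\<exists>F. realizes g s F" if "s = gen_inv g j" "j < g" for j
    unfolding that(1) by (rule exI, rule realizes_inv[OF that(2)])
qed

lemma generated_cong: "generated g F \<Longrightarrow> (\<And>X. F X = G X) \<Longrightarrow> generated g G"
  by (metis ext)

text \<open>The inversion has order 4, so its inverse is its cube and stays in the monoid.\<close>

lemma generated_inv3:
  assumes j: "j < g"
  shows "generated g (\<lambda>X. X(j := X (g + j), g + j := - X j))"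
  by (rule generated_cong[OF generated_comp[OF generated_inv[OF j] generated_comp[OF generated_inv[OF j] generated_inv[OF j]]]]) (use j in auto)

lemma generated_neg:
  assumes j: "j < g"
  shows "generated g (\<lambda>X. X(j := - X j, g + j := - X (g + j)))"
  by (rule generated_cong[OF generated_comp[OF generated_inv[OF j] generated_inv[OF j]]]) (use j in auto)

text \<open>Conjugation by the inversion exchanges upper and lower entries and turns an upper
  translation into a lower one of opposite sign.\<close>

lemma generated_lower:
  assumes j: "j < g"
  shows "generated g (\<lambda>X. X(g + j := X (g + j) + m * X j))"
  by (rule generated_cong[OF generated_comp[OF generated_inv[OF j] generated_comp[OF generated_diag[OF j, of "- m"] generated_inv3[OF j]]]])
     (use j in \<open>auto simp: fun_eq_iff\<close>)

text \<open>Conjugating the off-diagonal translation by the inversion in the coordinate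
  \<open>j\<close> alone gives an elementary matrix of GL(g) together with its contragredient. The
  direction of the conjugation determines the sign.\<close>

lemma generated_shear:
  assumes ij: "i < g" "j < g" "i \<noteq> j" and m: "m = 1 \<or> m = - 1"
  shows "generated g (\<lambda>X. X(i := X i + m * X j, g + j := X (g + j) - m * X (g + i)))"
  using m
proof
  assume [simp]: "m = 1"
  show ?thesis
    by (rule generated_cong[OF generated_comp[OF generated_inv3[OF ij(2)] generated_comp[OF generated_off[OF ij] generated_inv[OF ij(2)]]]])
       (use ij in \<open>auto simp: fun_eq_iff\<close>)
next
  assume [simp]: "m = - 1"
  show ?thesis
    by (rule generated_cong[OF generated_comp[OF generated_inv[OF ij(2)] generated_comp[OF generated_off[OF ij] generated_inv3[OF ij(2)]]]])
       (use ij in \<open>auto simp: fun_eq_iff\<close>)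
qed

lemma generated_off_minus:
  assumes ij: "i < g" "j < g" "i \<noteq> j"
  shows "generated g (\<lambda>X. X(i := X i - X (g + j), j := X j - X (g + i)))"
  by (rule generated_cong[OF generated_comp[OF generated_neg[OF ij(1)] generated_comp[OF generated_off[OF ij] generated_neg[OF ij(1)]]]])
     (use ij in \<open>auto simp: fun_eq_iff\<close>)

section \<open>Euclid's algorithm on one column\<close>

definition unit_fn :: "nat \<Rightarrow> nat \<Rightarrow> int" where "unit_fn i r = (if r = i then 1 else 0)"

text \<open>
  The weight 2 of the lower half makes Euclid's algorithm descend: a shear with the smaller
  entry of a pair decreases the height, and so does an inversion that puts the larger entry on top.
\<close>

definition height :: "nat \<Rightarrow> (nat \<Rightarrow> int) \<Rightarrow> nat" where
  "height g X = (\<Sum>j<g. nat \<bar>X j\<bar> + 2 * nat \<bar>X (g + j)\<bar>)"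

lemma height_less:
  assumes "j < g" "\<And>i. i < g \<Longrightarrow> i \<noteq> j \<Longrightarrow> \<bar>Y i\<bar> = \<bar>X i\<bar> \<and> \<bar>Y (g + i)\<bar> = \<bar>X (g + i)\<bar>"
    "\<bar>Y j\<bar> + 2 * \<bar>Y (g + j)\<bar> < \<bar>X j\<bar> + 2 * \<bar>X (g + j)\<bar>"
  shows "height g Y < height g X"
  unfolding height_def
proof (rule sum_strict_mono_ex1)
  have "int (nat \<bar>Y j\<bar> + 2 * nat \<bar>Y (g + j)\<bar>) < int (nat \<bar>X j\<bar> + 2 * nat \<bar>X (g + j)\<bar>)"
    using assms(3) by simp
  then have less: "nat \<bar>Y j\<bar> + 2 * nat \<bar>Y (g + j)\<bar> < nat \<bar>X j\<bar> + 2 * nat \<bar>X (g + j)\<bar>"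
    by (simp only: of_nat_less_iff)
  show "\<forall>i\<in>{..<g}. nat \<bar>Y i\<bar> + 2 * nat \<bar>Y (g + i)\<bar> \<le> nat \<bar>X i\<bar> + 2 * nat \<bar>X (g + i)\<bar>"
  proof
    fix i assume "i \<in> {..<g}"
    then show "nat \<bar>Y i\<bar> + 2 * nat \<bar>Y (g + i)\<bar> \<le> nat \<bar>X i\<bar> + 2 * nat \<bar>X (g + i)\<bar>"
      using assms(2)[of i] less by (cases "i = j") auto
  qed
  show "\<exists>i\<in>{..<g}. nat \<bar>Y i\<bar> + 2 * nat \<bar>Y (g + i)\<bar> < nat \<bar>X i\<bar> + 2 * nat \<bar>X (g + i)\<bar>"
    using assms(1) less by (intro bexI[of _ j]) auto
qed simp

lemma reduce_int:
  fixes a c :: int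
  assumes "\<bar>c\<bar> \<le> \<bar>a\<bar>" "c \<noteq> 0"
  obtains m where "m = 1 \<or> m = - 1" "\<bar>a + m * c\<bar> < \<bar>a\<bar>"
proof (cases "(a > 0) = (c > 0)")
  case True
  then show ?thesis using assms that[of "-1"] by auto
next
  case False
  then show ?thesis using assms that[of 1] by auto
qed

lemma omega_unit: "i < g \<Longrightarrow> omega g (unit_fn i) Y = Y (g + i)"
  by (subst omega_split[of i]) (auto simp: unit_fn_def intro!: sum.neutral)

lemma eq_upto_omega: "eq_upto (2 * g) X X' \<Longrightarrow> omega g X Y = omega g X' Y"
  unfolding omega_def eq_upto_def by (intro sum.cong) auto

text \<open>Among the operations that fix the first k unit vectors, one is taken that minimizes the
  height of the image of \<open>X\<close>. Minimality clears the lower half and leaves at most one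
  nonzero entry among the positions k, ..., g - 1. The pairing with \<open>Z\<close> shows that this
  entry exists and divides 1, so it also clears the entries above position k.\<close>

lemma column_reduction:
  assumes k: "k < g" and X0: "\<And>i. i < k \<Longrightarrow> X (g + i) = 0" and Z: "omega g X Z = 1" "\<And>i. i < k \<Longrightarrow> Z (g + i) = 0"
  shows "\<exists>F. generated g F \<and> (\<forall>i<k. eq_upto (2 * g) (F (unit_fn i)) (unit_fn i)) \<and> eq_upto (2 * g) (F X) (unit_fn k)"
proof -
  define fixing where "fixing F \<longleftrightarrow> generated g F \<and> (\<forall>i<k. eq_upto (2 * g) (F (unit_fn i)) (unit_fn i))" for F
  have fix_comp: "fixing (\<lambda>X. G (F X))" if "fixing G" "fixing F" for F G
    unfolding fixing_def
  proof (intro conjI allI impI)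
    show "generated g (\<lambda>X. G (F X))" using that by (auto simp: fixing_def intro: generated_comp)
    fix i assume i: "i < k"
    have "eq_upto (2 * g) (G (F (unit_fn i))) (G (unit_fn i))" using that i by (auto simp: fixing_def generated_def realizes_def)
    moreover have "eq_upto (2 * g) (G (unit_fn i)) (unit_fn i)" using that i by (auto simp: fixing_def)
    ultimately show "eq_upto (2 * g) (G (F (unit_fn i))) (unit_fn i)" by (rule eq_upto_trans)
  qed
  have fix_id: "fixing (\<lambda>X. X)"
  proof -
    have "generated g (\<lambda>X. X)" by (rule generated_cong[OF generated_diag[OF k, of 0]]) auto
    then show ?thesis by (simp add: fixing_def eq_upto_def)
  qed
  have fix_om: "omega g (F X) (F Y) = omega g X Y" if "fixing F" for F X Y using that by (auto simp: fixing_def generated_def realizes_def)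
  \<comment> \<open>The entry with index g + i is the pairing with the unit vector of index i, which
    is fixed.\<close>
  have fix_low: "F Y (g + i) = Y (g + i)" if "fixing F" "i < k" for F Y i
  proof -
    have "F Y (g + i) = omega g (unit_fn i) (F Y)" using that k by (simp add: omega_unit)
    also have "\<dots> = omega g (F (unit_fn i)) (F Y)" using that by (intro eq_upto_omega) (auto simp: fixing_def eq_upto_def)
    also have "\<dots> = Y (g + i)" using that k by (simp add: fix_om omega_unit)
    finally show ?thesis .
  qed
  have fix_diag: "fixing (\<lambda>X. X(j := X j + m * X (g + j)))" if "k \<le> j" "j < g" for j m
    unfolding fixing_def using that generated_diag[OF that(2)] by (auto simp: eq_upto_def unit_fn_def)
  have fix_lower: "fixing (\<lambda>X. X(g + j := X (g + j) + m * X j))" if "k \<le> j" "j < g" for j m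
    unfolding fixing_def using that generated_lower[OF that(2)] by (auto simp: eq_upto_def unit_fn_def)
  have fix_inv: "fixing (\<lambda>X. X(j := - X (g + j), g + j := X j))" if "k \<le> j" "j < g" for j
    unfolding fixing_def using that generated_inv[OF that(2)] by (auto simp: eq_upto_def unit_fn_def)
  have fix_neg: "fixing (\<lambda>X. X(j := - X j, g + j := - X (g + j)))" if "k \<le> j" "j < g" for j
    unfolding fixing_def using that generated_neg[OF that(2)] by (auto simp: eq_upto_def unit_fn_def)
  have fix_shear: "fixing (\<lambda>X. X(i := X i + m * X j, g + j := X (g + j) - m * X (g + i)))"
    if "k \<le> j" "j < g" "i < g" "i \<noteq> j" "m = 1 \<or> m = - 1" for i j m
    unfolding fixing_def using that generated_shear[OF that(3,2,4,5)] by (auto simp: eq_upto_def unit_fn_def)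
  obtain F where F: "fixing F" and min: "\<And>G. fixing G \<Longrightarrow> height g (F X) \<le> height g (G X)"
    using ex_has_least_nat[of fixing "\<lambda>X. X" "\<lambda>F. height g (F X)"] fix_id by auto
  define Y where "Y = F X"
  have minY: "height g Y \<le> height g (G Y)" if "fixing G" for G
    using min[OF fix_comp[OF that F]] by (simp add: Y_def)
  have lowY: "Y (g + i) = 0" if "i < k" for i using fix_low[OF F that, of X] X0[OF that] by (simp add: Y_def)
  have low0: "Y (g + j) = 0" if j: "j < g" for j
  proof (rule ccontr)
    assume c: "Y (g + j) \<noteq> 0"
    then have kj: "k \<le> j" using lowY by (meson not_le)
    consider "Y j = 0" | "Y j \<noteq> 0" "\<bar>Y j\<bar> \<le> \<bar>Y (g + j)\<bar>" | "\<bar>Y (g + j)\<bar> \<le> \<bar>Y j\<bar>" by linarith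
    then show False
    proof cases
      case 1
      have "height g (Y(j := - Y (g + j), g + j := Y j)) < height g Y"
        using c j 1 by (intro height_less[OF j]) auto
      with minY[OF fix_inv[OF kj j]] show ?thesis by simp
    next
      case 2
      obtain m where m: "\<bar>Y (g + j) + m * Y j\<bar> < \<bar>Y (g + j)\<bar>" using reduce_int[OF 2(2,1)] by metis
      have "height g (Y(g + j := Y (g + j) + m * Y j)) < height g Y"
        using m j by (intro height_less[OF j]) auto
      with minY[OF fix_lower[OF kj j, of m]] show ?thesis by simp
    next
      case 3
      obtain m where m: "\<bar>Y j + m * Y (g + j)\<bar> < \<bar>Y j\<bar>" using reduce_int[OF 3 c] by metis
      have "height g (Y(j := Y j + m * Y (g + j))) < height g Y"
        using m j by (intro height_less[OF j]) auto
      with minY[OF fix_diag[OF kj j, of m]] show ?thesis by simp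
    qed
  qed
  \<comment> \<open>Here \<open>i\<close> may be smaller than k: the shear adds entry
    \<open>j\<close> to entry \<open>i\<close>, and entry \<open>j\<close> of the unit vectors to be
    fixed is 0.\<close>
  have one: "Y i = 0" if ij: "i < g" "j < g" "i \<noteq> j" "k \<le> j" "Y j \<noteq> 0" "\<bar>Y j\<bar> \<le> \<bar>Y i\<bar>" for i j
  proof (rule ccontr)
    assume "Y i \<noteq> 0"
    obtain m where m: "m = 1 \<or> m = - 1" "\<bar>Y i + m * Y j\<bar> < \<bar>Y i\<bar>" using reduce_int[OF ij(6,5)] by metis
    have "height g (Y(i := Y i + m * Y j, g + j := Y (g + j) - m * Y (g + i))) < height g Y"
      using m ij low0 by (intro height_less[OF ij(1)]) auto
    with minY[OF fix_shear[OF ij(4,2,1,3) m(1)]] show False by simp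
  qed
  define W where "W = F Z"
  have YW: "omega g Y W = 1" using fix_om[OF F] Z by (simp add: Y_def W_def)
  have Wlow: "W (g + i) = 0" if "i < k" for i using fix_low[OF F that, of Z] Z(2)[OF that] by (simp add: W_def)
  have omYW: "omega g Y W = (\<Sum>i<g. Y i * W (g + i))" unfolding omega_def using low0 by (intro sum.cong) auto
  have "\<exists>p. k \<le> p \<and> p < g \<and> Y p \<noteq> 0"
  proof (rule ccontr)
    assume "\<not> ?thesis"
    then have "Y i * W (g + i) = 0" if "i < g" for i using that Wlow by (cases "i < k") auto
    then have "omega g Y W = 0" unfolding omYW by (intro sum.neutral) auto
    with YW show False by simp
  qed
  then obtain p where p: "k \<le> p" "p < g" "Y p \<noteq> 0" by blast
  have off: "Y i = 0" if "k \<le> i" "i < g" "i \<noteq> p" for i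
    using one[of i p] one[of p i] that p by (metis linear)
  have prod0: "Y i * W (g + i) = 0" if "i < g" "i \<noteq> p" for i
    using that Wlow off by (cases "i < k") auto
  have "omega g Y W = Y p * W (g + p)"
  proof -
    have "(\<Sum>i\<in>{..<g} - {p}. Y i * W (g + i)) = 0" by (rule sum.neutral) (use prod0 in blast)
    then show ?thesis unfolding omYW using p(2) by (simp add: sum.remove[of "{..<g}" p])
  qed
  then have "Y p dvd 1" using YW by (metis dvd_triv_left)
  then have Yp: "\<bar>Y p\<bar> = 1" by simp
  have offk: "Y i = 0" if i: "i < g" "i \<noteq> p" for i
  proof (cases "k \<le> i")
    case False
    show ?thesis
    proof (rule ccontr)
      assume "Y i \<noteq> 0"
      then have "\<bar>Y p\<bar> \<le> \<bar>Y i\<bar>" using Yp by linarith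
      then show False using one[OF i(1) p(2) i(2) p(1,3)] \<open>Y i \<noteq> 0\<close> by simp
    qed
  qed (use off i in auto)
  have Yeq: "Y r = 0" if "r < 2 * g" "r \<noteq> p" for r
    using offk[of r] low0[of "r - g"] that by (cases "r < g") auto
  have "\<exists>G. fixing G \<and> eq_upto (2 * g) (G Y) (\<lambda>r. if r = k then Y p else 0)"
  proof (cases "p = k")
    case True
    have "eq_upto (2 * g) Y (\<lambda>r. if r = k then Y p else 0)" using Yeq True by (simp add: eq_upto_def)
    with fix_id show ?thesis by blast
  next
    case False
    \<comment> \<open>Two shears carry the pivot from position p to position k: it is added there
      and then subtracted at p.\<close>
    let ?G1 = "\<lambda>X. X(k := X k + 1 * X p, g + p := X (g + p) - 1 * X (g + k))"
    let ?G2 = "\<lambda>X. X(p := X p + (- 1) * X k, g + k := X (g + k) - (- 1) * X (g + p))"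
    have "fixing (\<lambda>X. ?G2 (?G1 X))"
      by (rule fix_comp[OF fix_shear fix_shear]) (use p k False in auto)
    moreover have "eq_upto (2 * g) (?G2 (?G1 Y)) (\<lambda>r. if r = k then Y p else 0)"
      unfolding eq_upto_def using Yeq p k False by auto
    ultimately show ?thesis by blast
  qed
  then obtain G where G: "fixing G" "eq_upto (2 * g) (G Y) (\<lambda>r. if r = k then Y p else 0)" by blast
  have "\<exists>H. fixing H \<and> eq_upto (2 * g) (H Y) (unit_fn k)"
  proof (cases "Y p = 1")
    case True
    then show ?thesis using G by (auto simp: unit_fn_def[abs_def] eq_upto_def)
  next
    case False
    then have "Y p = - 1" using Yp by linarith
    let ?N = "\<lambda>X. X(k := - X k, g + k := - X (g + k)) :: nat \<Rightarrow> int"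
    have "fixing (\<lambda>X. ?N (G X))" by (rule fix_comp[OF fix_neg G(1)]) (use k in auto)
    moreover have "eq_upto (2 * g) (?N (G Y)) (unit_fn k)"
      using G(2) k \<open>Y p = - 1\<close> by (auto simp: eq_upto_def unit_fn_def)
    ultimately show ?thesis by blast
  qed
  then obtain H where H: "fixing H" "eq_upto (2 * g) (H (F X)) (unit_fn k)" by (auto simp: Y_def)
  then show ?thesis using fix_comp[OF H(1) F] by (auto simp: fixing_def intro!: exI[of _ "\<lambda>X. H (F X)"])
qed

section \<open>Symplectic matrices are products of generators\<close>

definition col_fn :: "int mat \<Rightarrow> nat \<Rightarrow> nat \<Rightarrow> int" where "col_fn M k r = M $$ (r, k)"

definition symp :: "nat \<Rightarrow> int mat \<Rightarrow> bool" where
  "symp g M \<longleftrightarrow> M \<in> carrier_mat (2 * g) (2 * g) \<and>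
     (\<forall>k<2 * g. \<forall>l<2 * g. omega g (col_fn M k) (col_fn M l) = omega g (unit_fn k) (unit_fn l))"

lemma Jmat_carrier: "Jmat g \<in> carrier_mat (2 * g) (2 * g)"
  by (simp add: Jmat_def mult_2)

lemma Jmat_index:
  assumes "r < 2 * g" "c < 2 * g"
  shows "Jmat g $$ (r, c) = (if r < g then (if c = g + r then 1 else 0) else (if r = g + c then - 1 else 0))"
  using assms by (auto simp: Jmat_def)

lemma omega_eq_Jmat:
  "omega g X Y = (\<Sum>r<2 * g. \<Sum>c<2 * g. X r * Jmat g $$ (r, c) * Y c)"
proof -
  have 1: "(\<Sum>c<2 * g. X r * Jmat g $$ (r, c) * Y c) = X r * Y (g + r)" if "r < g" for r
  proof -
    have "(\<Sum>c<2 * g. X r * Jmat g $$ (r, c) * Y c) = (\<Sum>c<2 * g. if c = g + r then X r * Y (g + r) else 0)"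
      using that by (intro sum.cong) (auto simp: Jmat_index)
    then show ?thesis using that by simp
  qed
  have 2: "(\<Sum>c<2 * g. X (g + r) * Jmat g $$ (g + r, c) * Y c) = - (X (g + r) * Y r)" if "r < g" for r
  proof -
    have "(\<Sum>c<2 * g. X (g + r) * Jmat g $$ (g + r, c) * Y c) = (\<Sum>c<2 * g. if c = r then - (X (g + r) * Y r) else 0)"
      using that by (intro sum.cong) (auto simp: Jmat_index)
    then show ?thesis using that by simp
  qed
  have "(\<Sum>r<2 * g. \<Sum>c<2 * g. X r * Jmat g $$ (r, c) * Y c) = (\<Sum>r<g. X r * Y (g + r)) + (\<Sum>r<g. - (X (g + r) * Y r))"
    unfolding sum_lessThan_double[of "\<lambda>r. \<Sum>c<2 * g. X r * Jmat g $$ (r, c) * Y c"] using 1 2 by simp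
  then show ?thesis by (simp add: omega_def sum_subtractf sum_negf)
qed

lemma bilinear_index:
  fixes M K :: "int mat"
  assumes "M \<in> carrier_mat n n" "K \<in> carrier_mat n n" "k < n" "l < n"
  shows "(transpose_mat M * K * M) $$ (k, l) = (\<Sum>r<n. \<Sum>c<n. M $$ (r, k) * K $$ (r, c) * M $$ (c, l))"
proof -
  have "(transpose_mat M * K * M) $$ (k, l) = (\<Sum>c<n. (transpose_mat M * K) $$ (k, c) * M $$ (c, l))"
    using assms by (simp add: scalar_prod_def atLeast0LessThan del: assoc_mult_mat)
  also have "\<dots> = (\<Sum>c<n. (\<Sum>r<n. M $$ (r, k) * K $$ (r, c)) * M $$ (c, l))"
    using assms by (simp add: scalar_prod_def atLeast0LessThan)
  also have "\<dots> = (\<Sum>c<n. \<Sum>r<n. M $$ (r, k) * K $$ (r, c) * M $$ (c, l))"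
    by (simp add: sum_distrib_right)
  also have "\<dots> = (\<Sum>r<n. \<Sum>c<n. M $$ (r, k) * K $$ (r, c) * M $$ (c, l))" by (rule sum.swap)
  finally show ?thesis .
qed

lemma omega_units: "k < 2 * g \<Longrightarrow> l < 2 * g \<Longrightarrow> omega g (unit_fn k) (unit_fn l) = Jmat g $$ (k, l)"
proof -
  assume kl: "k < 2 * g" "l < 2 * g"
  have "omega g (unit_fn k) (unit_fn l) = (\<Sum>r<2 * g. if r = k then (\<Sum>c<2 * g. if c = l then Jmat g $$ (k, l) else 0) else 0)"
    unfolding omega_eq_Jmat
  proof (intro sum.cong refl)
    fix r
    have "(\<Sum>c<2 * g. unit_fn k r * Jmat g $$ (r, c) * unit_fn l c) = (\<Sum>c<2 * g. if c = l then unit_fn k r * Jmat g $$ (r, l) else 0)"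
      by (intro sum.cong) (auto simp: unit_fn_def)
    then show "(\<Sum>c<2 * g. unit_fn k r * Jmat g $$ (r, c) * unit_fn l c) = (if r = k then (\<Sum>c<2 * g. if c = l then Jmat g $$ (k, l) else 0) else 0)"
      using kl by (simp add: unit_fn_def)
  qed
  then show ?thesis using kl by simp
qed

lemma Sp_int_iff_symp: "M \<in> Sp_int g \<longleftrightarrow> symp g M"
proof -
  have "(transpose_mat M * Jmat g * M = Jmat g) \<longleftrightarrow> (\<forall>k<2 * g. \<forall>l<2 * g. omega g (col_fn M k) (col_fn M l) = omega g (unit_fn k) (unit_fn l))"
    if M: "M \<in> carrier_mat (2 * g) (2 * g)"
  proof -
    have "(transpose_mat M * Jmat g * M = Jmat g) \<longleftrightarrow> (\<forall>k<2 * g. \<forall>l<2 * g. (transpose_mat M * Jmat g * M) $$ (k, l) = Jmat g $$ (k, l))"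
      using M Jmat_carrier[of g] by (auto simp: mat_eq_iff)
    also have "\<dots> \<longleftrightarrow> (\<forall>k<2 * g. \<forall>l<2 * g. omega g (col_fn M k) (col_fn M l) = Jmat g $$ (k, l))"
      by (simp add: bilinear_index[OF M Jmat_carrier] omega_eq_Jmat col_fn_def)
    finally show ?thesis by (simp add: omega_units)
  qed
  then show ?thesis unfolding Sp_int_def symp_def Jmat_def[symmetric] Let_def by auto
qed

lemma realizes_on_symp:
  assumes hc: "h \<in> carrier_mat (2 * g) (2 * g)" and F: "realizes g h F" and M: "symp g M"
  shows "symp g (h * M) \<and> (\<forall>k<2 * g. eq_upto (2 * g) (col_fn (h * M) k) (F (col_fn M k)))"
proof -
  have h: "eq_upto (2 * g) (coords (h *\<^sub>v x)) (F (coords x))" if "x \<in> carrier_vec (2 * g)" for x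
    using F that by (auto simp: realizes_def)
  have Mc: "M \<in> carrier_mat (2 * g) (2 * g)" using M by (simp add: symp_def)
  have Fe: "eq_upto (2 * g) (F X) (F Y)" if "eq_upto (2 * g) X Y" for X Y using F that by (auto simp: realizes_def)
  have col: "eq_upto (2 * g) (col_fn (h * M) k) (F (col_fn M k))" if k: "k < 2 * g" for k
  proof -
    have "col (h * M) k = h *\<^sub>v col M k" using hc Mc k by simp
    moreover have "eq_upto (2 * g) (col_fn (h * M) k) (coords (col (h * M) k))"
      using hc Mc k by (simp add: eq_upto_def col_fn_def coords_def)
    moreover have "eq_upto (2 * g) (coords (h *\<^sub>v col M k)) (F (coords (col M k)))"
      by (rule h, rule col_carrier_vec[OF k Mc])
    moreover have "eq_upto (2 * g) (F (coords (col M k))) (F (col_fn M k))"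
      by (rule Fe) (use Mc k in \<open>simp add: eq_upto_def col_fn_def coords_def\<close>)
    ultimately show ?thesis by (metis eq_upto_trans)
  qed
  have om: "omega g X Y = omega g X' Y'" if "eq_upto (2 * g) X X'" "eq_upto (2 * g) Y Y'" for X Y X' Y'
    using that unfolding omega_def eq_upto_def by (intro sum.cong) auto
  have "symp g (h * M)"
    unfolding symp_def
  proof (intro conjI allI impI)
    show "h * M \<in> carrier_mat (2 * g) (2 * g)" using hc Mc by simp
    fix k l assume kl: "k < 2 * g" "l < 2 * g"
    have "omega g (col_fn (h * M) k) (col_fn (h * M) l) = omega g (F (col_fn M k)) (F (col_fn M l))"
      by (rule om[OF col[OF kl(1)] col[OF kl(2)]])
    also have "\<dots> = omega g (col_fn M k) (col_fn M l)" using F by (auto simp: realizes_def)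
    finally show "omega g (col_fn (h * M) k) (col_fn (h * M) l) = omega g (unit_fn k) (unit_fn l)"
      using M kl by (simp add: symp_def)
  qed
  with col show ?thesis by blast
qed

lemma generated_on_symp:
  assumes F: "generated g F" and M: "symp g M"
  shows "\<exists>h\<in>gens g. symp g (h * M) \<and> (\<forall>k<2 * g. eq_upto (2 * g) (col_fn (h * M) k) (F (col_fn M k)))"
  using F realizes_on_symp[OF gens_carrier _ M] unfolding generated_def by blast

text \<open>The columns are treated one after another. The hypotheses of
  \<open>column_reduction\<close> are symplectic relations: entry g + i of a column is its pairing
  with the finished column i, and column g + k is the partner \<open>Z\<close> of column k.\<close>

lemma columns_reduction:
  assumes M: "symp g M" and k: "k \<le> g"
  shows "\<exists>h\<in>gens g. symp g (h * M) \<and> (\<forall>i<k. eq_upto (2 * g) (col_fn (h * M) i) (unit_fn i))"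
  using k
proof (induction k)
  case 0
  have "1\<^sub>m (2 * g) * M = M" using M by (auto simp: symp_def)
  with M show ?case by (intro bexI[of _ "1\<^sub>m (2 * g)"]) (auto intro: gens.one)
next
  case (Suc k)
  then obtain h where h: "h \<in> gens g" "symp g (h * M)" "\<And>i. i < k \<Longrightarrow> eq_upto (2 * g) (col_fn (h * M) i) (unit_fn i)" by auto
  define A where "A = h * M"
  note A = h(2,3)[folded A_def]
  have om: "omega g (col_fn A i) (col_fn A l) = Jmat g $$ (i, l)" if "i < 2 * g" "l < 2 * g" for i l
    using A(1) that by (simp add: symp_def omega_units)
  have low: "col_fn A l (g + i) = Jmat g $$ (i, l)" if "i < k" "l < 2 * g" for i l
  proof -
    have "col_fn A l (g + i) = omega g (unit_fn i) (col_fn A l)" using that Suc.prems by (simp add: omega_unit)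
    also have "\<dots> = omega g (col_fn A i) (col_fn A l)" using A(2)[OF that(1)] by (intro eq_upto_omega) (auto simp: eq_upto_def)
    finally show ?thesis using om that Suc.prems by simp
  qed
  have "\<exists>F. generated g F \<and> (\<forall>i<k. eq_upto (2 * g) (F (unit_fn i)) (unit_fn i)) \<and> eq_upto (2 * g) (F (col_fn A k)) (unit_fn k)"
  proof (rule column_reduction[where Z = "col_fn A (g + k)"])
    show "k < g" using Suc.prems by simp
    show "col_fn A k (g + i) = 0" if "i < k" for i using low[OF that, of k] that Suc.prems by (simp add: Jmat_index)
    show "omega g (col_fn A k) (col_fn A (g + k)) = 1" using om[of k "g + k"] Suc.prems by (simp add: Jmat_index)
    show "col_fn A (g + k) (g + i) = 0" if "i < k" for i using low[OF that, of "g + k"] that Suc.prems by (simp add: Jmat_index)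
  qed
  then obtain F where F: "generated g F" "\<And>i. i < k \<Longrightarrow> eq_upto (2 * g) (F (unit_fn i)) (unit_fn i)" "eq_upto (2 * g) (F (col_fn A k)) (unit_fn k)" by blast
  obtain h' where h': "h' \<in> gens g" "symp g (h' * A)" "\<And>i. i < 2 * g \<Longrightarrow> eq_upto (2 * g) (col_fn (h' * A) i) (F (col_fn A i))"
    using generated_on_symp[OF F(1) A(1)] by blast
  have "h' * A = (h' * h) * M"
    unfolding A_def using gens_carrier[OF h'(1)] gens_carrier[OF h(1)] M by (auto simp: symp_def)
  moreover have "eq_upto (2 * g) (col_fn (h' * A) i) (unit_fn i)" if i: "i < Suc k" for i
  proof (cases "i = k")
    case True
    then show ?thesis using eq_upto_trans[OF h'(3) F(3)] Suc.prems by simp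
  next
    case False
    then have "i < k" using i by simp
    have "eq_upto (2 * g) (F (col_fn A i)) (F (unit_fn i))" using F(1) A(2)[OF \<open>i < k\<close>] by (auto simp: generated_def realizes_def)
    then show ?thesis using eq_upto_trans[OF h'(3) eq_upto_trans[OF _ F(2)[OF \<open>i < k\<close>]]] \<open>i < k\<close> Suc.prems by simp
  qed
  ultimately show ?case using h'(2) gens_mult[OF h'(1) h(1)] by (metis)
qed

definition upper_height :: "nat \<Rightarrow> int mat \<Rightarrow> nat" where
  "upper_height g M = (\<Sum>z\<in>{..<g} \<times> {..<g}. nat \<bar>M $$ (fst z, g + snd z)\<bar>)"

text \<open>Once the first g columns are unit vectors, the symplectic relations leave an upper
  triangular block matrix with identity blocks on the diagonal and a symmetric upper block S. The
  translations among the generators change S by elementary symmetric matrices, so S = 0 for a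
  product of minimal \<open>upper_height\<close>.\<close>

lemma symp_left_inverse:
  assumes M: "symp g M"
  shows "\<exists>h\<in>gens g. h * M = 1\<^sub>m (2 * g)"
proof -
  define P where "P h \<longleftrightarrow> h \<in> gens g \<and> symp g (h * M) \<and> (\<forall>i<g. eq_upto (2 * g) (col_fn (h * M) i) (unit_fn i))" for h
  obtain h0 where "P h0" using columns_reduction[OF M order_refl] by (auto simp: P_def)
  then obtain h where h: "P h" and min: "\<And>h'. P h' \<Longrightarrow> upper_height g (h * M) \<le> upper_height g (h' * M)"
    using ex_has_least_nat[of P h0 "\<lambda>h. upper_height g (h * M)"] by auto
  define A where "A = h * M"
  have A: "symp g A" "\<And>i. i < g \<Longrightarrow> eq_upto (2 * g) (col_fn A i) (unit_fn i)" using h by (auto simp: P_def A_def)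
  have Mc: "M \<in> carrier_mat (2 * g) (2 * g)" and Ac: "A \<in> carrier_mat (2 * g) (2 * g)" using M A by (auto simp: symp_def)
  have om: "omega g (col_fn A i) (col_fn A l) = Jmat g $$ (i, l)" if "i < 2 * g" "l < 2 * g" for i l
    using A(1) that by (simp add: symp_def omega_units)
  have left: "A $$ (r, i) = (if r = i then 1 else 0)" if "r < 2 * g" "i < g" for r i
    using A(2)[OF that(2)] that by (auto simp: eq_upto_def col_fn_def unit_fn_def)
  have low: "A $$ (g + i, g + l) = (if i = l then 1 else 0)" if "i < g" "l < g" for i l
  proof -
    have "A $$ (g + i, g + l) = omega g (unit_fn i) (col_fn A (g + l))" using that by (simp add: omega_unit col_fn_def)
    also have "\<dots> = omega g (col_fn A i) (col_fn A (g + l))" using A(2)[OF that(1)] by (intro eq_upto_omega) (auto simp: eq_upto_def)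
    also have "\<dots> = (if i = l then 1 else 0)" using that by (simp add: om Jmat_index)
    finally show ?thesis .
  qed
  have sym: "A $$ (i, g + l) = A $$ (l, g + i)" if "i < g" "l < g" for i l
  proof -
    have "0 = omega g (col_fn A (g + i)) (col_fn A (g + l))" using that by (simp add: om Jmat_index)
    also have "\<dots> = (\<Sum>r<g. (if r = l then A $$ (l, g + i) else 0) - (if r = i then A $$ (i, g + l) else 0))"
      unfolding omega_def by (intro sum.cong) (use that low in \<open>auto simp: col_fn_def\<close>)
    also have "\<dots> = A $$ (l, g + i) - A $$ (i, g + l)" using that by (simp add: sum_subtractf)
    finally show ?thesis by simp
  qed
  have step: "upper_height g A \<le> upper_height g (h' * A)"
    if "h' \<in> gens g" "symp g (h' * A)" "\<And>i. i < g \<Longrightarrow> eq_upto (2 * g) (col_fn (h' * A) i) (unit_fn i)" for h'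
  proof -
    have e: "h' * A = (h' * h) * M"
      unfolding A_def using gens_carrier[OF that(1)] gens_carrier[of h g] h Mc by (auto simp: P_def)
    have "P (h' * h)" using that h gens_mult unfolding P_def e by blast
    from min[OF this] show ?thesis unfolding A_def[symmetric] e[symmetric] .
  qed
  \<comment> \<open>An operation that fixes the first g unit vectors keeps the finished columns, so
    the product with it still competes in the minimization. \<open>B\<close> describes the resulting
    entries without naming the matrix of the operation.\<close>
  have act_min: "upper_height g A \<le> upper_height g B"
    if F: "generated g F" and FB: "\<And>l r. l < 2 * g \<Longrightarrow> r < 2 * g \<Longrightarrow> B $$ (r, l) = F (col_fn A l) r"
      and fixed: "\<And>i. i < g \<Longrightarrow> eq_upto (2 * g) (F (unit_fn i)) (unit_fn i)" for F B
  proof -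
    obtain h' where h': "h' \<in> gens g" "symp g (h' * A)" "\<And>i. i < 2 * g \<Longrightarrow> eq_upto (2 * g) (col_fn (h' * A) i) (F (col_fn A i))"
      using generated_on_symp[OF F A(1)] by blast
    have "upper_height g A \<le> upper_height g (h' * A)"
    proof (rule step[OF h'(1,2)])
      fix i assume i: "i < g"
      have "eq_upto (2 * g) (F (col_fn A i)) (F (unit_fn i))" using F A(2)[OF i] by (auto simp: generated_def realizes_def)
      then show "eq_upto (2 * g) (col_fn (h' * A) i) (unit_fn i)"
        using eq_upto_trans[OF h'(3) eq_upto_trans[OF _ fixed[OF i]]] i by simp
    qed
    also have "upper_height g (h' * A) = upper_height g B"
      unfolding upper_height_def
    proof (intro sum.cong refl)
      fix z assume "z \<in> {..<g} \<times> {..<g}"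
      then have "fst z < 2 * g" "g + snd z < 2 * g" by auto
      then show "nat \<bar>(h' * A) $$ (fst z, g + snd z)\<bar> = nat \<bar>B $$ (fst z, g + snd z)\<bar>"
        using h'(3)[of "g + snd z"] FB by (simp add: eq_upto_def col_fn_def)
    qed
    finally show ?thesis .
  qed
  \<comment> \<open>Otherwise one operation brings a nonzero entry closer to 0: a diagonal entry is
    removed outright, a symmetric pair of off-diagonal entries moves by 1.\<close>
  have upper: "A $$ (p, g + q) = 0" if pq: "p < g" "q < g" for p q
  proof (rule ccontr)
    assume nz: "A $$ (p, g + q) \<noteq> 0"
    show False
    proof (cases "p = q")
      case True
      define F where "F X = X(p := X p + - A $$ (p, g + p) * X (g + p))" for X :: "nat \<Rightarrow> int"
      define B where "B = mat (2 * g) (2 * g) (\<lambda>(r, l). F (col_fn A l) r)"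
      have B: "B $$ (r, g + l) = (if r = p \<and> l = p then 0 else A $$ (r, g + l))" if "r < g" "l < g" for r l
        using that pq low by (auto simp: B_def F_def col_fn_def)
      have "upper_height g B < upper_height g A"
        unfolding upper_height_def
      proof (rule sum_strict_mono_ex1)
        show "\<exists>z\<in>{..<g} \<times> {..<g}. nat \<bar>B $$ (fst z, g + snd z)\<bar> < nat \<bar>A $$ (fst z, g + snd z)\<bar>"
          using pq nz True by (intro bexI[of _ "(p, p)"]) (auto simp: B)
      qed (auto simp: B)
      moreover have "upper_height g A \<le> upper_height g B"
      proof (rule act_min)
        show "generated g F" unfolding F_def by (rule generated_diag[OF pq(1)])
        show "eq_upto (2 * g) (F (unit_fn i)) (unit_fn i)" if "i < g" for i
          using that by (auto simp: F_def eq_upto_def unit_fn_def)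
      qed (simp add: B_def)
      ultimately show False by simp
    next
      case False
      obtain m where m: "m = 1 \<or> m = - 1" "\<bar>A $$ (p, g + q) + m\<bar> < \<bar>A $$ (p, g + q)\<bar>"
        using nz by (cases "A $$ (p, g + q) > 0") (force intro: that[of "- 1"] that[of 1])+
      define F where "F X = X(p := X p + m * X (g + q), q := X q + m * X (g + p))" for X :: "nat \<Rightarrow> int"
      define B where "B = mat (2 * g) (2 * g) (\<lambda>(r, l). F (col_fn A l) r)"
      have B: "B $$ (r, g + l) = (if (r = p \<and> l = q) \<or> (r = q \<and> l = p) then A $$ (p, g + q) + m else A $$ (r, g + l))" if "r < g" "l < g" for r l
        using that pq low sym[OF pq] False by (auto simp: B_def F_def col_fn_def)
      have "upper_height g B < upper_height g A"
        unfolding upper_height_def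
      proof (rule sum_strict_mono_ex1)
        show "\<exists>z\<in>{..<g} \<times> {..<g}. nat \<bar>B $$ (fst z, g + snd z)\<bar> < nat \<bar>A $$ (fst z, g + snd z)\<bar>"
          using pq m by (intro bexI[of _ "(p, q)"]) (auto simp: B)
        show "\<forall>z\<in>{..<g} \<times> {..<g}. nat \<bar>B $$ (fst z, g + snd z)\<bar> \<le> nat \<bar>A $$ (fst z, g + snd z)\<bar>"
          using m(2) sym[OF pq] by (auto simp: B)
      qed simp
      moreover have "upper_height g A \<le> upper_height g B"
      proof (rule act_min)
        show "generated g F"
          using m(1)
        proof
          assume "m = 1"
          then show ?thesis by (intro generated_cong[OF generated_off[OF pq False]]) (simp add: F_def)
        next
          assume "m = - 1"
          then show ?thesis by (intro generated_cong[OF generated_off_minus[OF pq False]]) (simp add: F_def)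
        qed
        show "eq_upto (2 * g) (F (unit_fn i)) (unit_fn i)" if "i < g" for i
          using that by (auto simp: F_def eq_upto_def unit_fn_def)
      qed (simp add: B_def)
      ultimately show False by simp
    qed
  qed
  have "A = 1\<^sub>m (2 * g)"
  proof (rule eq_matI)
    fix r c assume "r < dim_row (1\<^sub>m (2 * g))" "c < dim_col (1\<^sub>m (2 * g))"
    then have rc: "r < 2 * g" "c < 2 * g" by auto
    show "A $$ (r, c) = 1\<^sub>m (2 * g) $$ (r, c)"
    proof (cases "c < g")
      case True
      then show ?thesis using left rc by simp
    next
      case c: False
      then obtain l where l: "c = g + l" "l < g" using rc by (metis le_Suc_ex less_diff_conv2 mult_2 nat_add_left_cancel_less not_less)
      show ?thesis
      proof (cases "r < g")
        case True
        then show ?thesis using upper[OF True l(2)] l rc by simp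
      next
        case False
        then obtain i where "r = g + i" "i < g" using rc by (metis le_Suc_ex mult_2 nat_add_left_cancel_less not_less)
        then show ?thesis using low[of i l] l rc by simp
      qed
    qed
  qed (use Ac in auto)
  then show ?thesis using h by (auto simp: P_def A_def)
qed

lemma gens_symp: "h \<in> gens g \<Longrightarrow> symp g h"
proof (induction rule: gens.induct)
  case one
  have "eq_upto (2 * g) (col_fn (1\<^sub>m (2 * g)) k) (unit_fn k)" if "k < 2 * g" for k
    using that by (auto simp: eq_upto_def col_fn_def unit_fn_def)
  then show ?case
    unfolding symp_def omega_def by (auto simp: eq_upto_def intro!: sum.cong)
next
  case (step s h)
  obtain F where "realizes g s F" using base_gens_realizes[OF step(1)] by blast
  from realizes_on_symp[OF base_gens_carrier[OF step(1)] this step.IH] show ?case by simp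
qed

text \<open>M has a left inverse h in the monoid, and h in turn has a left inverse h' there. Hence M
  = h' (h M) = h' lies in the monoid.\<close>

lemma Sp_int_eq_gens: "Sp_int g = gens g"
proof
  show "gens g \<subseteq> Sp_int g" using gens_symp by (auto simp: Sp_int_iff_symp)
  show "Sp_int g \<subseteq> gens g"
  proof
    fix M assume "M \<in> Sp_int g"
    then have M: "symp g M" "M \<in> carrier_mat (2 * g) (2 * g)" by (auto simp: Sp_int_iff_symp symp_def)
    obtain h where h: "h \<in> gens g" "h * M = 1\<^sub>m (2 * g)" using symp_left_inverse[OF M(1)] by blast
    obtain h' where h': "h' \<in> gens g" "h' * h = 1\<^sub>m (2 * g)" using symp_left_inverse[OF gens_symp[OF h(1)]] by blast
    have "M = (h' * h) * M" using h'(2) M(2) by simp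
    also have "\<dots> = h' * (h * M)" using gens_carrier[OF h'(1)] gens_carrier[OF h(1)] M(2) by (rule assoc_mult_mat)
    also have "\<dots> = h'" using h(2) gens_carrier[OF h'(1)] by simp
    finally show "M \<in> gens g" using h'(1) by simp
  qed
qed

section \<open>The transformation law\<close>

text \<open>
  Characteristics correspond to the quadratic forms modulo 2 that polarize to the symplectic form.
  Symplectic matrices act on these forms by composition, which gives the affine action on characteristics.
\<close>

definition char_form :: "nat \<Rightarrow> bit vec \<Rightarrow> (nat \<Rightarrow> int) \<Rightarrow> bit" where
  "char_form g v x = (\<Sum>i<g. of_int (x i) * of_int (x (g + i)) + of_int (x i) * v $ (g + i) + of_int (x (g + i)) * v $ i)"

definition rowact :: "nat \<Rightarrow> int mat \<Rightarrow> (nat \<Rightarrow> int) \<Rightarrow> nat \<Rightarrow> int" where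
  "rowact g \<gamma> x c = (\<Sum>r<2 * g. x r * \<gamma> $$ (r, c))"

definition stack :: "nat \<Rightarrow> complex mat \<Rightarrow> complex mat" where
  "stack g \<tau> = mat (2 * g) g (\<lambda>(r, c). if r < g then \<tau> $$ (r, c) else if r = g + c then 1 else 0)"

definition char_action :: "nat \<Rightarrow> int mat \<Rightarrow> (bit vec \<Rightarrow> bit vec) \<Rightarrow> bool" where
  "char_action g \<gamma> \<phi> \<longleftrightarrow> bij_betw \<phi> (carrier_vec (2 * g)) (carrier_vec (2 * g)) \<and>
     (\<forall>u\<in>carrier_vec (2 * g). \<forall>v\<in>carrier_vec (2 * g). \<forall>w\<in>carrier_vec (2 * g). \<phi> (u + v + w) = \<phi> u + \<phi> v + \<phi> w) \<and>
     (\<forall>v\<in>carrier_vec (2 * g). \<forall>x. char_form g (\<phi> v) x = char_form g v (rowact g \<gamma> x))"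

text \<open>
  \<open>M\<close> and \<open>j\<close> stand for \<open>\<gamma> \<circ> \<tau>\<close> and \<open>C \<tau> + D\<close>. The relation \<open>\<gamma> (\<tau>; 1) = (M; 1) j\<close> composes without any matrix
  inversion.
\<close>

definition moves_to :: "nat \<Rightarrow> int mat \<Rightarrow> (bit vec \<Rightarrow> bit vec) \<Rightarrow> complex mat \<Rightarrow> complex mat \<Rightarrow> complex mat \<Rightarrow> bool" where
  "moves_to g \<gamma> \<phi> \<tau> M j \<longleftrightarrow> M \<in> siegel_space g \<and> j \<in> carrier_mat g g \<and> det j \<noteq> 0 \<and>
     map_mat of_int \<gamma> * stack g \<tau> = stack g M * j \<and>
     (\<forall>d\<le>4. \<forall>A. aff (2 * g) A \<longrightarrow> card A = 2 ^ d \<longrightarrow>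
        theta_prod g (\<phi> ` A) M ^ 2 ^ (4 - d) = det j ^ 8 * theta_prod g A \<tau> ^ 2 ^ (4 - d))"

definition theta_law :: "nat \<Rightarrow> int mat \<Rightarrow> bool" where
  "theta_law g \<gamma> \<longleftrightarrow> (\<exists>\<phi>. char_action g \<gamma> \<phi> \<and> (\<forall>\<tau>\<in>siegel_space g. \<exists>M j. moves_to g \<gamma> \<phi> \<tau> M j))"

section \<open>Composition of transformation laws\<close>

lemma stack_carrier: "stack g \<tau> \<in> carrier_mat (2 * g) g"
  by (simp add: stack_def)

lemma char_form_cong: "(\<And>r. r < 2 * g \<Longrightarrow> x r = y r) \<Longrightarrow> char_form g v x = char_form g v y"
  unfolding char_form_def by (intro sum.cong) auto

lemma rowact_mult:
  assumes "s \<in> carrier_mat (2 * g) (2 * g)" "h \<in> carrier_mat (2 * g) (2 * g)" "c < 2 * g"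
  shows "rowact g (s * h) x c = rowact g h (rowact g s x) c"
proof -
  have "rowact g (s * h) x c = (\<Sum>r<2 * g. \<Sum>k<2 * g. x r * (s $$ (r, k) * h $$ (k, c)))"
    unfolding rowact_def using assms by (intro sum.cong refl) (simp add: scalar_prod_def atLeast0LessThan sum_distrib_left)
  also have "\<dots> = (\<Sum>k<2 * g. \<Sum>r<2 * g. x r * (s $$ (r, k) * h $$ (k, c)))" by (rule sum.swap)
  also have "\<dots> = rowact g h (rowact g s x) c"
    unfolding rowact_def by (simp add: sum_distrib_right mult.assoc)
  finally show ?thesis .
qed

lemma char_action_add:
  assumes "char_action g \<gamma> \<phi>" "u \<in> carrier_vec (2 * g)" "v \<in> carrier_vec (2 * g)" "w \<in> carrier_vec (2 * g)"
  shows "\<phi> (u + v + w) = \<phi> u + \<phi> v + \<phi> w"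
  using assms unfolding char_action_def by blast

lemma aff_image:
  assumes "char_action g \<gamma> \<phi>" "aff (2 * g) A"
  shows "aff (2 * g) (\<phi> ` A)" "card (\<phi> ` A) = card A"
proof -
  have A: "A \<subseteq> carrier_vec (2 * g)" using assms(2) by (simp add: aff_def)
  have \<phi>: "bij_betw \<phi> (carrier_vec (2 * g)) (carrier_vec (2 * g))" using assms(1) by (simp add: char_action_def)
  show "card (\<phi> ` A) = card A" using \<phi> A by (meson bij_betw_def card_image inj_on_subset)
  show "aff (2 * g) (\<phi> ` A)"
    unfolding aff_def
  proof (intro conjI ballI)
    show "\<phi> ` A \<subseteq> carrier_vec (2 * g)" using \<phi> A by (auto simp: bij_betw_def)
    fix x y z assume "x \<in> \<phi> ` A" "y \<in> \<phi> ` A" "z \<in> \<phi> ` A"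
    then obtain u v w where uvw: "u \<in> A" "v \<in> A" "w \<in> A" "x = \<phi> u" "y = \<phi> v" "z = \<phi> w" by blast
    have "x + y + z = \<phi> (u + v + w)" unfolding uvw(4-6) by (rule char_action_add[OF assms(1), symmetric]) (use uvw A in blast)+
    moreover have "u + v + w \<in> A" using assms(2) uvw by (simp add: aff_def)
    ultimately show "x + y + z \<in> \<phi> ` A" by simp
  qed
qed

lemma char_action_comp:
  assumes s: "char_action g s \<phi>" and h: "char_action g h \<psi>"
    and c: "s \<in> carrier_mat (2 * g) (2 * g)" "h \<in> carrier_mat (2 * g) (2 * g)"
  shows "char_action g (s * h) (\<lambda>v. \<phi> (\<psi> v))"
proof -
  let ?C = "carrier_vec (2 * g) :: bit vec set"
  have b: "bij_betw \<phi> ?C ?C" "bij_betw \<psi> ?C ?C" using s h by (auto simp: char_action_def)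
  have \<psi>C: "\<psi> v \<in> ?C" if "v \<in> ?C" for v using b(2) that by (auto simp: bij_betw_def)
  show ?thesis
    unfolding char_action_def
  proof (intro conjI ballI allI)
    show "bij_betw (\<lambda>v. \<phi> (\<psi> v)) ?C ?C" using bij_betw_trans[OF b(2,1)] by (simp add: o_def)
    show "\<phi> (\<psi> (u + v + w)) = \<phi> (\<psi> u) + \<phi> (\<psi> v) + \<phi> (\<psi> w)" if "u \<in> ?C" "v \<in> ?C" "w \<in> ?C" for u v w
      unfolding char_action_add[OF h that] by (rule char_action_add[OF s]) (use that \<psi>C in blast)+
    show "char_form g (\<phi> (\<psi> v)) x = char_form g v (rowact g (s * h) x)" if "v \<in> ?C" for v x
    proof -
      have "char_form g (\<phi> (\<psi> v)) x = char_form g v (rowact g h (rowact g s x))"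
        using s h that \<psi>C by (simp add: char_action_def)
      also have "\<dots> = char_form g v (rowact g (s * h) x)" by (rule char_form_cong) (simp add: rowact_mult[OF c])
      finally show ?thesis .
    qed
  qed
qed

lemma theta_law_mult:
  assumes s: "theta_law g s" and h: "theta_law g h" and c: "s \<in> carrier_mat (2 * g) (2 * g)" "h \<in> carrier_mat (2 * g) (2 * g)"
  shows "theta_law g (s * h)"
proof -
  obtain \<phi> where \<phi>: "char_action g s \<phi>" "\<And>\<tau>. \<tau> \<in> siegel_space g \<Longrightarrow> \<exists>M j. moves_to g s \<phi> \<tau> M j" using s by (auto simp: theta_law_def)
  obtain \<psi> where \<psi>: "char_action g h \<psi>" "\<And>\<tau>. \<tau> \<in> siegel_space g \<Longrightarrow> \<exists>M j. moves_to g h \<psi> \<tau> M j" using h by (auto simp: theta_law_def)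
  have "\<exists>M j. moves_to g (s * h) (\<lambda>v. \<phi> (\<psi> v)) \<tau> M j" if \<tau>: "\<tau> \<in> siegel_space g" for \<tau>
  proof -
    obtain M1 j1 where 1: "moves_to g h \<psi> \<tau> M1 j1" using \<psi>(2)[OF \<tau>] by blast
    then have "M1 \<in> siegel_space g" by (simp add: moves_to_def)
    then obtain M j where 2: "moves_to g s \<phi> M1 M j" using \<phi>(2) by blast
    have jc: "j1 \<in> carrier_mat g g" "j \<in> carrier_mat g g" using 1 2 by (auto simp: moves_to_def)
    have cc: "map_mat complex_of_int s \<in> carrier_mat (2 * g) (2 * g)" "map_mat complex_of_int h \<in> carrier_mat (2 * g) (2 * g)" using c by auto
    have "map_mat of_int (s * h) * stack g \<tau> = map_mat of_int s * map_mat of_int h * stack g \<tau>"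
      by (simp only: of_int_hom.mat_hom_mult[OF c])
    also have "\<dots> = map_mat of_int s * (map_mat of_int h * stack g \<tau>)" by (rule assoc_mult_mat[OF cc stack_carrier])
    also have "\<dots> = map_mat of_int s * (stack g M1 * j1)" using 1 by (simp add: moves_to_def)
    also have "\<dots> = map_mat of_int s * stack g M1 * j1" by (rule assoc_mult_mat[OF cc(1) stack_carrier jc(1), symmetric])
    also have "\<dots> = stack g M * j * j1" using 2 by (simp add: moves_to_def)
    also have "\<dots> = stack g M * (j * j1)" by (rule assoc_mult_mat[OF stack_carrier jc(2,1)])
    finally have st: "map_mat of_int (s * h) * stack g \<tau> = stack g M * (j * j1)" .
    have dj: "det (j * j1) = det j * det j1" by (rule det_mult[OF jc(2,1)])
    have "moves_to g (s * h) (\<lambda>v. \<phi> (\<psi> v)) \<tau> M (j * j1)"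
      unfolding moves_to_def
    proof (intro conjI allI impI)
      show "M \<in> siegel_space g" "j * j1 \<in> carrier_mat g g" "det (j * j1) \<noteq> 0"
        using 1 2 jc dj by (auto simp: moves_to_def)
      show "map_mat of_int (s * h) * stack g \<tau> = stack g M * (j * j1)" by (rule st)
      fix d A assume d: "d \<le> 4" and A: "aff (2 * g) A" "card A = 2 ^ d"
      have "(\<lambda>v. \<phi> (\<psi> v)) ` A = \<phi> ` (\<psi> ` A)" by auto
      moreover have "theta_prod g (\<phi> ` (\<psi> ` A)) M ^ 2 ^ (4 - d) = det j ^ 8 * theta_prod g (\<psi> ` A) M1 ^ 2 ^ (4 - d)"
        using 2 d aff_image[OF \<psi>(1) A(1)] A(2) by (simp add: moves_to_def)
      moreover have "theta_prod g (\<psi> ` A) M1 ^ 2 ^ (4 - d) = det j1 ^ 8 * theta_prod g A \<tau> ^ 2 ^ (4 - d)"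
        using 1 d A by (simp add: moves_to_def)
      ultimately show "theta_prod g ((\<lambda>v. \<phi> (\<psi> v)) ` A) M ^ 2 ^ (4 - d) = det (j * j1) ^ 8 * theta_prod g A \<tau> ^ 2 ^ (4 - d)"
        by (simp add: dj power_mult_distrib)
    qed
    then show ?thesis by blast
  qed
  then show ?thesis
    using char_action_comp[OF \<phi>(1) \<psi>(1) c] unfolding theta_law_def by blast
qed

section \<open>Cancellation of the roots of unity in a monomial\<close>

lemma theta_prod_phase:
  assumes \<phi>: "inj_on \<phi> A" and \<theta>: "\<And>v. v \<in> A \<Longrightarrow> theta g (\<phi> v) M = \<kappa> * exp (pi * \<i> * of_real (r v)) * theta g v \<tau>"
    and \<kappa>: "\<kappa> ^ 16 = D" and d: "d \<le> 4" "card A = 2 ^ d" and r: "2 ^ (4 - d) * (\<Sum>v\<in>A. r v) = of_int (2 * k)"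
  shows "theta_prod g (\<phi> ` A) M ^ 2 ^ (4 - d) = D * theta_prod g A \<tau> ^ 2 ^ (4 - d)"
proof -
  have fin: "finite A" using d by (metis card.infinite power_eq_0_iff zero_neq_numeral)
  have "theta_prod g (\<phi> ` A) M = (\<Prod>v\<in>A. \<kappa> * exp (pi * \<i> * of_real (r v)) * theta g v \<tau>)"
    unfolding theta_prod_def by (simp add: prod.reindex[OF \<phi>] \<theta>)
  also have "\<dots> = \<kappa> ^ card A * (\<Prod>v\<in>A. exp (pi * \<i> * of_real (r v))) * theta_prod g A \<tau>"
    by (simp add: prod.distrib theta_prod_def)
  also have "(\<Prod>v\<in>A. exp (pi * \<i> * of_real (r v))) = exp (pi * \<i> * of_real (\<Sum>v\<in>A. r v))"
    using fin by (simp add: sum_distrib_left exp_sum)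
  finally have "theta_prod g (\<phi> ` A) M ^ 2 ^ (4 - d) = (\<kappa> ^ 2 ^ d) ^ 2 ^ (4 - d) * exp (pi * \<i> * of_real (\<Sum>v\<in>A. r v)) ^ 2 ^ (4 - d) * theta_prod g A \<tau> ^ 2 ^ (4 - d)"
    by (simp add: power_mult_distrib d(2))
  also have "(\<kappa> ^ 2 ^ d) ^ 2 ^ (4 - d) = D"
  proof -
    have "(2::nat) ^ d * 2 ^ (4 - d) = 2 ^ (d + (4 - d))" by (simp only: power_add)
    also have "\<dots> = 16" using d(1) by simp
    finally show ?thesis by (simp only: power_mult[symmetric] \<kappa>)
  qed
  also have "exp (pi * \<i> * of_real (\<Sum>v\<in>A. r v)) ^ 2 ^ (4 - d) = exp (pi * \<i> * of_int (2 * k))"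
  proof -
    have "exp (pi * \<i> * of_real (\<Sum>v\<in>A. r v)) ^ 2 ^ (4 - d) = exp (of_nat (2 ^ (4 - d)) * (pi * \<i> * of_real (\<Sum>v\<in>A. r v)))"
      by (rule exp_of_nat_mult[symmetric])
    also have "of_nat (2 ^ (4 - d)) * (pi * \<i> * of_real (\<Sum>v\<in>A. r v)) = pi * \<i> * of_real (2 ^ (4 - d) * (\<Sum>v\<in>A. r v))" by simp
    finally show ?thesis by (simp only: r of_real_of_int_eq)
  qed
  finally show ?thesis by (simp only: exp_even_pi mult_1_right)
qed

definition lift :: "bit \<Rightarrow> int" where "lift b = of_bit b"

lemma lift_simps [simp]: "lift 0 = 0" "lift 1 = 1"
  by (simp_all add: lift_def)

lemma theta_lift:
  "v \<in> carrier_vec (2 * g) \<Longrightarrow> \<tau> \<in> siegel_space g \<Longrightarrow> theta g v \<tau> = theta_int g \<tau> (\<lambda>i. lift (v $ i)) (\<lambda>i. lift (v $ (g + i)))"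
  by (simp add: theta_eq_theta_int siegel_space_def lift_def)

lemma sum_lift:
  assumes "finite A"
  shows "(\<Sum>v\<in>A. real_of_int (lift (l v))) = card {v \<in> A. l v = 1}"
proof -
  have "(\<Sum>v\<in>A. real_of_int (lift (l v))) = (\<Sum>v\<in>A. if l v = 1 then 1 else 0)"
  proof (intro sum.cong refl)
    fix v show "real_of_int (lift (l v)) = (if l v = 1 then 1 else 0)" by (cases "l v") auto
  qed
  also have "\<dots> = real (\<Sum>v\<in>A. if l v = 1 then 1 else 0)" unfolding of_nat_sum by (intro sum.cong refl) simp
  also have "(\<Sum>v\<in>A. if l v = 1 then 1 else 0 :: nat) = card {v \<in> A. l v = 1}"
    unfolding card_eq_sum by (rule sum.inter_filter[OF assms, symmetric])
  finally show ?thesis .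
qed

text \<open>Multiplying a count n by the exponent 2^(4-d) of the monomial makes its divisibility by
  powers of 2 independent of the dimension d.\<close>

lemma dvd_scale:
  assumes "card A = 2 ^ d" "d \<le> 4" "card A dvd 2 ^ k * n" "k \<le> 4"
  obtains t :: nat where "2 ^ (4 - d) * n = 2 ^ (4 - k) * t"
proof -
  have "2 ^ (4 - d) * card A dvd 2 ^ (4 - d) * (2 ^ k * n)" using assms(3) by (rule mult_dvd_mono[OF dvd_refl])
  also have "2 ^ (4 - d) * card A = 2 ^ (4 - d + d)" by (simp only: assms(1) power_add)
  also have "\<dots> = 2 ^ (k + (4 - k))" using assms by simp
  also have "\<dots> = 2 ^ k * 2 ^ (4 - k)" by (rule power_add)
  also have "2 ^ (4 - d) * (2 ^ k * n) = 2 ^ k * (2 ^ (4 - d) * n)" by simp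
  finally have "2 ^ (4 - k) dvd 2 ^ (4 - d) * n" by simp
  then show ?thesis using that by (auto simp: dvd_def)
qed

lemma lift_mult: "lift a * lift b = lift (a * b)"
  by (cases a; cases b) simp_all

lemma bit_mult_eq_1: "(a :: bit) * b = 1 \<longleftrightarrow> a = 1 \<and> b = 1"
  by (cases a; cases b) simp_all

text \<open>A product of k coordinates equals 1 exactly where k affine functions do, so its sum over
  \<open>A\<close>, times the exponent of the monomial, is divisible by 2^(4-k). The factors 8, 4
  and 2 suit phases with coefficients in quarters, halves and integers.\<close>

lemma count_lift:
  assumes A: "aff (2 * g) A" "card A = 2 ^ d" "d \<le> 4" and k: "i < 2 * g" "j < 2 * g" "l < 2 * g"
  obtains t1 t2 t3 :: int where
    "2 ^ (4 - d) * (\<Sum>v\<in>A. real_of_int (lift (v $ i))) = of_int (8 * t1)"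
    "2 ^ (4 - d) * (\<Sum>v\<in>A. real_of_int (lift (v $ i) * lift (v $ j))) = of_int (4 * t2)"
    "2 ^ (4 - d) * (\<Sum>v\<in>A. real_of_int (lift (v $ i) * lift (v $ j) * lift (v $ l))) = of_int (2 * t3)"
proof -
  have fin: "finite A" using A(1) by (rule aff_finite)
  have sub: "A \<subseteq> carrier_vec (2 * g)" using A(1) by (simp add: aff_def)
  note c = aff_on_coord[OF sub k(1)] aff_on_coord[OF sub k(2)] aff_on_coord[OF sub k(3)]
  have d1: "card A dvd 2 ^ 1 * card {v \<in> A. v $ i = 1}" using aff_card_dvd[OF A(1) c(1)] by simp
  have d2: "card A dvd 2 ^ 2 * card {v \<in> A. v $ i * v $ j = 1}" using aff_card_dvd2[OF A(1) c(1,2)] unfolding bit_mult_eq_1 by simp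
  have d3: "card A dvd 2 ^ 3 * card {v \<in> A. v $ i * v $ j * v $ l = 1}" using aff_card_dvd3[OF A(1) c] unfolding bit_mult_eq_1 by (simp add: conj_assoc)
  obtain t1 where t1: "2 ^ (4 - d) * card {v \<in> A. v $ i = 1} = 2 ^ (4 - 1) * t1" by (rule dvd_scale[OF A(2,3) d1]) auto
  obtain t2 where t2: "2 ^ (4 - d) * card {v \<in> A. v $ i * v $ j = 1} = 2 ^ (4 - 2) * t2" by (rule dvd_scale[OF A(2,3) d2]) auto
  obtain t3 where t3: "2 ^ (4 - d) * card {v \<in> A. v $ i * v $ j * v $ l = 1} = 2 ^ (4 - 3) * t3" by (rule dvd_scale[OF A(2,3) d3]) auto
  show ?thesis
  proof (rule that[of "int t1" "int t2" "int t3"])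
    show "2 ^ (4 - d) * (\<Sum>v\<in>A. real_of_int (lift (v $ i))) = of_int (8 * int t1)"
      using arg_cong[OF t1, of real] by (simp only: sum_lift[OF fin]) simp
    show "2 ^ (4 - d) * (\<Sum>v\<in>A. real_of_int (lift (v $ i) * lift (v $ j))) = of_int (4 * int t2)"
      using arg_cong[OF t2, of real] by (simp only: lift_mult sum_lift[OF fin]) simp
    show "2 ^ (4 - d) * (\<Sum>v\<in>A. real_of_int (lift (v $ i) * lift (v $ j) * lift (v $ l))) = of_int (2 * int t3)"
      using arg_cong[OF t3, of real] by (simp only: lift_mult sum_lift[OF fin]) simp
  qed
qed

lemma theta_lawI:
  assumes "char_action g \<gamma> \<phi>"
    and M: "\<And>\<tau>. \<tau> \<in> siegel_space g \<Longrightarrow> M \<tau> \<in> siegel_space g"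
    and J: "\<And>\<tau>. \<tau> \<in> siegel_space g \<Longrightarrow> J \<tau> \<in> carrier_mat g g"
    and st: "\<And>\<tau>. \<tau> \<in> siegel_space g \<Longrightarrow> map_mat of_int \<gamma> * stack g \<tau> = stack g (M \<tau>) * J \<tau>"
    and \<kappa>: "\<And>\<tau>. \<tau> \<in> siegel_space g \<Longrightarrow> det (J \<tau>) \<noteq> 0 \<and> \<kappa> \<tau> ^ 16 = det (J \<tau>) ^ 8"
    and \<theta>: "\<And>\<tau> v. \<tau> \<in> siegel_space g \<Longrightarrow> v \<in> carrier_vec (2 * g) \<Longrightarrow>
        theta g (\<phi> v) (M \<tau>) = \<kappa> \<tau> * exp (pi * \<i> * of_real (r v)) * theta g v \<tau>"
    and r: "\<And>A d. aff (2 * g) A \<Longrightarrow> card A = 2 ^ d \<Longrightarrow> d \<le> 4 \<Longrightarrow> \<exists>k. 2 ^ (4 - d) * (\<Sum>v\<in>A. r v) = of_int (2 * k)"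
  shows "theta_law g \<gamma>"
proof -
  have "moves_to g \<gamma> \<phi> \<tau> (M \<tau>) (J \<tau>)" if \<tau>: "\<tau> \<in> siegel_space g" for \<tau>
    unfolding moves_to_def
  proof (intro conjI allI impI)
    fix d A assume d: "d \<le> (4::nat)" and A: "aff (2 * g) A" "card A = 2 ^ d"
    obtain k where k: "2 ^ (4 - d) * (\<Sum>v\<in>A. r v) = of_int (2 * k)" using r[OF A d] by blast
    have sub: "A \<subseteq> carrier_vec (2 * g)" using A(1) by (simp add: aff_def)
    show "theta_prod g (\<phi> ` A) (M \<tau>) ^ 2 ^ (4 - d) = det (J \<tau>) ^ 8 * theta_prod g A \<tau> ^ 2 ^ (4 - d)"
    proof (rule theta_prod_phase[OF _ _ _ d A(2) k])
      show "inj_on \<phi> A" using assms(1) sub by (meson bij_betw_def char_action_def inj_on_subset)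
      show "\<kappa> \<tau> ^ 16 = det (J \<tau>) ^ 8" using \<kappa>[OF \<tau>] by simp
    qed (use \<theta>[OF \<tau>] sub in blast)
  qed (use M J st \<kappa> \<tau> in blast)+
  then show ?thesis using assms(1) unfolding theta_law_def by blast
qed

section \<open>The law for the three kinds of generators\<close>

lemma char_actionI:
  assumes "\<And>v. v \<in> carrier_vec (2 * g) \<Longrightarrow> \<phi> v \<in> carrier_vec (2 * g)"
    and "\<And>v. v \<in> carrier_vec (2 * g) \<Longrightarrow> \<phi> (\<phi> v) = v"
    and "\<And>u v w. u \<in> carrier_vec (2 * g) \<Longrightarrow> v \<in> carrier_vec (2 * g) \<Longrightarrow> w \<in> carrier_vec (2 * g) \<Longrightarrow> \<phi> (u + v + w) = \<phi> u + \<phi> v + \<phi> w"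
    and "\<And>v x. v \<in> carrier_vec (2 * g) \<Longrightarrow> char_form g (\<phi> v) x = char_form g v (rowact g \<gamma> x)"
  shows "char_action g \<gamma> \<phi>"
  unfolding char_action_def
  by (intro conjI ballI allI bij_betw_byWitness[of _ \<phi>]) (use assms in auto)

lemma sum_delta_right_int: "finite A \<Longrightarrow> (\<Sum>k\<in>A. f k * (if k = c then a else 0)) = (if c \<in> A then f c * a else (0::int))"
  by (simp add: if_distrib[of "\<lambda>x. _ * x"] sum.delta cong: if_cong)

lemma rowact_mat:
  assumes "c < 2 * g"
  shows "rowact g (mat (2 * g) (2 * g) f) x c = (\<Sum>r<2 * g. x r * f (r, c))"
  unfolding rowact_def using assms by (intro sum.cong) auto

lemma sum_delta_complex: "finite A \<Longrightarrow> (\<Sum>c\<in>A. (if c = k then a else 0) * f c) = (if k \<in> A then a * f k else (0::complex))"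
  by (simp add: if_distrib[of "\<lambda>x. x * _"] sum.delta cong: if_cong)

lemma mult_stack_index:
  assumes "r < 2 * g" "c < g"
  shows "(map_mat of_int (mat (2 * g) (2 * g) f) * stack g \<tau>) $$ (r, c) = (\<Sum>k<2 * g. of_int (f (r, k)) * stack g \<tau> $$ (k, c))"
  using assms by (simp add: stack_def scalar_prod_def atLeast0LessThan)

lemma stack_index: "r < 2 * g \<Longrightarrow> c < g \<Longrightarrow> stack g \<tau> $$ (r, c) = (if r < g then \<tau> $$ (r, c) else if r = g + c then 1 else 0)"
  by (simp add: stack_def)

lemma bit_diag_form: "(X::bit) * Q + X * (D + u * (1 + E)) + Q * E = X * (Q + u * X) + X * D + (Q + u * X) * E"
  by (cases X; cases Q; cases D; cases u; cases E) simp_all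

lemma bit_diag_affine: "((a::bit) + b + c) + u * (1 + (d + e + f)) = (a + u * (1 + d)) + (b + u * (1 + e)) + (c + u * (1 + f))"
  by (cases a; cases b; cases c; cases d; cases e; cases f; cases u) simp_all

text \<open>Read off modulo 2 from \<open>theta_int_add_diag\<close>. As an involution it also
  describes the inverse passage from the translated matrix back to the original one.\<close>

definition phi_diag :: "nat \<Rightarrow> nat \<Rightarrow> bit \<Rightarrow> bit vec \<Rightarrow> bit vec" where
  "phi_diag g i u v = vec (2 * g) (\<lambda>r. v $ r + (if r = g + i then u * (1 + v $ i) else 0))"

lemma char_action_diag:
  assumes i: "i < g"
  shows "char_action g (gen_diag g i m) (phi_diag g i (of_int m))"
proof (rule char_actionI)
  let ?\<phi> = "phi_diag g i (of_int m)"
  have idx: "?\<phi> v $ r = v $ r + (if r = g + i then of_int m * (1 + v $ i) else 0)" if "r < 2 * g" for v r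
    using that by (simp add: phi_diag_def)
  show c: "?\<phi> v \<in> carrier_vec (2 * g)" for v by (simp add: phi_diag_def)
  show "?\<phi> (?\<phi> v) = v" if "v \<in> carrier_vec (2 * g)" for v
  proof (rule eq_vecI)
    fix r assume "r < dim_vec v"
    then have r: "r < 2 * g" using that by simp
    show "?\<phi> (?\<phi> v) $ r = v $ r"
      using i r by (simp only: idx[of r] idx[of i]) (auto simp: add.assoc)
  qed (use that c[of "?\<phi> v"] in auto)
  show "?\<phi> (u + v + w) = ?\<phi> u + ?\<phi> v + ?\<phi> w" if uvw: "u \<in> carrier_vec (2 * g)" "v \<in> carrier_vec (2 * g)" "w \<in> carrier_vec (2 * g)" for u v w
  proof (rule eq_vecI)
    fix r assume "r < dim_vec (?\<phi> u + ?\<phi> v + ?\<phi> w)"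
    then have r: "r < 2 * g" by (simp add: phi_diag_def)
    have s: "(u + v + w) $ k = u $ k + v $ k + w $ k" if "k < 2 * g" for k
      using uvw that by (simp only: index_add_vec carrier_vecD)
    have "(?\<phi> u + ?\<phi> v + ?\<phi> w) $ r = ?\<phi> u $ r + ?\<phi> v $ r + ?\<phi> w $ r"
      using r by (simp only: index_add_vec carrier_vecD[OF c])
    then show "?\<phi> (u + v + w) $ r = (?\<phi> u + ?\<phi> v + ?\<phi> w) $ r"
      using i r by (cases "r = g + i") (simp_all only: idx s bit_diag_affine if_True if_False add_0_right mult_2 trans_less_add1 simp_thms)
  qed (use uvw c[of "u + v + w"] c[of w] in auto)
  show "char_form g (?\<phi> v) x = char_form g v (rowact g (gen_diag g i m) x)" if "v \<in> carrier_vec (2 * g)" for v x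
  proof -
    have row: "rowact g (gen_diag g i m) x c = x c + (if c = g + i then m * x i else 0)" if c: "c < 2 * g" for c
    proof -
      have "rowact g (gen_diag g i m) x c = (\<Sum>r<2 * g. x r * (if r = c then 1 else 0) + x r * (if r = i then (if c = g + i then m else 0) else 0))"
        unfolding gen_diag_def rowact_mat[OF c] by (intro sum.cong) (auto simp: algebra_simps)
      then show ?thesis unfolding sum.distrib using c i by (simp add: sum_delta_right_int mult.commute)
    qed
    show ?thesis
      unfolding char_form_def
    proof (intro sum.cong refl)
      fix k assume "k \<in> {..<g}"
      then have k: "k < g" "k < 2 * g" "g + k < 2 * g" by auto
      show "of_int (x k) * of_int (x (g + k)) + of_int (x k) * ?\<phi> v $ (g + k) + of_int (x (g + k)) * ?\<phi> v $ k =
        of_int (rowact g (gen_diag g i m) x k) * of_int (rowact g (gen_diag g i m) x (g + k)) +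
        of_int (rowact g (gen_diag g i m) x k) * v $ (g + k) + of_int (rowact g (gen_diag g i m) x (g + k)) * v $ k"
      proof (cases "k = i")
        case True
        have "k \<noteq> g + i" using k by simp
        then show ?thesis
          unfolding idx[OF k(2)] idx[OF k(3)] row[OF k(2)] row[OF k(3)]
          by (simp only: True if_True if_False add_0_right of_int_add of_int_mult bit_diag_form simp_thms)
      next
        case False
        then have "k \<noteq> g + i" "g + k \<noteq> g + i" using k by auto
        then show ?thesis
          unfolding idx[OF k(2)] idx[OF k(3)] row[OF k(2)] row[OF k(3)] by (simp only: if_False add_0_right)
      qed
    qed
  qed
qed

definition add_diag :: "nat \<Rightarrow> nat \<Rightarrow> int \<Rightarrow> complex mat \<Rightarrow> complex mat" where
  "add_diag g i m \<tau> = mat g g (\<lambda>(k, l). \<tau> $$ (k, l) + (if l = i then (if k = i then of_int m else 0) else 0))"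

lemma quad_add_diag:
  assumes "i < g"
  shows "quad g (add_diag g i m \<tau>) x = quad g \<tau> x + of_real (of_int m * (x i)\<^sup>2)"
proof -
  have "quad g (add_diag g i m \<tau>) x = (\<Sum>k<g. (\<Sum>l<g. \<tau> $$ (k, l) * of_real (x k * x l) + (if l = i then (if k = i then of_int m else 0) else 0) * of_real (x k * x l)))"
    unfolding quad_def by (intro sum.cong refl) (simp add: add_diag_def algebra_simps)
  also have "\<dots> = quad g \<tau> x + (\<Sum>k<g. (if k = i then of_int m else 0) * of_real (x k * x i))"
    unfolding sum.distrib quad_def using assms by (simp add: sum_delta_complex)
  also have "(\<Sum>k<g. (if k = i then of_int m else 0) * of_real (x k * x i)) = (of_int m * of_real (x i * x i) :: complex)"
    using assms by (subst sum_delta_complex) auto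
  finally show ?thesis by (simp add: power2_eq_square)
qed

lemma add_diag_siegel:
  assumes "\<tau> \<in> siegel_space g" "i < g"
  shows "add_diag g i m \<tau> \<in> siegel_space g"
proof -
  have "imag_quad g (add_diag g i m \<tau>) x = imag_quad g \<tau> x" for x
    using arg_cong[OF quad_add_diag[OF assms(2), of m \<tau> x], of Im] by (simp add: Im_quad)
  moreover have "add_diag g i m \<tau> $$ (k, l) = add_diag g i m \<tau> $$ (l, k)" if "k < g" "l < g" for k l
    using that siegel_sym[OF assms(1) that] by (simp add: add_diag_def)
  ultimately show ?thesis using assms(1) by (simp add: siegel_space_iff add_diag_def)
qed

lemma of_int_bit: "(of_int m :: bit) = (if even m then 0 else 1)"
  by (auto elim!: evenE oddE)

lemma theta_int_cong:
  assumes "\<And>k. k < g \<Longrightarrow> e k = e' k" "\<And>k. k < g \<Longrightarrow> d k = d' k"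
  shows "theta_int g \<tau> e d = theta_int g \<tau> e' d'"
proof -
  have "tterm g \<tau> (xvec e n) d = tterm g \<tau> (xvec e' n) d'" for n
    unfolding tterm_def quad_def using assms by (simp add: xvec_def)
  then show ?thesis by (simp add: theta_int_def)
qed

text \<open>The shift in \<open>theta_int_add_diag\<close> leads out of the lifted values 0 and 1
  and has to be undone by an even shift of \<open>d\<close>, which brings a phase of its own. For
  \<epsilon>_i = 0 no phase results; for \<epsilon>_i = 1 the phases -3m/4 and m combine to
  m/4.\<close>

lemma theta_law_gen_diag:
  assumes i: "i < g"
  shows "theta_law g (gen_diag g i m)"
proof (rule theta_lawI[where \<phi> = "phi_diag g i (of_int m)" and M = "add_diag g i m" and J = "\<lambda>_. 1\<^sub>m g" and \<kappa> = "\<lambda>_. 1"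
      and r = "\<lambda>v. real_of_int m / 4 * of_int (lift (v $ i))"])
  show "char_action g (gen_diag g i m) (phi_diag g i (of_int m))" by (rule char_action_diag[OF i])
  show "add_diag g i m \<tau> \<in> siegel_space g" if "\<tau> \<in> siegel_space g" for \<tau> using that i by (rule add_diag_siegel)
  show "map_mat of_int (gen_diag g i m) * stack g \<tau> = stack g (add_diag g i m \<tau>) * 1\<^sub>m g" for \<tau>
  proof (rule eq_matI)
    fix r c assume "r < dim_row (stack g (add_diag g i m \<tau>) * 1\<^sub>m g)" "c < dim_col (stack g (add_diag g i m \<tau>) * 1\<^sub>m g)"
    then have rc: "r < 2 * g" "c < g" using stack_carrier[of g "add_diag g i m \<tau>"] by auto
    have "(map_mat of_int (gen_diag g i m) * stack g \<tau>) $$ (r, c) =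
      (\<Sum>k<2 * g. (if k = r then 1 else 0) * stack g \<tau> $$ (k, c) + (if k = g + i then (if r = i then of_int m else 0) else 0) * stack g \<tau> $$ (k, c))"
      unfolding gen_diag_def mult_stack_index[OF rc] by (intro sum.cong) (auto simp: algebra_simps)
    also have "\<dots> = stack g \<tau> $$ (r, c) + (if r = i then of_int m else 0) * stack g \<tau> $$ (g + i, c)"
      unfolding sum.distrib using rc i by (simp add: sum_delta_complex)
    also have "\<dots> = stack g (add_diag g i m \<tau>) $$ (r, c)"
      using rc i by (auto simp: stack_index add_diag_def)
    finally show "(map_mat of_int (gen_diag g i m) * stack g \<tau>) $$ (r, c) = (stack g (add_diag g i m \<tau>) * 1\<^sub>m g) $$ (r, c)"
      using stack_carrier[of g "add_diag g i m \<tau>"] by simp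
  qed (auto simp: gen_diag_def carrier_matD[OF stack_carrier])
  show "\<exists>k. 2 ^ (4 - d) * (\<Sum>v\<in>A. real_of_int m / 4 * of_int (lift (v $ i))) = of_int (2 * k)"
    if A: "aff (2 * g) A" "card A = 2 ^ d" "d \<le> 4" for A d
  proof -
    obtain t where "2 ^ (4 - d) * (\<Sum>v\<in>A. real_of_int (lift (v $ i))) = of_int (8 * t)"
      by (rule count_lift[OF A, of i i i]) (use i in auto)
    moreover have "2 ^ (4 - d) * (\<Sum>v\<in>A. real_of_int m / 4 * of_int (lift (v $ i))) =
        real_of_int m / 4 * (2 ^ (4 - d) * (\<Sum>v\<in>A. real_of_int (lift (v $ i))))"
      unfolding sum_distrib_left[symmetric] by (simp only: mult.left_commute)
    ultimately have "2 ^ (4 - d) * (\<Sum>v\<in>A. real_of_int m / 4 * of_int (lift (v $ i))) = of_int (2 * (m * t))" by simp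
    then show ?thesis by blast
  qed
  show "theta g (phi_diag g i (of_int m) v) (add_diag g i m \<tau>) = 1 * exp (pi * \<i> * of_real (real_of_int m / 4 * of_int (lift (v $ i)))) * theta g v \<tau>"
    if \<tau>: "\<tau> \<in> siegel_space g" and v: "v \<in> carrier_vec (2 * g)" for \<tau> v
  proof -
    let ?v = "phi_diag g i (of_int m) v"
    let ?e = "\<lambda>k. lift (v $ k)" and ?d = "\<lambda>k. lift (v $ (g + k))" and ?d' = "\<lambda>k. lift (?v $ (g + k))"
    have ve: "?v $ k = v $ k" if "k < g" for k using that by (simp add: phi_diag_def)
    have vd: "?v $ (g + k) = v $ (g + k) + (if k = i then of_int m * (1 + v $ i) else 0)" if "k < g" for k
      using that by (simp add: phi_diag_def)
    have "theta g ?v (add_diag g i m \<tau>) = theta_int g (add_diag g i m \<tau>) (\<lambda>k. lift (?v $ k)) ?d'"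
      by (rule theta_lift) (use add_diag_siegel[OF \<tau> i] in \<open>auto simp: phi_diag_def\<close>)
    also have "\<dots> = theta_int g (add_diag g i m \<tau>) ?e ?d'" by (rule theta_int_cong) (simp_all add: ve)
    also have "\<dots> = exp (pi * \<i> * of_real (- of_int (m * (2 * ?e i + ?e i * ?e i)) / 4)) * theta_int g \<tau> ?e (?d'(i := ?d' i + m * (1 + ?e i)))"
      by (rule theta_int_add_diag[OF i quad_add_diag[OF i]])
    also have "\<dots> = exp (pi * \<i> * of_real (real_of_int m / 4 * of_int (lift (v $ i)))) * theta_int g \<tau> ?e ?d"
    proof (cases "v $ i")
      case zero
      then have e: "?e i = 0" by simp
      have "even (?d' i + m - ?d i)"
        unfolding vd[OF i] zero by (cases "v $ (g + i)"; cases "even m") (auto simp: of_int_bit)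
      then obtain k where k: "?d' i + m = ?d i + 2 * k" by (metis add.commute diff_add_cancel evenE)
      have "theta_int g \<tau> ?e (?d'(i := ?d' i + m * (1 + ?e i))) = theta_int g \<tau> ?e (?d(i := ?d i + 2 * k))"
        by (rule theta_int_cong) (use e k vd in auto)
      also have "\<dots> = theta_int g \<tau> ?e ?d" by (subst theta_int_shift_d[OF i]) (simp add: e)
      finally show ?thesis by (simp add: zero)
    next
      case one
      then have e: "?e i = 1" by simp
      have "?d' k = ?d k" if "k < g" for k using vd[OF that] one by auto
      then have "theta_int g \<tau> ?e (?d'(i := ?d' i + m * (1 + ?e i))) = theta_int g \<tau> ?e (?d(i := ?d i + 2 * m))"
        by (intro theta_int_cong) (use i e in auto)
      also have "\<dots> = exp (pi * \<i> * of_int (m * ?e i)) * theta_int g \<tau> ?e ?d" by (rule theta_int_shift_d[OF i])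
      finally have "exp (pi * \<i> * of_real (- of_int (m * (2 * ?e i + ?e i * ?e i)) / 4)) * theta_int g \<tau> ?e (?d'(i := ?d' i + m * (1 + ?e i)))
         = exp (pi * \<i> * of_real (- of_int (m * (2 * ?e i + ?e i * ?e i)) / 4)) * exp (pi * \<i> * of_int (m * ?e i)) * theta_int g \<tau> ?e ?d"
        by simp
      also have "exp (pi * \<i> * of_real (- of_int (m * (2 * ?e i + ?e i * ?e i)) / 4)) * exp (pi * \<i> * of_int (m * ?e i))
         = exp (pi * \<i> * of_real (real_of_int m / 4 * of_int (lift (v $ i))))"
        unfolding exp_add[symmetric] e by (rule arg_cong[of _ _ exp]) (simp add: field_simps)
      finally show ?thesis .
    qed
    also have "theta_int g \<tau> ?e ?d = theta g v \<tau>" by (rule theta_lift[OF v \<tau>, symmetric])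
    finally show ?thesis by simp
  qed
qed auto

definition phi_off :: "nat \<Rightarrow> nat \<Rightarrow> nat \<Rightarrow> bit vec \<Rightarrow> bit vec" where
  "phi_off g i j v = vec (2 * g) (\<lambda>r. v $ r + ((if r = g + i then v $ j else 0) + (if r = g + j then v $ i else 0)))"

lemma bit_off_form: "(X::bit) * Q + X * (D + E') + Q * E + (Y * R + Y * (F + E) + R * E') =
    X * (Q + Y) + X * D + (Q + Y) * E + (Y * (R + X) + Y * F + (R + X) * E')"
  by (cases X; cases Q; cases D; cases E; cases Y; cases R; cases F; cases E') simp_all

lemma bit_off_affine: "((a::bit) + b + c) + ((d + e + f) + (k + l + m)) = (a + (d + k)) + (b + (e + l)) + (c + (f + m))"
  by (simp only: ac_simps)

lemma sum_remove2:
  fixes f :: "nat \<Rightarrow> 'a :: comm_monoid_add"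
  assumes "i < g" "j < g" "i \<noteq> j"
  shows "(\<Sum>k<g. f k) = f i + f j + (\<Sum>k\<in>{..<g} - {i} - {j}. f k)"
proof -
  have "(\<Sum>k<g. f k) = f i + (\<Sum>k\<in>{..<g} - {i}. f k)" by (rule sum.remove) (use assms in auto)
  also have "(\<Sum>k\<in>{..<g} - {i}. f k) = f j + (\<Sum>k\<in>{..<g} - {i} - {j}. f k)" by (rule sum.remove) (use assms in auto)
  finally show ?thesis by (simp only: add.assoc)
qed

lemma char_action_off:
  assumes ij: "i < g" "j < g" "i \<noteq> j"
  shows "char_action g (gen_off g i j) (phi_off g i j)"
proof (rule char_actionI)
  let ?\<phi> = "phi_off g i j"
  have idx: "?\<phi> v $ r = v $ r + ((if r = g + i then v $ j else 0) + (if r = g + j then v $ i else 0))" if "r < 2 * g" for v r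
    using that by (simp add: phi_off_def)
  show c: "?\<phi> v \<in> carrier_vec (2 * g)" for v by (simp add: phi_off_def)
  show "?\<phi> (?\<phi> v) = v" if "v \<in> carrier_vec (2 * g)" for v
  proof (rule eq_vecI)
    fix r assume "r < dim_vec v"
    then have r: "r < 2 * g" using that by simp
    have s: "?\<phi> v $ k = v $ k" if "k < g" for k using idx[of k v] that by simp
    show "?\<phi> (?\<phi> v) $ r = v $ r"
      unfolding idx[OF r] s[OF ij(1)] s[OF ij(2)] by (rule bit_add_cancel(1))
  qed (use that c[of "?\<phi> v"] in auto)
  show "?\<phi> (u + v + w) = ?\<phi> u + ?\<phi> v + ?\<phi> w" if uvw: "u \<in> carrier_vec (2 * g)" "v \<in> carrier_vec (2 * g)" "w \<in> carrier_vec (2 * g)" for u v w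
  proof (rule eq_vecI)
    fix r assume "r < dim_vec (?\<phi> u + ?\<phi> v + ?\<phi> w)"
    then have r: "r < 2 * g" by (simp add: phi_off_def)
    have s: "(u + v + w) $ k = u $ k + v $ k + w $ k" if "k < 2 * g" for k
      using uvw that by (simp only: index_add_vec carrier_vecD)
    have s': "(if b then (u + v + w) $ k else 0) = (if b then u $ k else 0) + (if b then v $ k else 0) + (if b then w $ k else 0)" if "k < g" for k b
      using s[of k] that by simp
    have "(?\<phi> u + ?\<phi> v + ?\<phi> w) $ r = ?\<phi> u $ r + ?\<phi> v $ r + ?\<phi> w $ r"
      using r by (simp only: index_add_vec carrier_vecD[OF c])
    then show "?\<phi> (u + v + w) $ r = (?\<phi> u + ?\<phi> v + ?\<phi> w) $ r"
      unfolding idx[OF r] s[OF r] s'[OF ij(1)] s'[OF ij(2)] by (simp only: bit_off_affine)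
  qed (use uvw c[of "u + v + w"] c[of w] in auto)
  show "char_form g (?\<phi> v) x = char_form g v (rowact g (gen_off g i j) x)" if "v \<in> carrier_vec (2 * g)" for v x
  proof -
    have row: "rowact g (gen_off g i j) x c = x c + (if c = g + j then x i else 0) + (if c = g + i then x j else 0)" if c: "c < 2 * g" for c
    proof -
      have "rowact g (gen_off g i j) x c = (\<Sum>r<2 * g. x r * (if r = c then 1 else 0) + x r * (if r = i then (if c = g + j then 1 else 0) else 0)
         + x r * (if r = j then (if c = g + i then 1 else 0) else 0))"
        unfolding gen_off_def rowact_mat[OF c] by (intro sum.cong) (auto simp: algebra_simps)
      then show ?thesis unfolding sum.distrib using c ij by (simp add: sum_delta_right_int)
    qed
    let ?x' = "rowact g (gen_off g i j) x"
    have lowx: "?x' k = x k" if "k < g" for k using row[of k] that ij by simp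
    have hi: "?x' (g + i) = x (g + i) + x j" "?x' (g + j) = x (g + j) + x i" using row[of "g + i"] row[of "g + j"] ij by auto
    have ho: "?x' (g + k) = x (g + k)" if "k < g" "k \<noteq> i" "k \<noteq> j" for k using row[of "g + k"] that by simp
    have lowv: "?\<phi> v $ k = v $ k" if "k < g" for k using idx[of k v] that by simp
    have hv: "?\<phi> v $ (g + i) = v $ (g + i) + v $ j" "?\<phi> v $ (g + j) = v $ (g + j) + v $ i"
      using idx[of "g + i" v] idx[of "g + j" v] ij by auto
    have hov: "?\<phi> v $ (g + k) = v $ (g + k)" if "k < g" "k \<noteq> i" "k \<noteq> j" for k using idx[of "g + k" v] that by simp
    show ?thesis
      unfolding char_form_def sum_remove2[OF ij] hi hv lowx[OF ij(1)] lowx[OF ij(2)] lowv[OF ij(1)] lowv[OF ij(2)] of_int_add bit_off_form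
      by (rule arg_cong2[of _ _ _ _ "(+)"], rule refl, intro sum.cong refl) (simp add: lowx ho lowv hov)
  qed
qed

definition add_off :: "nat \<Rightarrow> nat \<Rightarrow> nat \<Rightarrow> complex mat \<Rightarrow> complex mat" where
  "add_off g i j \<tau> = mat g g (\<lambda>(k, l). \<tau> $$ (k, l) + (if l = j then (if k = i then 1 else 0) else 0) + (if l = i then (if k = j then 1 else 0) else 0))"

lemma quad_add_off:
  assumes "i < g" "j < g"
  shows "quad g (add_off g i j \<tau>) x = quad g \<tau> x + of_real (2 * x i * x j)"
proof -
  have "quad g (add_off g i j \<tau>) x = (\<Sum>k<g. (\<Sum>l<g. \<tau> $$ (k, l) * of_real (x k * x l) + (if l = j then (if k = i then 1 else 0) else 0) * of_real (x k * x l)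
      + (if l = i then (if k = j then 1 else 0) else 0) * of_real (x k * x l)))"
    unfolding quad_def by (intro sum.cong refl) (simp add: add_off_def algebra_simps)
  also have "\<dots> = quad g \<tau> x + (\<Sum>k<g. (if k = i then 1 else 0) * of_real (x k * x j)) + (\<Sum>k<g. (if k = j then 1 else 0) * of_real (x k * x i))"
    unfolding sum.distrib quad_def using assms by (simp add: sum_delta_complex)
  also have "(\<Sum>k<g. (if k = i then 1 else 0) * of_real (x k * x j)) = (1 * of_real (x i * x j) :: complex)"
    using assms by (subst sum_delta_complex) auto
  also have "(\<Sum>k<g. (if k = j then 1 else 0) * of_real (x k * x i)) = (1 * of_real (x j * x i) :: complex)"
    using assms by (subst sum_delta_complex) auto
  finally show ?thesis by simp
qed

lemma add_off_siegel:
  assumes "\<tau> \<in> siegel_space g" "i < g" "j < g"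
  shows "add_off g i j \<tau> \<in> siegel_space g"
proof -
  have "imag_quad g (add_off g i j \<tau>) x = imag_quad g \<tau> x" for x
    using arg_cong[OF quad_add_off[OF assms(2,3), of \<tau> x], of Im] by (simp add: Im_quad)
  moreover have "add_off g i j \<tau> $$ (k, l) = add_off g i j \<tau> $$ (l, k)" if "k < g" "l < g" for k l
    using that siegel_sym[OF assms(1) that] by (simp add: add_off_def)
  ultimately show ?thesis using assms(1) by (simp add: siegel_space_iff add_off_def)
qed

text \<open>The right side contains the carry of the addition as a polynomial in the lifted bits.
  This carry is the source of the cubic terms in the phase of an off-diagonal translation.\<close>

lemma lift_add: "lift (a + b) + b' = lift a + 2 * (b' * (1 - lift a))" if "b' = lift b"
  unfolding that by (cases a; cases b) simp_all

lemma theta_law_gen_off: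
  assumes ij: "i < g" "j < g" "i \<noteq> j"
  shows "theta_law g (gen_off g i j)"
proof -
  \<comment> \<open>The phase -1/2 from \<open>theta_int_add_offdiag\<close> and the two carries 1 -
    \<delta>_i and 1 - \<delta>_j, all multiplied by \<epsilon>_i \<epsilon>_j.\<close>
  let ?r = "\<lambda>v :: bit vec. 3 / 2 * real_of_int (lift (v $ i) * lift (v $ j)) - of_int (lift (v $ i) * lift (v $ j) * lift (v $ (g + i)))
       - of_int (lift (v $ i) * lift (v $ j) * lift (v $ (g + j)))"
  show ?thesis
  proof (rule theta_lawI[where \<phi> = "phi_off g i j" and M = "add_off g i j" and J = "\<lambda>_. 1\<^sub>m g" and \<kappa> = "\<lambda>_. 1" and r = ?r])
    show "char_action g (gen_off g i j) (phi_off g i j)" by (rule char_action_off[OF ij])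
    show "add_off g i j \<tau> \<in> siegel_space g" if "\<tau> \<in> siegel_space g" for \<tau> using that ij(1,2) by (rule add_off_siegel)
    show "map_mat of_int (gen_off g i j) * stack g \<tau> = stack g (add_off g i j \<tau>) * 1\<^sub>m g" for \<tau>
    proof (rule eq_matI)
      fix r c assume "r < dim_row (stack g (add_off g i j \<tau>) * 1\<^sub>m g)" "c < dim_col (stack g (add_off g i j \<tau>) * 1\<^sub>m g)"
      then have rc: "r < 2 * g" "c < g" using stack_carrier[of g "add_off g i j \<tau>"] by auto
      have "(map_mat of_int (gen_off g i j) * stack g \<tau>) $$ (r, c) =
        (\<Sum>k<2 * g. (if k = r then 1 else 0) * stack g \<tau> $$ (k, c) + (if k = g + j then (if r = i then 1 else 0) else 0) * stack g \<tau> $$ (k, c)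
          + (if k = g + i then (if r = j then 1 else 0) else 0) * stack g \<tau> $$ (k, c))"
        unfolding gen_off_def mult_stack_index[OF rc] by (intro sum.cong) (auto simp: algebra_simps)
      also have "\<dots> = stack g \<tau> $$ (r, c) + (if r = i then 1 else 0) * stack g \<tau> $$ (g + j, c) + (if r = j then 1 else 0) * stack g \<tau> $$ (g + i, c)"
        unfolding sum.distrib using rc ij by (simp add: sum_delta_complex)
      also have "\<dots> = stack g (add_off g i j \<tau>) $$ (r, c)"
        using rc ij by (auto simp: stack_index add_off_def)
      finally show "(map_mat of_int (gen_off g i j) * stack g \<tau>) $$ (r, c) = (stack g (add_off g i j \<tau>) * 1\<^sub>m g) $$ (r, c)"
        using stack_carrier[of g "add_off g i j \<tau>"] by simp
    qed (auto simp: gen_off_def carrier_matD[OF stack_carrier])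
    show "\<exists>k. 2 ^ (4 - d) * (\<Sum>v\<in>A. ?r v) = of_int (2 * k)"
      if A: "aff (2 * g) A" "card A = 2 ^ d" "d \<le> 4" for A d
    proof -
      obtain t2 t3 where t: "2 ^ (4 - d) * (\<Sum>v\<in>A. real_of_int (lift (v $ i) * lift (v $ j))) = of_int (4 * t2)"
        "2 ^ (4 - d) * (\<Sum>v\<in>A. real_of_int (lift (v $ i) * lift (v $ j) * lift (v $ (g + i)))) = of_int (2 * t3)"
        by (rule count_lift[OF A, of i j "g + i"]) (use ij in auto)
      obtain t4 where t4: "2 ^ (4 - d) * (\<Sum>v\<in>A. real_of_int (lift (v $ i) * lift (v $ j) * lift (v $ (g + j)))) = of_int (2 * t4)"
        by (rule count_lift[OF A, of i j "g + j"]) (use ij in auto)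
      have "2 ^ (4 - d) * (\<Sum>v\<in>A. ?r v) = 3 / 2 * (2 ^ (4 - d) * (\<Sum>v\<in>A. real_of_int (lift (v $ i) * lift (v $ j))))
         - 2 ^ (4 - d) * (\<Sum>v\<in>A. real_of_int (lift (v $ i) * lift (v $ j) * lift (v $ (g + i))))
         - 2 ^ (4 - d) * (\<Sum>v\<in>A. real_of_int (lift (v $ i) * lift (v $ j) * lift (v $ (g + j))))"
        unfolding sum_subtractf sum_distrib_left[symmetric] right_diff_distrib by (simp only: mult.left_commute)
      also have "\<dots> = of_int (2 * (3 * t2 - t3 - t4))" unfolding t t4 by simp
      finally show ?thesis by blast
    qed
    show "theta g (phi_off g i j v) (add_off g i j \<tau>) = 1 * exp (pi * \<i> * of_real (?r v)) * theta g v \<tau>"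
      if \<tau>: "\<tau> \<in> siegel_space g" and v: "v \<in> carrier_vec (2 * g)" for \<tau> v
    proof -
      let ?v = "phi_off g i j v"
      let ?e = "\<lambda>k. lift (v $ k)" and ?d = "\<lambda>k. lift (v $ (g + k))" and ?d' = "\<lambda>k. lift (?v $ (g + k))"
      have ve: "?v $ k = v $ k" if "k < g" for k using that by (simp add: phi_off_def)
      have vd: "?v $ (g + i) = v $ (g + i) + v $ j" "?v $ (g + j) = v $ (g + j) + v $ i"
        using ij by (auto simp: phi_off_def)
      have vo: "?v $ (g + k) = v $ (g + k)" if "k < g" "k \<noteq> i" "k \<noteq> j" for k
        using that by (simp add: phi_off_def)
      define a b where "a = ?e j * (1 - ?d i)" and "b = ?e i * (1 - ?d j)"
      have "theta g ?v (add_off g i j \<tau>) = theta_int g (add_off g i j \<tau>) (\<lambda>k. lift (?v $ k)) ?d'"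
        by (rule theta_lift) (use add_off_siegel[OF \<tau> ij(1,2)] in \<open>auto simp: phi_off_def\<close>)
      also have "\<dots> = theta_int g (add_off g i j \<tau>) ?e ?d'" by (rule theta_int_cong) (simp_all add: ve)
      also have "\<dots> = exp (pi * \<i> * of_real (- of_int (?e i * ?e j) / 2)) * theta_int g \<tau> ?e (?d'(i := ?d' i + ?e j, j := ?d' j + ?e i))"
        by (rule theta_int_add_offdiag[OF ij quad_add_off[OF ij(1,2)]])
      also have "theta_int g \<tau> ?e (?d'(i := ?d' i + ?e j, j := ?d' j + ?e i)) = theta_int g \<tau> ?e ((?d(i := ?d i + 2 * a))(j := (?d(i := ?d i + 2 * a)) j + 2 * b))"
        unfolding a_def b_def vd lift_add[OF refl] using ij by (intro theta_int_cong) (auto simp: vo)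
      also have "\<dots> = exp (pi * \<i> * of_int (b * ?e j)) * (exp (pi * \<i> * of_int (a * ?e i)) * theta_int g \<tau> ?e ?d)"
        by (simp only: theta_int_shift_d[OF ij(2)] theta_int_shift_d[OF ij(1), of \<tau> ?e ?d a])
      finally have "theta g ?v (add_off g i j \<tau>) = exp (pi * \<i> * of_real (- of_int (?e i * ?e j) / 2)) * exp (pi * \<i> * of_int (b * ?e j)) * exp (pi * \<i> * of_int (a * ?e i)) * theta_int g \<tau> ?e ?d"
        by (simp only: mult.assoc)
      also have "exp (pi * \<i> * of_real (- of_int (?e i * ?e j) / 2)) * exp (pi * \<i> * of_int (b * ?e j)) * exp (pi * \<i> * of_int (a * ?e i)) = exp (pi * \<i> * of_real (?r v))"
        unfolding exp_pi_i_add[symmetric] a_def b_def by (rule arg_cong[of _ _ exp]) (simp add: field_simps)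
      also have "theta_int g \<tau> ?e ?d = theta g v \<tau>" by (rule theta_lift[OF v \<tau>, symmetric])
      finally show ?thesis by simp
    qed
  qed auto
qed

definition phi_inv :: "nat \<Rightarrow> nat \<Rightarrow> bit vec \<Rightarrow> bit vec" where
  "phi_inv g j v = vec (2 * g) (\<lambda>r. if r = j then v $ (g + j) else if r = g + j then v $ j else v $ r)"

lemma bit_inv_form: "(X::bit) * Q + X * E + Q * D = Q * (- X) + Q * D + (- X) * E"
  by (cases X; cases Q; cases D; cases E) simp_all

lemma char_action_inv:
  assumes j: "j < g"
  shows "char_action g (gen_inv g j) (phi_inv g j)"
proof (rule char_actionI)
  let ?\<phi> = "phi_inv g j"
  have idx: "?\<phi> v $ r = (if r = j then v $ (g + j) else if r = g + j then v $ j else v $ r)" if "r < 2 * g" for v r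
    using that by (simp add: phi_inv_def)
  show c: "?\<phi> v \<in> carrier_vec (2 * g)" for v by (simp add: phi_inv_def)
  show "?\<phi> (?\<phi> v) = v" if "v \<in> carrier_vec (2 * g)" for v
  proof (rule eq_vecI)
    fix r assume "r < dim_vec v"
    then have r: "r < 2 * g" using that by simp
    show "?\<phi> (?\<phi> v) $ r = v $ r" using j r by (simp add: idx)
  qed (use that c[of "?\<phi> v"] in auto)
  show "?\<phi> (u + v + w) = ?\<phi> u + ?\<phi> v + ?\<phi> w" if uvw: "u \<in> carrier_vec (2 * g)" "v \<in> carrier_vec (2 * g)" "w \<in> carrier_vec (2 * g)" for u v w
  proof (rule eq_vecI)
    fix r assume "r < dim_vec (?\<phi> u + ?\<phi> v + ?\<phi> w)"
    then have r: "r < 2 * g" by (simp add: phi_inv_def)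
    have s: "(u + v + w) $ k = u $ k + v $ k + w $ k" if "k < 2 * g" for k
      using uvw that by (simp only: index_add_vec carrier_vecD)
    have "(?\<phi> u + ?\<phi> v + ?\<phi> w) $ r = ?\<phi> u $ r + ?\<phi> v $ r + ?\<phi> w $ r"
      using r by (simp only: index_add_vec carrier_vecD[OF c])
    then show "?\<phi> (u + v + w) $ r = (?\<phi> u + ?\<phi> v + ?\<phi> w) $ r"
      unfolding idx[OF r] using s[OF r] s[of "g + j"] s[of j] j by (simp only: if_split) auto
  qed (use uvw c[of "u + v + w"] c[of w] in auto)
  show "char_form g (?\<phi> v) x = char_form g v (rowact g (gen_inv g j) x)" if "v \<in> carrier_vec (2 * g)" for v x
  proof -
    have row: "rowact g (gen_inv g j) x c = (if c = j then x (g + j) else if c = g + j then - x j else x c)" if c: "c < 2 * g" for c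
    proof -
      have "rowact g (gen_inv g j) x c = (\<Sum>r<2 * g. x r * (if r = c then (if c \<noteq> j \<and> c \<noteq> g + j then 1 else 0) else 0) + x r * (if r = j then (if c = g + j then - 1 else 0) else 0)
         + x r * (if r = g + j then (if c = j then 1 else 0) else 0))"
        unfolding gen_inv_def rowact_mat[OF c]
      proof (intro sum.cong refl)
        fix r show "x r * (case (r, c) of (r, c) \<Rightarrow> (if r = c \<and> r \<noteq> j \<and> r \<noteq> g + j then 1 else 0) + (if r = j \<and> c = g + j then - 1 else 0) + (if r = g + j \<and> c = j then 1 else 0)) =
          x r * (if r = c then (if c \<noteq> j \<and> c \<noteq> g + j then 1 else 0) else 0) + x r * (if r = j then (if c = g + j then - 1 else 0) else 0)
           + x r * (if r = g + j then (if c = j then 1 else 0) else 0)"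
          unfolding prod.case distrib_left by (cases "r = c"; cases "r = j"; cases "r = g + j") simp_all
      qed
      then show ?thesis unfolding sum.distrib using c j by (simp add: sum_delta_right_int)
    qed
    let ?x' = "rowact g (gen_inv g j) x"
    have S: "(\<Sum>k<g. f k) = f j + (\<Sum>k\<in>{..<g} - {j}. f k)" for f :: "nat \<Rightarrow> bit"
      using j by (simp add: sum.remove)
    have x: "?x' j = x (g + j)" "?x' (g + j) = - x j" using row[of j] row[of "g + j"] j by auto
    have v: "?\<phi> v $ j = v $ (g + j)" "?\<phi> v $ (g + j) = v $ j" using idx[of j v] idx[of "g + j" v] j by auto
    show ?thesis
      unfolding char_form_def S x v of_int_minus
    proof (rule arg_cong2[of _ _ _ _ "(+)"], rule bit_inv_form, intro sum.cong refl)
      fix k assume "k \<in> {..<g} - {j}"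
      then have k: "k < 2 * g" "g + k < 2 * g" "k \<noteq> j" "g + k \<noteq> j" "k \<noteq> g + j" "g + k \<noteq> g + j" using j by auto
      show "of_int (x k) * of_int (x (g + k)) + of_int (x k) * ?\<phi> v $ (g + k) + of_int (x (g + k)) * ?\<phi> v $ k =
        of_int (?x' k) * of_int (?x' (g + k)) + of_int (?x' k) * v $ (g + k) + of_int (?x' (g + k)) * v $ k"
        unfolding row[OF k(1)] row[OF k(2)] idx[OF k(1)] idx[OF k(2)] using k by (simp only: if_False)
    qed
  qed
qed

text \<open>Expansion along column \<open>j\<close>, whose only possibly nonzero entry lies in the
  replaced row.\<close>

lemma det_row_replaced:
  assumes j: "j < g"
  shows "det (mat g g (\<lambda>(r, c). if r = j then f c else if r = c then 1 else 0)) = (f j :: complex)"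
proof -
  let ?A = "mat g g (\<lambda>(r, c). if r = j then f c else if r = c then 1 else 0) :: complex mat"
  have A: "?A \<in> carrier_mat g g" by simp
  have "det ?A = (\<Sum>i<g. ?A $$ (i, j) * cofactor ?A i j)" by (rule laplace_expansion_column[OF A j])
  also have "\<dots> = (\<Sum>i<g. if i = j then f j * cofactor ?A j j else 0)" using j by (intro sum.cong) auto
  also have "\<dots> = f j * cofactor ?A j j" using j by simp
  also have "mat_delete ?A j j = 1\<^sub>m (g - 1)"
    unfolding mat_delete_def by (rule eq_matI) (use j in auto)
  then have "cofactor ?A j j = 1" by (simp add: cofactor_def)
  finally show ?thesis by simp
qed

text \<open>C\<tau> + D is the identity with row \<open>j\<close> replaced by that of \<tau>, so its
  determinant is \<tau>_jj. The common factor is a square root of -\<i> \<tau>_jj, and \<i>^8 = 1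
  removes the fourth root of unity from its 16th power.\<close>

lemma theta_law_gen_inv:
  assumes j: "j < g"
  shows "theta_law g (gen_inv g j)"
proof -
  let ?J = "\<lambda>\<tau>. mat g g (\<lambda>(r, c). if r = j then \<tau> $$ (j, c) else if r = c then 1 else 0) :: complex mat"
  let ?r = "\<lambda>v :: bit vec. - (1 / 2) * real_of_int (lift (v $ j) * lift (v $ (g + j)))"
  show ?thesis
  proof (rule theta_lawI[where \<phi> = "phi_inv g j" and M = "inv_at g j" and J = ?J and \<kappa> = "\<lambda>\<tau>. csqrt (- \<i> * \<tau> $$ (j, j))" and r = ?r])
    show "char_action g (gen_inv g j) (phi_inv g j)" by (rule char_action_inv[OF j])
    show "inv_at g j \<tau> \<in> siegel_space g" if "\<tau> \<in> siegel_space g" for \<tau> using that j by (rule inv_at_siegel)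
    show "?J \<tau> \<in> carrier_mat g g" for \<tau> by simp
    show "det (?J \<tau>) \<noteq> 0 \<and> csqrt (- \<i> * \<tau> $$ (j, j)) ^ 16 = det (?J \<tau>) ^ 8" if "\<tau> \<in> siegel_space g" for \<tau>
    proof -
      have "csqrt (- \<i> * \<tau> $$ (j, j)) ^ 16 = ((csqrt (- \<i> * \<tau> $$ (j, j)))\<^sup>2) ^ 8" by (simp only: power_mult[symmetric]) simp
      also have "\<dots> = (\<i> * \<tau> $$ (j, j)) ^ 8" by simp
      also have "\<dots> = \<tau> $$ (j, j) ^ 8"
      proof -
        have "\<i> ^ 8 = (\<i> ^ 4) ^ 2" by (simp only: power_mult[symmetric]) simp
        then have "\<i> ^ 8 = 1" by simp
        then show ?thesis by (simp only: power_mult_distrib mult_1)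
      qed
      finally show ?thesis using siegel_Im_diag_pos[OF that j] by (auto simp: det_row_replaced[OF j])
    qed
    show "map_mat of_int (gen_inv g j) * stack g \<tau> = stack g (inv_at g j \<tau>) * ?J \<tau>" if \<tau>: "\<tau> \<in> siegel_space g" for \<tau>
    proof (rule eq_matI)
      have t: "\<tau> $$ (j, j) \<noteq> 0" using siegel_Im_diag_pos[OF \<tau> j] by auto
      fix r c assume "r < dim_row (stack g (inv_at g j \<tau>) * ?J \<tau>)" "c < dim_col (stack g (inv_at g j \<tau>) * ?J \<tau>)"
      then have rc: "r < 2 * g" "c < g" by (auto simp: stack_def)
      have "(map_mat of_int (gen_inv g j) * stack g \<tau>) $$ (r, c) =
        (\<Sum>k<2 * g. (if k = r then (if r \<noteq> j \<and> r \<noteq> g + j then 1 else 0) else 0) * stack g \<tau> $$ (k, c)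
          + (if k = g + j then (if r = j then - 1 else 0) else 0) * stack g \<tau> $$ (k, c)
          + (if k = j then (if r = g + j then 1 else 0) else 0) * stack g \<tau> $$ (k, c))"
        unfolding gen_inv_def mult_stack_index[OF rc] using j by (intro sum.cong) (auto simp: algebra_simps)
      also have "\<dots> = (if r = j then - stack g \<tau> $$ (g + j, c) else if r = g + j then stack g \<tau> $$ (j, c) else stack g \<tau> $$ (r, c))"
        unfolding sum.distrib using rc j by (simp add: sum_delta_complex)
      also have "\<dots> = stack g (inv_at g j \<tau>) $$ (r, j) * \<tau> $$ (j, c) + (if c = j then 0 else stack g (inv_at g j \<tau>) $$ (r, c))"
        using rc j t by (auto simp: stack_index inv_at_def field_simps)
      also have "\<dots> = (\<Sum>k<g. (if k = j then \<tau> $$ (j, c) else 0) * stack g (inv_at g j \<tau>) $$ (r, k) + (if k = c then (if c = j then 0 else 1) else 0) * stack g (inv_at g j \<tau>) $$ (r, k))"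
        unfolding sum.distrib using rc j by (simp add: sum_delta_complex)
      also have "\<dots> = (\<Sum>k<g. stack g (inv_at g j \<tau>) $$ (r, k) * ?J \<tau> $$ (k, c))"
        using rc j by (intro sum.cong) auto
      also have "\<dots> = (stack g (inv_at g j \<tau>) * ?J \<tau>) $$ (r, c)"
        using rc by (simp add: stack_def scalar_prod_def atLeast0LessThan)
      finally show "(map_mat of_int (gen_inv g j) * stack g \<tau>) $$ (r, c) = (stack g (inv_at g j \<tau>) * ?J \<tau>) $$ (r, c)" .
    qed (auto simp: gen_inv_def stack_def)
    show "\<exists>k. 2 ^ (4 - d) * (\<Sum>v\<in>A. ?r v) = of_int (2 * k)"
      if A: "aff (2 * g) A" "card A = 2 ^ d" "d \<le> 4" for A d
    proof -
      obtain t where t: "2 ^ (4 - d) * (\<Sum>v\<in>A. real_of_int (lift (v $ j) * lift (v $ (g + j)))) = of_int (4 * t)"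
        by (rule count_lift[OF A, of j "g + j" j]) (use j in auto)
      have "2 ^ (4 - d) * (\<Sum>v\<in>A. ?r v) = - (1 / 2) * (2 ^ (4 - d) * (\<Sum>v\<in>A. real_of_int (lift (v $ j) * lift (v $ (g + j)))))"
        unfolding sum_distrib_left[symmetric] by (simp only: mult.left_commute)
      also have "\<dots> = of_int (2 * (- t))" unfolding t by simp
      finally show ?thesis by blast
    qed
    show "theta g (phi_inv g j v) (inv_at g j \<tau>) = csqrt (- \<i> * \<tau> $$ (j, j)) * exp (pi * \<i> * of_real (?r v)) * theta g v \<tau>"
      if \<tau>: "\<tau> \<in> siegel_space g" and v: "v \<in> carrier_vec (2 * g)" for \<tau> v
    proof -
      let ?v = "phi_inv g j v"
      let ?e = "\<lambda>k. lift (v $ k)" and ?d = "\<lambda>k. lift (v $ (g + k))" and ?e' = "\<lambda>k. lift (?v $ k)" and ?d' = "\<lambda>k. lift (?v $ (g + k))"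
      have "theta g ?v (inv_at g j \<tau>) = theta_int g (inv_at g j \<tau>) ?e' ?d'"
        by (rule theta_lift) (use inv_at_siegel[OF \<tau> j] in \<open>auto simp: phi_inv_def\<close>)
      also have "\<dots> = csqrt (- \<i> * \<tau> $$ (j, j)) * exp (pi * \<i> * of_real (- of_int (?e' j * ?d' j) / 2)) * theta_int g \<tau> (?e'(j := ?d' j)) (?d'(j := ?e' j))"
        by (rule theta_int_inv_at[OF \<tau> j])
      also have "theta_int g \<tau> (?e'(j := ?d' j)) (?d'(j := ?e' j)) = theta_int g \<tau> ?e ?d"
        by (rule theta_int_cong) (use j in \<open>auto simp: phi_inv_def\<close>)
      also have "\<dots> = theta g v \<tau>" by (rule theta_lift[OF v \<tau>, symmetric])
      also have "- of_int (?e' j * ?d' j) / 2 = ?r v" using j by (simp add: phi_inv_def)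
      finally show ?thesis .
    qed
  qed
qed

lemma theta_law_one: "theta_law g (1\<^sub>m (2 * g))"
proof (cases "g = 0")
  case False
  \<comment> \<open>In positive genus the identity is the translation by 0; genus 0 has no
    generators and is treated directly.\<close>
  have "gen_diag g 0 0 = 1\<^sub>m (2 * g)" by (rule eq_matI) (auto simp: gen_diag_def)
  then show ?thesis using theta_law_gen_diag[of 0 g 0] False by simp
next
  case True
  show ?thesis
  proof (rule theta_lawI[where \<phi> = "\<lambda>v. v" and M = "\<lambda>\<tau>. \<tau>" and J = "\<lambda>_. 1\<^sub>m g" and \<kappa> = "\<lambda>_. 1" and r = "\<lambda>_. 0"])
    show "char_action g (1\<^sub>m (2 * g)) (\<lambda>v. v)" by (rule char_actionI) (auto simp: True char_form_def)
    show "map_mat of_int (1\<^sub>m (2 * g)) * stack g \<tau> = stack g \<tau> * 1\<^sub>m g" for \<tau>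
      by (rule eq_matI) (auto simp: True stack_def)
    show "\<exists>k. 2 ^ (4 - d) * (\<Sum>v\<in>A. 0) = real_of_int (2 * k)" for A :: "bit vec set" and d by (intro exI[of _ 0]) simp
  qed auto
qed

section \<open>From the generators to the forms on \<Gamma>(1,2)\<close>

lemma theta_law_Sp_int:
  assumes "\<gamma> \<in> Sp_int g"
  shows "theta_law g \<gamma>"
proof -
  have "\<gamma> \<in> gens g" using assms by (simp add: Sp_int_eq_gens)
  then show ?thesis
  proof (induction rule: gens.induct)
    case one
    show ?case by (rule theta_law_one)
  next
    case (step s h)
    have "theta_law g s" using step(1) by (cases rule: base_gens.cases) (auto intro: theta_law_gen_diag theta_law_gen_off theta_law_gen_inv)
    from theta_law_mult[OF this step.IH base_gens_carrier[OF step(1)] gens_carrier[OF step(2)]] show ?case .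
  qed
qed

text \<open>The coordinates of \<phi>(0) are the values of its quadratic form at the unit vectors.
  By compatibility with \<gamma> these are the products of the two halves of a row of \<gamma>, that
  is, the diagonal entries of A B^t and C D^t modulo 2.\<close>

lemma Gamma12_fixes_zero:
  assumes \<gamma>: "\<gamma> \<in> Gamma12 g" and \<phi>: "char_action g \<gamma> \<phi>"
  shows "\<phi> (0\<^sub>v (2 * g)) = 0\<^sub>v (2 * g)"
proof -
  let ?z = "0\<^sub>v (2 * g) :: bit vec"
  have c: "\<gamma> \<in> carrier_mat (2 * g) (2 * g)" using \<gamma> by (simp add: Gamma12_def Sp_int_def)
  have ev: "even (\<Sum>k<g. \<gamma> $$ (i, k) * \<gamma> $$ (i, g + k)) \<and> even (\<Sum>k<g. \<gamma> $$ (g + i, k) * \<gamma> $$ (g + i, g + k))" if "i < g" for i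
    using \<gamma> c that by (simp add: Gamma12_def split_block_def Let_def scalar_prod_def atLeast0LessThan add.commute[of g])
  have Q: "char_form g (\<phi> ?z) x = char_form g ?z (rowact g \<gamma> x)" for x using \<phi> by (simp add: char_action_def)
  have row: "rowact g \<gamma> (unit_fn r) k = \<gamma> $$ (r, k)" if "r < 2 * g" for r k
  proof -
    have "rowact g \<gamma> (unit_fn r) k = (\<Sum>s<2 * g. (if s = r then 1 else 0) * \<gamma> $$ (s, k))"
      unfolding rowact_def unit_fn_def ..
    then show ?thesis using that by (simp add: sum_delta_int)
  qed
  have R: "char_form g ?z (rowact g \<gamma> (unit_fn r)) = of_int (\<Sum>k<g. \<gamma> $$ (r, k) * \<gamma> $$ (r, g + k))" if "r < 2 * g" for r
  proof -
    have "char_form g ?z (rowact g \<gamma> (unit_fn r)) = (\<Sum>k<g. of_int (\<gamma> $$ (r, k)) * of_int (\<gamma> $$ (r, g + k)))"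
      unfolding char_form_def row[OF that] by (intro sum.cong refl) simp
    then show ?thesis by (simp only: of_int_sum of_int_mult)
  qed
  have L1: "char_form g v (unit_fn i) = v $ (g + i)" if "i < g" for i v
  proof -
    have "char_form g v (unit_fn i) = (\<Sum>k<g. if k = i then v $ (g + i) else 0)"
      unfolding char_form_def using that by (intro sum.cong refl) (auto simp: unit_fn_def)
    then show ?thesis using that by (simp only: sum.delta finite_lessThan lessThan_iff if_True)
  qed
  have L2: "char_form g v (unit_fn (g + i)) = v $ i" if "i < g" for i v
  proof -
    have "char_form g v (unit_fn (g + i)) = (\<Sum>k<g. if k = i then v $ i else 0)"
      unfolding char_form_def using that by (intro sum.cong refl) (auto simp: unit_fn_def)
    then show ?thesis using that by (simp only: sum.delta finite_lessThan lessThan_iff if_True)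
  qed
  have z1: "\<phi> ?z $ (g + i) = 0" if "i < g" for i
    using Q[of "unit_fn i"] R[of i] L1[OF that, of "\<phi> ?z"] ev[OF that] that by (simp add: of_int_bit)
  have z2: "\<phi> ?z $ i = 0" if "i < g" for i
    using Q[of "unit_fn (g + i)"] R[of "g + i"] L2[OF that, of "\<phi> ?z"] ev[OF that] that by (simp add: of_int_bit)
  have "\<phi> ?z \<in> carrier_vec (2 * g)" using \<phi> by (auto simp: char_action_def bij_betw_def)
  then show ?thesis
  proof (intro eq_vecI)
    fix r assume "r < dim_vec ?z"
    then show "\<phi> ?z $ r = ?z $ r" using z1[of "r - g"] z2[of r] by (cases "r < g") auto
  qed auto
qed

text \<open>The lower half of the relation between the stacked matrices says j = C\<tau> + D, and
  the upper half says A\<tau> + B = M j; the determinant condition permits dividing by j.\<close>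

lemma moves_to_action:
  assumes \<gamma>: "\<gamma> \<in> carrier_mat (2 * g) (2 * g)" and \<tau>: "\<tau> \<in> siegel_space g" and m: "moves_to g \<gamma> \<phi> \<tau> M j"
  shows "automorphy_mat g \<gamma> \<tau> = j" "siegel_action g \<gamma> \<tau> = M"
proof -
  have tc: "\<tau> \<in> carrier_mat g g" and Mc: "M \<in> carrier_mat g g" and jc: "j \<in> carrier_mat g g"
    and st: "map_mat of_int \<gamma> * stack g \<tau> = stack g M * j" and dj: "det j \<noteq> 0"
    using \<tau> m by (auto simp: moves_to_def siegel_space_def)
  have split: "(\<Sum>k<2 * g. f k) = (\<Sum>k<g. f k) + (\<Sum>k<g. f (g + k))" for f :: "nat \<Rightarrow> complex"
    using sum_lessThan_add[of f g g] by (simp add: mult_2 add.commute)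
  have L: "(map_mat of_int \<gamma> * stack g \<tau>) $$ (r, c) = (\<Sum>k<g. of_int (\<gamma> $$ (r, k)) * \<tau> $$ (k, c)) + of_int (\<gamma> $$ (r, g + c))"
    if "r < 2 * g" "c < g" for r c
  proof -
    have "(map_mat of_int \<gamma> * stack g \<tau>) $$ (r, c) = (\<Sum>k<2 * g. of_int (\<gamma> $$ (r, k)) * stack g \<tau> $$ (k, c))"
      using that \<gamma> by (simp add: stack_def scalar_prod_def atLeast0LessThan)
    also have "\<dots> = (\<Sum>k<g. of_int (\<gamma> $$ (r, k)) * \<tau> $$ (k, c)) + (\<Sum>k<g. (if k = c then of_int (\<gamma> $$ (r, g + c)) else 0))"
      unfolding split using that by (intro arg_cong2[of _ _ _ _ "(+)"] sum.cong refl) (auto simp: stack_index)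
    finally show ?thesis using that by simp
  qed
  have R: "(stack g M * j) $$ (r, c) = (\<Sum>k<g. stack g M $$ (r, k) * j $$ (k, c))" if "r < 2 * g" "c < g" for r c
    using that jc by (simp add: stack_def scalar_prod_def atLeast0LessThan)
  have lower: "(stack g M * j) $$ (g + r, c) = j $$ (r, c)" if "r < g" "c < g" for r c
  proof -
    have "(stack g M * j) $$ (g + r, c) = (\<Sum>k<g. (if k = r then 1 else 0) * j $$ (k, c))"
      using that by (subst R) (auto simp: stack_index intro!: sum.cong)
    then show ?thesis using that by (simp add: sum_delta_complex)
  qed
  have upper: "(stack g M * j) $$ (r, c) = (M * j) $$ (r, c)" if "r < g" "c < g" for r c
    using that Mc jc by (subst R) (auto simp: stack_index scalar_prod_def atLeast0LessThan)
  show a: "automorphy_mat g \<gamma> \<tau> = j"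
  proof (rule eq_matI)
    fix r c assume "r < dim_row j" "c < dim_col j"
    then have rc: "r < g" "c < g" using jc by auto
    then have "automorphy_mat g \<gamma> \<tau> $$ (r, c) = (\<Sum>k<g. of_int (\<gamma> $$ (g + r, k)) * \<tau> $$ (k, c)) + of_int (\<gamma> $$ (g + r, g + c))"
      using \<gamma> tc by (simp add: automorphy_mat_def split_block_def Let_def scalar_prod_def atLeast0LessThan add.commute)
    then show "automorphy_mat g \<gamma> \<tau> $$ (r, c) = j $$ (r, c)"
      using L[of "g + r" c] lower[OF rc] st rc by simp
  qed (use jc \<gamma> tc in \<open>auto simp: automorphy_mat_def split_block_def Let_def\<close>)
  have top: "(case split_block \<gamma> g g of (A, B, C, D) \<Rightarrow> map_mat of_int A * \<tau> + map_mat of_int B) = M * j"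
  proof (rule eq_matI)
    fix r c assume "r < dim_row (M * j)" "c < dim_col (M * j)"
    then have rc: "r < g" "c < g" using Mc jc by auto
    then have "(case split_block \<gamma> g g of (A, B, C, D) \<Rightarrow> map_mat of_int A * \<tau> + map_mat of_int B) $$ (r, c) =
        (\<Sum>k<g. of_int (\<gamma> $$ (r, k)) * \<tau> $$ (k, c)) + of_int (\<gamma> $$ (r, g + c))"
      using \<gamma> tc by (simp add: split_block_def Let_def scalar_prod_def atLeast0LessThan add.commute)
    then show "(case split_block \<gamma> g g of (A, B, C, D) \<Rightarrow> map_mat of_int A * \<tau> + map_mat of_int B) $$ (r, c) = (M * j) $$ (r, c)"
      using L[of r c] upper[OF rc] st rc by simp
  qed (use Mc jc \<gamma> tc in \<open>auto simp: split_block_def Let_def\<close>)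
  have "mat_inverse j \<noteq> None"
  proof
    assume "mat_inverse j = None"
    from mat_inverse(1)[OF jc this] have "j \<notin> Units (ring_mat TYPE(complex) g undefined)" .
    with det_non_zero_imp_unit[OF jc dj, of undefined] show False by blast
  qed
  then obtain j' where j': "mat_inverse j = Some j'" by blast
  from mat_inverse(2)[OF jc j'] have inv: "j * j' = 1\<^sub>m g" "j' \<in> carrier_mat g g" by auto
  have "siegel_action g \<gamma> \<tau> = (case split_block \<gamma> g g of (A, B, C, D) \<Rightarrow> map_mat of_int A * \<tau> + map_mat of_int B) * j'"
    by (simp add: siegel_action_def a j' split: prod.split)
  also have "\<dots> = M * (j * j')" unfolding top by (rule assoc_mult_mat[OF Mc jc inv(2)])
  also have "\<dots> = M" using inv(1) Mc by simp
  finally show "siegel_action g \<gamma> \<tau> = M" .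
qed

lemma G_form_eq: "G_form g i \<tau> = (\<Sum>V\<in>{V. lin (2 * g) V \<and> card V = 2 ^ i}. theta_prod g V \<tau> ^ 2 ^ (4 - i))"
  by (simp add: G_form_def char_subspaces_eq)

lemma finite_lin_sets: "finite {V. lin N V \<and> P V}"
  by (rule finite_subset[of _ "Pow (carrier_vec N)"]) (auto simp: lin_def)

lemma G_form_transform:
  assumes \<gamma>: "\<gamma> \<in> Gamma12 g" and \<tau>: "\<tau> \<in> siegel_space g" and i: "i \<le> 4"
  shows "G_form g i (siegel_action g \<gamma> \<tau>) = det (automorphy_mat g \<gamma> \<tau>) ^ 8 * G_form g i \<tau>"
proof -
  have Sp: "\<gamma> \<in> Sp_int g" and c: "\<gamma> \<in> carrier_mat (2 * g) (2 * g)" using \<gamma> by (auto simp: Gamma12_def Sp_int_def)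
  obtain \<phi> M j where \<phi>: "char_action g \<gamma> \<phi>" and m: "moves_to g \<gamma> \<phi> \<tau> M j"
    using theta_law_Sp_int[OF Sp] \<tau> unfolding theta_law_def by blast
  note eqs = moves_to_action[OF c \<tau> m]
  let ?C = "carrier_vec (2 * g) :: bit vec set" and ?S = "{V. lin (2 * g) V \<and> card V = 2 ^ i}"
  have z: "\<phi> (0\<^sub>v (2 * g)) = 0\<^sub>v (2 * g)" by (rule Gamma12_fixes_zero[OF \<gamma> \<phi>])
  have inj: "inj_on \<phi> ?C" using \<phi> by (auto simp: char_action_def bij_betw_def)
  have add: "\<phi> (u + v) = \<phi> u + \<phi> v" if "u \<in> ?C" "v \<in> ?C" for u v
  proof -
    have im: "\<phi> u \<in> ?C" "\<phi> v \<in> ?C" using \<phi> that by (auto simp: char_action_def bij_betw_def)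
    have "\<phi> (u + v + 0\<^sub>v (2 * g)) = \<phi> u + \<phi> v + \<phi> (0\<^sub>v (2 * g))" by (rule char_action_add[OF \<phi> that]) simp
    then show ?thesis using that im z by simp
  qed
  have lin_im: "\<phi> ` V \<in> ?S" if "V \<in> ?S" for V
  proof -
    have V: "lin (2 * g) V" "card V = 2 ^ i" using that by auto
    note a = aff_image[OF \<phi> lin_imp_aff[OF V(1)]]
    have "lin (2 * g) (\<phi> ` V)"
      unfolding lin_def
    proof (intro conjI ballI)
      show "\<phi> ` V \<subseteq> ?C" using a(1) by (simp add: aff_def)
      have "0\<^sub>v (2 * g) \<in> V" using V(1) by (simp add: lin_def)
      then show "0\<^sub>v (2 * g) \<in> \<phi> ` V" using z by (metis imageI)
      fix x y assume "x \<in> \<phi> ` V" "y \<in> \<phi> ` V"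
      then obtain u v where uv: "u \<in> V" "v \<in> V" "x = \<phi> u" "y = \<phi> v" by blast
      have "x + y = \<phi> (u + v)" using add[of u v] lin_carrier[OF V(1)] uv by simp
      moreover have "u + v \<in> V" using V(1) uv by (simp add: lin_def)
      ultimately show "x + y \<in> \<phi> ` V" by simp
    qed
    then show ?thesis using a(2) V(2) by simp
  qed
  have bij: "bij_betw ((`) \<phi>) ?S ?S"
    unfolding bij_betw_def
  proof
    show inj': "inj_on ((`) \<phi>) ?S"
    proof (rule inj_onI)
      fix V W assume "V \<in> ?S" "W \<in> ?S" "\<phi> ` V = \<phi> ` W"
      then show "V = W" using inj_on_image_eq_iff[OF inj, of V W] by (auto simp: lin_def)
    qed
    show "(`) \<phi> ` ?S = ?S" by (rule endo_inj_surj[OF finite_lin_sets _ inj']) (use lin_im in blast)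
  qed
  have "G_form g i M = (\<Sum>V\<in>?S. theta_prod g (\<phi> ` V) M ^ 2 ^ (4 - i))"
    unfolding G_form_eq by (rule sum.reindex_bij_betw[OF bij, symmetric])
  also have "\<dots> = (\<Sum>V\<in>?S. det j ^ 8 * theta_prod g V \<tau> ^ 2 ^ (4 - i))"
    using m i lin_imp_aff by (intro sum.cong refl) (auto simp: moves_to_def)
  also have "\<dots> = det j ^ 8 * G_form g i \<tau>" by (simp add: G_form_eq sum_distrib_left)
  finally show ?thesis by (simp only: eqs)
qed

lemma siegel_holomorphic_theta: "v \<in> carrier_vec (2 * g) \<Longrightarrow> siegel_holomorphic g (theta g v)"
  by (rule siegel_holomorphic_cong[OF siegel_holomorphic_theta_int]) (rule theta_lift[symmetric])

lemma siegel_holomorphic_G_form: "siegel_holomorphic g (G_form g i)"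
  unfolding G_form_eq[abs_def] theta_prod_def
  by (intro siegel_holomorphic_sum siegel_holomorphic_power siegel_holomorphic_prod siegel_holomorphic_theta)
     (auto simp: lin_def)

lemma siegel_holomorphic_cmult: "siegel_holomorphic g f \<Longrightarrow> siegel_holomorphic g (\<lambda>\<tau>. c * f \<tau>)"
  by (intro siegel_holomorphic_mult siegel_holomorphic_const)

lemma modular_form_sum_G:
  assumes "g \<noteq> 1"
  shows "modular_form g 8 (Gamma12 g) (\<lambda>\<tau>. \<Sum>i\<le>4. c i * G_form g i \<tau>)"
  unfolding modular_form_def
proof (intro conjI ballI impI)
  show "siegel_holomorphic g (\<lambda>\<tau>. \<Sum>i\<le>4. c i * G_form g i \<tau>)"
    by (intro siegel_holomorphic_sum siegel_holomorphic_cmult siegel_holomorphic_G_form)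
  show "(\<Sum>i\<le>4. c i * G_form g i (siegel_action g \<gamma> \<tau>)) = det (automorphy_mat g \<gamma> \<tau>) ^ 8 * (\<Sum>i\<le>4. c i * G_form g i \<tau>)"
    if "\<gamma> \<in> Gamma12 g" "\<tau> \<in> siegel_space g" for \<gamma> \<tau>
    unfolding sum_distrib_left by (intro sum.cong refl) (simp add: G_form_transform[OF that])
qed (use assms in auto)

section \<open>Factorization\<close>

definition singular_spaces :: "nat \<Rightarrow> bit vec set set" where
  "singular_spaces g = {V. totally_singular g V}"

text \<open>The exponent depends on the space alone instead of the index of a form, and it equals
  2^(4-i) for |V| = 2^i with i \<le> 4.\<close>

definition space_monomial :: "nat \<Rightarrow> bit vec set \<Rightarrow> complex mat \<Rightarrow> complex" where
  "space_monomial g V \<tau> = theta_prod g V \<tau> ^ (16 div card V)"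

text \<open>One sum over all totally singular spaces, with a coefficient for each dimension. It
  treats all genera up to 4 alike and can be regrouped by projections, which mix the
  dimensions.\<close>

definition theta_comb :: "nat \<Rightarrow> (nat \<Rightarrow> complex) \<Rightarrow> complex mat \<Rightarrow> complex" where
  "theta_comb g c \<tau> = (\<Sum>V\<in>singular_spaces g. c (ldim V) * space_monomial g V \<tau>)"

lemma finite_singular_spaces: "finite (singular_spaces g)"
  unfolding singular_spaces_def totally_singular_def by (rule finite_lin_sets)

lemma lin_le_16:
  assumes "lin N V" "card V \<le> 16"
  shows "ldim V \<le> 4"
proof -
  have "(2::nat) ^ ldim V \<le> 2 ^ 4" using assms card_lin by force
  then show ?thesis by (rule power_le_imp_le_exp[rotated]) simp
qed

lemma ldim_singular_spaces:
  assumes "V \<in> singular_spaces g"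
  shows "ldim V \<le> g"
proof -
  have "lin (2 * g) V" "card V \<le> 2 ^ g" using assms totally_singular_card_le by (auto simp: singular_spaces_def totally_singular_def)
  then have "(2::nat) ^ ldim V \<le> 2 ^ g" using card_lin by metis
  then show ?thesis by (rule power_le_imp_le_exp[rotated]) simp
qed

lemma theta_odd:
  assumes "v \<in> carrier_vec (2 * g)" "\<tau> \<in> siegel_space g" "parity_form g v = 1"
  shows "theta g v \<tau> = 0"
proof -
  have l: "(of_int (lift b) :: bit) = b" for b by (cases b) simp_all
  have "(of_int (\<Sum>i<g. lift (v $ i) * lift (v $ (g + i))) :: bit) = parity_form g v"
    unfolding parity_form_def of_int_sum of_int_mult l ..
  then have "odd (\<Sum>i<g. lift (v $ i) * lift (v $ (g + i)))"
    using assms(3) unfolding of_int_bit by (metis zero_neq_one)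
  then show ?thesis unfolding theta_lift[OF assms(1,2)] by (rule theta_int_odd)
qed

lemma theta_prod_nonsing:
  assumes "lin (2 * g) V" "\<not> totally_singular g V" "\<tau> \<in> siegel_space g"
  shows "theta_prod g V \<tau> = 0"
proof -
  obtain v where "v \<in> V" "parity_form g v = 1" using assms(1,2) bit_ne_0 by (auto simp: totally_singular_def)
  then show ?thesis
    using theta_odd[OF lin_carrier[OF assms(1)] assms(3)] lin_finite[OF assms(1)]
    unfolding theta_prod_def by (auto intro!: prod_zero)
qed

text \<open>Spaces that are not totally singular contribute nothing, and the others are grouped by
  their dimension, which is at most g \<le> 4.\<close>

lemma sum_G_eq_theta_comb:
  assumes \<tau>: "\<tau> \<in> siegel_space g" and g: "g \<le> 4"
  shows "(\<Sum>i\<le>4. c i * G_form g i \<tau>) = theta_comb g c \<tau>"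
proof -
  have "c i * G_form g i \<tau> = (\<Sum>V\<in>{V \<in> singular_spaces g. ldim V = i}. c (ldim V) * space_monomial g V \<tau>)" if "i \<le> 4" for i
  proof -
    have "(2::nat) ^ 4 div 2 ^ i = 2 ^ (4 - i)" using that by (intro power_diff[symmetric]) auto
    then have p: "(16::nat) div 2 ^ i = 2 ^ (4 - i)" by simp
    have e: "{V \<in> singular_spaces g. ldim V = i} = {V. (lin (2 * g) V \<and> card V = 2 ^ i) \<and> totally_singular g V}"
      using card_lin ldim_eqI by (auto simp: singular_spaces_def totally_singular_def)
    have "G_form g i \<tau> = (\<Sum>V\<in>{V \<in> singular_spaces g. ldim V = i}. theta_prod g V \<tau> ^ 2 ^ (4 - i))"
      unfolding G_form_eq e
      by (rule sum.mono_neutral_right[OF finite_lin_sets]) (auto simp: theta_prod_nonsing \<tau>)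
    also have "\<dots> = (\<Sum>V\<in>{V \<in> singular_spaces g. ldim V = i}. space_monomial g V \<tau>)"
      unfolding space_monomial_def p[symmetric] using card_lin by (intro sum.cong refl) (auto simp: singular_spaces_def totally_singular_def)
    finally show ?thesis by (simp add: sum_distrib_left)
  qed
  then have "(\<Sum>i\<le>4. c i * G_form g i \<tau>) = (\<Sum>i\<in>{..4}. \<Sum>V\<in>{V \<in> singular_spaces g. ldim V = i}. c (ldim V) * space_monomial g V \<tau>)"
    by (intro sum.cong) auto
  also have "\<dots> = theta_comb g c \<tau>"
    unfolding theta_comb_def using ldim_singular_spaces g by (intro sum.group finite_singular_spaces) fastforce+
  finally show ?thesis .
qed

section \<open>Restriction of monomials to block-diagonal matrices\<close>

definition char_left :: "nat \<Rightarrow> nat \<Rightarrow> bit vec \<Rightarrow> bit vec" where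
  "char_left k l v = vec (2 * k) (\<lambda>i. if i < k then v $ i else v $ (l + i))"

definition char_right :: "nat \<Rightarrow> nat \<Rightarrow> bit vec \<Rightarrow> bit vec" where
  "char_right k l v = vec (2 * l) (\<lambda>i. if i < l then v $ (k + i) else v $ (2 * k + i))"

definition char_join :: "nat \<Rightarrow> nat \<Rightarrow> bit vec \<Rightarrow> bit vec \<Rightarrow> bit vec" where
  "char_join k l x y = vec (2 * (k + l)) (\<lambda>i. if i < k then x $ i else if i < k + l then y $ (i - k)
     else if i < 2 * k + l then x $ (i - l) else y $ (i - 2 * k))"

text \<open>A characteristic of genus k + l is stored as (\<epsilon>', \<epsilon>'', \<delta>',
  \<delta>''), so each projection takes two separate quarters. These forms of the indices match the
  split sums in \<open>theta_int_diag_block\<close> and \<open>parity_form_split\<close>.\<close>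

lemma char_left_index: "i < k \<Longrightarrow> char_left k l v $ i = v $ i" "i < k \<Longrightarrow> char_left k l v $ (k + i) = v $ (k + l + i)"
  by (simp_all add: char_left_def ac_simps)

lemma char_right_index: "i < l \<Longrightarrow> char_right k l v $ i = v $ (i + k)" "i < l \<Longrightarrow> char_right k l v $ (l + i) = v $ (k + l + (i + k))"
proof -
  show "i < l \<Longrightarrow> char_right k l v $ i = v $ (i + k)" by (simp add: char_right_def add.commute)
  have e: "2 * k + (l + i) = k + l + (i + k)" by simp
  show "i < l \<Longrightarrow> char_right k l v $ (l + i) = v $ (k + l + (i + k))" unfolding e[symmetric] by (simp add: char_right_def)
qed

text \<open>The arithmetic of the interleaved indices is confined to this instance; the theory of
  projections only sees an abstract direct sum.\<close>

lemma split_product_char_left_char_right: "split_product (2 * (k + l)) (2 * k) (2 * l) (char_left k l) (char_right k l) (char_join k l)"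
proof
  show "char_left k l (v + w) = char_left k l v + char_left k l w" if "v \<in> carrier_vec (2 * (k + l))" "w \<in> carrier_vec (2 * (k + l))" for v w
    using that by (intro eq_vecI) (auto simp: char_left_def)
  show "char_right k l (v + w) = char_right k l v + char_right k l w" if "v \<in> carrier_vec (2 * (k + l))" "w \<in> carrier_vec (2 * (k + l))" for v w
    using that by (intro eq_vecI) (auto simp: char_right_def)
  show "char_join k l (char_left k l v) (char_right k l v) = v" if "v \<in> carrier_vec (2 * (k + l))" for v
  proof (rule eq_vecI)
    fix i assume "i < dim_vec v"
    then have i: "i < 2 * (k + l)" using that by simp
    show "char_join k l (char_left k l v) (char_right k l v) $ i = v $ i"
    proof (cases "i < k")
      case True then show ?thesis using i by (simp add: char_join_def char_left_def)
    next
      case a: False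
      show ?thesis
      proof (cases "i < k + l")
        case True
        then have "char_join k l (char_left k l v) (char_right k l v) $ i = char_right k l v $ (i - k)" using i a by (simp add: char_join_def)
        also have "\<dots> = v $ (i - k + k)" by (rule char_right_index) (use a True in auto)
        finally show ?thesis using a by simp
      next
        case b: False
        show ?thesis
        proof (cases "i < 2 * k + l")
          case True
          have e: "i - l = k + (i - k - l)" using b by simp
          have "char_join k l (char_left k l v) (char_right k l v) $ i = char_left k l v $ (k + (i - k - l))" unfolding e[symmetric] using i a b True by (simp add: char_join_def)
          also have "\<dots> = v $ (k + l + (i - k - l))" by (rule char_left_index) (use b True in auto)
          finally show ?thesis using b by simp
        next
          case False
          have e: "i - 2 * k = l + (i - 2 * k - l)" using False by simp
          have "char_join k l (char_left k l v) (char_right k l v) $ i = char_right k l v $ (l + (i - 2 * k - l))" unfolding e[symmetric] using i a b False by (simp add: char_join_def)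
          also have "\<dots> = v $ (k + l + (i - 2 * k - l + k))" by (rule char_right_index) (use i False in auto)
          also have "k + l + (i - 2 * k - l + k) = i" using False by simp
          finally show ?thesis .
        qed
      qed
    qed
  qed (use that in \<open>simp add: char_join_def\<close>)
  fix x y :: "bit vec" assume xy: "x \<in> carrier_vec (2 * k)" "y \<in> carrier_vec (2 * l)"
  show "char_left k l (char_join k l x y) = x"
    using xy by (intro eq_vecI) (auto simp: char_left_def char_join_def)
  show "char_right k l (char_join k l x y) = y"
    using xy by (intro eq_vecI) (auto simp: char_right_def char_join_def)
qed (auto simp: char_left_def char_right_def char_join_def)

lemma diag_block_index:
  assumes "\<tau>1 \<in> carrier_mat k k" "\<tau>2 \<in> carrier_mat l l"
  shows "diag_block_mat [\<tau>1, \<tau>2] \<in> carrier_mat (k + l) (k + l)"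
    "i < k + l \<Longrightarrow> j < k + l \<Longrightarrow> diag_block_mat [\<tau>1, \<tau>2] $$ (i, j) =
      (if i < k then if j < k then \<tau>1 $$ (i, j) else 0 else if j < k then 0 else \<tau>2 $$ (i - k, j - k))"
  using assms by (auto simp: Let_def)

lemma imag_quad_nonneg:
  assumes "\<tau> \<in> siegel_space g"
  shows "imag_quad g \<tau> x \<ge> 0"
proof (cases "\<exists>i<g. x i \<noteq> 0")
  case True
  then show ?thesis using assms by (force simp: siegel_space_iff)
next
  case False
  then have "imag_quad g \<tau> x = imag_quad g \<tau> (\<lambda>_. 0)" by (intro imag_quad_cong) auto
  then show ?thesis by (simp add: imag_quad_def)
qed

lemma diag_block_siegel:
  assumes t: "\<tau>1 \<in> siegel_space k" "\<tau>2 \<in> siegel_space l"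
  shows "diag_block_mat [\<tau>1, \<tau>2] \<in> siegel_space (k + l)"
proof -
  have c: "\<tau>1 \<in> carrier_mat k k" "\<tau>2 \<in> carrier_mat l l" using t by (auto simp: siegel_space_def)
  have q: "imag_quad (k + l) (diag_block_mat [\<tau>1, \<tau>2]) x = imag_quad k \<tau>1 x + imag_quad l \<tau>2 (\<lambda>i. x (i + k))" for x
    using arg_cong[OF quad_diag_block[OF c, of x], of Im] by (simp add: Im_quad)
  have "imag_quad (k + l) (diag_block_mat [\<tau>1, \<tau>2]) x > 0" if "i < k + l" "x i \<noteq> 0" for x i
  proof (cases "i < k")
    case True
    then have "imag_quad k \<tau>1 x > 0" using t that by (auto simp: siegel_space_iff)
    then show ?thesis unfolding q using imag_quad_nonneg[OF t(2)] by (rule add_pos_nonneg)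
  next
    case False
    then have "i - k < l" "x (i - k + k) \<noteq> 0" using that by auto
    then have "imag_quad l \<tau>2 (\<lambda>i. x (i + k)) > 0" using t by (auto simp: siegel_space_iff)
    then show ?thesis unfolding q using imag_quad_nonneg[OF t(1)] by (intro add_nonneg_pos)
  qed
  then show ?thesis
    unfolding siegel_space_iff using diag_block_index[OF c] siegel_sym[OF t(1)] siegel_sym[OF t(2)] by auto
qed

lemma theta_diag_block:
  assumes v: "v \<in> carrier_vec (2 * (k + l))" and t: "\<tau>1 \<in> siegel_space k" "\<tau>2 \<in> siegel_space l"
  shows "theta (k + l) v (diag_block_mat [\<tau>1, \<tau>2]) = theta k (char_left k l v) \<tau>1 * theta l (char_right k l v) \<tau>2"
proof -
  have c: "char_left k l v \<in> carrier_vec (2 * k)" "char_right k l v \<in> carrier_vec (2 * l)" by (auto simp: char_left_def char_right_def)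
  show ?thesis
    unfolding theta_lift[OF v diag_block_siegel[OF t]] theta_lift[OF c(1) t(1)] theta_lift[OF c(2) t(2)] theta_int_diag_block[OF t]
    by (intro arg_cong2[of _ _ _ _ times] theta_int_cong) (simp_all only: char_left_index char_right_index)
qed

lemma parity_form_split: "parity_form (k + l) v = parity_form k (char_left k l v) + parity_form l (char_right k l v)"
  unfolding parity_form_def sum_lessThan_add
  by (intro arg_cong2[of _ _ _ _ "(+)"] sum.cong refl) (simp_all only: char_left_index char_right_index lessThan_iff)

text \<open>All fibres have the same size, because translation by u + w maps the fibre of p u
  injectively into that of p w.\<close>

lemma card_fibre:
  fixes p :: "bit vec \<Rightarrow> bit vec"
  assumes V: "lin N V" and add: "\<And>v w. v \<in> V \<Longrightarrow> w \<in> V \<Longrightarrow> p (v + w) = p v + p w"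
    and p: "\<And>v. v \<in> V \<Longrightarrow> p v \<in> carrier_vec M" and x: "x \<in> p ` V"
  shows "card V = card (p ` V) * card {v \<in> V. p v = x}"
proof -
  note c = lin_carrier[OF V]
  have fin: "finite V" using V by (rule lin_finite)
  have le: "card {v \<in> V. p v = x} \<le> card {v \<in> V. p v = y}" if xy: "x \<in> p ` V" "y \<in> p ` V" for x y
  proof -
    obtain u w where u: "u \<in> V" "p u = x" and w: "w \<in> V" "p w = y" using xy by blast
    have "(\<lambda>v. v + (u + w)) ` {v \<in> V. p v = x} \<subseteq> {v \<in> V. p v = y}"
    proof (rule image_subsetI)
      fix v assume "v \<in> {v \<in> V. p v = x}"
      then have v: "v \<in> V" "p v = x" by auto
      have uw: "u + w \<in> V" using V u w by (simp add: lin_def)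
      then have vuw: "v + (u + w) \<in> V" using V v by (simp add: lin_def)
      have "p (v + (u + w)) = p u + (p u + p w)" using add[OF v(1) uw] add[OF u(1) w(1)] v(2) u(2) by simp
      also have "\<dots> = y" unfolding w(2)[symmetric] using p u w by (intro bitvec_add_cancel(2)) auto
      finally show "v + (u + w) \<in> {v \<in> V. p v = y}" using vuw by simp
    qed
    moreover have "inj_on (\<lambda>v. v + (u + w)) {v \<in> V. p v = x}"
    proof (rule inj_on_inverseI[where g = "\<lambda>v. v + (u + w)"])
      fix v assume "v \<in> {v \<in> V. p v = x}"
      then show "v + (u + w) + (u + w) = v" using c u w by (intro bitvec_add_cancel(1)[of _ N]) auto
    qed
    ultimately show ?thesis using fin by (intro card_inj_on_le[of _ _ "{v \<in> V. p v = y}"]) auto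
  qed
  have "card V = (\<Sum>y\<in>p ` V. card {v \<in> V. p v = y})"
    using sum.group[OF fin finite_imageI[OF fin], of p p "\<lambda>_. 1 :: nat"] by simp
  also have "\<dots> = (\<Sum>y\<in>p ` V. card {v \<in> V. p v = x})"
    using le x by (intro sum.cong refl) (meson le_antisym)
  finally show ?thesis by simp
qed

text \<open>Each point of the image is hit K times with |V| = |p V| K, so the exponent 16/|V|
  becomes 16/|p V|. The divisions are exact because |V| is a power of 2 not exceeding 16.\<close>

lemma prod_fibre:
  fixes a :: "bit vec \<Rightarrow> complex"
  assumes V: "lin N V" and add: "\<And>v w. v \<in> V \<Longrightarrow> w \<in> V \<Longrightarrow> p (v + w) = p v + p w"
    and p: "\<And>v. v \<in> V \<Longrightarrow> p v \<in> carrier_vec M" and W: "lin M (p ` V)" and le: "card V \<le> 16"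
  shows "(\<Prod>v\<in>V. a (p v)) ^ (16 div card V) = (\<Prod>x\<in>p ` V. a x) ^ (16 div card (p ` V))"
proof -
  have fin: "finite V" using V by (rule lin_finite)
  obtain x where x: "x \<in> p ` V" using V by (auto simp: lin_def)
  define K where "K = card {v \<in> V. p v = x}"
  have K: "card V = card (p ` V) * K" unfolding K_def by (rule card_fibre[OF V add p x])
  have pos: "card (p ` V) > 0" using x fin by (auto simp: card_gt_0_iff)
  have Ky: "card {v \<in> V. p v = y} = K" if "y \<in> p ` V" for y
    using card_fibre[OF V add p that] K pos by simp
  have "(\<Prod>v\<in>V. a (p v)) = (\<Prod>y\<in>p ` V. \<Prod>v\<in>{v \<in> V. p v = y}. a (p v))"
    by (rule prod.group[symmetric]) (use fin in auto)
  also have "\<dots> = (\<Prod>y\<in>p ` V. a y ^ K)"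
  proof (intro prod.cong refl)
    fix y assume "y \<in> p ` V"
    have "(\<Prod>v\<in>{v \<in> V. p v = y}. a (p v)) = (\<Prod>v\<in>{v \<in> V. p v = y}. a y)" by (intro prod.cong) auto
    then show "(\<Prod>v\<in>{v \<in> V. p v = y}. a (p v)) = a y ^ K" using Ky[OF \<open>y \<in> p ` V\<close>] by simp
  qed
  also have "\<dots> = (\<Prod>x\<in>p ` V. a x) ^ K" by (simp add: prod_power_distrib)
  finally have P: "(\<Prod>v\<in>V. a (p v)) = (\<Prod>x\<in>p ` V. a x) ^ K" .
  have "card V dvd 2 ^ 4" unfolding card_lin[OF V] by (intro le_imp_power_dvd lin_le_16[OF V le])
  then obtain q where "2 ^ 4 = card V * q" by (rule dvdE)
  then have q: "card (p ` V) * K * q = 16" unfolding K by simp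
  have "16 div card (p ` V) = card (p ` V) * (K * q) div card (p ` V)" unfolding q[symmetric] by (simp only: mult.assoc)
  also have "\<dots> = K * q" by (rule nonzero_mult_div_cancel_left) (use pos in simp)
  finally have "16 div card (p ` V) = K * q" .
  moreover have "16 div card V = q"
    unfolding K q[symmetric] by (rule nonzero_mult_div_cancel_left) (use q in \<open>intro notI; simp\<close>)
  ultimately show ?thesis by (simp add: P power_mult)
qed

definition spaces_over :: "nat \<Rightarrow> nat \<Rightarrow> bit vec set \<Rightarrow> bit vec set \<Rightarrow> bit vec set set" where
  "spaces_over k l V1 V2 = {V. lin (2 * (k + l)) V \<and> char_left k l ` V = V1 \<and> char_right k l ` V = V2}"

lemma space_monomial_diag_block:
  assumes V: "lin (2 * (k + l)) V" "card V \<le> 16" and t: "\<tau>1 \<in> siegel_space k" "\<tau>2 \<in> siegel_space l"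
  shows "space_monomial (k + l) V (diag_block_mat [\<tau>1, \<tau>2]) = space_monomial k (char_left k l ` V) \<tau>1 * space_monomial l (char_right k l ` V) \<tau>2"
proof -
  interpret S: split_product "2 * (k + l)" "2 * k" "2 * l" "char_left k l" "char_right k l" "char_join k l" by (rule split_product_char_left_char_right)
  note c = lin_carrier[OF V(1)]
  have "theta_prod (k + l) V (diag_block_mat [\<tau>1, \<tau>2]) = (\<Prod>v\<in>V. theta k (char_left k l v) \<tau>1) * (\<Prod>v\<in>V. theta l (char_right k l v) \<tau>2)"
    unfolding theta_prod_def prod.distrib[symmetric] by (intro prod.cong refl theta_diag_block c t)
  moreover have "(\<Prod>v\<in>V. theta k (char_left k l v) \<tau>1) ^ (16 div card V) = space_monomial k (char_left k l ` V) \<tau>1"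
    unfolding space_monomial_def theta_prod_def
    by (rule prod_fibre[OF V(1) _ _ S.lin_image(1)[OF V(1)] V(2)]) (intro S.p1_add S.p1_carrier c; assumption)+
  moreover have "(\<Prod>v\<in>V. theta l (char_right k l v) \<tau>2) ^ (16 div card V) = space_monomial l (char_right k l ` V) \<tau>2"
    unfolding space_monomial_def theta_prod_def
    by (rule prod_fibre[OF V(1) _ _ S.lin_image(2)[OF V(1)] V(2)]) (intro S.p2_add S.p2_carrier c; assumption)+
  ultimately show ?thesis by (simp add: space_monomial_def power_mult_distrib)
qed

lemma space_monomial_nonsing:
  assumes "lin (2 * g) V" "card V \<le> 16" "\<not> totally_singular g V" "\<tau> \<in> siegel_space g"
  shows "space_monomial g V \<tau> = 0"
proof -
  have "0 < card V" using card_lin[OF assms(1)] by simp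
  then have "0 < 16 div card V" using assms(2) by (simp add: div_greater_zero_iff)
  then show ?thesis by (simp add: space_monomial_def theta_prod_nonsing[OF assms(1,3,4)])
qed

text \<open>The spaces are grouped by their two projections. A projection that is not totally
  singular contains an odd characteristic and kills the term; conversely, a space with totally
  singular projections is itself totally singular, because parities add.\<close>

lemma theta_comb_diag_block:
  assumes kl: "k + l \<le> 4" and t: "\<tau>1 \<in> siegel_space k" "\<tau>2 \<in> siegel_space l"
  shows "theta_comb (k + l) c (diag_block_mat [\<tau>1, \<tau>2]) =
    (\<Sum>V1\<in>singular_spaces k. \<Sum>V2\<in>singular_spaces l. space_monomial k V1 \<tau>1 * space_monomial l V2 \<tau>2 * (\<Sum>V\<in>spaces_over k l V1 V2. c (ldim V)))"
proof -
  interpret S: split_product "2 * (k + l)" "2 * k" "2 * l" "char_left k l" "char_right k l" "char_join k l" by (rule split_product_char_left_char_right)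
  let ?D = "diag_block_mat [\<tau>1, \<tau>2]" and ?f = "\<lambda>V. (char_left k l ` V, char_right k l ` V)"
  define S where "S = {V \<in> singular_spaces (k + l). char_left k l ` V \<in> singular_spaces k \<and> char_right k l ` V \<in> singular_spaces l}"
  have V: "lin (2 * (k + l)) V" "card V \<le> 16" if "V \<in> singular_spaces (k + l)" for V
  proof -
    show "lin (2 * (k + l)) V" using that by (simp add: singular_spaces_def totally_singular_def)
    have "card V \<le> 2 ^ (k + l)" using that by (simp add: singular_spaces_def totally_singular_card_le)
    also have "\<dots> \<le> (2::nat) ^ 4" by (rule power_increasing) (use kl in auto)
    finally show "card V \<le> 16" by simp
  qed
  have "theta_comb (k + l) c ?D = (\<Sum>V\<in>S. c (ldim V) * space_monomial (k + l) V ?D)"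
    unfolding theta_comb_def
  proof (rule sum.mono_neutral_right[OF finite_singular_spaces])
    show "\<forall>V\<in>singular_spaces (k + l) - S. c (ldim V) * space_monomial (k + l) V ?D = 0"
    proof
      fix V assume "V \<in> singular_spaces (k + l) - S"
      then have v: "V \<in> singular_spaces (k + l)" "\<not> totally_singular k (char_left k l ` V) \<or> \<not> totally_singular l (char_right k l ` V)" by (auto simp: S_def singular_spaces_def)
      note L = V[OF v(1)]
      have "card (char_left k l ` V) \<le> 16" "card (char_right k l ` V) \<le> 16"
        using card_image_le[OF lin_finite[OF L(1)]] L(2) order_trans by blast+
      then have "space_monomial k (char_left k l ` V) \<tau>1 = 0 \<or> space_monomial l (char_right k l ` V) \<tau>2 = 0"
        using v(2) space_monomial_nonsing[OF S.lin_image(1)[OF L(1)]] space_monomial_nonsing[OF S.lin_image(2)[OF L(1)]] t by blast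
      then show "c (ldim V) * space_monomial (k + l) V ?D = 0" by (auto simp: space_monomial_diag_block[OF L t] simp del: diag_block_mat.simps)
    qed
  qed (auto simp: S_def)
  also have "\<dots> = (\<Sum>W\<in>singular_spaces k \<times> singular_spaces l. \<Sum>V\<in>{V \<in> S. ?f V = W}. c (ldim V) * space_monomial (k + l) V ?D)"
    by (rule sum.group[symmetric]) (auto simp: S_def finite_singular_spaces)
  also have "\<dots> = (\<Sum>(V1, V2)\<in>singular_spaces k \<times> singular_spaces l. space_monomial k V1 \<tau>1 * space_monomial l V2 \<tau>2 * (\<Sum>V\<in>spaces_over k l V1 V2. c (ldim V)))"
  proof (intro sum.cong refl, clarify)
    fix V1 V2 assume W: "V1 \<in> singular_spaces k" "V2 \<in> singular_spaces l"
    have e: "{V \<in> S. ?f V = (V1, V2)} = spaces_over k l V1 V2"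
    proof (intro equalityI subsetI)
      fix V assume "V \<in> spaces_over k l V1 V2"
      then have v: "lin (2 * (k + l)) V" "char_left k l ` V = V1" "char_right k l ` V = V2" by (auto simp: spaces_over_def)
      have char1: "\<forall>x\<in>V. parity_form (k + l) x = 0"
      proof
        fix x assume "x \<in> V"
        then have "char_left k l x \<in> V1" "char_right k l x \<in> V2" using v by auto
        then show "parity_form (k + l) x = 0" using W by (simp add: parity_form_split singular_spaces_def totally_singular_def)
      qed
      show "V \<in> {V \<in> S. ?f V = (V1, V2)}"
        using v(1) W char1 by (simp only: S_def singular_spaces_def totally_singular_def mem_Collect_eq v(2,3) simp_thms) blast
    qed (auto simp: S_def spaces_over_def singular_spaces_def totally_singular_def)
    show "(\<Sum>V\<in>{V \<in> S. ?f V = (V1, V2)}. c (ldim V) * space_monomial (k + l) V ?D) =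
        space_monomial k V1 \<tau>1 * space_monomial l V2 \<tau>2 * (\<Sum>V\<in>spaces_over k l V1 V2. c (ldim V))"
      unfolding e[symmetric] sum_distrib_left
    proof (intro sum.cong refl)
      fix V assume "V \<in> {V \<in> S. ?f V = (V1, V2)}"
      then have "V \<in> singular_spaces (k + l)" "char_left k l ` V = V1" "char_right k l ` V = V2" by (auto simp: S_def)
      then show "c (ldim V) * space_monomial (k + l) V ?D = space_monomial k V1 \<tau>1 * space_monomial l V2 \<tau>2 * c (ldim V)"
        using space_monomial_diag_block[OF V t, of V] by simp
    qed
  qed
  finally show ?thesis by (simp add: sum.cartesian_product)
qed

section \<open>Multiplicativity of the Moebius combination\<close>

lemma mobius_spaces_over:
  assumes "lin (2 * k) V1" "lin (2 * l) V2"
  shows "(\<Sum>V\<in>spaces_over k l V1 V2. mobius (ldim V)) = mobius (ldim V1) * mobius (ldim V2)"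
proof -
  interpret S: split_product "2 * (k + l)" "2 * k" "2 * l" "char_left k l" "char_right k l" "char_join k l" by (rule split_product_char_left_char_right)
  show ?thesis using S.mobius_over[OF assms] unfolding spaces_over_def S.over_def .
qed

lemma theta_comb_mobius_diag_block:
  assumes kl: "k + l \<le> 4" and t: "\<tau>1 \<in> siegel_space k" "\<tau>2 \<in> siegel_space l"
  shows "theta_comb (k + l) (\<lambda>i. of_int (mobius i)) (diag_block_mat [\<tau>1, \<tau>2]) =
    theta_comb k (\<lambda>i. of_int (mobius i)) \<tau>1 * theta_comb l (\<lambda>i. of_int (mobius i)) \<tau>2"
  unfolding theta_comb_diag_block[OF assms] theta_comb_def[of k] theta_comb_def[of l] sum_product
proof (intro sum.cong refl)
  fix V1 V2 assume "V1 \<in> singular_spaces k" "V2 \<in> singular_spaces l"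
  then have "lin (2 * k) V1" "lin (2 * l) V2" by (auto simp: singular_spaces_def totally_singular_def)
  then show "space_monomial k V1 \<tau>1 * space_monomial l V2 \<tau>2 * (\<Sum>V\<in>spaces_over k l V1 V2. of_int (mobius (ldim V))) =
      of_int (mobius (ldim V1)) * space_monomial k V1 \<tau>1 * (of_int (mobius (ldim V2)) * space_monomial l V2 \<tau>2)"
    by (simp add: mobius_spaces_over flip: of_int_sum)
qed

lemma theta_comb_cmult: "theta_comb g (\<lambda>i. a * c i) \<tau> = a * theta_comb g c \<tau>"
  by (simp add: theta_comb_def sum_distrib_left mult.assoc)

lemma theta_comb_diff: "theta_comb g (\<lambda>i. c i - d i) \<tau> = theta_comb g c \<tau> - theta_comb g d \<tau>"
  by (simp add: theta_comb_def sum_subtractf algebra_simps)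

lemma mobius_values: "mobius 0 = 1" "mobius 1 = -1" "mobius 2 = 2" "mobius 3 = -8" "mobius 4 = 64"
  by (simp_all add: numeral_eq_Suc)

lemma sum_atMost_4: "(\<Sum>i\<le>4. f i) = f 0 + f 1 + f 2 + f 3 + (f (4 :: nat) :: complex)"
  by (simp add: numeral_eq_Suc)

text \<open>Totally singular spaces have dimension at most g. This lets the lower genus forms, which
  stop at i = g, be written as sums over all i \<le> 4.\<close>

lemma G_form_dim_gt:
  assumes "\<tau> \<in> siegel_space g" "g < i"
  shows "G_form g i \<tau> = 0"
  unfolding G_form_eq
proof (intro sum.neutral ballI)
  fix V assume "V \<in> {V. lin (2 * g) V \<and> card V = 2 ^ i}"
  then have V: "lin (2 * g) V" "card V = 2 ^ i" by auto
  have "\<not> card V \<le> 2 ^ g" using assms(2) V(2) by simp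
  then have "\<not> totally_singular g V" using totally_singular_card_le by blast
  then show "theta_prod g V \<tau> ^ 2 ^ (4 - i) = 0" using theta_prod_nonsing V(1) assms(1) by simp
qed

lemma Xi_eq_theta_comb:
  "\<tau> \<in> siegel_space 1 \<Longrightarrow> Xi1 \<tau> = 1 / 2 * theta_comb 1 (\<lambda>i. of_int (mobius i)) \<tau>"
  "\<tau> \<in> siegel_space 2 \<Longrightarrow> Xi2 \<tau> = 1 / 4 * theta_comb 2 (\<lambda>i. of_int (mobius i)) \<tau>"
  "\<tau> \<in> siegel_space 3 \<Longrightarrow> Xi3 \<tau> = 1 / 8 * theta_comb 3 (\<lambda>i. of_int (mobius i)) \<tau>"
  "\<tau> \<in> siegel_space 4 \<Longrightarrow> Xi4 \<tau> = 1 / 16 * theta_comb 4 (\<lambda>i. of_int (mobius i)) \<tau>"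
  by (simp_all add: sum_G_eq_theta_comb[symmetric] sum_atMost_4 mobius_values G_form_dim_gt Xi1_def Xi2_def Xi3_def Xi4_def del: mobius.simps(2) One_nat_def)

lemma Xi4_factorization: "factorization_constraints Xi4"
  unfolding factorization_constraints_def restricts_to_product_def
proof (intro conjI ballI)
  show "Xi4 (diag_block_mat [\<tau>1, \<tau>2]) = Xi1 \<tau>1 * Xi3 \<tau>2" if t: "\<tau>1 \<in> siegel_space 1" "\<tau>2 \<in> siegel_space 3" for \<tau>1 \<tau>2
    using theta_comb_mobius_diag_block[OF _ t] Xi_eq_theta_comb(4)[of "diag_block_mat [\<tau>1, \<tau>2]"] diag_block_siegel[OF t]
    by (simp add: Xi_eq_theta_comb t del: diag_block_mat.simps One_nat_def)
  show "Xi4 (diag_block_mat [\<tau>1, \<tau>2]) = Xi2 \<tau>1 * Xi2 \<tau>2" if t: "\<tau>1 \<in> siegel_space 2" "\<tau>2 \<in> siegel_space 2" for \<tau>1 \<tau>2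
    using theta_comb_mobius_diag_block[OF _ t] Xi_eq_theta_comb(4)[of "diag_block_mat [\<tau>1, \<tau>2]"] diag_block_siegel[OF t]
    by (simp add: Xi_eq_theta_comb t del: diag_block_mat.simps)
qed

lemma Xi4_modular: "modular_form 4 8 (Gamma12 4) Xi4"
proof -
  have "Xi4 = (\<lambda>\<tau>. \<Sum>i\<le>4. (of_int (mobius i) / 16) * G_form 4 i \<tau>)"
    by (rule ext) (simp add: sum_atMost_4 mobius_values Xi4_def algebra_simps del: mobius.simps(2) One_nat_def)
  then show ?thesis using modular_form_sum_G[of 4 "\<lambda>i. of_int (mobius i) / 16"] by simp
qed

section \<open>Uniqueness\<close>

definition char1 :: "bit \<Rightarrow> bit \<Rightarrow> bit vec" where
  "char1 a b = vec 2 (\<lambda>i. if i = 0 then a else b)"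

lemma char1_index [simp]: "char1 a b $ 0 = a" "char1 a b $ Suc 0 = b"
  by (simp_all add: char1_def)

lemma char1_carrier [simp]: "char1 a b \<in> carrier_vec 2"
  by (simp add: char1_def)

lemma char1_eq_iff [simp]: "char1 a b = char1 a' b' \<longleftrightarrow> a = a' \<and> b = b'"
  by (metis char1_index)

lemma char1_add: "char1 a b + char1 a' b' = char1 (a + a') (b + b')"
  by (intro eq_vecI) (auto simp: char1_def)

lemma char1_zero: "0\<^sub>v 2 = char1 0 0"
  by (intro eq_vecI) (auto simp: char1_def)

lemma char1_cases:
  assumes "v \<in> carrier_vec 2"
  obtains a b where "v = char1 a b"
proof
  show "v = char1 (v $ 0) (v $ 1)"
    using assms by (intro eq_vecI) (auto simp: char1_def less_2_cases_iff)
qed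

lemma parity_form_char1: "parity_form 1 (char1 a b) = a * b"
  by (simp add: parity_form_def)

text \<open>The only odd characteristic is (1, 1). It is the sum of (0, 1) and (1, 0), which
  therefore never lie in a common totally singular space.\<close>

lemma singular_spaces_1: "singular_spaces 1 = {{char1 0 0}, {char1 0 0, char1 0 1}, {char1 0 0, char1 1 0}}"
proof (intro equalityI subsetI)
  fix V assume "V \<in> singular_spaces 1"
  then have V: "V \<subseteq> carrier_vec 2" "char1 0 0 \<in> V" "\<And>x y. x \<in> V \<Longrightarrow> y \<in> V \<Longrightarrow> x + y \<in> V" "\<And>x. x \<in> V \<Longrightarrow> parity_form 1 x = 0"
    by (auto simp: singular_spaces_def totally_singular_def lin_def char1_zero)
  have n11: "char1 1 1 \<notin> V"
  proof
    assume "char1 1 1 \<in> V"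
    from V(4)[OF this] show False unfolding parity_form_char1 by simp
  qed
  have nb: "\<not> (char1 0 1 \<in> V \<and> char1 1 0 \<in> V)"
  proof
    assume "char1 0 1 \<in> V \<and> char1 1 0 \<in> V"
    then have "char1 0 1 + char1 1 0 \<in> V" using V(3) by blast
    then show False using n11 by (simp add: char1_add)
  qed
  have "x \<in> {char1 0 0, char1 0 1, char1 1 0}" if x: "x \<in> V" for x
  proof -
    obtain a b where ab: "x = char1 a b" using V(1) x by (blast elim: char1_cases)
    show ?thesis using x n11 unfolding ab by (cases a; cases b) simp_all
  qed
  then have "V \<subseteq> {char1 0 0, char1 0 1, char1 1 0}" by blast
  then show "V \<in> {{char1 0 0}, {char1 0 0, char1 0 1}, {char1 0 0, char1 1 0}}"
    using V(2) nb by (cases "char1 0 1 \<in> V"; cases "char1 1 0 \<in> V") auto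
next
  fix V assume "V \<in> {{char1 0 0}, {char1 0 0, char1 0 1}, {char1 0 0, char1 1 0}}"
  then consider "V = {char1 0 0}" | "V = {char1 0 0, char1 0 1}" | "V = {char1 0 0, char1 1 0}" by blast
  then show "V \<in> singular_spaces 1"
    by cases (simp_all add: singular_spaces_def totally_singular_def lin_def char1_zero char1_add parity_form_char1 del: One_nat_def)
qed

definition theta1 :: "complex mat \<Rightarrow> int \<Rightarrow> int \<Rightarrow> complex" where
  "theta1 \<tau> e d = theta_int 1 \<tau> (\<lambda>_. e) (\<lambda>_. d)"

lemma theta_genus_1:
  assumes "\<tau> \<in> siegel_space 1"
  shows "theta 1 (char1 a b) \<tau> = theta1 \<tau> (lift a) (lift b)"
  unfolding theta1_def using assms by (subst theta_lift) (auto intro!: theta_int_cong)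

lemma sum_singular_spaces_1:
  fixes Z :: "bit vec set \<Rightarrow> complex"
  assumes "\<tau> \<in> siegel_space 1"
  shows "(\<Sum>V\<in>singular_spaces 1. space_monomial 1 V \<tau> * Z V) = theta1 \<tau> 0 0 ^ 8 * (theta1 \<tau> 0 0 ^ 8 * Z {char1 0 0}
    + theta1 \<tau> 0 1 ^ 8 * Z {char1 0 0, char1 0 1} + theta1 \<tau> 1 0 ^ 8 * Z {char1 0 0, char1 1 0})"
proof -
  have n: "{char1 0 0} \<noteq> {char1 0 0, char1 0 1}" "{char1 0 0} \<noteq> {char1 0 0, char1 1 0}" "{char1 0 0, char1 0 1} \<noteq> {char1 0 0, char1 1 0}"
    by (simp_all add: set_eq_iff) (metis char1_eq_iff zero_neq_one)+
  have e: "space_monomial 1 {char1 0 0} \<tau> = theta1 \<tau> 0 0 ^ 8 * theta1 \<tau> 0 0 ^ 8"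
    "space_monomial 1 {char1 0 0, char1 0 1} \<tau> = theta1 \<tau> 0 0 ^ 8 * theta1 \<tau> 0 1 ^ 8"
    "space_monomial 1 {char1 0 0, char1 1 0} \<tau> = theta1 \<tau> 0 0 ^ 8 * theta1 \<tau> 1 0 ^ 8"
    unfolding space_monomial_def theta_prod_def
    by (simp_all add: theta_genus_1[OF assms] power_mult_distrib del: One_nat_def flip: power_add numeral_2_eq_2)
  show ?thesis unfolding singular_spaces_1 using n by (simp add: e algebra_simps del: One_nat_def)
qed

text \<open>For \<theta>[1,0] only the eighth power is preserved, since the translation multiplies
  the theta constant by an eighth root of unity.\<close>

lemma theta1_add:
  "theta1 (add_diag 1 0 1 \<tau>) 0 0 = theta1 \<tau> 0 1" "theta1 (add_diag 1 0 1 \<tau>) 0 1 = theta1 \<tau> 0 0"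
  "theta1 (add_diag 1 0 1 \<tau>) 1 0 ^ 8 = theta1 \<tau> 1 0 ^ 8"
proof -
  have a: "theta1 (add_diag 1 0 1 \<tau>) e d = exp (pi * \<i> * of_real (- of_int (2 * e + e * e) / 4)) * theta1 \<tau> e (d + (1 + e))" for e d
    using theta_int_add_diag[OF _ quad_add_diag, of 0 1 1 \<tau> "\<lambda>_. e" "\<lambda>_. d"] unfolding theta1_def
    by (auto intro!: arg_cong2[of _ _ _ _ times] theta_int_cong)
  have s: "theta1 \<tau> e 2 = exp (pi * \<i> * of_int e) * theta1 \<tau> e 0" for e
    using theta_int_shift_d[of 0 1 \<tau> "\<lambda>_. e" "\<lambda>_. 0" 1] unfolding theta1_def
    by (auto intro!: arg_cong2[of _ _ _ _ times] theta_int_cong elim!: trans[rotated])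
  show "theta1 (add_diag 1 0 1 \<tau>) 0 0 = theta1 \<tau> 0 1" unfolding a by simp
  show "theta1 (add_diag 1 0 1 \<tau>) 0 1 = theta1 \<tau> 0 0" unfolding a using s[of 0] by simp
  have x: "exp (pi * \<i> * z) ^ 8 = exp (pi * \<i> * (8 * z))" for z
    by (simp add: exp_of_nat_mult[symmetric] mult_ac)
  have "exp (pi * \<i> * of_real (- of_int (2 * 1 + 1 * 1) / 4)) ^ 8 = exp (pi * \<i> * of_int (2 * - 3))"
    unfolding x by simp
  also have "\<dots> = 1" by (rule exp_even_pi)
  finally have p: "exp (pi * \<i> * of_real (- of_int (2 * 1 + 1 * 1) / 4)) ^ 8 = 1" .
  have "exp (pi * \<i> * of_int 1) ^ 8 = exp (pi * \<i> * of_int (2 * 4))"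
    unfolding x by simp
  also have "\<dots> = 1" by (rule exp_even_pi)
  finally have q: "exp (pi * \<i> * of_int 1) ^ 8 = 1" .
  have "theta1 (add_diag 1 0 1 \<tau>) 1 0 ^ 8 = (exp (pi * \<i> * of_real (- of_int (2 * 1 + 1 * 1) / 4)) * (exp (pi * \<i> * of_int 1) * theta1 \<tau> 1 0)) ^ 8"
    unfolding a[of 1] s[symmetric] by simp
  also have "\<dots> = theta1 \<tau> 1 0 ^ 8" unfolding power_mult_distrib p q by simp
  finally show "theta1 (add_diag 1 0 1 \<tau>) 1 0 ^ 8 = theta1 \<tau> 1 0 ^ 8" .
qed

lemma theta1_inv:
  assumes "\<tau> \<in> siegel_space 1" "e * d = 0"
  shows "theta1 (inv_at 1 0 \<tau>) e d = csqrt (- \<i> * \<tau> $$ (0, 0)) * theta1 \<tau> d e"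
  unfolding theta1_def using assms(2) by (subst theta_int_inv_at[OF assms(1)]) (auto intro!: theta_int_cong)

definition tau_i :: "complex mat" where
  "tau_i = mat 1 1 (\<lambda>_. \<i>)"

lemma tau_i_siegel: "tau_i \<in> siegel_space 1"
  by (auto simp: siegel_space_iff tau_i_def imag_quad_def zero_less_mult_iff)

lemma theta1_tau_i_swap: "theta1 tau_i 0 1 = theta1 tau_i 1 0"
proof -
  have "inv_at 1 0 tau_i = tau_i" by (rule eq_matI) (auto simp: inv_at_def tau_i_def)
  then show ?thesis using theta1_inv[OF tau_i_siegel, of 0 1] by (simp add: tau_i_def)
qed

text \<open>At \<i> the terms of \<theta>[1,0] are positive, and \<theta>[0,1] has the same value
  because the inversion fixes \<i>. The series of \<theta>[0,1] arises from that of \<theta>[0,0] by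
  negating the terms with odd n, so it is strictly smaller.\<close>

lemma theta1_tau_i_real:
  obtains A B where "theta1 tau_i 0 0 = of_real A" "theta1 tau_i 0 1 = of_real B" "0 < B" "B < A"
proof -
  define f where "f e n = exp (- pi * (xvec (\<lambda>_. e) n 0)\<^sup>2)" for e n
  define s :: "(nat \<Rightarrow> int) \<Rightarrow> real" where "s n = (if even (n 0) then 1 else - 1)" for n
  have t: "tterm 1 tau_i x d = exp (of_real (- pi * (x 0)\<^sup>2)) * exp (pi * \<i> * of_real (x 0 * d 0))" for x d
    by (simp add: tterm_def quad_def tau_i_def exp_add[symmetric] algebra_simps power2_eq_square)
  have t0: "tterm 1 tau_i (xvec (\<lambda>_. e) n) (\<lambda>_. 0) = of_real (f e n)" for e n
    unfolding t f_def by (simp flip: exp_of_real)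
  have e: "exp (pi * \<i> * of_real (xvec (\<lambda>_. 0) n 0 * of_int 1)) = of_real (s n)" for n
  proof (cases "even (n 0)")
    case True
    then obtain k where k: "n 0 = 2 * k" by (rule evenE)
    show ?thesis using exp_even_pi[of k] by (simp add: s_def xvec_def k)
  next
    case False
    then obtain k where k: "n 0 = 2 * k + 1" by (rule oddE)
    have "exp (pi * \<i> * of_int (n 0)) = exp (pi * \<i> * of_int (2 * k)) * exp (pi * \<i>)"
      unfolding exp_add[symmetric] k by (simp add: algebra_simps)
    then show ?thesis using False by (simp add: s_def xvec_def exp_even_pi del: of_int_mult)
  qed
  have t1: "tterm 1 tau_i (xvec (\<lambda>_. 0) n) (\<lambda>_. 1) = of_real (s n * f 0 n)" for n
    using e[of n] unfolding t f_def by (simp flip: exp_of_real)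
  have sm: "(\<lambda>n. f e n) summable_on lat 1" for e
    using summable_on_Re[OF tterm_summable[OF tau_i_siegel, of "\<lambda>_. e" "\<lambda>_. 0"]] unfolding t0 Re_complex_of_real .
  have sm1: "(\<lambda>n. s n * f 0 n) summable_on lat 1"
    using summable_on_Re[OF tterm_summable[OF tau_i_siegel, of "\<lambda>_. 0" "\<lambda>_. 1"]] unfolding t1 Re_complex_of_real .
  let ?A = "\<Sum>\<^sub>\<infinity>n\<in>lat 1. f 0 n" and ?B = "\<Sum>\<^sub>\<infinity>n\<in>lat 1. s n * f 0 n" and ?C = "\<Sum>\<^sub>\<infinity>n\<in>lat 1. f 1 n"
  have A: "theta1 tau_i 0 0 = of_real ?A" and C: "theta1 tau_i 1 0 = of_real ?C" 
    unfolding theta1_def theta_int_def t0 by (rule infsumI[OF has_sum_of_real[OF has_sum_infsum[OF sm]]])+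
  have B: "theta1 tau_i 0 1 = of_real ?B" 
    unfolding theta1_def theta_int_def t1 by (rule infsumI[OF has_sum_of_real[OF has_sum_infsum[OF sm1]]])
  have pos: "0 < (\<Sum>\<^sub>\<infinity>n\<in>lat 1. h n)" if "h summable_on lat 1" "\<And>n. h n \<ge> 0" "m \<in> lat 1" "h m > 0" for h :: "(nat \<Rightarrow> int) \<Rightarrow> real" and m
  proof (rule ccontr)
    assume "\<not> ?thesis"
    then have "h m = 0" using nonneg_infsum_le_0D[OF _ that(1) that(2) that(3)] by simp
    then show False using that(4) by simp
  qed
  have "0 < ?C" by (rule pos[OF sm, where m = "\<lambda>_. 0"]) (simp_all add: f_def lat_def)
  moreover have "?B = ?C" using theta1_tau_i_swap unfolding B C by simp
  moreover have "0 < ?A - ?B"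
  proof -
    have u: "(\<lambda>n. - (s n * f 0 n)) summable_on lat 1" using sm1 by (simp add: summable_on_uminus)
    have "0 < (\<Sum>\<^sub>\<infinity>n\<in>lat 1. f 0 n + - (s n * f 0 n))"
      by (rule pos[OF summable_on_add[OF sm u], where m = "\<lambda>i. if i = 0 then 1 else 0"]) (auto simp: s_def lat_def f_def)
    then show ?thesis unfolding infsum_add[OF sm u] by (simp add: infsum_uminus)
  qed
  ultimately show thesis using that[OF A B] by simp
qed

text \<open>The relations at the three points form a linear system with \<open>a\<close> on the
  diagonal and \<open>b\<close> elsewhere. Differences give X = Y = Z because a and b differ, and
  then a + 2b > 0 forces the common value to be 0.\<close>

lemma theta_relation_trivial:
  fixes X Y Z :: complex
  assumes "\<And>\<tau>. \<tau> \<in> siegel_space 1 \<Longrightarrow>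
    theta1 \<tau> 0 0 ^ 8 * (theta1 \<tau> 0 0 ^ 8 * X + theta1 \<tau> 0 1 ^ 8 * Y + theta1 \<tau> 1 0 ^ 8 * Z) = 0"
  shows "X = 0" "Y = 0"
proof -
  obtain A B where AB: "theta1 tau_i 0 0 = of_real A" "theta1 tau_i 0 1 = of_real B" "0 < B" "B < A" by (rule theta1_tau_i_real)
  have C: "theta1 tau_i 1 0 = of_real B" using AB(2) theta1_tau_i_swap by simp
  define a b where "a = A ^ 8" and "b = B ^ 8"
  have ab: "0 < b" "b < a" using AB(3,4) by (simp_all add: a_def b_def power_strict_mono)
  let ?t1 = "add_diag 1 0 1 tau_i"
  have t1: "?t1 \<in> siegel_space 1" by (rule add_diag_siegel[OF tau_i_siegel]) simp
  have t2: "inv_at 1 0 ?t1 \<in> siegel_space 1" by (rule inv_at_siegel[OF t1]) simp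
  \<comment> \<open>The inversion multiplies all three theta constants by the same nonzero factor
    \<open>q\<close>, whose eighth power \<open>s\<close> divides out of the relation.\<close>
  define q s where "q = csqrt (- \<i> * ?t1 $$ (0, 0))" and "s = q ^ 8"
  have "s \<noteq> 0" using siegel_Im_diag_pos[OF t1, of 0] by (auto simp: s_def q_def)
  have i: "theta1 (inv_at 1 0 ?t1) 0 0 = q * theta1 ?t1 0 0" "theta1 (inv_at 1 0 ?t1) 0 1 = q * theta1 ?t1 1 0"
    "theta1 (inv_at 1 0 ?t1) 1 0 = q * theta1 ?t1 0 1"
    unfolding q_def by (rule theta1_inv[OF t1]; simp)+
  have ne: "of_real a \<noteq> (0::complex)" "of_real b \<noteq> (0::complex)" using ab by auto
  have 0: "of_real a * X + of_real b * Y + of_real b * Z = 0"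
    using assms[OF tau_i_siegel] ne unfolding AB C a_def b_def by simp
  have 1: "of_real b * X + of_real a * Y + of_real b * Z = 0"
    using assms[OF t1] ne unfolding theta1_add AB C a_def b_def by simp
  have "s * of_real b * (s * of_real b * X + s * of_real b * Y + s * of_real a * Z) = 0"
    using assms[OF t2] unfolding i power_mult_distrib theta1_add AB C s_def a_def b_def by simp
  then have "s * of_real b * X + s * of_real b * Y + s * of_real a * Z = 0" using \<open>s \<noteq> 0\<close> ne by (simp only: mult_eq_0_iff simp_thms)
  then have "s * (of_real b * X + of_real b * Y + of_real a * Z) = 0" by (simp only: distrib_left mult.assoc)
  then have 2: "of_real b * X + of_real b * Y + of_real a * Z = 0" using \<open>s \<noteq> 0\<close> by simp
  have "(of_real a - of_real b) * (X - Y) =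
      (of_real a * X + of_real b * Y + of_real b * Z) - (of_real b * X + of_real a * Y + of_real b * Z)" by (simp add: algebra_simps)
  then have "(of_real a - of_real b) * (X - Y) = 0" unfolding 0 1 by simp
  then have XY: "X = Y" using ab by simp
  have "(of_real a - of_real b) * (Y - Z) =
      (of_real b * X + of_real a * Y + of_real b * Z) - (of_real b * X + of_real b * Y + of_real a * Z)" by (simp add: algebra_simps)
  then have "(of_real a - of_real b) * (Y - Z) = 0" unfolding 1 2 by simp
  then have YZ: "Y = Z" using ab by simp
  have "of_real (a + 2 * b) * X = 0" using 0 unfolding YZ[symmetric] XY[symmetric] by (simp add: algebra_simps)
  moreover have "of_real (a + 2 * b) \<noteq> (0 :: complex)" using ab by (simp del: of_real_add of_real_mult)
  ultimately show "X = 0" by simp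
  then show "Y = 0" using XY by simp
qed

section \<open>Recovering the coefficients from restrictions\<close>

lemma spaces_over_bounds:
  assumes W: "lin (2 * k) W" "lin (2 * l) V2"
  obtains D where "D \<in> spaces_over k l W V2" "card D = card W * card V2"
    "\<And>V. V \<in> spaces_over k l W V2 \<Longrightarrow> card V2 \<le> card V \<and> card V \<le> card D \<and> (card V = card D \<longrightarrow> V = D)"
proof -
  interpret S: split_product "2 * (k + l)" "2 * k" "2 * l" "char_left k l" "char_right k l" "char_join k l" by (rule split_product_char_left_char_right)
  \<comment> \<open>The direct sum contains every space with these projections, and the projection
    onto \<open>V2\<close> bounds the size from below.\<close>
  let ?D = "S.dsum W V2"
  have D: "lin (2 * (k + l)) ?D" "card ?D = card W * card V2"
    using S.lin_dsum[OF W] S.card_dsum[OF W] by auto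
  have fin: "finite ?D" using D(1) by (rule lin_finite)
  have "?D \<in> spaces_over k l W V2" using D(1) S.image_dsum[OF W] by (simp only: spaces_over_def mem_Collect_eq simp_thms)
  moreover note D(2)
  moreover have "card V2 \<le> card V \<and> card V \<le> card ?D \<and> (card V = card ?D \<longrightarrow> V = ?D)" if V: "V \<in> spaces_over k l W V2" for V
  proof -
    have L: "lin (2 * (k + l)) V" "char_right k l ` V = V2" using V by (simp_all only: spaces_over_def mem_Collect_eq)
    have "V \<in> S.over W V2" using V by (simp only: spaces_over_def S.over_def)
    then have "V \<subseteq> ?D" by (rule S.over_subset_dsum)
    moreover have "card (char_right k l ` V) \<le> card V" by (rule card_image_le[OF lin_finite[OF L(1)]])
    ultimately show ?thesis using L(2) card_mono[OF fin] card_subset_eq[OF fin] by blast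
  qed
  ultimately show thesis by (rule that)
qed

lemma finite_spaces_over: "finite (spaces_over k l W V2)"
  unfolding spaces_over_def by (rule finite_lin_sets)

text \<open>By \<open>theta_relation_trivial\<close> the parts over the zero space and over the line
  \<open>?W\<close> vanish separately. Over the zero space there is exactly one space for each
  \<open>V2\<close>, of the same dimension, so the hypothesis gives c 0 = ... = c h = 0. Over the
  line only the direct sum with a \<open>V2\<close> of dimension h has a coefficient not yet known
  to vanish, namely c (1 + h).\<close>

lemma coefficients_zero_step:
  assumes h: "1 + h \<le> 4"
    and IH: "\<And>c. (\<And>\<tau>. \<tau> \<in> siegel_space h \<Longrightarrow> theta_comb h c \<tau> = 0) \<Longrightarrow> \<forall>i\<le>h. c i = 0"
    and van: "\<And>\<tau>1 \<tau>2. \<tau>1 \<in> siegel_space 1 \<Longrightarrow> \<tau>2 \<in> siegel_space h \<Longrightarrow> theta_comb (1 + h) c (diag_block_mat [\<tau>1, \<tau>2]) = 0"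
  shows "\<forall>i\<le>1 + h. c i = 0"
proof -
  define Z where "Z W \<tau>2 = (\<Sum>V2\<in>singular_spaces h. space_monomial h V2 \<tau>2 * (\<Sum>V\<in>spaces_over 1 h W V2. c (ldim V)))" for W \<tau>2
  let ?U = "{char1 0 0}" and ?W = "{char1 0 0, char1 0 1}"
  have Z: "Z ?U \<tau>2 = 0" "Z ?W \<tau>2 = 0" if \<tau>2: "\<tau>2 \<in> siegel_space h" for \<tau>2
  proof -
    have "theta1 \<tau>1 0 0 ^ 8 * (theta1 \<tau>1 0 0 ^ 8 * Z ?U \<tau>2 + theta1 \<tau>1 0 1 ^ 8 * Z ?W \<tau>2 + theta1 \<tau>1 1 0 ^ 8 * Z {char1 0 0, char1 1 0} \<tau>2) = 0"
      if \<tau>1: "\<tau>1 \<in> siegel_space 1" for \<tau>1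
    proof -
      have "0 = (\<Sum>W\<in>singular_spaces 1. space_monomial 1 W \<tau>1 * Z W \<tau>2)"
        using van[OF \<tau>1 \<tau>2] unfolding theta_comb_diag_block[OF h \<tau>1 \<tau>2] Z_def sum_distrib_left mult.assoc by (rule sym)
      then show ?thesis unfolding sum_singular_spaces_1[OF \<tau>1] by (rule sym)
    qed
    from theta_relation_trivial[OF this] show "Z ?U \<tau>2 = 0" "Z ?W \<tau>2 = 0" by blast+
  qed
  have W: "lin (2 * 1) ?U" "lin (2 * 1) ?W"
    using singular_spaces_1 unfolding singular_spaces_def totally_singular_def by blast+
  have cW: "card ?U = 1" "card ?W = 2" by simp_all
  have L: "lin (2 * h) V2" "card V2 = 2 ^ ldim V2" "ldim V2 \<le> h" if "V2 \<in> singular_spaces h" for V2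
    using that ldim_singular_spaces card_lin by (auto simp: singular_spaces_def totally_singular_def)
  have "theta_comb h c \<tau>2 = Z ?U \<tau>2" for \<tau>2
    unfolding theta_comb_def Z_def
  proof (intro sum.cong refl)
    fix V2 assume V2: "V2 \<in> singular_spaces h"
    obtain D where D: "D \<in> spaces_over 1 h ?U V2" "card D = card ?U * card V2"
      "\<And>V. V \<in> spaces_over 1 h ?U V2 \<Longrightarrow> card V2 \<le> card V \<and> card V \<le> card D \<and> (card V = card D \<longrightarrow> V = D)"
      using spaces_over_bounds[OF W(1) L(1)[OF V2]] by blast
    have cD: "card D = card V2" using D(2) unfolding cW by simp
    have "V = D" if "V \<in> spaces_over 1 h ?U V2" for V using D(3)[OF that] cD by simp
    then have "spaces_over 1 h ?U V2 = {D}" using D(1) by blast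
    moreover have "ldim D = ldim V2" using cD L(2)[OF V2] by (intro ldim_eqI) simp
    ultimately show "c (ldim V2) * space_monomial h V2 \<tau>2 = space_monomial h V2 \<tau>2 * (\<Sum>V\<in>spaces_over 1 h ?U V2. c (ldim V))" by simp
  qed
  then have low: "c i = 0" if "i \<le> h" for i using IH[of c] Z(1) that by simp
  \<comment> \<open>The hypothesis is applied a second time, to the sequence supported at h that
    carries the last unknown coefficient.\<close>
  let ?c = "\<lambda>i. if i = h then c (1 + h) else 0"
  have "theta_comb h ?c \<tau>2 = Z ?W \<tau>2" for \<tau>2
    unfolding theta_comb_def Z_def
  proof (intro sum.cong refl)
    fix V2 assume V2: "V2 \<in> singular_spaces h"
    obtain D where D: "D \<in> spaces_over 1 h ?W V2" "card D = card ?W * card V2"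
      "\<And>V. V \<in> spaces_over 1 h ?W V2 \<Longrightarrow> card V2 \<le> card V \<and> card V \<le> card D \<and> (card V = card D \<longrightarrow> V = D)"
      using spaces_over_bounds[OF W(2) L(1)[OF V2]] by blast
    have cD: "card D = 2 ^ (1 + ldim V2)" using D(2) L(2)[OF V2] unfolding cW by simp
    have "c (ldim V) = 0" if "V \<in> spaces_over 1 h ?W V2 - {D}" for V
    proof -
      have "card V < card D" using D(3)[of V] that by force
      moreover have "card V = 2 ^ ldim V" using that by (intro card_lin[of "2 * (1 + h)"]) (simp only: spaces_over_def mem_Collect_eq Diff_iff)
      ultimately have "(2::nat) ^ ldim V < 2 ^ (1 + ldim V2)" unfolding cD by simp
      then have "ldim V < 1 + ldim V2" by (rule power_less_imp_less_exp[rotated]) simp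
      then show ?thesis using L(3)[OF V2] by (intro low) simp
    qed
    then have "(\<Sum>V\<in>spaces_over 1 h ?W V2. c (ldim V)) = c (ldim D)"
      using D(1) finite_spaces_over by (subst sum.remove[of _ D]) auto
    also have "\<dots> = ?c (ldim V2)"
      using ldim_eqI[OF cD] L(3)[OF V2] low by (cases "ldim V2 = h") auto
    finally show "?c (ldim V2) * space_monomial h V2 \<tau>2 = space_monomial h V2 \<tau>2 * (\<Sum>V\<in>spaces_over 1 h ?W V2. c (ldim V))" by simp
  qed
  then have "\<forall>i\<le>h. ?c i = 0" using Z(2) by (intro IH) simp
  then have "c (1 + h) = 0" by auto
  then show ?thesis using low by (metis le_Suc_eq plus_1_eq_Suc)
qed

text \<open>Genus 0 anchors the induction: the Siegel space is a point, and the only theta constant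
  equals 1.\<close>

lemma coefficients_zero_0:
  assumes "\<And>\<tau>. \<tau> \<in> siegel_space 0 \<Longrightarrow> theta_comb 0 c \<tau> = 0"
  shows "c 0 = 0"
proof -
  let ?t = "mat 0 0 (\<lambda>_. 0) :: complex mat"
  have t: "?t \<in> siegel_space 0" by (simp add: siegel_space_iff)
  have C: "carrier_vec (2 * 0) = {0\<^sub>v 0 :: bit vec}" by auto
  have "totally_singular 0 V \<longleftrightarrow> V = {0\<^sub>v 0}" for V
  proof
    assume "totally_singular 0 V"
    then have "V \<subseteq> {0\<^sub>v 0}" "0\<^sub>v 0 \<in> V" unfolding totally_singular_def lin_def C by simp_all
    then show "V = {0\<^sub>v 0}" by blast
  next
    assume "V = {0\<^sub>v 0}"
    then show "totally_singular 0 V" using lin_zero[of "2 * 0"] by (simp add: totally_singular_def parity_form_def)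
  qed
  then have "singular_spaces 0 = {{0\<^sub>v 0}}" by (simp add: singular_spaces_def)
  moreover have "ldim {0\<^sub>v 0} = 0" by (rule ldim_eqI) simp
  moreover have "lat 0 = {\<lambda>_. 0}" by (auto simp: lat_def)
  then have "theta_int 0 ?t e d = 1" for e d by (simp add: theta_int_def tterm_def quad_def)
  then have "theta 0 (0\<^sub>v 0) ?t = 1" by (subst theta_lift[OF _ t]) simp_all
  ultimately have "theta_comb 0 c ?t = c 0" by (simp add: theta_comb_def space_monomial_def theta_prod_def)
  then show ?thesis using assms[OF t] by simp
qed

lemma coefficients_zero:
  assumes "h \<le> 4" "\<And>\<tau>. \<tau> \<in> siegel_space h \<Longrightarrow> theta_comb h c \<tau> = 0"
  shows "\<forall>i\<le>h. c i = 0"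
  using assms
proof (induction h arbitrary: c)
  case 0
  then show ?case using coefficients_zero_0[of c] by simp
next
  case (Suc h)
  have "\<forall>i\<le>1 + h. c i = 0"
  proof (rule coefficients_zero_step)
    show "1 + h \<le> 4" using Suc.prems(1) by simp
    show "\<forall>i\<le>h. c i = 0" if "\<And>\<tau>. \<tau> \<in> siegel_space h \<Longrightarrow> theta_comb h c \<tau> = 0" for c
      using Suc.prems(1) that by (intro Suc.IH) auto
    show "theta_comb (1 + h) c (diag_block_mat [\<tau>1, \<tau>2]) = 0" if "\<tau>1 \<in> siegel_space 1" "\<tau>2 \<in> siegel_space h" for \<tau>1 \<tau>2
      using Suc.prems(2)[of "diag_block_mat [\<tau>1, \<tau>2]"] diag_block_siegel[OF that] by (simp del: diag_block_mat.simps)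
  qed
  then show ?case by simp
qed

text \<open>The Moebius coefficients over 16 already satisfy the constraints, so the difference of
  the coefficients gives a combination vanishing on H_1 x H_3, and
  \<open>coefficients_zero_step\<close> applies with h = 3.\<close>

lemma factorization_unique:
  assumes "factorization_constraints (\<lambda>\<tau>. \<Sum>i\<le>4. c i * G_form 4 i \<tau>)" "i \<le> 4"
  shows "c i = of_int (mobius i) / 16"
proof -
  let ?d = "\<lambda>i. c i - 1 / 16 * of_int (mobius i)"
  have "\<forall>i\<le>1 + 3. ?d i = 0"
  proof (rule coefficients_zero_step)
    show "\<forall>i\<le>3. c i = 0" if "\<And>\<tau>. \<tau> \<in> siegel_space 3 \<Longrightarrow> theta_comb 3 c \<tau> = 0" for c
      using that by (intro coefficients_zero) auto
    fix \<tau>1 \<tau>2 assume t: "\<tau>1 \<in> siegel_space 1" "\<tau>2 \<in> siegel_space 3"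
    let ?D = "diag_block_mat [\<tau>1, \<tau>2]"
    have D: "?D \<in> siegel_space 4" using diag_block_siegel[OF t] by (simp del: diag_block_mat.simps)
    have "theta_comb 4 c ?D = Xi1 \<tau>1 * Xi3 \<tau>2"
      using assms(1) t sum_G_eq_theta_comb[OF D, of c] unfolding factorization_constraints_def restricts_to_product_def
      by (simp del: diag_block_mat.simps One_nat_def)
    also have "\<dots> = 1 / 16 * theta_comb 4 (\<lambda>i. of_int (mobius i)) ?D"
      using Xi4_factorization t Xi_eq_theta_comb(4)[OF D] unfolding factorization_constraints_def restricts_to_product_def
      by (simp del: diag_block_mat.simps One_nat_def)
    finally have "theta_comb 4 ?d ?D = 0" unfolding theta_comb_diff theta_comb_cmult by simp
    then show "theta_comb (1 + 3) ?d ?D = 0" by (simp del: diag_block_mat.simps)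
  qed simp
  then show ?thesis using assms(2) by simp
qed

theorem theorem21:
  shows "modular_form 4 8 (Gamma12 4) Xi4 \<and>
    factorization_constraints Xi4 \<and>
    (\<forall>c :: nat \<Rightarrow> complex.
       factorization_constraints (\<lambda>\<tau>. \<Sum>i\<le>4. c i * G_form 4 i \<tau>) \<longrightarrow>
       c 0 = 1/16 \<and> c 1 = -1/16 \<and> c 2 = 2/16 \<and> c 3 = -8/16 \<and> c 4 = 64/16)"
proof (intro conjI allI impI)
  fix c :: "nat \<Rightarrow> complex"
  assume "factorization_constraints (\<lambda>\<tau>. \<Sum>i\<le>4. c i * G_form 4 i \<tau>)"
  then have "c i = of_int (mobius i) / 16" if "i \<le> 4" for i using that by (rule factorization_unique)
  from this[of 0] this[of 1] this[of 2] this[of 3] this[of 4]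
  show "c 0 = 1/16" "c 1 = -1/16" "c 2 = 2/16" "c 3 = -8/16" "c 4 = 64/16" by (simp_all only: mobius_values) simp_all
qed (rule Xi4_modular Xi4_factorization)+

end
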